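(* Let $\zeta\in\overline{\mathbb D}$, and let $b\in H^\infty$ be the non-extreme function corresponding to the Smirnov function $\phi(z):=z/(1-\overline{\zeta}z)$; that is, $(b,a)$ is the unique pair with $b/a=\phi$. Then $\mathcal D_\zeta=\mathcal H(b)$ with equality of norms; that is, the two spaces coincide as sets of holomorphic functions on $\mathbb D$ and $\|f\|_{\mathcal D_\zeta}=\|f\|_{\mathcal H(b)}$ for every $f$ in this common space.
   Context: $\mathbb D$ is the open unit disk, $\mathbb T$ the unit circle, $dA$ the normalized area measure on $\mathbb D$ (so $A(\mathbb D)=1$), $\mathrm{Hol}(\mathbb D)$ the space of holomorphic functions on $\mathbb D$, and $H^2$ the Hardy space with norm $\|f\|_{H^2}^2=\sum_n|\hat f(n)|^2=\lim_{r\to1^-}\frac1{2\pi}\int_{\mathbb T}|f(r\lambda)|^2|d\lambda|$. Weighted Dirichlet spaces. For $\zeta\in\overline{\mathbb D}$ and $f\in\mathrm{Hol}(\mathbb D)$, put $$\mathcal D_\zeta(f)=\int_{\mathbb D}\log\Bigl|\frac{1-\overline{\zeta}z}{\zeta-z}\Bigr|\frac{2}{1-|\zeta|^2}|f'(z)|^2\,dA(z)\quad(\zeta\in\mathbb D),\qquad \mathcal D_\zeta(f)=\int_{\mathbb D}\frac{1-|z|^2}{|\zeta-z|^2}|f'(z)|^2\,dA(z)\quad(\zeta\in\mathbb T).$$ The space $\mathcal D_\zeta$ is the set of $f\in\mathrm{Hol}(\mathbb D)$ with $\mathcal D_\zeta(f)<\infty$. It is contained in $H^2$, and is a Hilbert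 space with the norm $\|f\|_{\mathcal D_\zeta}^2:=\|f\|_{H^2}^2+\mathcal D_\zeta(f)$. De Branges--Rovnyak spaces. For $\psi\in L^\infty(\mathbb T)$, the Toeplitz operator $T_\psi:H^2\to H^2$ is $T_\psi f:=P_+(\psi f)$, where $P_+:L^2(\mathbb T)\to H^2$ is the orthogonal projection. For $b\in H^\infty$ with $\|b\|_{H^\infty}\le1$, $\mathcal H(b)$ is the image of $H^2$ under $(I-T_bT_{\overline b})^{1/2}$, with the norm making $(I-T_bT_{\overline b})^{1/2}$ a partial isometry of $H^2$ onto $\mathcal H(b)$, i.e. $\|(I-T_bT_{\overline b})^{1/2}f\|_{\mathcal H(b)}=\|f\|_{H^2}$ for $f\in H^2\ominus\ker(I-T_bT_{\overline b})^{1/2}$. Equivalently, $\mathcal H(b)$ is the reproducing kernel Hilbert space on $\mathbb D$ with kernel $(1-\overline{b(w)}b(z))/(1-\overline wz)$. Pairs. The function $b$ is called non-extreme if it is a non-extreme point of the closed unit ball of $H^\infty$, equivalently $\log(1-|b|^2)\in L^1(\mathbb T)$. In that case there is a unique outer function $a\in H^\infty$ with $a(0)>0$ and $|a|^2+|b|^2=1$ a.e. on $\mathbb T$; $(b,a)$ is then called a pair. The map $b\mapsto\phi:=b/a$ is a bijection between the non-extreme functions $b$ and the elements $\phi$ of the Smirnov class $N^+$ (quotients of two $H^\infty$ functions with outer denominator). *)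

theory Defs
  imports "HOL-Complex_Analysis.Complex_Analysis"
begin

abbreviation unit_disc :: "complex set" where
  "unit_disc \<equiv> ball 0 1"

definition area_measure :: "complex measure" where
  "area_measure = uniform_measure lborel unit_disc"

(* A Borel measure on the whole plane, concentrated on the unit circle, where it is |d\<xi>|/(2\<pi>). *)
definition circle_measure :: "complex measure" where
  "circle_measure = distr (uniform_measure lborel {0..2 * pi}) borel cis"

(* Functions on the disc are represented by their extension by 0 to the plane, so that
   equality of functions on the disc is equality in HOL and the pointwise vector space
   operations stay inside the set. *)
definition Hol :: "(complex \<Rightarrow> complex) set" where
  "Hol = {f. f holomorphic_on unit_disc \<and> (\<forall>z. z \<notin> unit_disc \<longrightarrow> f z = 0)}"


subsection \<open>The Hardy spaces\<close>

definition taylor_coeff :: "(complex \<Rightarrow> complex) \<Rightarrow> nat \<Rightarrow> complex" where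
  "taylor_coeff f n = (deriv ^^ n) f 0 / fact n"

definition H2 :: "(complex \<Rightarrow> complex) set" where
  "H2 = {f \<in> Hol. summable (\<lambda>n. (cmod (taylor_coeff f n))\<^sup>2)}"

definition H2_inner :: "(complex \<Rightarrow> complex) \<Rightarrow> (complex \<Rightarrow> complex) \<Rightarrow> complex" where
  "H2_inner f g = (\<Sum>n. taylor_coeff f n * cnj (taylor_coeff g n))"

definition H2_norm :: "(complex \<Rightarrow> complex) \<Rightarrow> real" where
  "H2_norm f = sqrt (\<Sum>n. (cmod (taylor_coeff f n))\<^sup>2)"

definition Hinf :: "(complex \<Rightarrow> complex) set" where
  "Hinf = {f \<in> Hol. bounded (f ` unit_disc)}"

definition Hinf_norm :: "(complex \<Rightarrow> complex) \<Rightarrow> real" where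
  "Hinf_norm f = (SUP z\<in>unit_disc. cmod (f z))"

definition Hinf_ball :: "(complex \<Rightarrow> complex) set" where
  "Hinf_ball = {f \<in> Hinf. Hinf_norm f \<le> 1}"

definition L2T :: "(complex \<Rightarrow> complex) set" where
  "L2T = {g \<in> borel_measurable circle_measure.
            integrable circle_measure (\<lambda>\<xi>. (cmod (g \<xi>))\<^sup>2)}"

(* The boundary function of f in H2, which identifies H2 with a closed subspace of L2 of the
   circle: the limit in L2 of the dilations f(r\<xi>) as r tends to 1. It is determined up to
   null sets (and agrees almost everywhere with the radial limits of f), so the choice of a
   representative does not matter below. *)
definition boundary_fun :: "(complex \<Rightarrow> complex) \<Rightarrow> complex \<Rightarrow> complex" where
  "boundary_fun f = (SOME g. g \<in> L2T \<and>
     ((\<lambda>r::real. LINT \<xi>|circle_measure. (cmod (f (of_real r * \<xi>) - g \<xi>))\<^sup>2) \<longlongrightarrow> 0) (at_left 1))"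


subsection \<open>Toeplitz operators\<close>

(* The orthogonal projection of L2 of the circle onto H2. *)
definition P_plus :: "(complex \<Rightarrow> complex) \<Rightarrow> complex \<Rightarrow> complex" where
  "P_plus g = (THE h. h \<in> H2 \<and>
     (\<forall>k\<in>H2. (LINT \<xi>|circle_measure. (g \<xi> - boundary_fun h \<xi>) * cnj (boundary_fun k \<xi>)) = 0))"

definition toeplitz :: "(complex \<Rightarrow> complex) \<Rightarrow> (complex \<Rightarrow> complex) \<Rightarrow> complex \<Rightarrow> complex" where
  "toeplitz \<psi> f = P_plus (\<lambda>\<xi>. \<psi> \<xi> * boundary_fun f \<xi>)"

definition bounded_positive_op :: "((complex \<Rightarrow> complex) \<Rightarrow> complex \<Rightarrow> complex) \<Rightarrow> bool" where
  "bounded_positive_op S \<longleftrightarrow>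
     (\<forall>f\<in>H2. S f \<in> H2) \<and>
     (\<forall>f\<in>H2. \<forall>g\<in>H2. \<forall>c d. S (\<lambda>z. c * f z + d * g z) = (\<lambda>z. c * S f z + d * S g z)) \<and>
     (\<exists>C. \<forall>f\<in>H2. H2_norm (S f) \<le> C * H2_norm f) \<and>
     (\<forall>f\<in>H2. H2_inner (S f) f \<in> \<real>\<^sub>\<ge>\<^sub>0)"

(* The positive square root of an operator on H2; the value 0 off H2 only serves to make it
   unique as a HOL function. *)
definition op_sqrt ::
  "((complex \<Rightarrow> complex) \<Rightarrow> complex \<Rightarrow> complex) \<Rightarrow> (complex \<Rightarrow> complex) \<Rightarrow> complex \<Rightarrow> complex" where
  "op_sqrt A = (THE S. bounded_positive_op S \<and> (\<forall>f\<in>H2. S (S f) = A f) \<and>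
                       (\<forall>f. f \<notin> H2 \<longrightarrow> S f = (\<lambda>z. 0)))"


subsection \<open>De Branges--Rovnyak spaces\<close>

(* The operator (I - T_b T_{conj b})^(1/2). *)
definition defect_op :: "(complex \<Rightarrow> complex) \<Rightarrow> (complex \<Rightarrow> complex) \<Rightarrow> complex \<Rightarrow> complex" where
  "defect_op b = op_sqrt (\<lambda>f z. f z -
     toeplitz (boundary_fun b) (toeplitz (\<lambda>\<xi>. cnj (boundary_fun b \<xi>)) f) z)"

definition dBR_space :: "(complex \<Rightarrow> complex) \<Rightarrow> (complex \<Rightarrow> complex) set" where
  "dBR_space b = defect_op b ` H2"

definition dBR_norm :: "(complex \<Rightarrow> complex) \<Rightarrow> (complex \<Rightarrow> complex) \<Rightarrow> real" where
  "dBR_norm b f = H2_norm (THE g. g \<in> H2 \<and> defect_op b g = f \<and>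
     (\<forall>k\<in>H2. defect_op b k = (\<lambda>z. 0) \<longrightarrow> H2_inner g k = 0))"


subsection \<open>Weighted Dirichlet spaces\<close>

definition dirichlet_integral :: "complex \<Rightarrow> (complex \<Rightarrow> complex) \<Rightarrow> ennreal" where
  "dirichlet_integral \<zeta> f =
     (if cmod \<zeta> < 1 then
        (\<integral>\<^sup>+z. ennreal (ln (cmod ((1 - cnj \<zeta> * z) / (\<zeta> - z))) * (2 / (1 - (cmod \<zeta>)\<^sup>2))
                     * (cmod (deriv f z))\<^sup>2) \<partial>area_measure)
      else
        (\<integral>\<^sup>+z. ennreal ((1 - (cmod z)\<^sup>2) / (cmod (\<zeta> - z))\<^sup>2 * (cmod (deriv f z))\<^sup>2) \<partial>area_measure))"

definition dirichlet_space :: "complex \<Rightarrow> (complex \<Rightarrow> complex) set" where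
  "dirichlet_space \<zeta> = {f \<in> Hol. dirichlet_integral \<zeta> f < \<infinity>}"

definition dirichlet_norm :: "complex \<Rightarrow> (complex \<Rightarrow> complex) \<Rightarrow> real" where
  "dirichlet_norm \<zeta> f = sqrt ((H2_norm f)\<^sup>2 + enn2real (dirichlet_integral \<zeta> f))"


subsection \<open>Pairs\<close>

definition non_extreme :: "(complex \<Rightarrow> complex) \<Rightarrow> bool" where
  "non_extreme b \<longleftrightarrow> b \<in> Hinf_ball \<and>
     (\<exists>f\<in>Hinf_ball. \<exists>g\<in>Hinf_ball. f \<noteq> g \<and>
        (\<exists>t::real. 0 < t \<and> t < 1 \<and> b = (\<lambda>z. of_real (1 - t) * f z + of_real t * g z)))"

(* Bounded outer functions: f is, up to a unimodular constant, the exponential of the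
   Herglotz integral of log|f|. Non-vanishing on the boundary is stated separately, since it
   is part of log|f| being integrable but ln 0 = 0 in HOL. *)
definition outer_Hinf :: "(complex \<Rightarrow> complex) \<Rightarrow> bool" where
  "outer_Hinf f \<longleftrightarrow> f \<in> Hinf \<and>
     (AE \<xi> in circle_measure. boundary_fun f \<xi> \<noteq> 0) \<and>
     integrable circle_measure (\<lambda>\<xi>. ln (cmod (boundary_fun f \<xi>))) \<and>
     (\<exists>c. cmod c = 1 \<and> (\<forall>z\<in>unit_disc. f z =
        c * exp (LINT \<xi>|circle_measure.
                   (\<xi> + z) / (\<xi> - z) * of_real (ln (cmod (boundary_fun f \<xi>))))))"

definition is_pair :: "(complex \<Rightarrow> complex) \<Rightarrow> (complex \<Rightarrow> complex) \<Rightarrow> bool" where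
  "is_pair b a \<longleftrightarrow> non_extreme b \<and> outer_Hinf a \<and> Im (a 0) = 0 \<and> Re (a 0) > 0 \<and>
     (AE \<xi> in circle_measure. (cmod (boundary_fun a \<xi>))\<^sup>2 + (cmod (boundary_fun b \<xi>))\<^sup>2 = 1)"

end

theory Submission imports Defs begin

text \<open>Both spaces turn out to consist of the \<open>f = const + (z - \<zeta>) g\<close> with \<open>f, g\<close> in \<open>H\<^sup>2\<close>, with
  squared norm \<open>\<parallel>f\<parallel>\<^sup>2 + \<parallel>g\<parallel>\<^sup>2\<close>.

  On the de Branges--Rovnyak side, \<open>|a|\<^sup>2 + |b|\<^sup>2 = 1\<close> and \<open>(1 - \<zeta>\<^sup>* z) b = z a\<close> give
  \<open>(1 + |1 - \<zeta>\<^sup>* z|\<^sup>2) |a|\<^sup>2 = |1 - \<zeta>\<^sup>* z|\<^sup>2\<close> on the circle. Spectral factorisation of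
  \<open>1 + |1 - \<zeta>\<^sup>* z|\<^sup>2 = P\<^sup>2 |1 - \<beta> z|\<^sup>2\<close> and outerness of \<open>a\<close> yield \<open>b = c z / (P (1 - \<beta> z))\<close> with
  \<open>|c| = 1\<close>. Then \<open>I - T\<^sub>b T\<^sub>b\<^sup>* = J J\<^sup>*\<close> for the first projection \<open>J\<close> of the closed graph
  \<open>{(f, g)}\<close>, and the positive square root has the same range as \<open>J\<close>, with the same norm.

  On the Dirichlet side this is the local Douglas formula \<open>D\<^sub>\<zeta> f = \<parallel>g\<parallel>\<^sup>2\<close>. For \<open>|\<zeta>| = 1\<close> the integral is
  \<open>\<Sum> |F n|\<^sup>2 / ((n + 1) (n + 2))\<close>, where \<open>F\<close> are the coefficients of \<open>f' / (\<zeta> - z)\<close>, and summation by parts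
  telescopes it. For \<open>|\<zeta>| < 1\<close> the moments of the Green function of the disc form the Gram matrix
  of the quotients \<open>(z\<^sup>m - \<zeta>\<^sup>m) / (z - \<zeta>)\<close>, which settles polynomials; density does the rest.\<close>

section \<open>Square roots of positive operators\<close>

text \<open>Put A = I - M M', where M is multiplication by b and M' its adjoint. If (A h, K h) lies
  in the graph and f \<bullet> A h + g \<bullet> K h = f \<bullet> h for every pair (f, g) in it,
  then h \<mapsto> (A h, K h) is the adjoint of J and A = J J'. Two factorisations of the same
  operator have equal ranges with equal quotient norms (Douglas), and J is injective because f
  determines g; this replaces any work with reproducing kernels. The square root enters
  \<open>defect_op\<close> only through a definite description over all bounded positive
  complex-linear operators. Existence and uniqueness are therefore both needed, against competitors
  not known to be symmetric or to commute with anything. The operator theory uses the real inner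
  product Re <x, y>; complex scalars are operators that commute with everything in sight. For
  |\<zeta>| = 1 the difficulty is that the relation determines the coefficients of g only up to a
  constant, which must be fixed so that g becomes square summable. For |\<zeta>| < 1 a limit of
  polynomials gives just one inequality for the energy; the other one uses that first inequality to
  control the error.\<close>

lemma quadratic_nonneg_imp_zero:
  fixes b c :: real
  assumes "\<And>t. 2 * t * b + t\<^sup>2 * c \<ge> 0"
  shows "b = 0"
proof (rule ccontr)
  assume "b \<noteq> 0"
  have c: "c \<ge> 0" using assms[of 1] assms[of "-1"] by simp
  \<comment> \<open>The minimiser - b / c is undefined for c = 0. The added 1 repairs this and still
    makes the quadratic negative, with value - t^2 (c + 2).\<close>
  define t where "t = - b / (c + 1)"
  have b: "b = - (t * (c + 1))" using c by (simp add: t_def)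
  have "t \<noteq> 0" using \<open>b \<noteq> 0\<close> b by auto
  have "0 \<le> 2 * t * b + t\<^sup>2 * c" by (rule assms)
  also have "\<dots> = - (t\<^sup>2 * (c + 2))" by (simp add: b power2_eq_square algebra_simps)
  finally show False using \<open>t \<noteq> 0\<close> c by (simp add: mult_le_0_iff)
qed

text \<open>Lax--Milgram type version of the Riesz representation theorem: minimise
  \<open>\<parallel>S h\<parallel>\<^sup>2 - 2 l h\<close>; by the parallelogram law \<open>S\<close> maps a minimising sequence to a Cauchy sequence.\<close>

lemma riesz_range:
  fixes S :: "'a::real_vector \<Rightarrow> 'b::{real_inner, banach}" and l :: "'a \<Rightarrow> real"
  assumes S: "linear S" and l: "linear l" and bd: "\<And>h. \<bar>l h\<bar> \<le> C * norm (S h)"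
  obtains x where "x \<in> closure (range S)" "\<And>h. x \<bullet> S h = l h"
proof -
  define \<phi> where "\<phi> h = (norm (S h))\<^sup>2 - 2 * l h" for h
  have lower: "\<phi> h \<ge> - C\<^sup>2" for h
  proof -
    have "2 * l h \<le> 2 * (C * norm (S h))" using bd[of h] by simp
    also have "\<dots> \<le> (norm (S h))\<^sup>2 + C\<^sup>2"
      using sum_squares_bound[of C "norm (S h)"] by (simp add: algebra_simps)
    finally show ?thesis unfolding \<phi>_def by simp
  qed
  define m where "m = Inf (range \<phi>)"
  have bdd: "bdd_below (range \<phi>)" using lower by (auto simp: bdd_below_def)
  have m: "m \<le> \<phi> h" for h unfolding m_def by (rule cInf_lower) (use bdd in auto)
  have "\<exists>h. \<phi> h < m + 1 / real (Suc n)" for n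
  proof -
    have "Inf (range \<phi>) < m + 1 / real (Suc n)" by (simp add: m_def)
    then show ?thesis using cInf_less_iff[OF _ bdd] by auto
  qed
  then obtain h where h: "\<And>n. \<phi> (h n) < m + 1 / real (Suc n)" by metis
  have par: "(norm (S u - S v))\<^sup>2 \<le> 2 * (\<phi> u + \<phi> v - 2 * m)" for u v
  proof -
    let ?w = "(1/2) *\<^sub>R (u + v)"
    have "S ?w = (1/2) *\<^sub>R (S u + S v)" "l ?w = (l u + l v) / 2"
      using S l by (simp_all add: linear_add linear_scale)
    then have "\<phi> ?w = (norm (S u + S v))\<^sup>2 / 4 - (l u + l v)"
      by (simp add: \<phi>_def power_divide)
    moreover have "(norm (S u + S v))\<^sup>2 + (norm (S u - S v))\<^sup>2 = 2 * (norm (S u))\<^sup>2 + 2 * (norm (S v))\<^sup>2"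
      by (simp add: power2_norm_eq_inner inner_simps inner_commute)
    ultimately show ?thesis using m[of ?w] by (simp add: \<phi>_def)
  qed
  have "Cauchy (\<lambda>n. S (h n))"
  proof (rule metric_CauchyI)
    fix e :: real assume "e > 0"
    then obtain N :: nat where N: "4 / e\<^sup>2 < real N" using reals_Archimedean2 by blast
    then have "N > 0" using \<open>e > 0\<close> by (metis divide_pos_pos of_nat_0_less_iff order_less_trans zero_less_numeral zero_less_power)
    show "\<exists>N. \<forall>m\<ge>N. \<forall>n\<ge>N. dist (S (h m)) (S (h n)) < e"
    proof (intro exI allI impI)
      fix p q assume "p \<ge> N" "q \<ge> N"
      have le: "1 / real (Suc k) \<le> 1 / real N" if "k \<ge> N" for k
        using that \<open>N > 0\<close> by (simp add: frac_le)
      have "(norm (S (h p) - S (h q)))\<^sup>2 \<le> 2 * (\<phi> (h p) + \<phi> (h q) - 2 * m)" by (rule par)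
      also have "\<dots> < 2 * (1 / real N + 1 / real N)"
        using h[of p] h[of q] le[OF \<open>p \<ge> N\<close>] le[OF \<open>q \<ge> N\<close>] by simp
      also have "\<dots> = 4 / real N" by simp
      also have "\<dots> < e\<^sup>2" using N \<open>N > 0\<close> \<open>e > 0\<close> by (simp add: field_simps)
      finally show "dist (S (h p)) (S (h q)) < e"
        using \<open>e > 0\<close> by (simp add: dist_norm power_less_imp_less_base)
    qed
  qed
  then obtain x where x: "(\<lambda>n. S (h n)) \<longlonglongrightarrow> x"
    using Cauchy_convergent convergent_def by blast
  have "(\<lambda>n. \<phi> (h n)) \<longlonglongrightarrow> m"
  proof (rule tendsto_sandwich[OF _ _ tendsto_const])
    show "\<forall>\<^sub>F n in sequentially. m \<le> \<phi> (h n)" using m by simp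
    show "\<forall>\<^sub>F n in sequentially. \<phi> (h n) \<le> m + 1 / real (Suc n)"
      using h by (intro always_eventually) (auto intro: less_imp_le)
    show "(\<lambda>n. m + 1 / real (Suc n)) \<longlonglongrightarrow> m"
      using tendsto_add[OF tendsto_const LIMSEQ_inverse_real_of_nat, of m] by (simp add: inverse_eq_divide)
  qed
  have "x \<bullet> S k = l k" for k
  proof -
    \<comment> \<open>First variation at the minimum. The limit x need not be in the range of S, so
      the perturbation by t k is made at \<open>h n\<close> and the limit in n is taken
      afterwards.\<close>
    have "2 * t * (x \<bullet> S k - l k) + t\<^sup>2 * (norm (S k))\<^sup>2 \<ge> 0" for t
    proof -
      have shift: "\<phi> (h n + t *\<^sub>R k) = \<phi> (h n) + 2 * t * (S (h n) \<bullet> S k - l k) + t\<^sup>2 * (norm (S k))\<^sup>2" for n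
      proof -
        have "S (h n + t *\<^sub>R k) = S (h n) + t *\<^sub>R S k" "l (h n + t *\<^sub>R k) = l (h n) + t * l k"
          using S l by (simp_all add: linear_add linear_scale)
        then show ?thesis unfolding \<phi>_def power2_norm_eq_inner
          by (simp add: inner_add_left inner_add_right inner_commute[of "S k" "S (h n)"] power2_eq_square algebra_simps)
      qed
      have ge: "m \<le> \<phi> (h n) + 2 * t * (S (h n) \<bullet> S k - l k) + t\<^sup>2 * (norm (S k))\<^sup>2" for n
        using m[of "h n + t *\<^sub>R k"] unfolding shift .
      have lim: "(\<lambda>n. \<phi> (h n) + 2 * t * (S (h n) \<bullet> S k - l k) + t\<^sup>2 * (norm (S k))\<^sup>2)
          \<longlonglongrightarrow> m + 2 * t * (x \<bullet> S k - l k) + t\<^sup>2 * (norm (S k))\<^sup>2"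
        by (intro tendsto_add tendsto_mult tendsto_diff tendsto_inner tendsto_const \<open>(\<lambda>n. \<phi> (h n)) \<longlonglongrightarrow> m\<close> x)
      have "m \<le> m + 2 * t * (x \<bullet> S k - l k) + t\<^sup>2 * (norm (S k))\<^sup>2"
        by (rule LIMSEQ_le_const[OF lim]) (use ge in blast)
      then show ?thesis by simp
    qed
    then have "x \<bullet> S k - l k = 0" by (rule quadratic_nonneg_imp_zero)
    then show ?thesis by simp
  qed
  moreover have "x \<in> closure (range S)"
  proof (rule Lim_in_closed_set[OF closed_closure _ _ x])
    show "\<forall>\<^sub>F n in sequentially. S (h n) \<in> closure (range S)"
      by (intro always_eventually allI closure_subset[THEN subsetD] rangeI)
  qed simp
  ultimately show thesis by (rule that[rotated])
qed

text \<open>Riesz representation of x \<mapsto> T x \<bullet> y, with the identity in the role of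
  \<open>S\<close>. The bound for the adjoint comes from
  \<open>(norm (T' y))\<^sup>2 = T (T' y) \<bullet> y\<close>.\<close>

lemma adjoint_exists:
  fixes T :: "'a::{real_inner, banach} \<Rightarrow> 'b::real_inner"
  assumes T: "bounded_linear T"
  obtains T' where "bounded_linear T'" "\<And>x y. T x \<bullet> y = x \<bullet> T' y"
proof -
  interpret T: bounded_linear T by fact
  have "\<exists>z. \<forall>x. z \<bullet> x = T x \<bullet> y" for y
  proof -
    have "linear (\<lambda>x. T x \<bullet> y)"
      by (rule linearI) (simp_all add: T.add T.scaleR inner_simps)
    moreover have "\<bar>T x \<bullet> y\<bar> \<le> (onorm T * norm y) * norm x" for x
    proof -
      have "\<bar>T x \<bullet> y\<bar> \<le> norm (T x) * norm y" by (rule Cauchy_Schwarz_ineq2)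
      also have "\<dots> \<le> (onorm T * norm x) * norm y" by (intro mult_right_mono onorm T) auto
      finally show ?thesis by (simp add: algebra_simps)
    qed
    ultimately obtain z where "\<And>x. z \<bullet> x = T x \<bullet> y"
      using riesz_range[of "\<lambda>x. x" "\<lambda>x. T x \<bullet> y"] linear_id unfolding id_def by metis
    then show ?thesis by blast
  qed
  then obtain T' where T': "\<And>y x. T' y \<bullet> x = T x \<bullet> y" by metis
  have ext: "u = v" if "\<And>x. u \<bullet> x = v \<bullet> x" for u v :: 'a
    using that[of "u - v"] by (metis inner_eq_zero_iff inner_diff_left right_minus_eq)
  have "bounded_linear T'"
  proof
    show "T' (x + y) = T' x + T' y" for x y
      by (rule ext) (simp add: T' inner_simps)
    show "T' (r *\<^sub>R x) = r *\<^sub>R T' x" for r x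
      by (rule ext) (simp add: T' inner_simps)
    show "\<exists>K. \<forall>x. norm (T' x) \<le> norm x * K"
    proof (intro exI allI)
      fix y
      have "(norm (T' y))\<^sup>2 = T (T' y) \<bullet> y" by (simp add: power2_norm_eq_inner T')
      also have "\<dots> \<le> norm (T (T' y)) * norm y" by (rule norm_cauchy_schwarz)
      also have "\<dots> \<le> (onorm T * norm (T' y)) * norm y" by (intro mult_right_mono onorm T) auto
      finally have "norm (T' y) * norm (T' y) \<le> norm (T' y) * (norm y * onorm T)"
        by (simp add: power2_eq_square algebra_simps)
      then show "norm (T' y) \<le> norm y * onorm T"
        by (cases "norm (T' y) = 0") (auto simp: onorm_pos_le[OF T])
    qed
  qed
  moreover have "T x \<bullet> y = x \<bullet> T' y" for x y using T'[of y x] by (simp add: inner_commute)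
  ultimately show thesis using that by blast
qed

text \<open>Visser's iteration for the square root of I - X: a fixed point Y = (X + Y Y) / 2
  satisfies (I - Y)(I - Y) = I - X.\<close>

primrec visser :: "('a::real_normed_vector \<Rightarrow>\<^sub>L 'a) \<Rightarrow> nat \<Rightarrow> ('a \<Rightarrow>\<^sub>L 'a)" where
  "visser X 0 = 0"
| "visser X (Suc n) = (1/2) *\<^sub>R (X + (visser X n o\<^sub>L visser X n))"

text \<open>The scalar iteration for X = 1. It is increasing and bounded by 1, and it majorises the
  norms of the operator iterates and of their increments, so its convergence forces theirs.\<close>

primrec visser_real :: "nat \<Rightarrow> real" where
  "visser_real 0 = 0"
| "visser_real (Suc n) = (1 + (visser_real n)\<^sup>2) / 2"

lemma visser_real_bounds: "0 \<le> visser_real n \<and> visser_real n \<le> 1"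
proof (induction n)
  case (Suc n)
  then have "(visser_real n)\<^sup>2 \<le> 1" by (simp add: power_le_one)
  then show ?case by (simp add: add_nonneg_nonneg)
qed simp

lemma visser_real_mono: "visser_real n \<le> visser_real (Suc n)"
proof -
  have "0 \<le> (1 - visser_real n)\<^sup>2" by simp
  then show ?thesis by (simp add: power2_eq_square algebra_simps)
qed

lemma visser_commute:
  assumes "X o\<^sub>L T = T o\<^sub>L X"
  shows "visser X n o\<^sub>L T = T o\<^sub>L visser X n"
proof -
  have X: "X (T v) = T (X v)" for v
    using assms by (metis blinfun_apply_blinfun_compose)
  have "visser X n (T v) = T (visser X n v)" for v
    by (induction n arbitrary: v) (simp_all add: blinfun.bilinear_simps X)
  then show ?thesis by (intro blinfun_eqI) simp
qed

lemma norm_visser: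
  assumes "norm X \<le> 1" shows "norm (visser X n) \<le> visser_real n"
proof (induction n)
  case (Suc n)
  have "norm (visser X n o\<^sub>L visser X n) \<le> norm (visser X n) * norm (visser X n)"
    by (rule norm_blinfun_compose)
  also have "\<dots> \<le> (visser_real n)\<^sup>2"
    using Suc visser_real_bounds[of n] by (simp add: power2_eq_square mult_mono)
  finally have "norm (X + (visser X n o\<^sub>L visser X n)) \<le> 1 + (visser_real n)\<^sup>2"
    using assms norm_triangle_ineq[of X "visser X n o\<^sub>L visser X n"] by linarith
  then show ?case by simp
qed simp

text \<open>All iterates are polynomials in X and commute, hence Y Y - Z Z = (Y + Z)(Y - Z) for
  consecutive ones. Taking norms gives exactly the recursion for the scalar increments.\<close>

lemma norm_visser_diff:
  assumes "norm X \<le> 1"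
  shows "norm (visser X (Suc n) - visser X n) \<le> visser_real (Suc n) - visser_real n"
proof (induction n)
  case 0 then show ?case using assms by simp
next
  case (Suc n)
  let ?Y = "visser X (Suc n)" and ?Z = "visser X n"
  have com: "?Y o\<^sub>L ?Z = ?Z o\<^sub>L ?Y"
    by (rule visser_commute, rule visser_commute[symmetric]) simp
  then have com': "?Y (?Z v) = ?Z (?Y v)" for v by (metis blinfun_apply_blinfun_compose)
  have "visser X (Suc (Suc n)) - ?Y = (1/2) *\<^sub>R ((?Y o\<^sub>L ?Y) - (?Z o\<^sub>L ?Z))"
    unfolding scaleR_diff_right[symmetric]
    using visser.simps(2)[of X "Suc n"] visser.simps(2)[of X n]
    by (metis add_diff_cancel_left scaleR_diff_right)
  also have "(?Y o\<^sub>L ?Y) - (?Z o\<^sub>L ?Z) = (?Y + ?Z) o\<^sub>L (?Y - ?Z)"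
    by (rule blinfun_eqI) (simp only: blinfun.bilinear_simps blinfun_apply_blinfun_compose com', simp)
  finally have eq: "visser X (Suc (Suc n)) - ?Y = (1/2) *\<^sub>R ((?Y + ?Z) o\<^sub>L (?Y - ?Z))" .
  have "norm ((?Y + ?Z) o\<^sub>L (?Y - ?Z)) \<le> norm (?Y + ?Z) * norm (?Y - ?Z)"
    by (rule norm_blinfun_compose)
  also have "\<dots> \<le> (visser_real (Suc n) + visser_real n) * (visser_real (Suc n) - visser_real n)"
    using norm_visser[OF assms, of "Suc n"] norm_visser[OF assms, of n] visser_real_bounds Suc
    by (intro mult_mono norm_triangle_le add_mono) (auto intro: add_nonneg_nonneg simp del: visser_real.simps)
  finally have "norm (visser X (Suc (Suc n)) - ?Y)
      \<le> (visser_real (Suc n) + visser_real n) * (visser_real (Suc n) - visser_real n) / 2"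
    unfolding eq by (simp del: visser.simps visser_real.simps)
  also have "\<dots> = visser_real (Suc (Suc n)) - visser_real (Suc n)"
    using visser_real.simps(2)[of "Suc n"] visser_real.simps(2)[of n]
    by (simp only:) (simp add: field_simps power2_eq_square)
  finally show ?case .
qed

text \<open>The root is I - Y with Y the norm limit of the iteration; it is positive because Y has
  norm at most 1. Being a norm limit of polynomials in X it commutes with everything that commutes
  with X, and this last clause is what later yields complex linearity and uniqueness.\<close>

lemma positive_sqrt_exists:
  fixes X :: "'a::{real_inner, banach} \<Rightarrow>\<^sub>L 'a"
  assumes X: "norm X \<le> 1" and sym: "\<And>x y. X x \<bullet> y = x \<bullet> X y"
  obtains S :: "'a \<Rightarrow>\<^sub>L 'a" where
    "\<And>x. S (S x) = x - X x" "\<And>x y. S x \<bullet> y = x \<bullet> S y" "\<And>x. S x \<bullet> x \<ge> 0"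
    "\<And>T. X o\<^sub>L T = T o\<^sub>L X \<Longrightarrow> S o\<^sub>L T = T o\<^sub>L S"
proof -
  have "convergent visser_real"
    using visser_real_bounds visser_real_mono
    by (intro Bseq_monoseq_convergent BseqI'[where K=1] incseq_imp_monoseq incseq_SucI) simp_all
  then have "Cauchy visser_real" by (simp add: convergent_Cauchy)
  have dist: "norm (visser X (n + k) - visser X n) \<le> visser_real (n + k) - visser_real n" for n k
  proof (induction k)
    case (Suc k)
    have "norm (visser X (n + Suc k) - visser X n)
       \<le> norm (visser X (Suc (n + k)) - visser X (n + k)) + norm (visser X (n + k) - visser X n)"
      using norm_triangle_ineq[of "visser X (Suc (n + k)) - visser X (n + k)" "visser X (n + k) - visser X n"]
      by simp
    then show ?case using Suc norm_visser_diff[OF X, of "n + k"] by simp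
  qed simp
  have "Cauchy (visser X)"
  proof (rule metric_CauchyI)
    fix e :: real assume "e > 0"
    then obtain N where N: "\<And>m n. m \<ge> N \<Longrightarrow> n \<ge> N \<Longrightarrow> dist (visser_real m) (visser_real n) < e"
      using metric_CauchyD[OF \<open>Cauchy visser_real\<close>] by blast
    have le: "dist (visser X m) (visser X n) < e" if "n \<ge> N" "m \<ge> n" for m n
      using dist[of n "m - n"] N[of m n] that by (simp add: dist_norm)
    show "\<exists>N. \<forall>m\<ge>N. \<forall>n\<ge>N. dist (visser X m) (visser X n) < e"
    proof (intro exI allI impI)
      fix m n assume "m \<ge> N" "n \<ge> N"
      then show "dist (visser X m) (visser X n) < e"
        using le[of n m] le[of m n] by (cases "n \<le> m") (auto simp: dist_commute)
    qed
  qed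
  then obtain Y where Y: "visser X \<longlonglongrightarrow> Y" using Cauchy_convergent convergent_def by blast
  have Yv: "(\<lambda>n. visser X n v) \<longlonglongrightarrow> Y v" for v
    by (rule blinfun.tendsto[OF Y tendsto_const])
  have "norm Y \<le> 1"
  proof (rule LIMSEQ_le_const2[OF tendsto_norm[OF Y]], intro exI allI impI)
    show "norm (visser X n) \<le> 1" for n
      using norm_visser[OF X, of n] visser_real_bounds[of n] by linarith
  qed
  have fixp: "Y v = (1/2) *\<^sub>R (X v + Y (Y v))" for v
  proof (rule LIMSEQ_unique)
    show "(\<lambda>n. visser X (Suc n) v) \<longlonglongrightarrow> Y v" using Yv by (rule LIMSEQ_Suc)
    have "(\<lambda>n. (1/2) *\<^sub>R (X v + (visser X n o\<^sub>L visser X n) v)) \<longlonglongrightarrow> (1/2) *\<^sub>R (X v + (Y o\<^sub>L Y) v)"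
      by (intro tendsto_scaleR tendsto_add tendsto_const blinfun.tendsto Y
          bounded_bilinear.tendsto[OF bounded_bilinear_blinfun_compose])
    then show "(\<lambda>n. visser X (Suc n) v) \<longlonglongrightarrow> (1/2) *\<^sub>R (X v + Y (Y v))"
      by (simp add: blinfun.bilinear_simps)
  qed
  have symn: "visser X n x \<bullet> y = x \<bullet> visser X n y" for n x y
    by (induction n arbitrary: x y) (simp_all add: blinfun.bilinear_simps sym inner_simps)
  have symY: "Y x \<bullet> y = x \<bullet> Y y" for x y
  proof (rule LIMSEQ_unique)
    show "(\<lambda>n. visser X n x \<bullet> y) \<longlonglongrightarrow> Y x \<bullet> y" by (intro tendsto_inner tendsto_const Yv)
    show "(\<lambda>n. visser X n x \<bullet> y) \<longlonglongrightarrow> x \<bullet> Y y" unfolding symn by (intro tendsto_inner tendsto_const Yv)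
  qed
  define S where "S = id_blinfun - Y"
  have Sv: "S v = v - Y v" for v by (simp add: S_def blinfun.bilinear_simps)
  show thesis
  proof (rule that)
    show "S (S x) = x - X x" for x
    proof -
      have "2 *\<^sub>R Y x = X x + Y (Y x)" by (subst fixp[of x]) simp
      then have "X x = Y x + Y x - Y (Y x)" by (simp add: scaleR_2)
      then show ?thesis by (simp add: Sv blinfun.bilinear_simps)
    qed
    show "S x \<bullet> y = x \<bullet> S y" for x y by (simp add: Sv inner_simps symY)
    show "S x \<bullet> x \<ge> 0" for x
    proof -
      have "Y x \<bullet> x \<le> norm (Y x) * norm x" by (rule norm_cauchy_schwarz)
      also have "\<dots> \<le> (norm Y * norm x) * norm x" by (intro mult_right_mono norm_blinfun) auto
      also have "\<dots> \<le> (1 * norm x) * norm x" by (intro mult_right_mono \<open>norm Y \<le> 1\<close>) auto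
      finally show ?thesis by (simp add: Sv inner_simps power2_norm_eq_inner[symmetric] power2_eq_square)
    qed
    show "S o\<^sub>L T = T o\<^sub>L S" if "X o\<^sub>L T = T o\<^sub>L X" for T
    proof (rule blinfun_eqI)
      fix v
      have "Y (T v) = T (Y v)"
      proof (rule LIMSEQ_unique)
        show "(\<lambda>n. visser X n (T v)) \<longlonglongrightarrow> Y (T v)" by (rule Yv)
        have "visser X n (T v) = T (visser X n v)" for n
          using visser_commute[OF that, of n] by (metis blinfun_apply_blinfun_compose)
        then show "(\<lambda>n. visser X n (T v)) \<longlonglongrightarrow> T (Y v)"
          using blinfun.tendsto[OF tendsto_const Yv[of v]] by simp
      qed
      then show "(S o\<^sub>L T) v = (T o\<^sub>L S) v" by (simp add: Sv blinfun.bilinear_simps)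
    qed
  qed
qed

text \<open>Cauchy--Schwarz for the semi-inner product S x \<bullet> y, in the form of a vanishing
  first variation in the direction S x.\<close>

lemma positive_symmetric_eq_0:
  fixes S :: "'a::real_inner \<Rightarrow> 'a"
  assumes "linear S" "\<And>x y. S x \<bullet> y = x \<bullet> S y" "\<And>x. S x \<bullet> x \<ge> 0" "S x \<bullet> x = 0"
  shows "S x = 0"
proof -
  have "2 * t * (S x \<bullet> S x) + t\<^sup>2 * (S (S x) \<bullet> S x) \<ge> 0" for t
    using assms(3)[of "x + t *\<^sub>R S x"] assms
    by (simp add: linear_add linear_scale inner_simps power2_eq_square algebra_simps)
  then have "S x \<bullet> S x = 0" by (rule quadratic_nonneg_imp_zero)
  then show ?thesis by simp
qed

text \<open>With E = S - R, commutation gives (S + R) E = S S - R R = 0. Pairing with E x produces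
  two nonnegative terms with sum 0, so S E = R E = 0, thus E E = 0, and symmetry of E gives E =
  0.\<close>

lemma positive_sqrt_unique:
  fixes S R :: "'a::real_inner \<Rightarrow> 'a"
  assumes S: "linear S" "\<And>x y. S x \<bullet> y = x \<bullet> S y" "\<And>x. S x \<bullet> x \<ge> 0"
    and R: "linear R" "\<And>x y. R x \<bullet> y = x \<bullet> R y" "\<And>x. R x \<bullet> x \<ge> 0"
    and sq: "\<And>x. S (S x) = R (R x)" and com: "\<And>x. S (R x) = R (S x)"
  shows "S = R"
proof
  define E where "E x = S x - R x" for x
  have symE: "E x \<bullet> y = x \<bullet> E y" for x y by (simp add: E_def inner_simps S R)
  have "S (E x) + R (E x) = 0" for x
    using S(1) R(1) by (simp add: E_def linear_diff sq com)
  then have "S (E x) \<bullet> E x + R (E x) \<bullet> E x = 0" for x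
    by (metis inner_add_left inner_zero_left)
  then have "S (E x) \<bullet> E x = 0" "R (E x) \<bullet> E x = 0" for x
    using S(3)[of "E x"] R(3)[of "E x"] by (smt (verit))+
  then have "S (E x) = 0" "R (E x) = 0" for x
    using positive_symmetric_eq_0[OF S] positive_symmetric_eq_0[OF R] by blast+
  then have "E (E x) = 0" for x using E_def[of "E x"] by simp
  then have "E x \<bullet> E x = 0" for x using symE[of x "E x"] by (simp only: inner_zero_right)
  then have "E x = 0" for x by (simp only: inner_eq_zero_iff)
  then show "S x = R x" for x using E_def[of x] by simp
qed

text \<open>Here \<open>S\<close> plays the role of the square root of \<open>A = J J\<^sup>*\<close>, where \<open>J\<close> is the first
  projection restricted to the closed graph \<open>\<Gamma>\<close> and \<open>h \<mapsto> (A h, K h)\<close> is its adjoint.\<close>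

lemma range_sqrt_graph:
  fixes S :: "'a::{real_inner, banach} \<Rightarrow> 'a" and \<Gamma> :: "('a \<times> 'b::{real_inner, banach}) set"
  assumes lin: "bounded_linear S" and sym: "\<And>x y. S x \<bullet> y = x \<bullet> S y"
    and inj: "inj S" and \<Gamma>: "closed \<Gamma>"
    and graph: "\<And>f g g'. (f, g) \<in> \<Gamma> \<Longrightarrow> (f, g') \<in> \<Gamma> \<Longrightarrow> g = g'"
    and K: "linear K" "\<And>h. (S (S h), K h) \<in> \<Gamma>"
    and adj: "\<And>f g h. (f, g) \<in> \<Gamma> \<Longrightarrow> f \<bullet> S (S h) + g \<bullet> K h = f \<bullet> h"
  shows "range S = fst ` \<Gamma>" and "(S x, g) \<in> \<Gamma> \<Longrightarrow> (norm x)\<^sup>2 = (norm (S x))\<^sup>2 + (norm g)\<^sup>2"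
proof -
  interpret S: bounded_linear S by fact
  have nrm: "(norm (S (S h)))\<^sup>2 + (norm (K h))\<^sup>2 = (norm (S h))\<^sup>2" for h
    using adj[OF K(2)[of h], of h] by (simp add: power2_norm_eq_inner sym)
  \<comment> \<open>For x = S h the choice g = K h works, by \<open>nrm\<close>. Since K is
    dominated by S in norm, K h converges whenever S h does, and closedness of \<Gamma> extends the
    claim to the closure of the range.\<close>
  have main: "\<exists>g. (S x, g) \<in> \<Gamma> \<and> (norm x)\<^sup>2 = (norm (S x))\<^sup>2 + (norm g)\<^sup>2" if cl: "x \<in> closure (range S)" for x
  proof -
    obtain y where y: "\<And>n. y n \<in> range S" "y \<longlonglongrightarrow> x" using closure_sequential[THEN iffD1, OF cl] by blast
    have "\<forall>n. \<exists>u. y n = S u" using y(1) by blast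
    then obtain h where h: "\<And>n. y n = S (h n)" by metis
    have "(\<lambda>n. S (h n)) = y" by (rule ext) (rule h[symmetric])
    then have yx: "(\<lambda>n. S (h n)) \<longlonglongrightarrow> x" using y(2) by simp
    have "norm (K u) \<le> norm (S u)" for u
      using nrm[of u] zero_le_power2[of "norm (S (S u))"] 
      by - (rule power2_le_imp_le, linarith, rule norm_ge_zero)
    then have Kle: "dist (K u) (K v) \<le> dist (S u) (S v)" for u v
      unfolding dist_norm linear_diff[OF K(1), symmetric] S.diff[symmetric] by blast
    have "Cauchy (\<lambda>n. K (h n))"
    proof (rule metric_CauchyI)
      fix e :: real assume "e > 0"
      then obtain N where N: "\<And>m n. m \<ge> N \<Longrightarrow> n \<ge> N \<Longrightarrow> dist (S (h m)) (S (h n)) < e"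
        using metric_CauchyD[OF LIMSEQ_imp_Cauchy[OF yx]] by blast
      then show "\<exists>N. \<forall>m\<ge>N. \<forall>n\<ge>N. dist (K (h m)) (K (h n)) < e"
        using order_le_less_trans[OF Kle] by blast
    qed
    then obtain g where g: "(\<lambda>n. K (h n)) \<longlonglongrightarrow> g" using Cauchy_convergent convergent_def by blast
    have Sx: "(\<lambda>n. S (S (h n))) \<longlonglongrightarrow> S x" by (rule S.tendsto[OF yx])
    have "(S x, g) \<in> \<Gamma>"
      using closed_sequentially[OF \<Gamma>, of "\<lambda>n. (S (S (h n)), K (h n))"] K(2) tendsto_Pair[OF Sx g] by blast
    moreover have "(norm x)\<^sup>2 = (norm (S x))\<^sup>2 + (norm g)\<^sup>2"
    proof (rule LIMSEQ_unique)
      show "(\<lambda>n. (norm (S (h n)))\<^sup>2) \<longlonglongrightarrow> (norm x)\<^sup>2" by (intro tendsto_power tendsto_norm yx)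
      show "(\<lambda>n. (norm (S (h n)))\<^sup>2) \<longlonglongrightarrow> (norm (S x))\<^sup>2 + (norm g)\<^sup>2"
        by (subst nrm[symmetric]) (intro tendsto_add tendsto_power tendsto_norm Sx g)
    qed
    ultimately show ?thesis by blast
  qed
  \<comment> \<open>Density of the range: the projection x' of x onto its closure has S x' = S x by
    symmetry, and S is injective.\<close>
  have cl: "x \<in> closure (range S)" for x
  proof -
    have "linear (\<lambda>h. x \<bullet> S h)" by (rule linearI) (simp_all add: S.add S.scaleR inner_simps)
    moreover have "\<bar>x \<bullet> S h\<bar> \<le> norm x * norm (S h)" for h by (rule Cauchy_Schwarz_ineq2)
    ultimately obtain x' where x': "x' \<in> closure (range S)" "\<And>h. x' \<bullet> S h = x \<bullet> S h"
      using riesz_range[OF S.linear_axioms] by metis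
    have "S x' \<bullet> h = S x \<bullet> h" for h using x'(2)[of h] by (simp add: sym)
    then have "(S x' - S x) \<bullet> (S x' - S x) = 0" by (simp add: inner_diff_left)
    then have "S x' = S x" by simp
    then show ?thesis using injD[OF inj] x'(1) by blast
  qed
  show "(norm x)\<^sup>2 = (norm (S x))\<^sup>2 + (norm g)\<^sup>2" if "(S x, g) \<in> \<Gamma>"
    using main[OF cl[of x]] graph that by blast
  show "range S = fst ` \<Gamma>"
  proof (intro subset_antisym subsetI)
    fix f assume "f \<in> range S"
    then obtain x where "f = S x" by blast
    then obtain g where "(f, g) \<in> \<Gamma>" using main[OF cl[of x]] by blast
    then show "f \<in> fst ` \<Gamma>" by force
  next
    fix f assume "f \<in> fst ` \<Gamma>"
    then obtain g where fg: "(f, g) \<in> \<Gamma>" by auto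
    \<comment> \<open>The functional h \<mapsto> f \<bullet> h is bounded by a multiple of the norm
      of S h, so it is represented through S by some x; symmetry turns x \<bullet> S h = f \<bullet>
      h into S x = f.\<close>
    have "\<bar>f \<bullet> h\<bar> \<le> (norm f + norm g) * norm (S h)" for h
    proof -
      have "norm (S (S h)) \<le> norm (S h)" "norm (K h) \<le> norm (S h)"
        using nrm[of h] zero_le_power2[of "norm (S (S h))"] zero_le_power2[of "norm (K h)"]
        by - (rule power2_le_imp_le, linarith, rule norm_ge_zero)+
      then have "norm f * norm (S (S h)) + norm g * norm (K h) \<le> norm f * norm (S h) + norm g * norm (S h)"
        by (intro add_mono mult_left_mono) auto
      moreover have "\<bar>f \<bullet> h\<bar> \<le> norm f * norm (S (S h)) + norm g * norm (K h)"
        using adj[OF fg, of h] Cauchy_Schwarz_ineq2[of f "S (S h)"] Cauchy_Schwarz_ineq2[of g "K h"] by linarith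
      ultimately show ?thesis by (simp add: algebra_simps)
    qed
    moreover have "linear (\<lambda>h. f \<bullet> h)" by (rule linearI) (simp_all add: inner_simps)
    ultimately obtain x where x: "\<And>h. x \<bullet> S h = f \<bullet> h"
      using riesz_range[OF S.linear_axioms] by metis
    then have "S x \<bullet> (S x - f) = f \<bullet> (S x - f)" by (simp add: sym)
    then have "(S x - f) \<bullet> (S x - f) = 0" by (simp add: inner_diff_left)
    then have "S x = f" by simp
    then show "f \<in> range S" by blast
  qed
qed

section \<open>The Hilbert space of square-summable sequences\<close>

text \<open>A type of its own, so that the theory of Banach spaces and bounded operators applies to
  H2 through \<open>l2_fun\<close>. The inner product instantiated on it is the real part of the
  complex pairing of coefficients.\<close>

typedef l2 = "{x :: nat \<Rightarrow> complex. summable (\<lambda>n. (cmod (x n))\<^sup>2)}"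
  morphisms coef Abs_l2
  by (rule exI[of _ "\<lambda>_. 0"]) simp

lemma summable_coef: "summable (\<lambda>n. (cmod (coef x n))\<^sup>2)"
  using coef[of x] by simp

lemma coef_Abs_l2: "summable (\<lambda>n. (cmod (x n))\<^sup>2) \<Longrightarrow> coef (Abs_l2 x) = x"
  by (rule Abs_l2_inverse) simp

lemma l2_eqI: "(\<And>n. coef x n = coef y n) \<Longrightarrow> x = y"
  by (metis coef_inject ext)

lemma cmod_add_square_le: "(cmod (a + b))\<^sup>2 \<le> 2 * (cmod a)\<^sup>2 + 2 * (cmod b)\<^sup>2"
proof -
  have "(cmod (a + b))\<^sup>2 + (cmod (a - b))\<^sup>2 = 2 * (cmod a)\<^sup>2 + 2 * (cmod b)\<^sup>2"
    unfolding cmod_power2 by (simp add: power2_eq_square algebra_simps)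
  then show ?thesis by (smt (verit) zero_le_power2)
qed

lemma summable_square_add:
  assumes "summable (\<lambda>n. (cmod (x n))\<^sup>2)" "summable (\<lambda>n. (cmod (y n))\<^sup>2)"
  shows "summable (\<lambda>n. (cmod (x n + y n))\<^sup>2)"
proof (rule summable_comparison_test'[where N=0])
  show "summable (\<lambda>n. 2 * (cmod (x n))\<^sup>2 + 2 * (cmod (y n))\<^sup>2)"
    using assms by (intro summable_add summable_mult)
qed (simp add: cmod_add_square_le)

lemma summable_square_mult:
  assumes "summable (\<lambda>n. (cmod (x n))\<^sup>2)"
  shows "summable (\<lambda>n. (cmod (c * x n))\<^sup>2)"
  using summable_mult[OF assms, of "(cmod c)\<^sup>2"] by (simp add: norm_mult power_mult_distrib)

lemma summable_square_prod:
  assumes "summable (\<lambda>n. (cmod (x n))\<^sup>2)" "summable (\<lambda>n. (cmod (y n))\<^sup>2)"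
  shows "summable (\<lambda>n. cmod (x n) * cmod (y n))"
proof (rule summable_comparison_test'[where N=0])
  show "summable (\<lambda>n. (cmod (x n))\<^sup>2 + (cmod (y n))\<^sup>2)" using assms by (rule summable_add)
  show "norm (cmod (x n) * cmod (y n)) \<le> (cmod (x n))\<^sup>2 + (cmod (y n))\<^sup>2" for n
  proof -
    have "0 \<le> cmod (x n) * cmod (y n)" by simp
    then show ?thesis unfolding real_norm_def
      using sum_squares_bound[of "cmod (x n)" "cmod (y n)"] by linarith
  qed
qed

instantiation l2 :: real_vector
begin
definition "0 = Abs_l2 (\<lambda>_. 0)"
definition "x + y = Abs_l2 (\<lambda>n. coef x n + coef y n)"
definition "- x = Abs_l2 (\<lambda>n. - coef x n)"
definition "x - y = Abs_l2 (\<lambda>n. coef x n - coef y n)"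
definition "r *\<^sub>R x = Abs_l2 (\<lambda>n. r *\<^sub>R coef x n)"

lemma coef_zero [simp]: "coef 0 n = 0"
  by (simp add: zero_l2_def coef_Abs_l2)

lemma coef_add [simp]: "coef (x + y) n = coef x n + coef y n"
  by (simp add: plus_l2_def coef_Abs_l2 summable_square_add summable_coef)

lemma coef_uminus [simp]: "coef (- x) n = - coef x n"
  by (simp add: uminus_l2_def coef_Abs_l2 summable_coef)

lemma coef_diff [simp]: "coef (x - y) n = coef x n - coef y n"
  using summable_square_add[OF summable_coef[of x], of "\<lambda>n. - coef y n"]
  by (simp add: minus_l2_def coef_Abs_l2 summable_coef)

lemma coef_scaleR [simp]: "coef (r *\<^sub>R x) n = r *\<^sub>R coef x n"
  using summable_square_mult[OF summable_coef[of x], of "complex_of_real r"]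
  by (simp add: scaleR_l2_def coef_Abs_l2 scaleR_conv_of_real)

instance
  by standard (auto intro!: l2_eqI simp: algebra_simps)
end

lemma abs_inner_complex_le: "\<bar>a \<bullet> b\<bar> \<le> cmod a * cmod b" for a b :: complex
  by (rule Cauchy_Schwarz_ineq2)

lemma summable_inner_coef: "summable (\<lambda>n. coef x n \<bullet> coef y n)"
  by (rule summable_comparison_test'[OF summable_square_prod[OF summable_coef[of x] summable_coef[of y]], where N=0])
     (simp add: abs_inner_complex_le)

instantiation l2 :: real_inner
begin
definition "x \<bullet> y = (\<Sum>n. coef x n \<bullet> coef y n)"
definition "norm x = sqrt (x \<bullet> x)" for x :: l2
definition "dist x y = norm (x - y)" for x y :: l2
definition "sgn x = x /\<^sub>R norm x" for x :: l2
definition "(uniformity :: (l2 \<times> l2) filter) = (INF e\<in>{0 <..}. principal {(x, y). dist x y < e})"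
definition "open U = (\<forall>x\<in>U. eventually (\<lambda>(x', y). x' = x \<longrightarrow> y \<in> U) uniformity)" for U :: "l2 set"

instance
proof
  fix x y z :: l2 and r :: real
  show "x \<bullet> y = y \<bullet> x" by (simp add: inner_l2_def inner_commute)
  show "(x + y) \<bullet> z = x \<bullet> z + y \<bullet> z"
    by (simp add: inner_l2_def inner_add_left suminf_add summable_inner_coef)
  show "(r *\<^sub>R x) \<bullet> y = r * (x \<bullet> y)"
    by (simp add: inner_l2_def suminf_mult summable_inner_coef)
  show "0 \<le> x \<bullet> x" by (simp add: inner_l2_def suminf_nonneg summable_inner_coef)
  show "(x \<bullet> x = 0) = (x = 0)"
  proof
    assume "x \<bullet> x = 0"
    then have "\<forall>n. coef x n \<bullet> coef x n = 0"
      using suminf_eq_zero_iff[OF summable_inner_coef[of x x]] by (simp add: inner_l2_def)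
    then show "x = 0" by (intro l2_eqI) simp
  next
    assume "x = 0"
    then have "coef x n = 0" for n by simp
    then show "x \<bullet> x = 0" by (simp add: inner_l2_def)
  qed
  show "norm x = sqrt (x \<bullet> x)" by (rule norm_l2_def)
  show "dist x y = norm (x - y)" by (rule dist_l2_def)
  show "sgn x = x /\<^sub>R norm x" by (rule sgn_l2_def)
next
  show "(uniformity :: (l2 \<times> l2) filter) = (INF e\<in>{0 <..}. principal {(x, y). dist x y < e})"
    by (rule uniformity_l2_def)
next
  fix U :: "l2 set"
  show "open U = (\<forall>x\<in>U. eventually (\<lambda>(x', y). x' = x \<longrightarrow> y \<in> U) uniformity)"
    by (rule open_l2_def)
qed
end

lemma l2_norm_square: "(norm x)\<^sup>2 = (\<Sum>n. (cmod (coef x n))\<^sup>2)"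
  unfolding power2_norm_eq_inner by (rule inner_l2_def)

lemma sum_coef_le: "(\<Sum>n<N. (cmod (coef x n))\<^sup>2) \<le> (norm x)\<^sup>2"
  unfolding l2_norm_square by (rule sum_le_suminf) (auto simp: summable_coef)

lemma coef_le_norm: "cmod (coef x n) \<le> norm x"
proof (rule power2_le_imp_le)
  have "(cmod (coef x n))\<^sup>2 \<le> (\<Sum>k<Suc n. (cmod (coef x k))\<^sup>2)"
    by (simp add: sum_nonneg)
  then show "(cmod (coef x n))\<^sup>2 \<le> (norm x)\<^sup>2" using sum_coef_le order_trans by blast
qed simp

lemma l2_limit_coef: "X \<longlonglongrightarrow> x \<Longrightarrow> (\<lambda>k. coef (X k) n) \<longlonglongrightarrow> coef x n"
proof (rule LIMSEQ_I)
  fix e :: real assume X: "X \<longlonglongrightarrow> x" and "e > 0"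
  then obtain N where N: "\<And>k. k \<ge> N \<Longrightarrow> norm (X k - x) < e" using LIMSEQ_D by blast
  show "\<exists>N. \<forall>k\<ge>N. norm (coef (X k) n - coef x n) < e"
    using N coef_le_norm[of "_ - x" n] by (intro exI[of _ N]) (force intro: order_le_less_trans)
qed

lemma l2_boundI:
  assumes "\<And>N. (\<Sum>n<N. (cmod (c n))\<^sup>2) \<le> e\<^sup>2" "e \<ge> 0"
  shows "summable (\<lambda>n. (cmod (c n))\<^sup>2)" "norm (Abs_l2 c) \<le> e"
proof -
  show s: "summable (\<lambda>n. (cmod (c n))\<^sup>2)"
  proof (rule bounded_imp_summable)
    show "(\<Sum>k\<le>n. (cmod (c k))\<^sup>2) \<le> e\<^sup>2" for n
      using assms(1)[of "Suc n"] by (simp only: lessThan_Suc_atMost)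
  qed simp
  show "norm (Abs_l2 c) \<le> e"
    using assms by - (rule power2_le_imp_le[OF _ assms(2)], simp add: l2_norm_square coef_Abs_l2[OF s] suminf_le_const[OF s])
qed

instance l2 :: banach
proof
  fix X :: "nat \<Rightarrow> l2" assume X: "Cauchy X"
  have "Cauchy (\<lambda>k. coef (X k) n)" for n
  proof (rule metric_CauchyI)
    fix e :: real assume "e > 0"
    then obtain N where N: "\<And>k l. k \<ge> N \<Longrightarrow> l \<ge> N \<Longrightarrow> dist (X k) (X l) < e"
      using metric_CauchyD[OF X] by blast
    show "\<exists>N. \<forall>k\<ge>N. \<forall>l\<ge>N. dist (coef (X k) n) (coef (X l) n) < e"
    proof (intro exI[of _ N] allI impI)
      fix k l assume "k \<ge> N" "l \<ge> N"
      then show "dist (coef (X k) n) (coef (X l) n) < e"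
        using N[of k l] coef_le_norm[of "X k - X l" n] by (simp add: dist_norm)
    qed
  qed
  then have "\<forall>n. \<exists>c. (\<lambda>k. coef (X k) n) \<longlonglongrightarrow> c" using Cauchy_convergent_iff convergent_def by blast
  then obtain c where c: "\<And>n. (\<lambda>k. coef (X k) n) \<longlonglongrightarrow> c n" by metis
  \<comment> \<open>The index k is fixed and l tends to infinity inside each finite section; the
    resulting bound does not depend on N.\<close>
  have bd: "\<exists>K. \<forall>k\<ge>K. \<forall>N. (\<Sum>n<N. (cmod (coef (X k) n - c n))\<^sup>2) \<le> e\<^sup>2" if e: "e > 0" for e
  proof -
    obtain K where K: "\<And>k l. k \<ge> K \<Longrightarrow> l \<ge> K \<Longrightarrow> dist (X k) (X l) < e"
      using metric_CauchyD[OF X e] by blast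
    show ?thesis
    proof (intro exI[of _ K] allI impI)
      fix k N assume k: "k \<ge> K"
      have lim: "(\<lambda>l. \<Sum>n<N. (cmod (coef (X k) n - coef (X l) n))\<^sup>2) \<longlonglongrightarrow> (\<Sum>n<N. (cmod (coef (X k) n - c n))\<^sup>2)"
        by (intro tendsto_sum tendsto_power tendsto_norm tendsto_diff tendsto_const c)
      show "(\<Sum>n<N. (cmod (coef (X k) n - c n))\<^sup>2) \<le> e\<^sup>2"
      proof (rule LIMSEQ_le_const2[OF lim], intro exI[of _ K] allI impI)
        fix l assume "l \<ge> K"
        have "(\<Sum>n<N. (cmod (coef (X k) n - coef (X l) n))\<^sup>2) \<le> (norm (X k - X l))\<^sup>2"
          using sum_coef_le[of "X k - X l" N] by simp
        also have "\<dots> \<le> e\<^sup>2" using K[OF k \<open>l \<ge> K\<close>] by (intro power_mono) (auto simp: dist_norm)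
        finally show "(\<Sum>n<N. (cmod (coef (X k) n - coef (X l) n))\<^sup>2) \<le> e\<^sup>2" .
      qed
    qed
  qed
  obtain K where K: "\<And>N. (\<Sum>n<N. (cmod (coef (X K) n - c n))\<^sup>2) \<le> 1\<^sup>2" using bd[of 1] by auto
  have "summable (\<lambda>n. (cmod (coef (X K) n - c n))\<^sup>2)" by (rule l2_boundI(1)[of _ 1]) (use K in auto)
  then have "summable (\<lambda>n. (cmod (c n - coef (X K) n))\<^sup>2)" by (simp add: norm_minus_commute)
  from summable_square_add[OF this summable_coef[of "X K"]] have sc: "summable (\<lambda>n. (cmod (c n))\<^sup>2)" by simp
  have "X \<longlonglongrightarrow> Abs_l2 c"
  proof (rule LIMSEQ_I)
    fix e :: real assume "e > 0"
    then have "e / 2 > 0" by simp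
    from bd[OF this] obtain K where K: "\<And>k N. k \<ge> K \<Longrightarrow> (\<Sum>n<N. (cmod (coef (X k) n - c n))\<^sup>2) \<le> (e/2)\<^sup>2" by blast
    show "\<exists>K. \<forall>k\<ge>K. norm (X k - Abs_l2 c) < e"
    proof (intro exI[of _ K] allI impI)
      fix k assume "k \<ge> K"
      have "X k - Abs_l2 c = Abs_l2 (\<lambda>n. coef (X k) n - c n)"
        by (simp add: minus_l2_def coef_Abs_l2[OF sc])
      then have "norm (X k - Abs_l2 c) \<le> e / 2"
        using l2_boundI(2)[of "\<lambda>n. coef (X k) n - c n" "e/2"] K[OF \<open>k \<ge> K\<close>] \<open>e > 0\<close> by simp
      then show "norm (X k - Abs_l2 c) < e" using \<open>e > 0\<close> by simp
    qed
  qed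
  then show "convergent X" unfolding convergent_def by blast
qed

section \<open>Complex scalars, shifts and the complex inner product\<close>

definition cscale :: "complex \<Rightarrow> l2 \<Rightarrow> l2" where
  "cscale a x = Abs_l2 (\<lambda>n. a * coef x n)"

lemma coef_cscale [simp]: "coef (cscale a x) n = a * coef x n"
  by (simp add: cscale_def coef_Abs_l2 summable_square_mult summable_coef)

definition shift :: "l2 \<Rightarrow> l2" where
  "shift x = Abs_l2 (\<lambda>n. case n of 0 \<Rightarrow> 0 | Suc m \<Rightarrow> coef x m)"

definition backshift :: "l2 \<Rightarrow> l2" where
  "backshift x = Abs_l2 (\<lambda>n. coef x (Suc n))"

lemma coef_shift: "coef (shift x) n = (case n of 0 \<Rightarrow> 0 | Suc m \<Rightarrow> coef x m)"
proof -
  have "summable (\<lambda>n. (cmod (case n of 0 \<Rightarrow> 0 | Suc m \<Rightarrow> coef x m))\<^sup>2)"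
    by (subst summable_Suc_iff[symmetric]) (simp add: summable_coef)
  then show ?thesis by (simp add: shift_def coef_Abs_l2)
qed

lemma coef_shift_simps [simp]: "coef (shift x) 0 = 0" "coef (shift x) (Suc n) = coef x n"
  by (simp_all add: coef_shift)

lemma coef_backshift [simp]: "coef (backshift x) n = coef x (Suc n)"
proof -
  have "summable (\<lambda>n. (cmod (coef x (Suc n)))\<^sup>2)" by (subst summable_Suc_iff) (rule summable_coef)
  then show ?thesis by (simp add: backshift_def coef_Abs_l2)
qed

lemma cinner_coef_summable: "summable (\<lambda>n. coef x n * cnj (coef y n))"
  by (rule summable_comparison_test'[OF summable_square_prod[OF summable_coef[of x] summable_coef[of y]], where N=0])
     (simp add: norm_mult)

definition cinner :: "l2 \<Rightarrow> l2 \<Rightarrow> complex" where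
  "cinner x y = (\<Sum>n. coef x n * cnj (coef y n))"

lemma Re_cinner: "Re (cinner x y) = x \<bullet> y"
  unfolding cinner_def inner_l2_def
  by (subst Re_suminf[OF cinner_coef_summable]) (simp add: inner_complex_def)

lemma cinner_diff_left: "cinner (x - y) z = cinner x z - cinner y z"
  by (simp add: cinner_def algebra_simps suminf_diff[OF cinner_coef_summable cinner_coef_summable])

lemma cinner_cscale_left: "cinner (cscale a x) y = a * cinner x y"
  by (simp add: cinner_def suminf_mult[OF cinner_coef_summable, symmetric] mult.assoc)

lemma cinner_commute: "cinner x y = cnj (cinner y x)"
proof -
  have "(\<lambda>n. coef y n * cnj (coef x n)) sums cinner y x"
    unfolding cinner_def by (rule summable_sums[OF cinner_coef_summable])
  then have "(\<lambda>n. cnj (coef y n * cnj (coef x n))) sums cnj (cinner y x)" by (simp only: sums_cnj)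
  then show ?thesis unfolding cinner_def[of x y] by (simp add: sums_iff mult.commute)
qed

lemma cinner_cscale_right: "cinner x (cscale a y) = cnj a * cinner x y"
  by (subst (1 2) cinner_commute) (simp add: cinner_cscale_left)

lemma cinner_self: "cinner x x = of_real ((norm x)\<^sup>2)"
proof (rule complex_eqI)
  show "Im (cinner x x) = Im (of_real ((norm x)\<^sup>2))"
    using arg_cong[OF cinner_commute[of x x], of Im] by simp
qed (simp add: Re_cinner power2_norm_eq_inner)

text \<open>Together with \<open>Re_cinner\<close> this recovers the complex pairing from the real
  one, so a complex identity follows from a real identity and compatibility with
  \<open>cscale\<close>.\<close>

lemma Im_cinner: "Im (cinner x y) = x \<bullet> cscale \<i> y"
  unfolding Re_cinner[symmetric] cinner_cscale_right by simp

lemma cinner_eq_iff: "cinner x y = cinner u v \<longleftrightarrow> x \<bullet> y = u \<bullet> v \<and> x \<bullet> cscale \<i> y = u \<bullet> cscale \<i> v"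
  by (simp add: complex_eq_iff Re_cinner Im_cinner)

lemma cscale_inner: "cscale a x \<bullet> y = x \<bullet> cscale (cnj a) y"
  unfolding Re_cinner[symmetric] cinner_cscale_left cinner_cscale_right by simp

lemma norm_cscale: "norm (cscale a x) = cmod a * norm x"
proof -
  have "(norm (cscale a x))\<^sup>2 = (cmod a * norm x)\<^sup>2"
    unfolding l2_norm_square power_mult_distrib
    by (simp add: norm_mult power_mult_distrib suminf_mult[OF summable_coef])
  then show ?thesis by simp
qed

lemma cscale_of_real: "cscale (of_real r) x = r *\<^sub>R x"
  by (rule l2_eqI) (simp add: scaleR_conv_of_real)

lemma cscale_add: "cscale a (x + y) = cscale a x + cscale a y"
  by (rule l2_eqI) (simp add: algebra_simps)

lemma shift_inner: "shift x \<bullet> y = x \<bullet> backshift y"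
  using suminf_split_head[OF summable_inner_coef[of "shift x" y]] by (simp add: inner_l2_def)

lemma norm_shift: "norm (shift x) = norm x"
proof -
  have "shift x \<bullet> shift x = x \<bullet> x"
  proof -
    have "backshift (shift x) = x" by (rule l2_eqI) simp
    then show ?thesis by (simp add: shift_inner)
  qed
  then show ?thesis by (simp add: norm_l2_def)
qed

lemma norm_backshift: "norm (backshift x) \<le> norm x"
proof -
  have "(norm (backshift x))\<^sup>2 = shift (backshift x) \<bullet> x" by (simp add: power2_norm_eq_inner shift_inner)
  also have "\<dots> \<le> norm (shift (backshift x)) * norm x" by (rule norm_cauchy_schwarz)
  finally show ?thesis by (cases "norm (backshift x) = 0") (simp_all add: norm_shift power2_eq_square)
qed

lemma bounded_linear_cscale: "bounded_linear (cscale a)"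
  by (rule bounded_linear_intro[where K="cmod a"])
     (auto intro!: l2_eqI simp: algebra_simps norm_cscale)

lemma bounded_linear_shift: "bounded_linear shift"
  by (rule bounded_linear_intro[where K=1])
     (auto intro!: l2_eqI simp: norm_shift coef_shift split: nat.splits)

lemma bounded_linear_backshift: "bounded_linear backshift"
  by (rule bounded_linear_intro[where K=1])
     (auto intro!: l2_eqI simp: norm_backshift)

section \<open>The quotient graph\<close>

text \<open>The inverse of I - T, obtained from Banach's fixed point theorem for v \<mapsto> x + T
  v. With T = \<beta> times the shift it is division by 1 - \<beta> z; with T = \<zeta> times the
  backward shift it solves the graph relation for g.\<close>

lemma neumann_inverse:
  fixes T :: "'a::banach \<Rightarrow> 'a"
  assumes T: "bounded_linear T" and q: "\<And>x. norm (T x) \<le> q * norm x" "0 \<le> q" "q < 1"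
  obtains R where "bounded_linear R" "\<And>x. R x - T (R x) = x" "\<And>x. R (x - T x) = x"
proof -
  interpret T: bounded_linear T by fact
  have uniq: "u = v" if "u - T u = v - T v" for u v
  proof -
    have "T (u - v) = u - v" using that by (simp add: T.diff algebra_simps)
    then have "norm (u - v) \<le> q * norm (u - v)" using q(1)[of "u - v"] by simp
    then have "(1 - q) * norm (u - v) \<le> 0" by (simp add: algebra_simps)
    then show ?thesis using q(3) by (simp add: mult_le_0_iff)
  qed
  have "\<exists>!v. x + T v = v" for x
  proof (rule banach_fix_type[OF q(2,3)], intro allI)
    fix u v
    show "dist (x + T u) (x + T v) \<le> q * dist u v"
      using q(1)[of "u - v"] by (simp add: dist_norm T.diff)
  qed
  then obtain R where R: "\<And>x. x + T (R x) = R x" by metis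
  have RT: "R x - T (R x) = x" for x using R[of x] by (metis add_diff_cancel_right')
  show thesis
  proof (rule that)
    show "bounded_linear R"
    proof (rule bounded_linear_intro[where K="1 / (1 - q)"])
      show "R (x + y) = R x + R y" for x y
        by (rule uniq) (simp add: RT T.add algebra_simps, metis RT add.commute diff_add_cancel diff_diff_eq)
      show "R (r *\<^sub>R x) = r *\<^sub>R R x" for r x
        by (rule uniq) (metis RT T.scaleR scaleR_diff_right)
      show "norm (R x) \<le> norm x * (1 / (1 - q))" for x
      proof -
        have "norm (R x) - norm (T (R x)) \<le> norm x"
          using norm_triangle_ineq2[of "R x" "T (R x)"] by (simp add: RT)
        then have "norm (R x) * (1 - q) \<le> norm x" using q(1)[of "R x"] by (simp add: algebra_simps)
        then show ?thesis using q(3) by (simp add: field_simps)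
      qed
    qed
    show "R x - T (R x) = x" for x by (rule RT)
    show "R (x - T x) = x" for x by (rule uniq) (rule RT)
  qed
qed

text \<open>In terms of power series \<open>f = const + (z - \<zeta>) g\<close>.\<close>

definition quot_graph :: "complex \<Rightarrow> (l2 \<times> l2) set" where
  "quot_graph \<zeta> = {(f, g). \<forall>n. coef f (Suc n) = coef g n - \<zeta> * coef g (Suc n)}"

lemma quot_graphD: "(f, g) \<in> quot_graph \<zeta> \<Longrightarrow> backshift f = g - cscale \<zeta> (backshift g)"
  by (rule l2_eqI) (simp add: quot_graph_def)

lemma closed_quot_graph: "closed (quot_graph \<zeta>)"
  unfolding closed_sequential_limits
proof (intro allI impI, elim conjE)
  fix X l assume X: "\<forall>k. X k \<in> quot_graph \<zeta>" and lim: "X \<longlonglongrightarrow> l"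
  have f: "(\<lambda>k. coef (fst (X k)) n) \<longlonglongrightarrow> coef (fst l) n" for n
    by (rule l2_limit_coef[OF tendsto_fst[OF lim]])
  have g: "(\<lambda>k. coef (snd (X k)) n) \<longlonglongrightarrow> coef (snd l) n" for n
    by (rule l2_limit_coef[OF tendsto_snd[OF lim]])
  have "coef (fst l) (Suc n) = coef (snd l) n - \<zeta> * coef (snd l) (Suc n)" for n
  proof (rule LIMSEQ_unique[OF f])
    have "coef (fst (X k)) (Suc n) = coef (snd (X k)) n - \<zeta> * coef (snd (X k)) (Suc n)" for k
      using X[rule_format, of k] by (auto simp: quot_graph_def)
    then show "(\<lambda>k. coef (fst (X k)) (Suc n)) \<longlonglongrightarrow> coef (snd l) n - \<zeta> * coef (snd l) (Suc n)"
      by (simp only:) (intro tendsto_diff tendsto_mult tendsto_const g)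
  qed
  then show "l \<in> quot_graph \<zeta>" by (auto simp: quot_graph_def split: prod.split)
qed

text \<open>The difference of two solutions satisfies d n = \<zeta> d (n + 1), so for |\<zeta>|
  \<le> 1 its moduli do not decrease, whereas square summability makes them tend to 0.\<close>

lemma quot_graph_unique:
  assumes "cmod \<zeta> \<le> 1" "(f, g) \<in> quot_graph \<zeta>" "(f, g') \<in> quot_graph \<zeta>"
  shows "g = g'"
proof -
  define d where "d n = coef (g - g') n" for n
  have d: "d n = \<zeta> * d (Suc n)" for n
  proof -
    have "coef g n - \<zeta> * coef g (Suc n) = coef g' n - \<zeta> * coef g' (Suc n)"
      using assms(2,3) unfolding quot_graph_def by (metis (mono_tags, lifting) case_prodD mem_Collect_eq)
    then show ?thesis by (simp add: d_def algebra_simps)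
  qed
  have inc: "cmod (d n) \<le> cmod (d (Suc n))" for n
    using mult_right_mono[OF assms(1), of "cmod (d (Suc n))"] by (subst d) (simp add: norm_mult)
  have mono: "cmod (d n) \<le> cmod (d m)" if "n \<le> m" for n m
    using lift_Suc_mono_le[of "\<lambda>n. cmod (d n)", OF inc that] .
  have "(\<lambda>n. (cmod (d n))\<^sup>2) \<longlonglongrightarrow> 0"
    unfolding d_def by (rule summable_LIMSEQ_zero[OF summable_coef])
  then have lim: "(\<lambda>n. cmod (d n)) \<longlonglongrightarrow> 0"
    using tendsto_real_sqrt[of "\<lambda>n. (cmod (d n))\<^sup>2" 0] by simp
  have "cmod (d n) \<le> 0" for n
    by (rule LIMSEQ_le_const[OF lim]) (use mono in blast)
  then have "d n = 0" for n by simp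
  then show "g = g'" by (intro l2_eqI) (simp add: d_def)
qed

definition unit_l2 :: "nat \<Rightarrow> l2" where
  "unit_l2 k = Abs_l2 (\<lambda>n. if n = k then 1 else 0)"

lemma coef_unit_l2: "coef (unit_l2 k) n = (if n = k then 1 else 0)"
  unfolding unit_l2_def
  by (subst coef_Abs_l2) (auto intro!: summable_finite[of "{k}"] split: if_splits)

lemma inner_cscale_unit_l2: "cscale a (unit_l2 k) \<bullet> x = a \<bullet> coef x k"
proof -
  have "cscale a (unit_l2 k) \<bullet> x = (\<Sum>n\<in>{k}. coef (cscale a (unit_l2 k)) n \<bullet> coef x n)"
    unfolding inner_l2_def by (rule suminf_finite) (auto simp: coef_unit_l2)
  then show ?thesis by (simp add: coef_unit_l2)
qed

text \<open>\<open>M\<close> is multiplication by \<open>b = c z / (P (1 - \<beta> z))\<close> and \<open>v = c / (P (1 - \<beta> z)) M\<^sup>* h\<close>, so that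
  \<open>h - U v = (I - M M\<^sup>*) h\<close>; the relation \<open>P\<^sup>2 (1 - \<beta> U)\<^sup>* (1 - \<beta> U) = I + (1 - \<zeta>\<^sup>* U)\<^sup>* (1 - \<zeta>\<^sup>* U)\<close>
  puts \<open>(h - U v, (1 - \<zeta>\<^sup>* U) v)\<close> into the graph.\<close>

lemma defect_sqrt_range:
  fixes \<zeta> \<beta> c :: complex and P :: real
  assumes \<zeta>: "cmod \<zeta> \<le> 1" and c: "cmod c = 1" and \<beta>: "cmod \<beta> < 1" and P: "P > 0"
    and P\<beta>: "P\<^sup>2 * (1 + \<beta> * cnj \<beta>) = 2 + \<zeta> * cnj \<zeta>" "P\<^sup>2 * \<beta> = cnj \<zeta>"
    and M: "bounded_linear M" and M': "bounded_linear M'" and adj: "\<And>x y. M x \<bullet> y = x \<bullet> M' y"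
    and eq: "\<And>u. M u - cscale \<beta> (shift (M u)) = cscale (c / P) (shift u)"
  obtains S where "bounded_linear S" "\<And>x y. S x \<bullet> y = x \<bullet> S y" "\<And>x. S x \<bullet> x \<ge> 0"
    "\<And>x. S (S x) = x - M (M' x)"
    "\<And>T x. bounded_linear T \<Longrightarrow> (\<And>x. T (M (M' x)) = M (M' (T x))) \<Longrightarrow> S (T x) = T (S x)"
    "inj S" "range S = fst ` quot_graph \<zeta>"
    "\<And>x g. (S x, g) \<in> quot_graph \<zeta> \<Longrightarrow> (norm x)\<^sup>2 = (norm (S x))\<^sup>2 + (norm g)\<^sup>2"
proof -
  interpret M: bounded_linear M by fact
  interpret M': bounded_linear M' by fact
  define T where "T x = cscale \<beta> (shift x)" for x
  have T: "bounded_linear T"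
    unfolding T_def by (rule bounded_linear_compose[OF bounded_linear_cscale bounded_linear_shift])
  obtain R where R: "bounded_linear R" "\<And>x. R x - T (R x) = x" "\<And>x. R (x - T x) = x"
    by (rule neumann_inverse[OF T, of "cmod \<beta>"]) (use \<beta> in \<open>auto simp: T_def norm_cscale norm_shift\<close>)
  \<comment> \<open>V is multiplication by b / z = c / (P (1 - \<beta> z)), so that M is the shift
    after V (\<open>MV\<close>).\<close>
  define V where "V k = cscale (c / P) (R k)" for k
  have V: "bounded_linear V"
    unfolding V_def by (rule bounded_linear_compose[OF bounded_linear_cscale R(1)])
  have Veq: "coef (V k) n - \<beta> * coef (shift (V k)) n = c / P * coef k n" for k n
  proof -
    have "coef (R k) n - \<beta> * coef (shift (R k)) n = coef k n"
      using arg_cong[OF R(2)[of k], of "\<lambda>x. coef x n"] by (simp add: T_def)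
    moreover have "coef (shift (V k)) n = c / P * coef (shift (R k)) n"
      by (simp add: V_def coef_shift split: nat.split)
    ultimately show ?thesis by (simp add: V_def algebra_simps)
  qed
  have MV: "M u = shift (V u)" for u
  proof -
    have "shift (V u) - T (shift (V u)) = cscale (c / P) (shift u)"
    proof (rule l2_eqI)
      fix n
      show "coef (shift (V u) - T (shift (V u))) n = coef (cscale (c / P) (shift u)) n"
        using Veq[of u "n - 1"] by (cases n) (simp_all add: T_def)
    qed
    then have "R (shift (V u) - T (shift (V u))) = R (M u - T (M u))"
      using eq[of u] by (simp add: T_def)
    then show ?thesis by (simp add: R(3))
  qed
  define A where "A h = h - M (M' h)" for h
  define K where "K h = V (M' h) - cscale (cnj \<zeta>) (shift (V (M' h)))" for h
  have K: "bounded_linear K"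
    unfolding K_def
    by (intro bounded_linear_sub bounded_linear_compose[OF V M']
        bounded_linear_compose[OF bounded_linear_cscale bounded_linear_compose[OF bounded_linear_shift bounded_linear_compose[OF V M']]])
  \<comment> \<open>The adjoint of the relation M (1 - \<beta> \<open>shift\<close>) = (c / P)
    \<open>shift\<close>, read off in coefficients; it differs from the hypothesis by commuting M
    with \<beta> \<open>shift\<close>.\<close>
  have M'c: "coef (M' h) n - cnj \<beta> * coef (M' h) (Suc n) = cnj c / P * coef h (Suc n)" for h n
  proof -
    have "y \<bullet> (M' h - cscale (cnj \<beta>) (backshift (M' h))) = y \<bullet> cscale (cnj (c / P)) (backshift h)" for y
    proof -
      have "M (y - T y) = cscale (c / P) (shift y)"
      proof -
        have "M (T y) = T (M y)"
        proof -
          have "M (T y) = R (cscale (c / P) (shift (T y)))"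
            using eq[of "T y"] R(3)[of "M (T y)"] by (simp add: T_def)
          also have "cscale (c / P) (shift (T y)) = T (M y) - T (T (M y))"
          proof -
            have "T (M y) - T (T (M y)) = T (cscale (c / P) (shift y))"
              using eq[of y] bounded_linear.linear[OF T] by (metis T_def linear_diff)
            also have "\<dots> = cscale (c / P) (shift (T y))"
              by (rule l2_eqI) (simp add: T_def coef_shift split: nat.split)
            finally show ?thesis by simp
          qed
          finally show ?thesis by (simp add: R(3))
        qed
        then show ?thesis using eq[of y] by (simp add: M.diff T_def)
      qed
      then have "(y - T y) \<bullet> M' h = cscale (c / P) (shift y) \<bullet> h" by (metis adj)
      then show ?thesis
        by (simp add: T_def inner_diff_left inner_diff_right cscale_inner shift_inner
            bounded_linear.linear[OF bounded_linear_backshift])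
           (metis (no_types, lifting) coef_backshift coef_cscale l2_eqI)
    qed
    then have "M' h - cscale (cnj \<beta>) (backshift (M' h)) = cscale (cnj (c / P)) (backshift h)"
      by (rule vector_eq_ldot[THEN iffD1, OF allI])
    from arg_cong[OF this, of "\<lambda>x. coef x n"] show ?thesis by simp
  qed
  have AK: "(A h, K h) \<in> quot_graph \<zeta>" for h
    unfolding quot_graph_def mem_Collect_eq prod.case
  proof
    fix n
    define v where "v m = coef (V (M' h)) m" for m
    \<comment> \<open>The coefficient of v preceding the n-th one, equal to 0 for n = 0. Writing it
      with \<open>shift\<close> avoids a case distinction.\<close>
    define u where "u = coef (shift (V (M' h))) n"
    have cc: "c * cnj c = 1" using complex_norm_square[of c] c by simp
    have c0: "c \<noteq> 0" using c by auto
    have k: "coef (M' h) n = P * cnj c * (v n - \<beta> * u)"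
            "coef (M' h) (Suc n) = P * cnj c * (v (Suc n) - \<beta> * v n)"
    proof -
      have *: "P * cnj c * (c / P * y) = y" for y
      proof -
        have "P * cnj c * (c / P * y) = (c * cnj c) * y" using P by simp
        then show ?thesis by (simp only: cc mult_1)
      qed
      show "coef (M' h) n = P * cnj c * (v n - \<beta> * u)"
        unfolding v_def u_def Veq by (simp only: *)
      show "coef (M' h) (Suc n) = P * cnj c * (v (Suc n) - \<beta> * v n)"
        unfolding v_def using Veq[of "M' h" "Suc n"] by (simp only: coef_shift_simps *)
    qed
    have "P * c * (cnj c / P * coef h (Suc n)) = (c * cnj c) * coef h (Suc n)" using P by simp
    then have "coef h (Suc n) = P * c * (cnj c / P * coef h (Suc n))" by (simp only: cc mult_1)
    also have "\<dots> = P * c * (coef (M' h) n - cnj \<beta> * coef (M' h) (Suc n))" by (simp only: M'c)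
    also have "\<dots> = P\<^sup>2 * (c * cnj c) * ((v n - \<beta> * u) - cnj \<beta> * (v (Suc n) - \<beta> * v n))"
      unfolding k by (simp add: power2_eq_square algebra_simps)
    also have "\<dots> = P\<^sup>2 * (1 + \<beta> * cnj \<beta>) * v n - P\<^sup>2 * \<beta> * u - P\<^sup>2 * cnj \<beta> * v (Suc n)"
      by (simp add: cc algebra_simps)
    also have "P\<^sup>2 * cnj \<beta> = \<zeta>" using arg_cong[OF P\<beta>(2), of cnj] by simp
    finally have hn: "coef h (Suc n) = (2 + \<zeta> * cnj \<zeta>) * v n - cnj \<zeta> * u - \<zeta> * v (Suc n)"
      by (simp only: P\<beta>)
    show "coef (A h) (Suc n) = coef (K h) n - \<zeta> * coef (K h) (Suc n)"
      by (simp add: A_def K_def MV hn v_def[symmetric] u_def[symmetric] algebra_simps)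
  qed
  \<comment> \<open>This is the adjoint identity of J. As M M' h is the shift of v = V M' h, pairing
    it with f moves a backward shift onto f, where the graph relation replaces it by g - \<zeta>
    \<open>backshift\<close> g; transposing that operator produces K h.\<close>
  have rep: "f \<bullet> A h + g \<bullet> K h = f \<bullet> h" if "(f, g) \<in> quot_graph \<zeta>" for f g h
  proof -
    let ?v = "V (M' h)"
    have "f \<bullet> M (M' h) = backshift f \<bullet> ?v" by (simp add: MV inner_commute[of f] shift_inner) (rule inner_commute)
    also have "\<dots> = g \<bullet> ?v - cscale \<zeta> (backshift g) \<bullet> ?v" by (simp add: quot_graphD[OF that] inner_diff_left)
    also have "cscale \<zeta> (backshift g) \<bullet> ?v = g \<bullet> cscale (cnj \<zeta>) (shift ?v)"
    proof -
      have "cscale \<zeta> (backshift g) \<bullet> ?v = shift (cscale (cnj \<zeta>) ?v) \<bullet> g"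
        by (subst cscale_inner, subst inner_commute, rule shift_inner[symmetric])
      also have "shift (cscale (cnj \<zeta>) ?v) = cscale (cnj \<zeta>) (shift ?v)"
        by (rule l2_eqI) (simp add: coef_shift split: nat.split)
      finally show ?thesis by (simp add: inner_commute)
    qed
    finally show ?thesis by (simp add: A_def K_def inner_diff_right)
  qed
  \<comment> \<open>Putting the pair (A h, K h) into \<open>rep\<close> shows that A is positive,
    which says that M' is a contraction; then M is one too, as the square root construction
    requires.\<close>
  have nM': "norm (M' h) \<le> norm h" for h
  proof -
    have "A h \<bullet> h = (norm (A h))\<^sup>2 + (norm (K h))\<^sup>2"
      using rep[OF AK[of h], of h] by (simp add: power2_norm_eq_inner)
    then have "A h \<bullet> h \<ge> 0" by simp
    then have "M (M' h) \<bullet> h \<le> h \<bullet> h" by (simp add: A_def inner_diff_left)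
    then have "(norm (M' h))\<^sup>2 \<le> (norm h)\<^sup>2" by (simp add: adj power2_norm_eq_inner)
    then show ?thesis by (rule power2_le_imp_le) simp
  qed
  have nM: "norm (M u) \<le> norm u" for u
  proof -
    have "(norm (M u))\<^sup>2 = u \<bullet> M' (M u)" by (simp add: power2_norm_eq_inner adj)
    also have "\<dots> \<le> norm u * norm (M' (M u))" by (rule norm_cauchy_schwarz)
    also have "\<dots> \<le> norm u * norm (M u)" by (intro mult_left_mono nM') simp
    finally show ?thesis by (cases "norm (M u) = 0") (simp_all add: power2_eq_square)
  qed
  define X where "X = Blinfun (\<lambda>x. M (M' x))"
  have X: "X x = M (M' x)" for x
    unfolding X_def by (simp add: bounded_linear_Blinfun_apply bounded_linear_compose[OF M M'])
  have nX: "norm X \<le> 1"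
    using order_trans[OF nM nM'] by (intro norm_blinfun_bound) (auto simp: X)
  have symX: "X x \<bullet> y = x \<bullet> X y" for x y
    by (simp add: X adj inner_commute[of x "M (M' y)"]) (rule inner_commute)
  obtain S :: "l2 \<Rightarrow>\<^sub>L l2" where S: "\<And>x. S (S x) = x - X x" "\<And>x y. S x \<bullet> y = x \<bullet> S y" "\<And>x. S x \<bullet> x \<ge> 0"
      "\<And>T. X o\<^sub>L T = T o\<^sub>L X \<Longrightarrow> S o\<^sub>L T = T o\<^sub>L S"
    by (rule positive_sqrt_exists[OF nX symX], rule that)
  have SA: "S (S x) = A x" for x by (simp add: S(1) A_def X)
  have inj: "inj S"
  proof (rule injI)
    fix x y assume "S x = S y"
    define h where "h = x - y"
    have "S h = 0" using \<open>S x = S y\<close> by (simp add: h_def blinfun.bilinear_simps)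
    then have Ah: "A h = 0" using SA[of h] by (simp add: blinfun.bilinear_simps)
    then have Kh: "K h = 0" using rep[OF AK[of h], of h] by simp
    have orth: "f \<bullet> h = 0" if "(f, g) \<in> quot_graph \<zeta>" for f g
      using rep[OF that, of h] Ah Kh by simp
    \<comment> \<open>If A h = 0 then h is orthogonal to every first component of the graph. These
      include the constants and z^(n+1) - \<zeta> z^n (with g = z^n), which generate all monomials
      by induction.\<close>
    have "coef h n = 0" for n
    proof (induction n)
      case 0
      have "(cscale (coef h 0) (unit_l2 0), 0) \<in> quot_graph \<zeta>"
        by (simp add: quot_graph_def coef_unit_l2)
      from orth[OF this] show ?case by (simp add: inner_cscale_unit_l2)
    next
      case (Suc n)
      let ?a = "coef h (Suc n)"
      have "(cscale ?a (unit_l2 (Suc n)) + cscale (- \<zeta> * ?a) (unit_l2 n), cscale ?a (unit_l2 n)) \<in> quot_graph \<zeta>"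
        by (auto simp: quot_graph_def coef_unit_l2)
      from orth[OF this] show ?case by (simp add: inner_add_left inner_cscale_unit_l2 Suc)
    qed
    then have "h = 0" by (intro l2_eqI) simp
    then show "x = y" by (simp add: h_def)
  qed
  show thesis
  proof (rule that[of S])
    note rg = range_sqrt_graph[of S "quot_graph \<zeta>" K, OF blinfun.bounded_linear_right S(2) inj closed_quot_graph
      quot_graph_unique[OF \<zeta>] bounded_linear.linear[OF K], unfolded SA, OF _ _ AK rep]
    show "range S = fst ` quot_graph \<zeta>" by (rule rg(1))
    show "(S x, g) \<in> quot_graph \<zeta> \<Longrightarrow> (norm x)\<^sup>2 = (norm (S x))\<^sup>2 + (norm g)\<^sup>2" for x g by (rule rg(2))
    show "S (T' x) = T' (S x)" if T': "bounded_linear T'" and com: "\<And>x. T' (M (M' x)) = M (M' (T' x))" for T' x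
    proof -
      have app: "Blinfun T' x = T' x" for x by (rule bounded_linear_Blinfun_apply[OF T', THEN fun_cong])
      have "X o\<^sub>L Blinfun T' = Blinfun T' o\<^sub>L X"
        by (rule blinfun_eqI) (simp add: app X com)
      from S(4)[OF this] have "(S o\<^sub>L Blinfun T') x = (Blinfun T' o\<^sub>L S) x" by simp
      then show ?thesis by (simp add: app)
    qed
  qed (use S inj in \<open>auto simp: X blinfun.bounded_linear_right\<close>)
qed

section \<open>Functions on the disc and on the circle\<close>

lemma power_series_Hol:
  assumes "\<And>z. cmod z < 1 \<Longrightarrow> summable (\<lambda>n. a n * z ^ n)"
    and f: "\<And>z. f z = (if cmod z < 1 then \<Sum>n. a n * z ^ n else 0)"
  shows "f \<in> Hol" and "taylor_coeff f n = a n"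
proof -
  define F where "F = Abs_fps a"
  have R: "fps_conv_radius F \<ge> 1"
    unfolding fps_conv_radius_def F_def
  proof (rule conv_radius_geI_ex)
    fix r :: real assume "0 < r" "ereal r < 1"
    then show "\<exists>z. norm z = r \<and> summable (\<lambda>n. fps_nth (Abs_fps a) n * z ^ n)"
      using assms(1)[of "of_real r"] by (intro exI[of _ "of_real r"]) simp
  qed
  have eval: "eval_fps F z = f z" if "z \<in> ball 0 1" for z
    using that by (simp add: eval_fps_def F_def f)
  have "ball 0 1 \<subseteq> eball (0::complex) (fps_conv_radius F)"
  proof
    fix z :: complex assume "z \<in> ball 0 1"
    then have "ereal (norm z) < 1" by (simp add: one_ereal_def)
    then have "ereal (norm z) < fps_conv_radius F" using R by (rule order_less_le_trans)
    then show "z \<in> eball 0 (fps_conv_radius F)" by (simp add: in_eball_iff)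
  qed
  then have "eval_fps F holomorphic_on ball 0 1" by (rule holomorphic_on_eval_fps)
  then have "f holomorphic_on ball 0 1" by (rule holomorphic_transform) (rule eval)
  then show "f \<in> Hol" by (simp add: Hol_def f)
  have "f has_fps_expansion F"
    unfolding has_fps_expansion_def
  proof
    show "0 < fps_conv_radius F" using R by (simp add: order_less_le_trans[of 0 1])
    have "eventually (\<lambda>z. z \<in> ball 0 1) (nhds (0::complex))"
      by (intro eventually_nhds_in_open) auto
    then show "\<forall>\<^sub>F z in nhds 0. eval_fps F z = f z"
      by eventually_elim (rule eval)
  qed
  from fps_nth_fps_expansion[OF this, of n] show "taylor_coeff f n = a n"
    by (simp add: taylor_coeff_def F_def)
qed

lemma Hol_sums:
  assumes "f \<in> Hol" "cmod z < 1"
  shows "(\<lambda>n. taylor_coeff f n * z ^ n) sums f z"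
  using holomorphic_power_series[of f 0 1 z] assms by (simp add: Hol_def taylor_coeff_def)

lemma Hol_eqI:
  assumes "f \<in> Hol" "g \<in> Hol" "\<And>z. cmod z < 1 \<Longrightarrow> f z = g z"
  shows "f = g"
proof
  fix z show "f z = g z" using assms by (cases "cmod z < 1") (auto simp: Hol_def)
qed

lemma Hol_abs_summable:
  assumes "f \<in> Hol" "0 \<le> r" "r < 1"
  shows "summable (\<lambda>n. cmod (taylor_coeff f n) * r ^ n)"
proof -
  have "summable (\<lambda>n. taylor_coeff f n * of_real ((r + 1) / 2) ^ n)"
    using Hol_sums[OF assms(1), of "of_real ((r + 1) / 2)"] assms by (simp add: sums_iff norm_divide flip: of_real_add of_real_divide)
  from powser_insidea[OF this, of "of_real r"] assms show ?thesis
    by (simp add: norm_mult norm_power norm_divide flip: of_real_add of_real_divide)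
qed

definition l2_fun :: "l2 \<Rightarrow> complex \<Rightarrow> complex" where
  "l2_fun x z = (if cmod z < 1 then \<Sum>n. coef x n * z ^ n else 0)"

lemma l2_fun_summable: "cmod z < 1 \<Longrightarrow> summable (\<lambda>n. cmod (coef x n) * cmod z ^ n)"
  by (rule summable_comparison_test'[where N=0 and g="\<lambda>n. norm x * cmod z ^ n"])
     (auto intro!: mult_right_mono coef_le_norm summable_mult summable_geometric)

lemma l2_fun_sums: "cmod z < 1 \<Longrightarrow> (\<lambda>n. coef x n * z ^ n) sums l2_fun x z"
  using summable_norm_cancel[of "\<lambda>n. coef x n * z ^ n"] l2_fun_summable[of z x]
  by (simp add: l2_fun_def norm_mult norm_power summable_sums)

lemma l2_fun_Hol: "l2_fun x \<in> Hol" and taylor_coeff_l2_fun: "taylor_coeff (l2_fun x) n = coef x n"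
  using power_series_Hol[of "coef x" "l2_fun x"] l2_fun_sums by (auto simp: sums_iff l2_fun_def)

lemma l2_fun_in_H2: "l2_fun x \<in> H2"
  by (simp add: H2_def l2_fun_Hol taylor_coeff_l2_fun summable_coef)

lemma H2_eq_range: "H2 = range l2_fun"
proof (intro subset_antisym subsetI)
  fix f assume f: "f \<in> H2"
  define x where "x = Abs_l2 (taylor_coeff f)"
  have "coef x = taylor_coeff f" using f by (simp add: x_def H2_def coef_Abs_l2)
  then have "f = l2_fun x"
    using f Hol_sums[of f] l2_fun_sums[of _ x] by (intro Hol_eqI l2_fun_Hol) (auto simp: H2_def sums_iff)
  then show "f \<in> range l2_fun" by blast
qed (auto simp: l2_fun_in_H2)

lemma l2_fun_inject: "l2_fun x = l2_fun y \<longleftrightarrow> x = y"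
  by (metis l2_eqI taylor_coeff_l2_fun)

lemma l2_fun_eqI: "(\<And>z. cmod z < 1 \<Longrightarrow> l2_fun x z = l2_fun y z) \<Longrightarrow> x = y"
  using Hol_eqI[OF l2_fun_Hol l2_fun_Hol, of x y] by (simp add: l2_fun_inject)

lemma H2_norm_l2_fun: "H2_norm (l2_fun x) = norm x"
  by (simp add: H2_norm_def taylor_coeff_l2_fun l2_norm_square[symmetric])

lemma H2_inner_l2_fun: "H2_inner (l2_fun x) (l2_fun y) = cinner x y"
  by (simp add: H2_inner_def taylor_coeff_l2_fun cinner_def)

lemma l2_fun_add: "l2_fun (x + y) z = l2_fun x z + l2_fun y z"
  using sums_add[OF l2_fun_sums[of z x] l2_fun_sums[of z y]] l2_fun_sums[of z "x + y"]
  by (cases "cmod z < 1") (auto simp: sums_iff algebra_simps l2_fun_def)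

lemma l2_fun_cscale: "l2_fun (cscale a x) z = a * l2_fun x z"
  using sums_mult[OF l2_fun_sums, of z a x] l2_fun_sums[of z "cscale a x"]
  by (cases "cmod z < 1") (auto simp: sums_iff algebra_simps l2_fun_def)

lemma l2_fun_diff: "l2_fun (x - y) z = l2_fun x z - l2_fun y z"
  using sums_diff[OF l2_fun_sums[of z x] l2_fun_sums[of z y]] l2_fun_sums[of z "x - y"]
  by (cases "cmod z < 1") (auto simp: sums_iff algebra_simps l2_fun_def)

lemma l2_fun_zero: "l2_fun 0 = (\<lambda>z. 0)"
  by (rule ext) (simp add: l2_fun_def)

lemma l2_fun_shift: "l2_fun (shift x) z = z * l2_fun x z"
proof (cases "cmod z < 1")
  case True
  have "(\<lambda>n. coef (shift x) (Suc n) * z ^ Suc n) sums (z * l2_fun x z)"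
    using sums_mult[OF l2_fun_sums[OF True, of x], of z] by (simp add: algebra_simps)
  then have "(\<lambda>n. coef (shift x) n * z ^ n) sums (z * l2_fun x z)"
    by (subst (asm) sums_Suc_iff) simp
  then show ?thesis using l2_fun_sums[OF True, of "shift x"] sums_unique2 by blast
qed (simp add: l2_fun_def)

section \<open>Normalized arc length and Fourier series on the circle\<close>

lemma circle_measure_sets [measurable_cong, simp]: "sets circle_measure = sets borel"
  and circle_measure_space [simp]: "space circle_measure = UNIV"
  by (simp_all add: circle_measure_def)

lemma measurable_cis [measurable]: "cis \<in> borel_measurable borel"
  by (intro borel_measurable_continuous_onI continuous_intros)

lemma measurable_cnj [measurable]: "cnj \<in> borel_measurable borel"
  by (intro borel_measurable_continuous_onI continuous_intros)

lemma emeasure_circle_UNIV [simp]: "emeasure circle_measure UNIV = 1"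
  unfolding circle_measure_def by (subst emeasure_distr) (auto simp: emeasure_uniform_measure_1)

lemma measure_circle_UNIV [simp]: "measure circle_measure UNIV = 1"
  by (simp add: measure_def)

interpretation circle: finite_measure circle_measure
  by (rule finite_measureI) simp

lemma AE_circle: "AE \<xi> in circle_measure. cmod \<xi> = 1"
  unfolding circle_measure_def by (subst AE_distr_iff) auto

lemma uniform_interval_density:
  "uniform_measure lborel {0..2 * pi} = density lborel (\<lambda>t. ennreal (indicator {0..2 * pi} t / (2 * pi)))"
  unfolding uniform_measure_def
  by (intro density_cong) (auto simp: divide_ennreal[symmetric] ennreal_indicator)

lemma circle_integral:
  fixes f :: "complex \<Rightarrow> 'b :: {banach, second_countable_topology}"
  assumes [measurable]: "f \<in> borel_measurable borel"
  shows "integral\<^sup>L circle_measure f = (1 / (2 * pi)) *\<^sub>R (LINT t|lborel. indicator {0..2 * pi} t *\<^sub>R f (cis t))"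
proof -
  have "integral\<^sup>L circle_measure f = (LINT t|uniform_measure lborel {0..2 * pi}. f (cis t))"
    unfolding circle_measure_def by (subst integral_distr) simp_all
  also have "\<dots> = (LINT t|lborel. (indicator {0..2 * pi} t / (2 * pi)) *\<^sub>R f (cis t))"
    unfolding uniform_interval_density by (subst integral_density) auto
  also have "\<dots> = (LINT t|lborel. (1 / (2 * pi)) *\<^sub>R (indicator {0..2 * pi} t *\<^sub>R f (cis t)))"
    by simp
  finally show ?thesis by (simp only: integral_scaleR_right)
qed

lemma circle_integrable_bounded:
  fixes f :: "complex \<Rightarrow> 'b :: {banach, second_countable_topology}"
  assumes "f \<in> borel_measurable borel" "\<And>\<xi>. cmod \<xi> = 1 \<Longrightarrow> norm (f \<xi>) \<le> C"
  shows "integrable circle_measure f"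
proof (rule circle.integrable_const_bound[where B=C])
  show "AE \<xi> in circle_measure. norm (f \<xi>) \<le> C" using AE_circle by eventually_elim (rule assms(2))
qed (use assms(1) in simp)

lemma circle_integral_power:
  assumes "k > 0"
  shows "(LINT \<xi>|circle_measure. \<xi> ^ k) = 0"
proof -
  have der: "((\<lambda>t. cis (real k * t) / (\<i> * k)) has_vector_derivative cis (real k * t)) (at t within {0..2*pi})" for t
  proof -
    have "((\<lambda>t. exp (\<i> * of_real (real k * t)) / (\<i> * k)) has_vector_derivative exp (\<i> * of_real (real k * t))) (at t within {0..2*pi})"
      using assms by (auto intro!: derivative_eq_intros has_vector_derivative_real_field simp: mult_ac)
    then show ?thesis by (simp add: cis_conv_exp)
  qed
  have "(LINT t|lborel. indicator {0..2 * pi} t *\<^sub>R cis t ^ k) = (LINT t|lborel. indicator {0..2 * pi} t *\<^sub>R cis (real k * t))"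
    by (simp only: Complex.DeMoivre)
  also have "\<dots> = cis (real k * (2 * pi)) / (\<i> * k) - cis (real k * 0) / (\<i> * k)"
  proof (rule integral_FTC_Icc[OF _ der])
    show "continuous_on {0..2 * pi} (\<lambda>t. cis (real k * t))"
      unfolding cis_conv_exp by (intro continuous_intros)
  qed simp
  also have "\<dots> = 0" by (simp add: cis_mult mult.commute[of "real k"] cis_multiple_2pi)
  finally show ?thesis by (subst circle_integral) simp_all
qed

lemma circle_integral_monomials:
  "(LINT \<xi>|circle_measure. \<xi> ^ n * cnj \<xi> ^ m) = (if n = m then 1 else 0)"
proof -
  have unit: "\<xi> * cnj \<xi> = 1" if "cmod \<xi> = 1" for \<xi>
    using complex_norm_square[of \<xi>] that by simp
  consider "n = m" | k where "n = m + k" "k > 0" | k where "m = n + k" "k > 0"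
    by (metis less_imp_add_positive linorder_neqE_nat)
  then show ?thesis
  proof cases
    case 1
    have "(LINT \<xi>|circle_measure. \<xi> ^ n * cnj \<xi> ^ m) = (LINT \<xi>|circle_measure. 1)"
    proof (rule integral_cong_AE)
      show "AE \<xi> in circle_measure. \<xi> ^ n * cnj \<xi> ^ m = 1"
        using AE_circle by eventually_elim (simp add: 1 unit flip: power_mult_distrib)
    qed measurable
    then show ?thesis using 1 by simp
  next
    case 2
    have "(LINT \<xi>|circle_measure. \<xi> ^ n * cnj \<xi> ^ m) = (LINT \<xi>|circle_measure. \<xi> ^ k)"
    proof (rule integral_cong_AE)
      show "AE \<xi> in circle_measure. \<xi> ^ n * cnj \<xi> ^ m = \<xi> ^ k"
        using AE_circle
      proof eventually_elim
        case (elim \<xi>)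
        have "\<xi> ^ n * cnj \<xi> ^ m = \<xi> ^ k * (\<xi> * cnj \<xi>) ^ m"
          by (simp add: 2 power_add power_mult_distrib)
        then show ?case by (simp add: unit elim)
      qed
    qed measurable
    then show ?thesis using 2 circle_integral_power by simp
  next
    case 3
    have "(LINT \<xi>|circle_measure. \<xi> ^ n * cnj \<xi> ^ m) = (LINT \<xi>|circle_measure. cnj (\<xi> ^ k))"
    proof (rule integral_cong_AE)
      show "AE \<xi> in circle_measure. \<xi> ^ n * cnj \<xi> ^ m = cnj (\<xi> ^ k)"
        using AE_circle
      proof eventually_elim
        case (elim \<xi>)
        have "\<xi> ^ n * cnj \<xi> ^ m = cnj (\<xi> ^ k) * (\<xi> * cnj \<xi>) ^ n"
          by (simp add: 3 power_add power_mult_distrib)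
        then show ?case by (simp add: unit elim)
      qed
    qed measurable
    also have "\<dots> = cnj (LINT \<xi>|circle_measure. \<xi> ^ k)" by (rule Bochner_Integration.integral_cnj)
    finally show ?thesis using 3 circle_integral_power by simp
  qed
qed

text \<open>The source of all Fourier computations below: with a power of \<xi>, a power of its
  conjugate, or the conjugate of another such series as bounded weight G it yields vanishing means,
  Fourier coefficients and Parseval's identity.\<close>

lemma circle_integral_series:
  assumes a: "summable (\<lambda>n. cmod (a n))" and G [measurable]: "G \<in> borel_measurable borel"
    and C: "\<And>\<xi>. cmod \<xi> = 1 \<Longrightarrow> cmod (G \<xi>) \<le> C"
  shows "(\<lambda>n. a n * (LINT \<xi>|circle_measure. \<xi> ^ n * G \<xi>)) sums (LINT \<xi>|circle_measure. (\<Sum>n. a n * \<xi> ^ n) * G \<xi>)"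
proof -
  let ?f = "\<lambda>n \<xi>. a n * (\<xi> ^ n * G \<xi>)"
  have C0: "C \<ge> 0" using C[of 1] norm_ge_zero[of "G 1"] by (simp add: order_trans[OF norm_ge_zero])
  have bd: "cmod (?f n \<xi>) \<le> cmod (a n) * C" if "cmod \<xi> = 1" for n \<xi>
    using C[OF that] that by (simp add: norm_mult norm_power mult_left_mono)
  have int: "integrable circle_measure (?f n)" for n
    by (rule circle_integrable_bounded[OF _ bd]) auto
  have aC: "summable (\<lambda>n. cmod (a n) * C)" using a by (rule summable_mult2)
  have "(\<lambda>n. integral\<^sup>L circle_measure (?f n)) sums (LINT \<xi>|circle_measure. (\<Sum>n. ?f n \<xi>))"
  proof (rule sums_integral[OF int])
    show "AE \<xi> in circle_measure. summable (\<lambda>n. norm (?f n \<xi>))"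
      using AE_circle
    proof eventually_elim
      case (elim \<xi>)
      show ?case by (rule summable_comparison_test'[OF aC, where N=0]) (simp add: bd[OF elim])
    qed
    have "(LINT \<xi>|circle_measure. norm (?f n \<xi>)) \<le> (LINT \<xi>|circle_measure. cmod (a n) * C)" for n
      using AE_circle
      by (intro integral_mono_AE integrable_norm int) (auto intro: bd elim!: eventually_mono)
    then show "summable (\<lambda>n. LINT \<xi>|circle_measure. norm (?f n \<xi>))"
      by (intro summable_comparison_test'[OF aC, where N=0]) simp
  qed
  moreover have "(LINT \<xi>|circle_measure. (\<Sum>n. ?f n \<xi>)) = (LINT \<xi>|circle_measure. (\<Sum>n. a n * \<xi> ^ n) * G \<xi>)"
  proof (rule integral_cong_AE)
    show "AE \<xi> in circle_measure. (\<Sum>n. ?f n \<xi>) = (\<Sum>n. a n * \<xi> ^ n) * G \<xi>"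
      using AE_circle
    proof eventually_elim
      case (elim \<xi>)
      have "summable (\<lambda>n. a n * \<xi> ^ n)"
        by (rule summable_comparison_test'[OF a, where N=0]) (simp add: norm_mult norm_power elim)
      then show ?case by (simp add: suminf_mult2 mult.assoc)
    qed
  qed auto
  ultimately show ?thesis by simp
qed

lemma circle_fourier_coeff:
  assumes a: "summable (\<lambda>n. cmod (a n))"
  shows "(LINT \<xi>|circle_measure. (\<Sum>n. a n * \<xi> ^ n) * cnj \<xi> ^ k) = a k"
proof -
  have "(\<lambda>n. a n * (LINT \<xi>|circle_measure. \<xi> ^ n * cnj \<xi> ^ k)) sums
      (LINT \<xi>|circle_measure. (\<Sum>n. a n * \<xi> ^ n) * cnj \<xi> ^ k)"
    by (rule circle_integral_series[OF a, where C=1]) (auto simp: norm_power)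
  moreover have "(\<lambda>n. a n * (LINT \<xi>|circle_measure. \<xi> ^ n * cnj \<xi> ^ k)) sums a k"
  proof -
    have "(\<lambda>n. a n * (LINT \<xi>|circle_measure. \<xi> ^ n * cnj \<xi> ^ k)) = (\<lambda>n. if n = k then a n else 0)"
      by (rule ext) (simp only: circle_integral_monomials, simp)
    then show ?thesis using sums_single[of k a] by (simp only:)
  qed
  ultimately show ?thesis by (rule sums_unique2)
qed

lemma circle_integral_series_power:
  assumes a: "summable (\<lambda>n. cmod (a n))"
  shows "(LINT \<xi>|circle_measure. (\<Sum>n. a n * \<xi> ^ n) * \<xi> ^ k) = (if k = 0 then a 0 else 0)"
proof -
  have "(\<lambda>n. a n * (LINT \<xi>|circle_measure. \<xi> ^ n * \<xi> ^ k)) sums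
      (LINT \<xi>|circle_measure. (\<Sum>n. a n * \<xi> ^ n) * \<xi> ^ k)"
    by (rule circle_integral_series[OF a, where C=1]) (auto simp: norm_power)
  moreover have "(LINT \<xi>|circle_measure. \<xi> ^ n * \<xi> ^ k) = (if n = 0 \<and> k = 0 then 1 else 0)" for n
    using circle_integral_monomials[of "n + k" 0] by (simp add: power_add)
  then have "(\<lambda>n. a n * (LINT \<xi>|circle_measure. \<xi> ^ n * \<xi> ^ k))
      = (\<lambda>n. if n = 0 then (if k = 0 then a 0 else 0) else 0)"
    by (intro ext) simp
  then have "(\<lambda>n. a n * (LINT \<xi>|circle_measure. \<xi> ^ n * \<xi> ^ k)) sums (if k = 0 then a 0 else 0)"
    using sums_single[of 0 "\<lambda>_. if k = 0 then a 0 else 0"] by (simp only:)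
  ultimately show ?thesis by (rule sums_unique2)
qed

lemma series_measurable [measurable]: "(\<lambda>\<xi>::complex. \<Sum>n. a n * \<xi> ^ n :: complex) \<in> borel_measurable borel"
  by measurable

lemma circle_parseval:
  assumes a: "summable (\<lambda>n. cmod (a n))" and b: "summable (\<lambda>n. cmod (b n))"
  shows "(\<lambda>n. a n * cnj (b n)) sums (LINT \<xi>|circle_measure. (\<Sum>n. a n * \<xi> ^ n) * cnj (\<Sum>n. b n * \<xi> ^ n))"
proof -
  have bd: "cmod (cnj (\<Sum>n. b n * \<xi> ^ n)) \<le> (\<Sum>n. cmod (b n))" if "cmod \<xi> = 1" for \<xi>
    using summable_norm[of "\<lambda>n. b n * \<xi> ^ n"] b that by (simp add: norm_mult norm_power)
  have "(\<lambda>n. a n * (LINT \<xi>|circle_measure. \<xi> ^ n * cnj (\<Sum>n. b n * \<xi> ^ n))) sums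
      (LINT \<xi>|circle_measure. (\<Sum>n. a n * \<xi> ^ n) * cnj (\<Sum>n. b n * \<xi> ^ n))"
    by (rule circle_integral_series[OF a _ bd]) measurable
  moreover have "(LINT \<xi>|circle_measure. \<xi> ^ n * cnj (\<Sum>n. b n * \<xi> ^ n)) = cnj (b n)" for n
  proof -
    have "(LINT \<xi>|circle_measure. \<xi> ^ n * cnj (\<Sum>n. b n * \<xi> ^ n))
        = (LINT \<xi>|circle_measure. cnj ((\<Sum>n. b n * \<xi> ^ n) * cnj \<xi> ^ n))"
      by (rule Bochner_Integration.integral_cong) (simp_all add: mult.commute)
    also have "\<dots> = cnj (LINT \<xi>|circle_measure. (\<Sum>n. b n * \<xi> ^ n) * cnj \<xi> ^ n)" by (rule Bochner_Integration.integral_cnj)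
    finally show ?thesis by (simp add: circle_fourier_coeff[OF b])
  qed
  ultimately show ?thesis by simp
qed

lemma circle_parseval_norm:
  assumes a: "summable (\<lambda>n. cmod (a n))"
  shows "(\<lambda>n. (cmod (a n))\<^sup>2) sums (LINT \<xi>|circle_measure. (cmod (\<Sum>n. a n * \<xi> ^ n))\<^sup>2)"
proof -
  have "(\<lambda>n. a n * cnj (a n)) sums (LINT \<xi>|circle_measure. (\<Sum>n. a n * \<xi> ^ n) * cnj (\<Sum>n. a n * \<xi> ^ n))"
    by (rule circle_parseval[OF a a])
  then have "(\<lambda>n. complex_of_real ((cmod (a n))\<^sup>2)) sums
      (LINT \<xi>|circle_measure. complex_of_real ((cmod (\<Sum>n. a n * \<xi> ^ n))\<^sup>2))"
    unfolding complex_norm_square .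
  then show ?thesis by (simp only: integral_complex_of_real sums_of_real_iff)
qed

section \<open>Square-integrable functions on the circle\<close>

lemma L2T_measurable: "f \<in> L2T \<Longrightarrow> f \<in> borel_measurable borel"
  and L2T_integrable: "f \<in> L2T \<Longrightarrow> integrable circle_measure (\<lambda>\<xi>. (cmod (f \<xi>))\<^sup>2)"
  by (auto simp: L2T_def)

lemma L2T_I:
  "f \<in> borel_measurable borel \<Longrightarrow> integrable circle_measure (\<lambda>\<xi>. (cmod (f \<xi>))\<^sup>2) \<Longrightarrow> f \<in> L2T"
  by (auto simp: L2T_def)

lemma L2T_bound:
  assumes g: "g \<in> L2T" and f: "f \<in> borel_measurable borel"
    and le: "AE \<xi> in circle_measure. cmod (f \<xi>) \<le> C * cmod (g \<xi>)" 
  shows "f \<in> L2T"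
proof (rule L2T_I[OF f])
  have "integrable circle_measure (\<lambda>\<xi>. C\<^sup>2 * (cmod (g \<xi>))\<^sup>2)"
    by (intro integrable_mult_right L2T_integrable g)
  then show "integrable circle_measure (\<lambda>\<xi>. (cmod (f \<xi>))\<^sup>2)"
  proof (rule Bochner_Integration.integrable_bound)
    show "(\<lambda>\<xi>. (cmod (f \<xi>))\<^sup>2) \<in> borel_measurable circle_measure" using f by measurable
    show "AE \<xi> in circle_measure. norm ((cmod (f \<xi>))\<^sup>2) \<le> norm (C\<^sup>2 * (cmod (g \<xi>))\<^sup>2)"
      using le
    proof eventually_elim
      case (elim \<xi>)
      then have "(cmod (f \<xi>))\<^sup>2 \<le> (C * cmod (g \<xi>))\<^sup>2" by (intro power_mono) auto
      then show ?case by (simp add: power_mult_distrib)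
    qed
  qed
qed

lemma L2T_bounded:
  assumes "f \<in> borel_measurable borel" "\<And>\<xi>. cmod \<xi> = 1 \<Longrightarrow> cmod (f \<xi>) \<le> C"
  shows "f \<in> L2T"
proof (rule L2T_I[OF assms(1)])
  show "integrable circle_measure (\<lambda>\<xi>. (cmod (f \<xi>))\<^sup>2)"
  proof (rule circle_integrable_bounded)
    show "(\<lambda>\<xi>. (cmod (f \<xi>))\<^sup>2) \<in> borel_measurable borel" using assms(1) by measurable
    show "cmod \<xi> = 1 \<Longrightarrow> norm ((cmod (f \<xi>))\<^sup>2) \<le> C\<^sup>2" for \<xi>
      using assms(2)[of \<xi>] by (simp add: power_mono)
  qed
qed

lemma L2T_add: "f \<in> L2T \<Longrightarrow> g \<in> L2T \<Longrightarrow> (\<lambda>\<xi>. f \<xi> + g \<xi>) \<in> L2T"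
proof (rule L2T_I)
  assume fg: "f \<in> L2T" "g \<in> L2T"
  note [measurable] = L2T_measurable[OF fg(1)] L2T_measurable[OF fg(2)]
  show "(\<lambda>\<xi>. f \<xi> + g \<xi>) \<in> borel_measurable borel" by measurable
  have "integrable circle_measure (\<lambda>\<xi>. 2 * (cmod (f \<xi>))\<^sup>2 + 2 * (cmod (g \<xi>))\<^sup>2)"
    by (intro Bochner_Integration.integrable_add integrable_mult_right L2T_integrable fg)
  then show "integrable circle_measure (\<lambda>\<xi>. (cmod (f \<xi> + g \<xi>))\<^sup>2)"
    by (rule Bochner_Integration.integrable_bound) (auto simp: cmod_add_square_le)
qed

lemma L2T_diff: "f \<in> L2T \<Longrightarrow> g \<in> L2T \<Longrightarrow> (\<lambda>\<xi>. f \<xi> - g \<xi>) \<in> L2T"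
proof -
  assume f: "f \<in> L2T" and g: "g \<in> L2T"
  have "(\<lambda>\<xi>. - g \<xi>) \<in> L2T" using g by (auto simp: L2T_def)
  from L2T_add[OF f this] show ?thesis by simp
qed

lemma L2T_diff_square_le:
  assumes "f \<in> L2T" "g \<in> L2T" "h \<in> L2T"
  shows "(LINT \<xi>|circle_measure. (cmod (f \<xi> - h \<xi>))\<^sup>2)
     \<le> 2 * (LINT \<xi>|circle_measure. (cmod (f \<xi> - g \<xi>))\<^sup>2) + 2 * (LINT \<xi>|circle_measure. (cmod (g \<xi> - h \<xi>))\<^sup>2)"
proof -
  note i = L2T_integrable[OF L2T_diff[OF assms(1,3)]] L2T_integrable[OF L2T_diff[OF assms(1,2)]]
    L2T_integrable[OF L2T_diff[OF assms(2,3)]]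
  have "(LINT \<xi>|circle_measure. (cmod (f \<xi> - h \<xi>))\<^sup>2)
      \<le> (LINT \<xi>|circle_measure. 2 * (cmod (f \<xi> - g \<xi>))\<^sup>2 + 2 * (cmod (g \<xi> - h \<xi>))\<^sup>2)"
  proof (rule integral_mono)
    show "(cmod (f \<xi> - h \<xi>))\<^sup>2 \<le> 2 * (cmod (f \<xi> - g \<xi>))\<^sup>2 + 2 * (cmod (g \<xi> - h \<xi>))\<^sup>2" for \<xi>
      using cmod_add_square_le[of "f \<xi> - g \<xi>" "g \<xi> - h \<xi>"] by simp
  qed (intro i Bochner_Integration.integrable_add integrable_mult_right)+
  also have "\<dots> = 2 * (LINT \<xi>|circle_measure. (cmod (f \<xi> - g \<xi>))\<^sup>2) + 2 * (LINT \<xi>|circle_measure. (cmod (g \<xi> - h \<xi>))\<^sup>2)"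
    by (subst Bochner_Integration.integral_add) (auto intro!: i integrable_mult_right)
  finally show ?thesis .
qed

lemma L2T_abs_prod_integrable:
  assumes "f \<in> L2T" "g \<in> L2T"
  shows "integrable circle_measure (\<lambda>\<xi>. cmod (f \<xi>) * cmod (g \<xi>))"
proof -
  note [measurable] = L2T_measurable[OF assms(1)] L2T_measurable[OF assms(2)]
  have "integrable circle_measure (\<lambda>\<xi>. (cmod (f \<xi>))\<^sup>2 + (cmod (g \<xi>))\<^sup>2)"
    by (intro Bochner_Integration.integrable_add L2T_integrable assms)
  then show ?thesis
  proof (rule Bochner_Integration.integrable_bound)
    have "norm (cmod a * cmod b) \<le> norm ((cmod a)\<^sup>2 + (cmod b)\<^sup>2)" for a b
    proof -
      have "0 \<le> cmod a * cmod b" by simp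
      then show ?thesis using sum_squares_bound[of "cmod a" "cmod b"] unfolding real_norm_def by linarith
    qed
    then show "AE \<xi> in circle_measure. norm (cmod (f \<xi>) * cmod (g \<xi>)) \<le> norm ((cmod (f \<xi>))\<^sup>2 + (cmod (g \<xi>))\<^sup>2)"
      by simp
  qed measurable
qed

lemma L2T_prod_integrable:
  assumes "f \<in> L2T" "g \<in> L2T"
  shows "integrable circle_measure (\<lambda>\<xi>. f \<xi> * cnj (g \<xi>))"
proof -
  note [measurable] = L2T_measurable[OF assms(1)] L2T_measurable[OF assms(2)]
  show ?thesis
    by (rule Bochner_Integration.integrable_bound[OF L2T_abs_prod_integrable[OF assms]])
       (auto simp: norm_mult)
qed

lemma L2T_Cauchy_Schwarz:
  assumes "f \<in> L2T" "g \<in> L2T"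
  shows "cmod (LINT \<xi>|circle_measure. f \<xi> * cnj (g \<xi>))
     \<le> sqrt (LINT \<xi>|circle_measure. (cmod (f \<xi>))\<^sup>2) * sqrt (LINT \<xi>|circle_measure. (cmod (g \<xi>))\<^sup>2)"
proof -
  define a where "a = (LINT \<xi>|circle_measure. (cmod (f \<xi>))\<^sup>2)"
  define c where "c = (LINT \<xi>|circle_measure. (cmod (g \<xi>))\<^sup>2)"
  define b where "b = (LINT \<xi>|circle_measure. cmod (f \<xi>) * cmod (g \<xi>))"
  note i = L2T_integrable[OF assms(1)] L2T_integrable[OF assms(2)] L2T_abs_prod_integrable[OF assms]
  have q: "0 \<le> a - 2 * t * b + t\<^sup>2 * c" for t
  proof -
    have "0 \<le> (LINT \<xi>|circle_measure. (cmod (f \<xi>) - t * cmod (g \<xi>))\<^sup>2)" by simp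
    also have "\<dots> = (LINT \<xi>|circle_measure. ((cmod (f \<xi>))\<^sup>2 - (2 * t) * (cmod (f \<xi>) * cmod (g \<xi>))) + t\<^sup>2 * (cmod (g \<xi>))\<^sup>2)"
      by (rule Bochner_Integration.integral_cong) (auto simp: power2_eq_square algebra_simps)
    also have "\<dots> = a - 2 * t * b + t\<^sup>2 * c"
      unfolding a_def b_def c_def using i
      by (subst Bochner_Integration.integral_add, simp, simp, subst Bochner_Integration.integral_diff) simp_all
    finally show ?thesis .
  qed
  have a0: "a \<ge> 0" and c0: "c \<ge> 0" and b0: "b \<ge> 0" by (simp_all add: a_def b_def c_def)
  have "b\<^sup>2 \<le> a * c"
  proof (cases "c = 0")
    case True
    have "b = 0"
    proof (rule ccontr)
      assume "b \<noteq> 0"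
      \<comment> \<open>With c = 0 the quadratic is a - 2 t b, and this t makes it equal to
        -1.\<close>
      then show False using q[of "(a + 1) / (2 * b)"] True by simp
    qed
    then show ?thesis using True by simp
  next
    case False
    then have "c > 0" using c0 by simp
    have "0 \<le> (a - 2 * (b / c) * b + (b / c)\<^sup>2 * c) * c" using q[of "b / c"] \<open>c > 0\<close> by simp
    also have "\<dots> = a * c - b\<^sup>2" using \<open>c > 0\<close> by (simp add: field_simps power2_eq_square)
    finally show ?thesis by simp
  qed
  then have "b \<le> sqrt (a * c)" by (rule real_le_rsqrt)
  moreover have "cmod (LINT \<xi>|circle_measure. f \<xi> * cnj (g \<xi>)) \<le> b"
    unfolding b_def using integral_norm_bound[of circle_measure "\<lambda>\<xi>. f \<xi> * cnj (g \<xi>)"] by (simp add: norm_mult)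
  ultimately show ?thesis unfolding a_def[symmetric] c_def[symmetric] by (simp add: real_sqrt_mult)
qed

text \<open>Riesz--Fischer. Along a subsequence with squared distances at most (1/4)^j the
  increments have integrals at most (1/2)^j, so it converges almost everywhere; Fatou's lemma
  transfers the Cauchy estimate to the limit.\<close>

lemma L2T_complete:
  fixes u :: "nat \<Rightarrow> complex \<Rightarrow> complex"
  assumes u: "\<And>n. u n \<in> L2T"
    and cau: "\<And>e. e > 0 \<Longrightarrow> \<exists>N. \<forall>m\<ge>N. \<forall>n\<ge>N. (LINT \<xi>|circle_measure. (cmod (u m \<xi> - u n \<xi>))\<^sup>2) \<le> e"
  obtains g where "g \<in> L2T" "(\<lambda>n. LINT \<xi>|circle_measure. (cmod (u n \<xi> - g \<xi>))\<^sup>2) \<longlonglongrightarrow> 0"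
proof -
  note [measurable] = L2T_measurable[OF u]
  have "\<forall>j. \<exists>N. \<forall>m\<ge>N. \<forall>n\<ge>N. (LINT \<xi>|circle_measure. (cmod (u m \<xi> - u n \<xi>))\<^sup>2) \<le> (1/4) ^ j"
    using cau by simp
  then obtain N where N: "\<And>j m n. m \<ge> N j \<Longrightarrow> n \<ge> N j \<Longrightarrow> (LINT \<xi>|circle_measure. (cmod (u m \<xi> - u n \<xi>))\<^sup>2) \<le> (1/4) ^ j"
    by metis
  \<comment> \<open>Summing the thresholds makes \<open>k j\<close> exceed \<open>N i\<close> for
    all i \<le> j at once.\<close>
  define k where "k j = (\<Sum>i\<le>j. N i)" for j
  have kN: "k j \<ge> N i" if "i \<le> j" for i j
    unfolding k_def using that by (intro member_le_sum) auto
  define d where "d j \<xi> = cmod (u (k (Suc j)) \<xi> - u (k j) \<xi>)" for j \<xi>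
  have [measurable]: "d j \<in> borel_measurable borel" for j unfolding d_def by measurable
  have dint: "integrable circle_measure (\<lambda>\<xi>. (d j \<xi>)\<^sup>2)" for j
    unfolding d_def by (intro L2T_integrable L2T_diff u)
  have dle: "(\<integral>\<^sup>+\<xi>. ennreal (d j \<xi>) \<partial>circle_measure) \<le> ennreal ((1/2) ^ j)" for j
  proof -
    \<comment> \<open>The inequality of arithmetic and geometric means with weight 2^j, standing in
      for Cauchy--Schwarz against the constant 1.\<close>
    have pw: "d j \<xi> \<le> (2 ^ j * (d j \<xi>)\<^sup>2 + (1/2) ^ j) / 2" for \<xi>
    proof -
      have "0 \<le> (2 ^ j * d j \<xi> - 1)\<^sup>2 / 2 ^ j" by simp
      also have "\<dots> = 2 ^ j * (d j \<xi>)\<^sup>2 - 2 * d j \<xi> + (1/2) ^ j"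
        by (simp add: power2_eq_square field_simps)
      finally show ?thesis by simp
    qed
    have int: "integrable circle_measure (\<lambda>\<xi>. (2 ^ j * (d j \<xi>)\<^sup>2 + (1/2) ^ j) / 2)"
      by (intro integrable_divide_zero Bochner_Integration.integrable_add integrable_mult_right dint) simp
    have "(\<integral>\<^sup>+\<xi>. ennreal (d j \<xi>) \<partial>circle_measure) \<le> (\<integral>\<^sup>+\<xi>. ennreal ((2 ^ j * (d j \<xi>)\<^sup>2 + (1/2) ^ j) / 2) \<partial>circle_measure)"
      by (intro nn_integral_mono ennreal_leI pw)
    also have "\<dots> = ennreal (LINT \<xi>|circle_measure. (2 ^ j * (d j \<xi>)\<^sup>2 + (1/2) ^ j) / 2)"
      by (intro nn_integral_eq_integral int) simp
    also have "(LINT \<xi>|circle_measure. (2 ^ j * (d j \<xi>)\<^sup>2 + (1/2) ^ j) / 2)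
        = (2 ^ j * (LINT \<xi>|circle_measure. (d j \<xi>)\<^sup>2) + (1/2) ^ j) / 2"
      using dint[of j] by simp
    also have "\<dots> \<le> (2 ^ j * (1/4) ^ j + (1/2) ^ j) / 2"
    proof -
      have "(LINT \<xi>|circle_measure. (d j \<xi>)\<^sup>2) \<le> (1/4) ^ j"
        unfolding d_def by (rule N) (auto intro: kN)
      then show ?thesis by (intro divide_right_mono add_right_mono mult_left_mono) auto
    qed
    also have "(2 ^ j * (1/4) ^ j + (1/2) ^ j) / 2 = (1/2 :: real) ^ j"
      by (simp flip: power_mult_distrib)
    finally show ?thesis by (simp add: ennreal_leI)
  qed
  have "(\<integral>\<^sup>+\<xi>. (\<Sum>j. ennreal (d j \<xi>)) \<partial>circle_measure) = (\<Sum>j. \<integral>\<^sup>+\<xi>. ennreal (d j \<xi>) \<partial>circle_measure)"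
    by (rule nn_integral_suminf) measurable
  also have "\<dots> \<le> (\<Sum>j. ennreal ((1/2) ^ j))" by (intro suminf_le dle) auto
  also have "\<dots> = ennreal (\<Sum>j. (1/2) ^ j)" by (intro suminf_ennreal2) (auto simp: summable_geometric)
  finally have "(\<integral>\<^sup>+\<xi>. (\<Sum>j. ennreal (d j \<xi>)) \<partial>circle_measure) \<noteq> \<infinity>"
    by (metis ennreal_less_top infinity_ennreal_def leD)
  then have "AE \<xi> in circle_measure. (\<Sum>j. ennreal (d j \<xi>)) \<noteq> \<infinity>"
    by (intro nn_integral_PInf_AE) measurable
  then have conv: "AE \<xi> in circle_measure. convergent (\<lambda>j. u (k j) \<xi>)"
  proof eventually_elim
    case (elim \<xi>)
    have "summable (\<lambda>j. d j \<xi>)" using elim by (intro summable_suminf_not_top) (auto simp: d_def)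
    then have "summable (\<lambda>j. u (k (Suc j)) \<xi> - u (k j) \<xi>)"
      unfolding d_def by (rule summable_norm_cancel)
    then have "convergent (\<lambda>n. \<Sum>j<n. u (k (Suc j)) \<xi> - u (k j) \<xi>)" by (simp only: summable_iff_convergent)
    then have "convergent (\<lambda>n. u (k n) \<xi> - u (k 0) \<xi>)" by (simp only: sum_lessThan_telescope[of "\<lambda>j. u (k j) \<xi>"])
    then show ?case by (simp add: convergent_diff_const_right_iff)
  qed
  define g where "g \<xi> = lim (\<lambda>j. u (k j) \<xi>)" for \<xi>
  have g [measurable]: "g \<in> borel_measurable borel" unfolding g_def by measurable
  have lim: "AE \<xi> in circle_measure. (\<lambda>j. u (k j) \<xi>) \<longlonglongrightarrow> g \<xi>"
    using conv by eventually_elim (simp add: g_def convergent_LIMSEQ_iff)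
  have main: "(\<integral>\<^sup>+\<xi>. ennreal ((cmod (u n \<xi> - g \<xi>))\<^sup>2) \<partial>circle_measure) \<le> ennreal ((1/4) ^ i)" if n: "n \<ge> N i" for n i
  proof -
    have "(\<integral>\<^sup>+\<xi>. ennreal ((cmod (u n \<xi> - g \<xi>))\<^sup>2) \<partial>circle_measure)
        = (\<integral>\<^sup>+\<xi>. liminf (\<lambda>j. ennreal ((cmod (u n \<xi> - u (k j) \<xi>))\<^sup>2)) \<partial>circle_measure)"
    proof (rule nn_integral_cong_AE)
      show "AE \<xi> in circle_measure. ennreal ((cmod (u n \<xi> - g \<xi>))\<^sup>2) = liminf (\<lambda>j. ennreal ((cmod (u n \<xi> - u (k j) \<xi>))\<^sup>2))"
        using lim
      proof eventually_elim
        case (elim \<xi>)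
        have "(\<lambda>j. ennreal ((cmod (u n \<xi> - u (k j) \<xi>))\<^sup>2)) \<longlonglongrightarrow> ennreal ((cmod (u n \<xi> - g \<xi>))\<^sup>2)"
          by (intro tendsto_ennrealI tendsto_power tendsto_norm tendsto_diff tendsto_const elim)
        then show ?case by (intro lim_imp_Liminf[symmetric]) auto
      qed
    qed
    also have "\<dots> \<le> liminf (\<lambda>j. \<integral>\<^sup>+\<xi>. ennreal ((cmod (u n \<xi> - u (k j) \<xi>))\<^sup>2) \<partial>circle_measure)"
      by (rule nn_integral_liminf) measurable
    also have "\<dots> \<le> liminf (\<lambda>j. ennreal ((1/4) ^ i))"
    proof (rule Liminf_mono)
      show "\<forall>\<^sub>F j in sequentially. (\<integral>\<^sup>+\<xi>. ennreal ((cmod (u n \<xi> - u (k j) \<xi>))\<^sup>2) \<partial>circle_measure) \<le> ennreal ((1/4) ^ i)"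
        using eventually_ge_at_top[of i]
      proof eventually_elim
        case (elim j)
        have "(\<integral>\<^sup>+\<xi>. ennreal ((cmod (u n \<xi> - u (k j) \<xi>))\<^sup>2) \<partial>circle_measure) = ennreal (LINT \<xi>|circle_measure. (cmod (u n \<xi> - u (k j) \<xi>))\<^sup>2)"
          by (intro nn_integral_eq_integral L2T_integrable L2T_diff u) simp
        then show ?case using N[OF n kN[OF elim]] by (simp add: ennreal_leI)
      qed
    qed
    also have "\<dots> = ennreal ((1/4) ^ i)" by (simp add: Liminf_const)
    finally show ?thesis .
  qed
  have dif: "(\<lambda>\<xi>. u n \<xi> - g \<xi>) \<in> L2T" if "n \<ge> N i" for n i
  proof (rule L2T_I)
    show "integrable circle_measure (\<lambda>\<xi>. (cmod (u n \<xi> - g \<xi>))\<^sup>2)"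
      using main[OF that] by (intro integrableI_bounded) (auto simp: less_top[symmetric] top_unique)
  qed measurable
  show thesis
  proof (rule that)
    have "(\<lambda>\<xi>. u (N 0) \<xi> - (u (N 0) \<xi> - g \<xi>)) \<in> L2T" by (rule L2T_diff[OF u dif[where i=0, OF order_refl]])
    then show "g \<in> L2T" by simp
    show "(\<lambda>n. LINT \<xi>|circle_measure. (cmod (u n \<xi> - g \<xi>))\<^sup>2) \<longlonglongrightarrow> 0"
    proof (rule LIMSEQ_I)
      fix e :: real assume "e > 0"
      then obtain i where i: "(1/4 :: real) ^ i < e" using real_arch_pow_inv[of e "1/4"] by auto
      show "\<exists>M. \<forall>n\<ge>M. norm ((LINT \<xi>|circle_measure. (cmod (u n \<xi> - g \<xi>))\<^sup>2) - 0) < e"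
      proof (intro exI[of _ "N i"] allI impI)
        fix n assume n: "n \<ge> N i"
        have "ennreal (LINT \<xi>|circle_measure. (cmod (u n \<xi> - g \<xi>))\<^sup>2) \<le> ennreal ((1/4) ^ i)"
          using main[OF n] nn_integral_eq_integral[OF L2T_integrable[OF dif[OF n]]] by simp
        then have "(LINT \<xi>|circle_measure. (cmod (u n \<xi> - g \<xi>))\<^sup>2) \<le> (1/4) ^ i" by (simp add: ennreal_le_iff)
        then show "norm ((LINT \<xi>|circle_measure. (cmod (u n \<xi> - g \<xi>))\<^sup>2) - 0) < e" using i by simp
      qed
    qed
  qed
qed

section \<open>Boundary functions and Toeplitz operators\<close>

definition circle_series :: "l2 \<Rightarrow> complex \<Rightarrow> complex" where
  "circle_series x \<xi> = (\<Sum>n. coef x n * \<xi> ^ n)"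

text \<open>For absolutely summable coefficients the series converges at every point of the circle
  and Parseval applies directly. Truncations and dilations are of this kind and approximate
  everything else.\<close>

definition abs_l2 :: "l2 \<Rightarrow> bool" where
  "abs_l2 x \<longleftrightarrow> summable (\<lambda>n. cmod (coef x n))"

lemma circle_series_measurable [measurable]: "circle_series x \<in> borel_measurable borel"
  unfolding circle_series_def by measurable

lemma abs_l2_summable: "abs_l2 x \<Longrightarrow> cmod \<xi> = 1 \<Longrightarrow> summable (\<lambda>n. coef x n * \<xi> ^ n)"
  by (rule summable_norm_cancel) (simp add: abs_l2_def norm_mult norm_power)

lemma abs_l2_diff: "abs_l2 x \<Longrightarrow> abs_l2 y \<Longrightarrow> abs_l2 (x - y)"
  unfolding abs_l2_def
  by (rule summable_comparison_test'[where N=0 and g="\<lambda>n. cmod (coef x n) + cmod (coef y n)"])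
     (auto intro: summable_add norm_triangle_ineq4)

lemma circle_series_diff:
  "abs_l2 x \<Longrightarrow> abs_l2 y \<Longrightarrow> cmod \<xi> = 1 \<Longrightarrow> circle_series (x - y) \<xi> = circle_series x \<xi> - circle_series y \<xi>"
  unfolding circle_series_def
  by (simp add: suminf_diff abs_l2_summable left_diff_distrib)

lemma circle_series_L2T: "abs_l2 x \<Longrightarrow> circle_series x \<in> L2T"
proof (rule L2T_bounded[where C="\<Sum>n. cmod (coef x n)"])
  fix \<xi> :: complex assume "abs_l2 x" "cmod \<xi> = 1"
  then show "cmod (circle_series x \<xi>) \<le> (\<Sum>n. cmod (coef x n))"
    using summable_norm[of "\<lambda>n. coef x n * \<xi> ^ n"]
    by (simp add: circle_series_def abs_l2_def norm_mult norm_power)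
qed measurable

lemma circle_series_cinner:
  "abs_l2 x \<Longrightarrow> abs_l2 y \<Longrightarrow> (LINT \<xi>|circle_measure. circle_series x \<xi> * cnj (circle_series y \<xi>)) = cinner x y"
  using circle_parseval[of "coef x" "coef y"]
  by (simp add: abs_l2_def circle_series_def cinner_def sums_iff)

lemma circle_series_norm:
  "abs_l2 x \<Longrightarrow> (LINT \<xi>|circle_measure. (cmod (circle_series x \<xi>))\<^sup>2) = (norm x)\<^sup>2"
  using circle_parseval_norm[of "coef x"]
  by (simp add: abs_l2_def circle_series_def l2_norm_square sums_iff)

lemma circle_series_norm_diff:
  assumes "abs_l2 x" "abs_l2 y"
  shows "(LINT \<xi>|circle_measure. (cmod (circle_series x \<xi> - circle_series y \<xi>))\<^sup>2) = (norm (x - y))\<^sup>2"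
proof -
  have "(LINT \<xi>|circle_measure. (cmod (circle_series x \<xi> - circle_series y \<xi>))\<^sup>2)
      = (LINT \<xi>|circle_measure. (cmod (circle_series (x - y) \<xi>))\<^sup>2)"
  proof (rule integral_cong_AE)
    show "AE \<xi> in circle_measure. (cmod (circle_series x \<xi> - circle_series y \<xi>))\<^sup>2 = (cmod (circle_series (x - y) \<xi>))\<^sup>2"
      using AE_circle by eventually_elim (simp add: circle_series_diff assms)
  qed measurable
  then show ?thesis by (simp add: circle_series_norm abs_l2_diff assms)
qed

definition trunc :: "nat \<Rightarrow> l2 \<Rightarrow> l2" where
  "trunc N x = Abs_l2 (\<lambda>n. if n < N then coef x n else 0)"

lemma coef_trunc: "coef (trunc N x) n = (if n < N then coef x n else 0)"
proof -
  have "summable (\<lambda>n. (cmod (if n < N then coef x n else 0))\<^sup>2)"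
    by (rule summable_finite[of "{..<N}"]) auto
  then show ?thesis by (simp add: trunc_def coef_Abs_l2)
qed

lemma abs_l2_trunc: "abs_l2 (trunc N x)"
  unfolding abs_l2_def coef_trunc by (rule summable_finite[of "{..<N}"]) auto

lemma trunc_tendsto: "(\<lambda>N. trunc N x) \<longlonglongrightarrow> x"
proof -
  have eq: "(norm (trunc N x - x))\<^sup>2 = (norm x)\<^sup>2 - (\<Sum>n<N. (cmod (coef x n))\<^sup>2)" for N
  proof -
    have "(\<lambda>n. (cmod (coef (trunc N x) n))\<^sup>2) sums (\<Sum>n<N. (cmod (coef x n))\<^sup>2)"
      using sums_finite[of "{..<N}" "\<lambda>n. (cmod (coef (trunc N x) n))\<^sup>2"] by (simp add: coef_trunc)
    moreover have "(\<lambda>n. (cmod (coef x n))\<^sup>2) sums (norm x)\<^sup>2"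
      unfolding l2_norm_square by (rule summable_sums[OF summable_coef])
    ultimately have "(\<lambda>n. (cmod (coef x n))\<^sup>2 - (cmod (coef (trunc N x) n))\<^sup>2) sums ((norm x)\<^sup>2 - (\<Sum>n<N. (cmod (coef x n))\<^sup>2))"
      by (intro sums_diff)
    moreover have "(\<lambda>n. (cmod (coef x n))\<^sup>2 - (cmod (coef (trunc N x) n))\<^sup>2) = (\<lambda>n. (cmod (coef (trunc N x - x) n))\<^sup>2)"
      by (auto simp: coef_trunc)
    ultimately show ?thesis by (simp add: l2_norm_square sums_iff)
  qed
  have "(\<lambda>N. (norm x)\<^sup>2 - (\<Sum>n<N. (cmod (coef x n))\<^sup>2)) \<longlonglongrightarrow> (norm x)\<^sup>2 - (norm x)\<^sup>2"
    by (intro tendsto_diff tendsto_const) (simp add: l2_norm_square summable_LIMSEQ summable_coef)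
  then have "(\<lambda>N. (norm (trunc N x - x))\<^sup>2) \<longlonglongrightarrow> 0" by (simp add: eq)
  then have "(\<lambda>N. sqrt ((norm (trunc N x - x))\<^sup>2)) \<longlonglongrightarrow> sqrt 0" by (rule tendsto_real_sqrt)
  then have "(\<lambda>N. norm (trunc N x - x)) \<longlonglongrightarrow> 0" by simp
  then show ?thesis by (simp add: LIM_zero_iff tendsto_norm_zero_iff)
qed

definition dilate :: "real \<Rightarrow> l2 \<Rightarrow> l2" where
  "dilate r x = Abs_l2 (\<lambda>n. coef x n * of_real (r ^ n))"

lemma dilate_summable:
  assumes "0 \<le> r" "r \<le> 1"
  shows "summable (\<lambda>n. (cmod (coef x n * of_real (r ^ n)))\<^sup>2)"
proof (rule summable_comparison_test'[OF summable_coef[of x], where N=0])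
  show "norm ((cmod (coef x n * of_real (r ^ n)))\<^sup>2) \<le> (cmod (coef x n))\<^sup>2" for n
    using assms by (simp add: norm_mult norm_power power_mult_distrib mult_left_le power_le_one)
qed

lemma coef_dilate: "0 \<le> r \<Longrightarrow> r \<le> 1 \<Longrightarrow> coef (dilate r x) n = coef x n * of_real (r ^ n)"
  unfolding dilate_def by (subst coef_Abs_l2[OF dilate_summable]) auto

lemma abs_l2_dilate: "0 \<le> r \<Longrightarrow> r < 1 \<Longrightarrow> abs_l2 (dilate r x)"
  using l2_fun_summable[of "of_real r" x]
  by (simp add: abs_l2_def coef_dilate norm_mult norm_power)

lemma norm_dilate_le: "0 \<le> r \<Longrightarrow> r \<le> 1 \<Longrightarrow> norm (dilate r x) \<le> norm x"
proof -
  assume r: "0 \<le> r" "r \<le> 1"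
  have "(norm (dilate r x))\<^sup>2 \<le> (norm x)\<^sup>2"
    unfolding l2_norm_square
  proof (rule suminf_le[OF _ summable_coef summable_coef])
    show "(cmod (coef (dilate r x) n))\<^sup>2 \<le> (cmod (coef x n))\<^sup>2" for n
      using r by (simp add: coef_dilate norm_mult norm_power power_mult_distrib mult_left_le power_le_one)
  qed
  then show ?thesis by (rule power2_le_imp_le) simp
qed

lemma circle_series_dilate:
  "0 \<le> r \<Longrightarrow> r < 1 \<Longrightarrow> cmod \<xi> = 1 \<Longrightarrow> circle_series (dilate r x) \<xi> = l2_fun x (of_real r * \<xi>)"
  by (simp add: circle_series_def l2_fun_def coef_dilate norm_mult power_mult_distrib mult.assoc)

lemma eventually_at_left_1: "\<forall>\<^sub>F r in at_left (1::real). 0 < r \<and> r < 1"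
  using eventually_at_left_real[of 0 "1::real"] by (simp add: eventually_mono)

text \<open>Dominated convergence for series (Tannery): the k-th term |x_k|^2 (1 - r^k)^2 tends to 0
  and stays below |x_k|^2.\<close>

lemma dilate_tendsto: "((\<lambda>r. norm (dilate r x - x)) \<longlongrightarrow> 0) (at_left 1)"
proof -
  have "eventually (\<lambda>r. summable (\<lambda>k. norm ((cmod (coef x k))\<^sup>2 * (1 - r ^ k)\<^sup>2))) (at_left 1) \<and>
      summable (\<lambda>n. norm (0::real)) \<and>
      ((\<lambda>r. \<Sum>k. (cmod (coef x k))\<^sup>2 * (1 - r ^ k)\<^sup>2) \<longlongrightarrow> (\<Sum>k. 0::real)) (at_left (1::real))"
  proof (rule tannerys_theorem[where M="\<lambda>k. (cmod (coef x k))\<^sup>2"])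
    fix k
    have "((\<lambda>r. (cmod (coef x k))\<^sup>2 * (1 - r ^ k)\<^sup>2) \<longlongrightarrow> (cmod (coef x k))\<^sup>2 * (1 - 1 ^ k)\<^sup>2) (at_left 1)"
      by (intro tendsto_intros)
    then show "((\<lambda>r. (cmod (coef x k))\<^sup>2 * (1 - r ^ k)\<^sup>2) \<longlongrightarrow> 0) (at_left 1)" by simp
  next
    show "\<forall>\<^sub>F (k, r) in at_top \<times>\<^sub>F at_left 1. norm ((cmod (coef x k))\<^sup>2 * (1 - r ^ k)\<^sup>2) \<le> (cmod (coef x k))\<^sup>2"
      unfolding eventually_prod_filter
    proof (intro exI conjI allI impI)
      show "\<forall>\<^sub>F k in at_top. True" by simp
      show "\<forall>\<^sub>F r in at_left (1::real). 0 < r \<and> r < 1" by (rule eventually_at_left_1)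
      fix k :: nat and r :: real assume r: "0 < r \<and> r < 1"
      have "0 \<le> 1 - r ^ k" "1 - r ^ k \<le> 1" using r by (auto simp: power_le_one)
      then have "(1 - r ^ k)\<^sup>2 \<le> 1" by (simp add: power_le_one)
      then show "case (k, r) of (k, r) \<Rightarrow> norm ((cmod (coef x k))\<^sup>2 * (1 - r ^ k)\<^sup>2) \<le> (cmod (coef x k))\<^sup>2"
        by (simp add: mult_left_le)
    qed
  qed (auto simp: summable_coef)
  then have "((\<lambda>r. \<Sum>k. (cmod (coef x k))\<^sup>2 * (1 - r ^ k)\<^sup>2) \<longlongrightarrow> 0) (at_left (1::real))" by simp
  moreover have "\<forall>\<^sub>F r in at_left (1::real). (\<Sum>k. (cmod (coef x k))\<^sup>2 * (1 - r ^ k)\<^sup>2) = (norm (dilate r x - x))\<^sup>2"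
    using eventually_at_left_1
  proof eventually_elim
    case (elim r)
    have "(cmod (coef (dilate r x - x) k))\<^sup>2 = (cmod (coef x k))\<^sup>2 * (1 - r ^ k)\<^sup>2" for k
    proof -
      have "coef (dilate r x - x) k = coef x k * of_real (- (1 - r ^ k))"
        using elim by (simp add: coef_dilate algebra_simps)
      then show ?thesis by (simp only: norm_mult power_mult_distrib norm_of_real power2_abs power2_minus)
    qed
    then show ?case by (simp add: l2_norm_square)
  qed
  ultimately have "((\<lambda>r. (norm (dilate r x - x))\<^sup>2) \<longlongrightarrow> 0) (at_left 1)" by (rule Lim_transform_eventually)
  then have "((\<lambda>r. sqrt ((norm (dilate r x - x))\<^sup>2)) \<longlongrightarrow> sqrt 0) (at_left 1)" by (rule tendsto_real_sqrt)
  then show ?thesis by simp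
qed

section \<open>Boundary functions as mean-square limits of dilations\<close>

lemma l2_fun_measurable [measurable]: "l2_fun x \<in> borel_measurable borel"
  unfolding l2_fun_def by measurable

lemma dilation_L2T: "0 \<le> r \<Longrightarrow> r < 1 \<Longrightarrow> (\<lambda>\<xi>. l2_fun x (of_real r * \<xi>)) \<in> L2T"
proof (rule L2T_bound[OF circle_series_L2T[OF abs_l2_dilate], where C=1])
  assume "0 \<le> r" "r < 1"
  then show "AE \<xi> in circle_measure. cmod (l2_fun x (of_real r * \<xi>)) \<le> 1 * cmod (circle_series (dilate r x) \<xi>)"
    using AE_circle by (auto simp: circle_series_dilate elim!: eventually_mono)
qed auto

lemma dilation_integral_cong:
  assumes "0 \<le> r" "r < 1" and [measurable]: "G \<in> borel_measurable borel"
  shows "(LINT \<xi>|circle_measure. (cmod (l2_fun x (of_real r * \<xi>) - G \<xi>))\<^sup>2)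
       = (LINT \<xi>|circle_measure. (cmod (circle_series (dilate r x) \<xi> - G \<xi>))\<^sup>2)"
proof (rule integral_cong_AE)
  show "AE \<xi> in circle_measure. (cmod (l2_fun x (of_real r * \<xi>) - G \<xi>))\<^sup>2 = (cmod (circle_series (dilate r x) \<xi> - G \<xi>))\<^sup>2"
    using AE_circle by eventually_elim (simp add: circle_series_dilate assms)
qed measurable

text \<open>The limit g of the truncated series exists by completeness. Comparing a dilation with g
  through the N-th truncation and letting N tend to infinity bounds the squared distance by
  \<open>2 * (norm (dilate r x - x))\<^sup>2\<close>.\<close>

lemma boundary_exists:
  "\<exists>g. g \<in> L2T \<and> ((\<lambda>r::real. LINT \<xi>|circle_measure. (cmod (l2_fun x (of_real r * \<xi>) - g \<xi>))\<^sup>2) \<longlongrightarrow> 0) (at_left 1)"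
proof -
  let ?u = "\<lambda>N. circle_series (trunc N x)"
  have cau: "\<exists>N. \<forall>m\<ge>N. \<forall>n\<ge>N. (LINT \<xi>|circle_measure. (cmod (?u m \<xi> - ?u n \<xi>))\<^sup>2) \<le> e" if "e > 0" for e
  proof -
    have "Cauchy (\<lambda>N. trunc N x)" by (rule LIMSEQ_imp_Cauchy[OF trunc_tendsto])
    then obtain N where N: "\<And>m n. m \<ge> N \<Longrightarrow> n \<ge> N \<Longrightarrow> dist (trunc m x) (trunc n x) < sqrt e"
      using metric_CauchyD[of "\<lambda>N. trunc N x" "sqrt e"] \<open>e > 0\<close> by auto
    show ?thesis
    proof (intro exI[of _ N] allI impI)
      fix m n assume mn: "m \<ge> N" "n \<ge> N"
      have "(norm (trunc m x - trunc n x))\<^sup>2 \<le> (sqrt e)\<^sup>2"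
        using N[OF mn] by (intro power_mono) (auto simp: dist_norm)
      then show "(LINT \<xi>|circle_measure. (cmod (?u m \<xi> - ?u n \<xi>))\<^sup>2) \<le> e"
        using \<open>e > 0\<close> by (simp add: circle_series_norm_diff abs_l2_trunc)
    qed
  qed
  obtain g where g: "g \<in> L2T" "(\<lambda>n. LINT \<xi>|circle_measure. (cmod (?u n \<xi> - g \<xi>))\<^sup>2) \<longlonglongrightarrow> 0"
    by (rule L2T_complete[of ?u, OF circle_series_L2T[OF abs_l2_trunc] cau], assumption, rule that)
  have le: "(LINT \<xi>|circle_measure. (cmod (l2_fun x (of_real r * \<xi>) - g \<xi>))\<^sup>2) \<le> 2 * (norm (dilate r x - x))\<^sup>2"
    if r: "0 < r \<and> r < 1" for r
  proof (rule LIMSEQ_le_const)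
    have "(\<lambda>N. 2 * (norm (dilate r x - trunc N x))\<^sup>2 + 2 * (LINT \<xi>|circle_measure. (cmod (?u N \<xi> - g \<xi>))\<^sup>2))
        \<longlonglongrightarrow> 2 * (norm (dilate r x - x))\<^sup>2 + 2 * 0"
      by (intro tendsto_add tendsto_mult tendsto_power tendsto_norm tendsto_diff tendsto_const trunc_tendsto g)
    then show "(\<lambda>N. 2 * (norm (dilate r x - trunc N x))\<^sup>2 + 2 * (LINT \<xi>|circle_measure. (cmod (?u N \<xi> - g \<xi>))\<^sup>2))
        \<longlonglongrightarrow> 2 * (norm (dilate r x - x))\<^sup>2" by simp
    have "(LINT \<xi>|circle_measure. (cmod (l2_fun x (of_real r * \<xi>) - g \<xi>))\<^sup>2)
       \<le> 2 * (norm (dilate r x - trunc N x))\<^sup>2 + 2 * (LINT \<xi>|circle_measure. (cmod (?u N \<xi> - g \<xi>))\<^sup>2)" for N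
      using L2T_diff_square_le[OF circle_series_L2T circle_series_L2T g(1), of "dilate r x" "trunc N x"] r
      by (simp add: circle_series_norm_diff abs_l2_trunc abs_l2_dilate dilation_integral_cong L2T_measurable g)
    then show "\<exists>N. \<forall>n\<ge>N. (LINT \<xi>|circle_measure. (cmod (l2_fun x (of_real r * \<xi>) - g \<xi>))\<^sup>2)
       \<le> 2 * (norm (dilate r x - trunc n x))\<^sup>2 + 2 * (LINT \<xi>|circle_measure. (cmod (?u n \<xi> - g \<xi>))\<^sup>2)"
      by auto
  qed
  have "((\<lambda>r. LINT \<xi>|circle_measure. (cmod (l2_fun x (of_real r * \<xi>) - g \<xi>))\<^sup>2) \<longlongrightarrow> 0) (at_left 1)"
  proof (rule tendsto_sandwich[OF _ _ tendsto_const])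
    have "((\<lambda>r. 2 * (norm (dilate r x - x))\<^sup>2) \<longlongrightarrow> 2 * 0\<^sup>2) (at_left 1)"
      by (intro tendsto_mult tendsto_power tendsto_const dilate_tendsto)
    then show "((\<lambda>r. 2 * (norm (dilate r x - x))\<^sup>2) \<longlongrightarrow> 0) (at_left 1)" by simp
    show "\<forall>\<^sub>F r in at_left 1. (LINT \<xi>|circle_measure. (cmod (l2_fun x (of_real r * \<xi>) - g \<xi>))\<^sup>2) \<le> 2 * (norm (dilate r x - x))\<^sup>2"
      using eventually_at_left_1 by eventually_elim (rule le)
  qed simp
  then show ?thesis using g(1) by blast
qed

lemma boundary_L2T: "boundary_fun (l2_fun x) \<in> L2T"
  and boundary_limit: "((\<lambda>r::real. LINT \<xi>|circle_measure. (cmod (l2_fun x (of_real r * \<xi>) - boundary_fun (l2_fun x) \<xi>))\<^sup>2) \<longlongrightarrow> 0) (at_left 1)"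
  using someI_ex[OF boundary_exists[of x]] unfolding boundary_fun_def by blast+

text \<open>\<open>boundary_fun\<close> is an arbitrary choice among representatives, so it can only
  be identified almost everywhere; this is the means of doing so.\<close>

lemma boundary_unique:
  assumes g: "g \<in> L2T"
    and lim: "((\<lambda>r::real. LINT \<xi>|circle_measure. (cmod (l2_fun x (of_real r * \<xi>) - g \<xi>))\<^sup>2) \<longlongrightarrow> 0) (at_left 1)"
  shows "AE \<xi> in circle_measure. boundary_fun (l2_fun x) \<xi> = g \<xi>"
proof -
  let ?b = "boundary_fun (l2_fun x)"
  let ?I = "LINT \<xi>|circle_measure. (cmod (?b \<xi> - g \<xi>))\<^sup>2"
  have "?I \<le> 0"
  proof (rule tendsto_lowerbound)
    have "((\<lambda>r::real. 2 * (LINT \<xi>|circle_measure. (cmod (l2_fun x (of_real r * \<xi>) - ?b \<xi>))\<^sup>2)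
       + 2 * (LINT \<xi>|circle_measure. (cmod (l2_fun x (of_real r * \<xi>) - g \<xi>))\<^sup>2)) \<longlongrightarrow> 2 * 0 + 2 * 0) (at_left 1)"
      by (intro tendsto_add tendsto_mult tendsto_const lim boundary_limit)
    then show "((\<lambda>r::real. 2 * (LINT \<xi>|circle_measure. (cmod (l2_fun x (of_real r * \<xi>) - ?b \<xi>))\<^sup>2)
       + 2 * (LINT \<xi>|circle_measure. (cmod (l2_fun x (of_real r * \<xi>) - g \<xi>))\<^sup>2)) \<longlongrightarrow> 0) (at_left 1)" by simp
    show "\<forall>\<^sub>F r in at_left (1::real). ?I \<le> 2 * (LINT \<xi>|circle_measure. (cmod (l2_fun x (of_real r * \<xi>) - ?b \<xi>))\<^sup>2)
       + 2 * (LINT \<xi>|circle_measure. (cmod (l2_fun x (of_real r * \<xi>) - g \<xi>))\<^sup>2)"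
      using eventually_at_left_1
    proof eventually_elim
      case (elim r)
      then show ?case
        using L2T_diff_square_le[OF boundary_L2T dilation_L2T g, of r x x] by (simp add: norm_minus_commute)
    qed
  qed simp
  then have "?I = 0" by (simp add: antisym)
  then have "AE \<xi> in circle_measure. (cmod (?b \<xi> - g \<xi>))\<^sup>2 = 0"
    using integral_nonneg_eq_0_iff_AE[OF L2T_integrable[OF L2T_diff[OF boundary_L2T g]]] by simp
  then show ?thesis by eventually_elim simp
qed

text \<open>Passage to boundary values preserves inner products: Parseval holds for the dilations,
  and both sides are continuous as r tends to 1, the integral side by Cauchy--Schwarz applied to
  each factor's error.\<close>

lemma boundary_cinner:
  "(LINT \<xi>|circle_measure. boundary_fun (l2_fun x) \<xi> * cnj (boundary_fun (l2_fun y) \<xi>)) = cinner x y"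
proof -
  let ?f = "boundary_fun (l2_fun x)" and ?g = "boundary_fun (l2_fun y)"
  let ?J = "LINT \<xi>|circle_measure. ?f \<xi> * cnj (?g \<xi>)"
  let ?c = "sqrt (LINT \<xi>|circle_measure. (cmod (?f \<xi>))\<^sup>2)"
  let ?d = "\<lambda>r::real. LINT \<xi>|circle_measure. (cmod (l2_fun x (of_real r * \<xi>) - ?f \<xi>))\<^sup>2"
  let ?e = "\<lambda>r::real. LINT \<xi>|circle_measure. (cmod (l2_fun y (of_real r * \<xi>) - ?g \<xi>))\<^sup>2"
  have dil: "((\<lambda>r. dilate r z) \<longlongrightarrow> z) (at_left 1)" for z
    using dilate_tendsto[of z] by (simp add: LIM_zero_iff tendsto_norm_zero_iff)
  have icont: "((\<lambda>r. dilate r x \<bullet> cscale a (dilate r y)) \<longlongrightarrow> x \<bullet> cscale a y) (at_left 1)" for a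
    by (intro tendsto_inner bounded_linear.tendsto[OF bounded_linear_cscale] dil)
  have cc: "cinner u v = Complex (u \<bullet> cscale 1 v) (u \<bullet> cscale \<i> v)" for u v
  proof -
    have "cscale 1 v = v" by (rule l2_eqI) simp
    then show ?thesis by (simp add: complex_eq_iff Re_cinner Im_cinner)
  qed
  have "((\<lambda>r. cinner (dilate r x) (dilate r y)) \<longlongrightarrow> cinner x y) (at_left 1)"
    unfolding cc by (intro tendsto_Complex icont)
  moreover have "((\<lambda>r. cinner (dilate r x) (dilate r y)) \<longlongrightarrow> ?J) (at_left 1)"
  proof (rule LIM_zero_cancel, rule Lim_null_comparison)
    have "((\<lambda>r. sqrt (?d r) * norm y + ?c * sqrt (?e r)) \<longlongrightarrow> sqrt 0 * norm y + ?c * sqrt 0) (at_left 1)"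
      by (intro tendsto_intros boundary_limit)
    then show "((\<lambda>r. sqrt (?d r) * norm y + ?c * sqrt (?e r)) \<longlongrightarrow> 0) (at_left 1)" by simp
    show "\<forall>\<^sub>F r in at_left 1. norm (cinner (dilate r x) (dilate r y) - ?J) \<le> sqrt (?d r) * norm y + ?c * sqrt (?e r)"
      using eventually_at_left_1
    proof eventually_elim
      case (elim r)
      let ?F = "circle_series (dilate r x)" and ?G = "circle_series (dilate r y)"
      have FG: "?F \<in> L2T" "?G \<in> L2T" using elim by (auto intro!: circle_series_L2T abs_l2_dilate)
      have "cinner (dilate r x) (dilate r y) = (LINT \<xi>|circle_measure. ?F \<xi> * cnj (?G \<xi>))"
        using elim by (simp add: circle_series_cinner abs_l2_dilate)
      also have "\<dots> - ?J = (LINT \<xi>|circle_measure. ?F \<xi> * cnj (?G \<xi>) - ?f \<xi> * cnj (?g \<xi>))"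
        by (intro Bochner_Integration.integral_diff[symmetric] L2T_prod_integrable FG boundary_L2T)
      also have "\<dots> = (LINT \<xi>|circle_measure. (?F \<xi> - ?f \<xi>) * cnj (?G \<xi>) + ?f \<xi> * cnj (?G \<xi> - ?g \<xi>))"
        by (intro Bochner_Integration.integral_cong) (auto simp: algebra_simps)
      also have "\<dots> = (LINT \<xi>|circle_measure. (?F \<xi> - ?f \<xi>) * cnj (?G \<xi>)) + (LINT \<xi>|circle_measure. ?f \<xi> * cnj (?G \<xi> - ?g \<xi>))"
        by (intro Bochner_Integration.integral_add L2T_prod_integrable L2T_diff FG boundary_L2T)
      finally have "norm (cinner (dilate r x) (dilate r y) - ?J)
         \<le> cmod (LINT \<xi>|circle_measure. (?F \<xi> - ?f \<xi>) * cnj (?G \<xi>)) + cmod (LINT \<xi>|circle_measure. ?f \<xi> * cnj (?G \<xi> - ?g \<xi>))"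
        by (simp only: norm_triangle_ineq)
      also have "\<dots> \<le> sqrt (LINT \<xi>|circle_measure. (cmod (?F \<xi> - ?f \<xi>))\<^sup>2) * sqrt (LINT \<xi>|circle_measure. (cmod (?G \<xi>))\<^sup>2)
          + ?c * sqrt (LINT \<xi>|circle_measure. (cmod (?G \<xi> - ?g \<xi>))\<^sup>2)"
        by (intro add_mono L2T_Cauchy_Schwarz L2T_diff FG boundary_L2T)
      also have "\<dots> \<le> sqrt (?d r) * norm y + ?c * sqrt (?e r)"
        using elim norm_dilate_le[of r y]
        by (intro add_mono mult_left_mono)
           (simp_all add: dilation_integral_cong L2T_measurable boundary_L2T circle_series_norm abs_l2_dilate mult_left_mono)
      finally show ?case .
    qed
  qed
  ultimately show ?thesis by (intro tendsto_unique[of "at_left (1::real)"]) simp_all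
qed

text \<open>At radius r the error splits into m(r \<xi>) times the error of x, and (m(r \<xi>) -
  m(\<xi>)) times its boundary function. Boundedness handles the first summand, and the Lipschitz
  condition up to the circle bounds the second by K (1 - r) times a fixed square-integrable
  function.\<close>

lemma boundary_mult:
  assumes K: "\<And>z w. cmod z \<le> 1 \<Longrightarrow> cmod w \<le> 1 \<Longrightarrow> cmod (m z - m w) \<le> K * cmod (z - w)"
    and bd: "\<And>z. cmod z \<le> 1 \<Longrightarrow> cmod (m z) \<le> C"
    and eq: "\<And>z. cmod z < 1 \<Longrightarrow> l2_fun y z = m z * l2_fun x z"
  shows "AE \<xi> in circle_measure. boundary_fun (l2_fun y) \<xi> = m \<xi> * boundary_fun (l2_fun x) \<xi>"
proof -
  let ?f = "boundary_fun (l2_fun x)"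
  have [measurable]: "?f \<in> borel_measurable borel" by (rule L2T_measurable[OF boundary_L2T])
  \<comment> \<open>Continuity of m is known only on the closed disc; cutting it off there gives a
    Borel function on the plane that agrees with m on the circle.\<close>
  define m' where "m' \<xi> = (if \<xi> \<in> cball 0 1 then m \<xi> else 0)" for \<xi>
  have K0: "K \<ge> 0" using K[of 1 0] norm_ge_zero[of "m 1 - m 0"] by (simp add: order_trans[OF norm_ge_zero])
  have "continuous_on (cball 0 1) m"
    unfolding continuous_on_iff
  proof (intro ballI allI impI)
    fix z e :: real and w assume "w \<in> cball (0::complex) 1" "0 < e"
    then show "\<exists>d>0. \<forall>x'\<in>cball 0 1. dist x' w < d \<longrightarrow> dist (m x') (m w) < e"
    proof (intro exI[of _ "e / (K + 1)"] conjI ballI impI)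
      fix x' assume "x' \<in> cball 0 1" "dist x' w < e / (K + 1)"
      then have "cmod (m x' - m w) \<le> K * cmod (x' - w)" "(K + 1) * cmod (x' - w) < e"
        using \<open>w \<in> cball 0 1\<close> K0 K[of x' w] by (auto simp: dist_norm field_simps)
      moreover have "K * cmod (x' - w) \<le> (K + 1) * cmod (x' - w)" by (intro mult_right_mono) auto
      ultimately show "dist (m x') (m w) < e" by (simp add: dist_norm)
    qed (use K0 in auto)
  qed
  then have m' [measurable]: "m' \<in> borel_measurable borel"
    unfolding m'_def by (intro borel_measurable_continuous_on_if) auto
  have m'1: "m' \<xi> = m \<xi>" if "cmod \<xi> = 1" for \<xi> using that by (simp add: m'_def)
  have g: "(\<lambda>\<xi>. m' \<xi> * ?f \<xi>) \<in> L2T"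
  proof (rule L2T_bound[OF boundary_L2T[of x], where C=C])
    show "AE \<xi> in circle_measure. cmod (m' \<xi> * ?f \<xi>) \<le> C * cmod (?f \<xi>)"
      using AE_circle by eventually_elim (simp add: m'1 norm_mult mult_right_mono bd)
  qed measurable
  have "AE \<xi> in circle_measure. boundary_fun (l2_fun y) \<xi> = m' \<xi> * ?f \<xi>"
  proof (rule boundary_unique[OF g])
    let ?d = "\<lambda>r::real. LINT \<xi>|circle_measure. (cmod (l2_fun x (of_real r * \<xi>) - ?f \<xi>))\<^sup>2"
    let ?F = "LINT \<xi>|circle_measure. (cmod (?f \<xi>))\<^sup>2"
    show "((\<lambda>r::real. LINT \<xi>|circle_measure. (cmod (l2_fun y (of_real r * \<xi>) - m' \<xi> * ?f \<xi>))\<^sup>2) \<longlongrightarrow> 0) (at_left 1)"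
    proof (rule tendsto_sandwich[OF _ _ tendsto_const])
      have "((\<lambda>r. 2 * C\<^sup>2 * ?d r + 2 * K\<^sup>2 * (1 - r)\<^sup>2 * ?F) \<longlongrightarrow> 2 * C\<^sup>2 * 0 + 2 * K\<^sup>2 * (1 - 1)\<^sup>2 * ?F) (at_left 1)"
        by (intro tendsto_intros boundary_limit)
      then show "((\<lambda>r. 2 * C\<^sup>2 * ?d r + 2 * K\<^sup>2 * (1 - r)\<^sup>2 * ?F) \<longlongrightarrow> 0) (at_left 1)" by simp
      show "\<forall>\<^sub>F r in at_left 1. (LINT \<xi>|circle_measure. (cmod (l2_fun y (of_real r * \<xi>) - m' \<xi> * ?f \<xi>))\<^sup>2)
          \<le> 2 * C\<^sup>2 * ?d r + 2 * K\<^sup>2 * (1 - r)\<^sup>2 * ?F"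
        using eventually_at_left_1
      proof eventually_elim
        case (elim r)
        have i1: "integrable circle_measure (\<lambda>\<xi>. (cmod (l2_fun x (of_real r * \<xi>) - ?f \<xi>))\<^sup>2)"
          using elim by (intro L2T_integrable L2T_diff dilation_L2T boundary_L2T) auto
        have i2: "integrable circle_measure (\<lambda>\<xi>. (cmod (?f \<xi>))\<^sup>2)" by (intro L2T_integrable boundary_L2T)
        have "(LINT \<xi>|circle_measure. (cmod (l2_fun y (of_real r * \<xi>) - m' \<xi> * ?f \<xi>))\<^sup>2)
           \<le> (LINT \<xi>|circle_measure. 2 * C\<^sup>2 * (cmod (l2_fun x (of_real r * \<xi>) - ?f \<xi>))\<^sup>2 + 2 * K\<^sup>2 * (1 - r)\<^sup>2 * (cmod (?f \<xi>))\<^sup>2)"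
        proof (rule integral_mono_AE)
          show "integrable circle_measure (\<lambda>\<xi>. (cmod (l2_fun y (of_real r * \<xi>) - m' \<xi> * ?f \<xi>))\<^sup>2)"
            using elim by (intro L2T_integrable L2T_diff dilation_L2T g) auto
          show "integrable circle_measure (\<lambda>\<xi>. 2 * C\<^sup>2 * (cmod (l2_fun x (of_real r * \<xi>) - ?f \<xi>))\<^sup>2 + 2 * K\<^sup>2 * (1 - r)\<^sup>2 * (cmod (?f \<xi>))\<^sup>2)"
            by (intro Bochner_Integration.integrable_add integrable_mult_right i1 i2)
          show "AE \<xi> in circle_measure. (cmod (l2_fun y (of_real r * \<xi>) - m' \<xi> * ?f \<xi>))\<^sup>2
            \<le> 2 * C\<^sup>2 * (cmod (l2_fun x (of_real r * \<xi>) - ?f \<xi>))\<^sup>2 + 2 * K\<^sup>2 * (1 - r)\<^sup>2 * (cmod (?f \<xi>))\<^sup>2"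
            using AE_circle
          proof eventually_elim
            case \<xi>: (elim \<xi>)
            let ?z = "of_real r * \<xi>"
            have z: "cmod ?z < 1" using elim \<xi> by (simp add: norm_mult)
            have "?z - \<xi> = of_real (r - 1) * \<xi>" by (simp add: algebra_simps)
            then have dz: "cmod (?z - \<xi>) = 1 - r" using elim \<xi> by (simp only: norm_mult norm_of_real) simp
            have "l2_fun y ?z - m' \<xi> * ?f \<xi> = m ?z * (l2_fun x ?z - ?f \<xi>) + (m ?z - m \<xi>) * ?f \<xi>"
              unfolding eq[OF z] m'1[OF \<xi>] by (simp add: algebra_simps)
            then have "(cmod (l2_fun y ?z - m' \<xi> * ?f \<xi>))\<^sup>2
               \<le> 2 * (cmod (m ?z * (l2_fun x ?z - ?f \<xi>)))\<^sup>2 + 2 * (cmod ((m ?z - m \<xi>) * ?f \<xi>))\<^sup>2"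
              by (simp only: cmod_add_square_le)
            also have "\<dots> \<le> 2 * (C * cmod (l2_fun x ?z - ?f \<xi>))\<^sup>2 + 2 * ((K * (1 - r)) * cmod (?f \<xi>))\<^sup>2"
              unfolding norm_mult using bd[of ?z] K[of ?z \<xi>] z \<xi> dz
              by (intro add_mono mult_left_mono power_mono mult_right_mono mult_nonneg_nonneg) auto
            finally show ?case by (simp add: power_mult_distrib)
          qed
        qed
        also have "\<dots> = 2 * C\<^sup>2 * ?d r + 2 * K\<^sup>2 * (1 - r)\<^sup>2 * ?F"
          by (subst Bochner_Integration.integral_add) (auto intro!: i1 i2 integrable_mult_right)
        finally show ?case .
      qed
    qed simp
  qed
  then show ?thesis using AE_circle by eventually_elim (simp add: m'1)
qed

section \<open>The projection onto H2 and Toeplitz operators\<close>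

lemma P_plus_eqI:
  assumes G: "G \<in> L2T"
    and eq: "\<And>k. (LINT \<xi>|circle_measure. G \<xi> * cnj (boundary_fun (l2_fun k) \<xi>)) = cinner h k"
  shows "P_plus G = l2_fun h"
proof -
  have split: "(LINT \<xi>|circle_measure. (G \<xi> - boundary_fun (l2_fun y) \<xi>) * cnj (boundary_fun (l2_fun k) \<xi>))
      = cinner h k - cinner y k" for y k
    unfolding left_diff_distrib
    by (subst Bochner_Integration.integral_diff)
       (auto intro!: L2T_prod_integrable G boundary_L2T simp: eq boundary_cinner)
  show ?thesis
    unfolding P_plus_def H2_eq_range
  proof (rule the_equality)
    show "l2_fun h \<in> range l2_fun \<and> (\<forall>k\<in>range l2_fun. (LINT \<xi>|circle_measure. (G \<xi> - boundary_fun (l2_fun h) \<xi>) * cnj (boundary_fun k \<xi>)) = 0)"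
      by (auto simp: split)
  next
    fix f assume f: "f \<in> range l2_fun \<and> (\<forall>k\<in>range l2_fun. (LINT \<xi>|circle_measure. (G \<xi> - boundary_fun f \<xi>) * cnj (boundary_fun k \<xi>)) = 0)"
    then obtain y where y: "f = l2_fun y" by blast
    have "cinner h k = cinner y k" for k using f split[of y k] by (auto simp: y)
    then have "cinner (h - y) (h - y) = 0" by (simp add: cinner_diff_left)
    then show "f = l2_fun h" by (simp add: cinner_self y)
  qed
qed

text \<open>The symbol \<psi> is any Borel representative of the boundary values of m, since
  \<open>boundary_fun b\<close> is known only up to null sets. The projection does nothing to an
  analytic product; for the conjugate symbol the factor moves to the other side of the pairing,
  which is the action of the adjoint.\<close>

lemma toeplitz_multiplier:
  assumes K: "\<And>z w. cmod z \<le> 1 \<Longrightarrow> cmod w \<le> 1 \<Longrightarrow> cmod (m z - m w) \<le> K * cmod (z - w)"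
    and bd: "\<And>z. cmod z \<le> 1 \<Longrightarrow> cmod (m z) \<le> C"
    and M: "\<And>x z. cmod z < 1 \<Longrightarrow> l2_fun (M x) z = m z * l2_fun x z"
    and adj: "\<And>x y. cinner (M x) y = cinner x (M' y)"
    and \<psi>: "\<psi> \<in> borel_measurable borel" "AE \<xi> in circle_measure. \<psi> \<xi> = m \<xi>"
  shows "toeplitz \<psi> (l2_fun x) = l2_fun (M x)"
    and "toeplitz (\<lambda>\<xi>. cnj (\<psi> \<xi>)) (l2_fun x) = l2_fun (M' x)"
proof -
  note [measurable] = \<psi>(1) L2T_measurable[OF boundary_L2T]
  have bM: "AE \<xi> in circle_measure. boundary_fun (l2_fun (M y)) \<xi> = \<psi> \<xi> * boundary_fun (l2_fun y) \<xi>" for y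
  proof -
    have "AE \<xi> in circle_measure. boundary_fun (l2_fun (M y)) \<xi> = m \<xi> * boundary_fun (l2_fun y) \<xi>"
      by (rule boundary_mult[OF K bd M])
    then show ?thesis using \<psi>(2) by eventually_elim simp
  qed
  have L: "(\<lambda>\<xi>. \<psi> \<xi> * boundary_fun (l2_fun x) \<xi>) \<in> L2T"
    by (rule L2T_bound[OF boundary_L2T[of "M x"], where C=1])
       (use bM[of x] in \<open>auto elim!: eventually_mono\<close>)
  have L': "(\<lambda>\<xi>. cnj (\<psi> \<xi>) * boundary_fun (l2_fun x) \<xi>) \<in> L2T"
    by (rule L2T_bound[OF boundary_L2T[of "M x"], where C=1])
       (use bM[of x] in \<open>auto elim!: eventually_mono simp: norm_mult\<close>)
  show "toeplitz \<psi> (l2_fun x) = l2_fun (M x)"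
    unfolding toeplitz_def
  proof (rule P_plus_eqI[OF L])
    fix k
    have "(LINT \<xi>|circle_measure. \<psi> \<xi> * boundary_fun (l2_fun x) \<xi> * cnj (boundary_fun (l2_fun k) \<xi>))
        = (LINT \<xi>|circle_measure. boundary_fun (l2_fun (M x)) \<xi> * cnj (boundary_fun (l2_fun k) \<xi>))"
      by (rule integral_cong_AE) (use bM[of x] in \<open>auto elim!: eventually_mono\<close>)
    then show "(LINT \<xi>|circle_measure. \<psi> \<xi> * boundary_fun (l2_fun x) \<xi> * cnj (boundary_fun (l2_fun k) \<xi>)) = cinner (M x) k"
      by (simp add: boundary_cinner)
  qed
  show "toeplitz (\<lambda>\<xi>. cnj (\<psi> \<xi>)) (l2_fun x) = l2_fun (M' x)"
    unfolding toeplitz_def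
  proof (rule P_plus_eqI[OF L'])
    fix k
    have "(LINT \<xi>|circle_measure. cnj (\<psi> \<xi>) * boundary_fun (l2_fun x) \<xi> * cnj (boundary_fun (l2_fun k) \<xi>))
        = (LINT \<xi>|circle_measure. boundary_fun (l2_fun x) \<xi> * cnj (boundary_fun (l2_fun (M k)) \<xi>))"
      by (rule integral_cong_AE) (use bM[of k] in \<open>auto elim!: eventually_mono\<close>)
    also have "\<dots> = cinner x (M k)" by (rule boundary_cinner)
    also have "\<dots> = cinner (M' x) k"
      using adj[of k x] cinner_commute[of x "M k"] cinner_commute[of "M' x" k] by simp
    finally show "(LINT \<xi>|circle_measure. cnj (\<psi> \<xi>) * boundary_fun (l2_fun x) \<xi> * cnj (boundary_fun (l2_fun k) \<xi>)) = cinner (M' x) k" .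
  qed
qed

section \<open>The space of the explicit symbol\<close>

text \<open>Polarisation: positivity makes the complex form <s x, x> real for all x, and over
  complex scalars this forces symmetry. \<open>bounded_positive_op\<close> does not state symmetry,
  so a competing square root gets it from here.\<close>

lemma symmetric_of_complex_positive:
  assumes add: "\<And>x y. s (x + y) = s x + s y" and scale: "\<And>a x. s (cscale a x) = cscale a (s x)"
    and pos: "\<And>x. cinner (s x) x \<in> \<real>\<^sub>\<ge>\<^sub>0"
  shows "s x \<bullet> y = x \<bullet> s y"
proof -
  have im: "s x \<bullet> cscale \<i> x = 0" for x
    using pos[of x] by (simp add: Im_cinner[symmetric] complex_nonneg_Reals_iff)
  have cross: "s x \<bullet> cscale \<i> y + s y \<bullet> cscale \<i> x = 0" for x y
    using im[of "x + y"] im[of x] im[of y] by (simp add: add cscale_add inner_add_left inner_add_right)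
  \<comment> \<open>Replacing y by - \<i> y turns the statement \<open>cross\<close> about imaginary
    parts into the one about real parts.\<close>
  let ?w = "cscale (- \<i>) y"
  have "cscale \<i> ?w = y" by (rule l2_eqI) simp
  moreover have "s ?w \<bullet> cscale \<i> x = - (s y \<bullet> x)"
  proof -
    have "s ?w \<bullet> cscale \<i> x = s y \<bullet> cscale \<i> (cscale \<i> x)" by (simp only: scale cscale_inner complex_cnj_minus complex_cnj_i minus_minus)
    also have "cscale \<i> (cscale \<i> x) = - x" by (rule l2_eqI) simp
    finally show ?thesis by simp
  qed
  ultimately have "s x \<bullet> y = s y \<bullet> x" using cross[of x ?w] by simp
  then show ?thesis by (simp add: inner_commute)
qed

text \<open>For complex-linear s, symmetry with respect to the real inner product makes s x
  \<bullet> \<i> x equal to its own negative, so the complex pairing is real.\<close>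

lemma nonneg_cinner_of_symmetric:
  assumes scale: "\<And>a x. s (cscale a x) = cscale a (s x)"
    and sym: "\<And>x y. s x \<bullet> y = x \<bullet> s y" and pos: "\<And>x. s x \<bullet> x \<ge> 0"
  shows "cinner (s x) x \<in> \<real>\<^sub>\<ge>\<^sub>0"
proof -
  have "s x \<bullet> cscale \<i> x = x \<bullet> cscale \<i> (s x)" by (simp add: sym scale)
  also have "\<dots> = cscale \<i> (s x) \<bullet> x" by (rule inner_commute)
  also have "\<dots> = s x \<bullet> cscale (- \<i>) x" by (simp add: cscale_inner)
  also have "cscale (- \<i>) x = - cscale \<i> x" by (rule l2_eqI) simp
  finally have "s x \<bullet> cscale \<i> x = 0" by simp
  then show ?thesis using pos[of x] by (simp add: complex_nonneg_Reals_iff Re_cinner Im_cinner)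
qed

lemma l2_fun_unit_0: "cmod z < 1 \<Longrightarrow> l2_fun (unit_l2 0) z = 1"
proof -
  assume z: "cmod z < 1"
  have "(\<lambda>n. coef (unit_l2 0) n * z ^ n) = (\<lambda>n. if n = 0 then z ^ n else 0)"
    by (rule ext) (simp add: coef_unit_l2)
  then have "(\<lambda>n. if n = 0 then z ^ n else 0) sums l2_fun (unit_l2 0) z"
    using l2_fun_sums[OF z, of "unit_l2 0"] by (simp only:)
  then show ?thesis using sums_single[of 0 "\<lambda>n. z ^ n"] by (auto dest: sums_unique2)
qed

lemma boundary_unit_0: "AE \<xi> in circle_measure. boundary_fun (l2_fun (unit_l2 0)) \<xi> = 1"
proof (rule boundary_unique)
  show "(\<lambda>\<xi>. 1) \<in> L2T" by (rule L2T_bounded[where C=1]) auto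
  have "\<forall>\<^sub>F r in at_left (1::real). (LINT \<xi>|circle_measure. (cmod (l2_fun (unit_l2 0) (of_real r * \<xi>) - 1))\<^sup>2) = 0"
    using eventually_at_left_1
  proof eventually_elim
    case (elim r)
    have "(LINT \<xi>|circle_measure. (cmod (l2_fun (unit_l2 0) (of_real r * \<xi>) - 1))\<^sup>2) = (LINT \<xi>|circle_measure. 0)"
    proof (rule integral_cong_AE)
      show "AE \<xi> in circle_measure. (cmod (l2_fun (unit_l2 0) (of_real r * \<xi>) - 1))\<^sup>2 = 0"
        using AE_circle by eventually_elim (use elim in \<open>simp add: l2_fun_unit_0 norm_mult\<close>)
    qed measurable
    then show ?case by simp
  qed
  then show "((\<lambda>r. LINT \<xi>|circle_measure. (cmod (l2_fun (unit_l2 0) (of_real r * \<xi>) - 1))\<^sup>2) \<longlongrightarrow> 0) (at_left (1::real))"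
    by (rule tendsto_eventually)
qed

text \<open>S, transported to H2, satisfies the definite description. A competitor s has X = I - s
  s, so s commutes with X, hence with S by \<open>com\<close>; thus the uniqueness of commuting
  positive roots applies.\<close>

lemma op_sqrt_eqI:
  assumes S: "bounded_linear S" "\<And>x y. S x \<bullet> y = x \<bullet> S y" "\<And>x. S x \<bullet> x \<ge> 0"
    and X: "\<And>x. S (S x) = x - X x"
    and com: "\<And>T x. bounded_linear T \<Longrightarrow> (\<And>x. T (X x) = X (T x)) \<Longrightarrow> S (T x) = T (S x)"
    and scale: "\<And>a x. cscale a (X x) = X (cscale a x)"
    and A: "\<And>x. A (l2_fun x) = l2_fun (x - X x)"
  shows "op_sqrt A (l2_fun x) = l2_fun (S x)"
proof -
  interpret S: bounded_linear S by fact
  have Sscale: "S (cscale a x) = cscale a (S x)" for a x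
    by (rule com[OF bounded_linear_cscale scale])
  define Sop where "Sop f = (if f \<in> H2 then l2_fun (S (inv l2_fun f)) else (\<lambda>z. 0))" for f
  have inj: "inj l2_fun" by (rule injI) (simp add: l2_fun_inject)
  have Sop: "Sop (l2_fun x) = l2_fun (S x)" for x
    by (simp add: Sop_def l2_fun_in_H2 inj)
  have comb: "(\<lambda>z. c * l2_fun u z + d * l2_fun v z) = l2_fun (cscale c u + cscale d v)" for c d u v
    by (rule ext) (simp add: l2_fun_add l2_fun_cscale)
  have "op_sqrt A = Sop"
    unfolding op_sqrt_def
  proof (rule the_equality)
    have "bounded_positive_op Sop"
      unfolding bounded_positive_op_def H2_eq_range
    proof (intro conjI ballI allI)
      show "Sop f \<in> range l2_fun" if "f \<in> range l2_fun" for f using that by (auto simp: Sop)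
      show "Sop (\<lambda>z. c * f z + d * g z) = (\<lambda>z. c * Sop f z + d * Sop g z)"
        if "f \<in> range l2_fun" "g \<in> range l2_fun" for f g c d
        using that by (auto simp: Sop comb S.add Sscale)
      show "\<exists>C. \<forall>f\<in>range l2_fun. H2_norm (Sop f) \<le> C * H2_norm f"
        by (rule exI[of _ "onorm S"]) (auto simp: Sop H2_norm_l2_fun intro: onorm S.bounded_linear_axioms)
      show "H2_inner (Sop f) f \<in> \<real>\<^sub>\<ge>\<^sub>0" if "f \<in> range l2_fun" for f
        using that nonneg_cinner_of_symmetric[of S, OF Sscale S(2,3)] by (auto simp: Sop H2_inner_l2_fun)
    qed
    then show "bounded_positive_op Sop \<and> (\<forall>f\<in>H2. Sop (Sop f) = A f) \<and> (\<forall>f. f \<notin> H2 \<longrightarrow> Sop f = (\<lambda>z. 0))"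
    proof (intro conjI ballI allI impI)
      show "Sop (Sop f) = A f" if "f \<in> H2" for f
        using that unfolding H2_eq_range by (auto simp: Sop A X)
      show "Sop f = (\<lambda>z. 0)" if "f \<notin> H2" for f using that by (simp add: Sop_def)
    qed
  next
    fix S' assume S': "bounded_positive_op S' \<and> (\<forall>f\<in>H2. S' (S' f) = A f) \<and> (\<forall>f. f \<notin> H2 \<longrightarrow> S' f = (\<lambda>z. 0))"
    have S'1: "\<And>f. f \<in> H2 \<Longrightarrow> S' f \<in> H2"
      and S'2: "\<And>f g c d. f \<in> H2 \<Longrightarrow> g \<in> H2 \<Longrightarrow> S' (\<lambda>z. c * f z + d * g z) = (\<lambda>z. c * S' f z + d * S' g z)"
      and S'3: "\<exists>C. \<forall>f\<in>H2. H2_norm (S' f) \<le> C * H2_norm f"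
      and S'4: "\<And>f. f \<in> H2 \<Longrightarrow> H2_inner (S' f) f \<in> \<real>\<^sub>\<ge>\<^sub>0"
      and S'5: "\<And>f. f \<in> H2 \<Longrightarrow> S' (S' f) = A f" and S'6: "\<And>f. f \<notin> H2 \<Longrightarrow> S' f = (\<lambda>z. 0)"
      using S' by (simp_all add: bounded_positive_op_def)
    have "\<exists>y. S' (l2_fun x) = l2_fun y" for x
      using S'1[OF l2_fun_in_H2, of x] unfolding H2_eq_range by auto
    then obtain s where s: "\<And>x. S' (l2_fun x) = l2_fun (s x)" by metis
    have scomb: "s (cscale c u + cscale d v) = cscale c (s u) + cscale d (s v)" for c d u v
    proof -
      have "S' (\<lambda>z. c * l2_fun u z + d * l2_fun v z) = (\<lambda>z. c * S' (l2_fun u) z + d * S' (l2_fun v) z)"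
        by (rule S'2[OF l2_fun_in_H2 l2_fun_in_H2])
      then show ?thesis by (simp add: s comb l2_fun_inject)
    qed
    have c1: "cscale 1 u = u" and c0: "cscale 0 u = 0" for u by (auto intro: l2_eqI)
    have sadd: "s (u + v) = s u + s v" for u v using scomb[of 1 u 1 v] by (simp add: c1)
    have sscale: "s (cscale c u) = cscale c (s u)" for c u using scomb[of c u 0 u] by (simp add: c0)
    have pos: "cinner (s u) u \<in> \<real>\<^sub>\<ge>\<^sub>0" for u
      using S'4[OF l2_fun_in_H2, of u] by (simp add: H2_inner_l2_fun s)
    obtain C where C: "\<And>f. f \<in> H2 \<Longrightarrow> H2_norm (S' f) \<le> C * H2_norm f"
      using S'3 by blast
    have blin: "bounded_linear s"
    proof (rule bounded_linear_intro[where K=C])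
      show "s (r *\<^sub>R u) = r *\<^sub>R s u" for r u using sscale[of "of_real r" u] by (simp add: cscale_of_real)
      show "norm (s u) \<le> norm u * C" for u
        using C[OF l2_fun_in_H2, of u] by (simp add: s H2_norm_l2_fun mult.commute)
    qed (rule sadd)
    have sym: "s u \<bullet> v = u \<bullet> s v" for u v by (rule symmetric_of_complex_positive[OF sadd sscale pos])
    have nonneg: "s u \<bullet> u \<ge> 0" for u using pos[of u] by (simp add: complex_nonneg_Reals_iff Re_cinner)
    have sq: "s (s u) = u - X u" for u
    proof -
      have "S' (S' (l2_fun u)) = A (l2_fun u)" by (rule S'5[OF l2_fun_in_H2])
      then show ?thesis by (simp add: s A l2_fun_inject)
    qed
    have "s (X u) = X (s u)" for u
    proof -
      have "s (u - X u) = s u - X (s u)" using sq[of "s u"] sq[of u] by simp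
      then show ?thesis using bounded_linear.linear[OF blin] by (simp add: linear_diff)
    qed
    then have "S (s u) = s (S u)" for u by (rule com[OF blin])
    moreover have "S (S u) = s (s u)" for u by (simp only: sq X)
    ultimately have "S = s"
      by (intro positive_sqrt_unique S(2,3) S.linear_axioms bounded_linear.linear[OF blin] sym nonneg)
    show "S' = Sop"
    proof
      fix f
      show "S' f = Sop f"
      proof (cases "f \<in> H2")
        case True
        then obtain x where "f = l2_fun x" unfolding H2_eq_range by blast
        then show ?thesis using \<open>S = s\<close> by (simp add: s Sop)
      next
        case False
        then show ?thesis by (simp add: S'6 Sop_def)
      qed
    qed
  qed
  then show ?thesis by (simp add: Sop)
qed

text \<open>Multiplication by b is built on coefficient sequences from the inverse of 1 - \<beta>
  \<open>shift\<close>; boundary values only serve to recognise it and its adjoint as the two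
  Toeplitz operators. The defect operator is injective, so the preimage in \<open>dBR_norm\<close>
  is unique and its orthogonality condition is automatic.\<close>

lemma dBR_explicit:
  fixes \<zeta> \<beta> c :: complex and P :: real
  assumes \<zeta>: "cmod \<zeta> \<le> 1" and c: "cmod c = 1" and \<beta>: "cmod \<beta> < 1" and P: "P > 0"
    and P\<beta>: "P\<^sup>2 * (1 + \<beta> * cnj \<beta>) = 2 + \<zeta> * cnj \<zeta>" "P\<^sup>2 * \<beta> = cnj \<zeta>"
    and b: "b \<in> Hol" "\<And>z. cmod z < 1 \<Longrightarrow> b z = c * z / (P * (1 - \<beta> * z))"
  shows "dBR_space b = l2_fun ` fst ` quot_graph \<zeta>"
    and "(f, g) \<in> quot_graph \<zeta> \<Longrightarrow> dBR_norm b (l2_fun f) = sqrt ((norm f)\<^sup>2 + (norm g)\<^sup>2)"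
proof -
  define m where "m z = c * z / (P * (1 - \<beta> * z))" for z
  define \<delta> where "\<delta> = 1 - cmod \<beta>"
  have \<delta>: "\<delta> > 0" using \<beta> by (simp add: \<delta>_def)
  have low: "cmod (1 - \<beta> * z) \<ge> \<delta>" if "cmod z \<le> 1" for z
  proof -
    have "cmod \<beta> * cmod z \<le> cmod \<beta> * 1" using that by (intro mult_left_mono) auto
    then show ?thesis using norm_triangle_ineq2[of 1 "\<beta> * z"] by (simp add: norm_mult \<delta>_def)
  qed
  have nz: "1 - \<beta> * z \<noteq> 0" if "cmod z \<le> 1" for z using low[OF that] \<delta> by auto
  \<comment> \<open>The difference is c (z - w) / (P (1 - \<beta> z) (1 - \<beta> w)), and both
    linear factors are at least \<delta> in modulus on the closed disc.\<close>
  have mK: "cmod (m z - m w) \<le> (1 / (P * \<delta>\<^sup>2)) * cmod (z - w)" if "cmod z \<le> 1" "cmod w \<le> 1" for z w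
  proof -
    have "m z - m w = c * (z - w) / (P * ((1 - \<beta> * z) * (1 - \<beta> * w)))"
      using nz[OF that(1)] nz[OF that(2)] P by (simp add: m_def divide_simps) (simp add: algebra_simps)
    then have "cmod (m z - m w) = cmod (z - w) / (P * (cmod (1 - \<beta> * z) * cmod (1 - \<beta> * w)))"
      using P c by (simp add: norm_mult norm_divide)
    also have "\<dots> \<le> cmod (z - w) / (P * \<delta>\<^sup>2)"
      using low[OF that(1)] low[OF that(2)] P \<delta> unfolding power2_eq_square
      by (intro divide_left_mono mult_left_mono mult_mono mult_pos_pos) auto
    finally show ?thesis by simp
  qed
  have mC: "cmod (m z) \<le> 1 / (P * \<delta>)" if "cmod z \<le> 1" for z
  proof -
    have "cmod (m z) = cmod z / (P * cmod (1 - \<beta> * z))" using P c by (simp add: m_def norm_mult norm_divide)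
    also have "\<dots> \<le> 1 / (P * \<delta>)" using low[OF that] P \<delta> that by (intro frac_le mult_left_mono) auto
    finally show ?thesis .
  qed
  define T where "T x = cscale \<beta> (shift x)" for x
  have T: "bounded_linear T"
    unfolding T_def by (rule bounded_linear_compose[OF bounded_linear_cscale bounded_linear_shift])
  obtain R where R: "bounded_linear R" "\<And>x. R x - T (R x) = x"
    by (rule neumann_inverse[OF T, of "cmod \<beta>"]) (use \<beta> in \<open>auto simp: T_def norm_cscale norm_shift\<close>)
  define M where "M u = cscale (c / P) (shift (R u))" for u
  have M: "bounded_linear M"
    unfolding M_def
    by (rule bounded_linear_compose[OF bounded_linear_cscale bounded_linear_compose[OF bounded_linear_shift R(1)]])
  have Rz: "(1 - \<beta> * z) * l2_fun (R u) z = l2_fun u z" for u z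
  proof -
    have "l2_fun (R u - T (R u)) z = l2_fun u z" by (simp only: R(2))
    then show ?thesis by (simp add: T_def l2_fun_diff l2_fun_cscale l2_fun_shift algebra_simps)
  qed
  have Mz: "l2_fun (M u) z = m z * l2_fun u z" if "cmod z < 1" for u z
  proof -
    have "l2_fun (M u) z = c / P * (z * l2_fun (R u) z)" by (simp add: M_def l2_fun_cscale l2_fun_shift)
    also have "\<dots> = m z * ((1 - \<beta> * z) * l2_fun (R u) z)" using nz[of z] that by (simp add: m_def)
    finally show ?thesis by (simp only: Rz)
  qed
  have Meq: "M u - cscale \<beta> (shift (M u)) = cscale (c / P) (shift u)" for u
  proof (rule l2_fun_eqI)
    fix z :: complex assume z: "cmod z < 1"
    then show "l2_fun (M u - cscale \<beta> (shift (M u))) z = l2_fun (cscale (c / P) (shift u)) z"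
      using nz[of z] P by (simp add: l2_fun_diff l2_fun_cscale l2_fun_shift Mz m_def divide_simps) (simp add: algebra_simps)
  qed
  obtain M' where M': "bounded_linear M'" "\<And>x y. M x \<bullet> y = x \<bullet> M' y"
    using adjoint_exists[OF M] by metis
  have Mscale: "M (cscale a x) = cscale a (M x)" for a x
    by (rule l2_fun_eqI) (simp add: Mz l2_fun_cscale)
  have M'scale: "M' (cscale a y) = cscale a (M' y)" for a y
  proof (rule vector_eq_ldot[THEN iffD1, OF allI])
    fix x
    have "x \<bullet> M' (cscale a y) = M x \<bullet> cscale a y" by (simp add: M')
    also have "\<dots> = M (cscale (cnj a) x) \<bullet> y" by (simp add: Mscale cscale_inner)
    also have "\<dots> = x \<bullet> cscale a (M' y)" by (simp add: M' cscale_inner)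
    finally show "x \<bullet> M' (cscale a y) = x \<bullet> cscale a (M' y)" .
  qed
  have cadj: "cinner (M x) y = cinner x (M' y)" for x y
    by (simp add: cinner_eq_iff M' M'scale)
  obtain S where S: "bounded_linear S" "\<And>x y. S x \<bullet> y = x \<bullet> S y" "\<And>x. S x \<bullet> x \<ge> 0"
    "\<And>x. S (S x) = x - M (M' x)"
    "\<And>T x. bounded_linear T \<Longrightarrow> (\<And>x. T (M (M' x)) = M (M' (T x))) \<Longrightarrow> S (T x) = T (S x)"
    "inj S" "range S = fst ` quot_graph \<zeta>"
    "\<And>x g. (S x, g) \<in> quot_graph \<zeta> \<Longrightarrow> (norm x)\<^sup>2 = (norm (S x))\<^sup>2 + (norm g)\<^sup>2"
  proof (rule defect_sqrt_range[OF \<zeta> c \<beta> P P\<beta> M M' Meq])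
    fix S assume a: "bounded_linear S" "\<And>x y. S x \<bullet> y = x \<bullet> S y" "\<And>x. S x \<bullet> x \<ge> 0"
      "\<And>x. S (S x) = x - M (M' x)"
      "\<And>T x. bounded_linear T \<Longrightarrow> (\<And>x. T (M (M' x)) = M (M' (T x))) \<Longrightarrow> S (T x) = T (S x)"
      "inj S" "range S = fst ` quot_graph \<zeta>"
      "\<And>x g. (S x, g) \<in> quot_graph \<zeta> \<Longrightarrow> (norm x)\<^sup>2 = (norm (S x))\<^sup>2 + (norm g)\<^sup>2"
    show thesis
    proof (rule that[OF a(1,2,3,4)])
      show "S (T x) = T (S x)" if "bounded_linear T" "\<And>x. T (M (M' x)) = M (M' (T x))" for T x
        using that by (rule a(5))
    qed (rule a(6,7,8) | assumption)+
  qed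
  \<comment> \<open>As the image of the constant 1 under M, b inherits the boundary values m from
    \<open>boundary_mult\<close>.\<close>
  have b1: "b = l2_fun (M (unit_l2 0))"
    by (rule Hol_eqI[OF b(1) l2_fun_Hol]) (simp add: b Mz l2_fun_unit_0 m_def)
  have bb: "boundary_fun b \<in> borel_measurable borel" unfolding b1 by (rule L2T_measurable[OF boundary_L2T])
  have bm: "AE \<xi> in circle_measure. boundary_fun b \<xi> = m \<xi>"
  proof -
    have "AE \<xi> in circle_measure. boundary_fun b \<xi> = m \<xi> * boundary_fun (l2_fun (unit_l2 0)) \<xi>"
      unfolding b1 by (rule boundary_mult[OF mK mC Mz])
    then show ?thesis using boundary_unit_0 by eventually_elim simp
  qed
  note toep = toeplitz_multiplier[OF mK mC Mz cadj bb bm]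
  have D: "defect_op b (l2_fun x) = l2_fun (S x)" for x
    unfolding defect_op_def
    by (rule op_sqrt_eqI[OF S(1-5)]) (auto simp: Mscale M'scale toep l2_fun_diff)
  show sp: "dBR_space b = l2_fun ` fst ` quot_graph \<zeta>"
    unfolding dBR_space_def H2_eq_range S(7)[symmetric] by (simp only: image_image D)
  show "dBR_norm b (l2_fun f) = sqrt ((norm f)\<^sup>2 + (norm g)\<^sup>2)" if fg: "(f, g) \<in> quot_graph \<zeta>"
  proof -
    have "f \<in> range S" unfolding S(7) using fg by force
    then obtain x where x: "f = S x" by blast
    have S0: "S k = 0 \<Longrightarrow> k = 0" for k
      using injD[OF S(6), of k 0] linear_0[OF bounded_linear.linear[OF S(1)]] by simp
    have "(THE h. h \<in> H2 \<and> defect_op b h = l2_fun f \<and> (\<forall>k\<in>H2. defect_op b k = (\<lambda>z. 0) \<longrightarrow> H2_inner h k = 0)) = l2_fun x"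
    proof (rule the_equality)
      have "H2_inner (l2_fun x) k = 0" if kH: "k \<in> H2" and kz: "defect_op b k = (\<lambda>z. 0)" for k
      proof -
        obtain y where y: "k = l2_fun y" using kH by (auto simp: H2_eq_range)
        then have "l2_fun (S y) = l2_fun 0" using kz by (simp add: D l2_fun_zero)
        then have "y = 0" using S0 by (simp only: l2_fun_inject)
        then show ?thesis by (simp add: y H2_inner_l2_fun cinner_def)
      qed
      then show "l2_fun x \<in> H2 \<and> defect_op b (l2_fun x) = l2_fun f \<and> (\<forall>k\<in>H2. defect_op b k = (\<lambda>z. 0) \<longrightarrow> H2_inner (l2_fun x) k = 0)"
        by (simp add: l2_fun_in_H2 D x)
    next
      fix h assume h: "h \<in> H2 \<and> defect_op b h = l2_fun f \<and> (\<forall>k\<in>H2. defect_op b k = (\<lambda>z. 0) \<longrightarrow> H2_inner h k = 0)"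
      then obtain y where y: "h = l2_fun y" by (auto simp: H2_eq_range)
      then have "S y = S x" using h by (simp add: D x l2_fun_inject)
      then show "h = l2_fun x" using y injD[OF S(6), of y x] by simp
    qed
    then have "dBR_norm b (l2_fun f) = norm x" by (simp add: dBR_norm_def H2_norm_l2_fun)
    also have "\<dots> = sqrt ((norm f)\<^sup>2 + (norm g)\<^sup>2)"
      using S(8)[of x g] fg by (simp add: x real_sqrt_unique)
    finally show ?thesis .
  qed
qed

section \<open>Herglotz integrals and pairs\<close>

text \<open>The term for n = 0 is 1 / 0 = 0, so the sum may start at 0. The same convention is used
  in all logarithmic series below.\<close>

lemma Ln_one_minus_sums: "cmod w < 1 \<Longrightarrow> (\<lambda>n. - (w ^ n / of_nat n)) sums Ln (1 - w)"
proof -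
  assume "cmod w < 1"
  then have "(\<lambda>n. (- 1) ^ Suc n / of_nat n * (- w) ^ n) sums Ln (1 + (- w))" by (intro Ln_series) simp
  moreover have "(- 1) ^ Suc n / of_nat n * (- w) ^ n = - (w ^ n / of_nat n)" for n
  proof -
    have "(- 1) ^ n * (- 1) ^ n = (1 :: complex)" by (simp add: power_mult_distrib[symmetric])
    then have "(- 1) ^ Suc n / of_nat n * ((- 1) ^ n * w ^ n) = - (w ^ n / of_nat n)"
      by (simp add: mult.assoc[symmetric])
    then show ?thesis by (simp only: power_minus[of w n])
  qed
  ultimately have "(\<lambda>n. - (w ^ n / of_nat n)) sums Ln (1 + (- w))" by (simp only:)
  then show ?thesis by simp
qed

lemma log_coeff_summable:
  assumes "cmod \<eta> < 1" shows "summable (\<lambda>n. cmod (- (\<eta> ^ n / of_nat n)))"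
proof (rule summable_comparison_test'[where N=1 and g="\<lambda>n. cmod \<eta> ^ n"])
  show "summable (\<lambda>n. cmod \<eta> ^ n)" using assms by (simp add: summable_geometric)
  show "norm (cmod (- (\<eta> ^ n / of_nat n))) \<le> cmod \<eta> ^ n" if "n \<ge> 1" for n
  proof -
    have "cmod \<eta> ^ n / real n \<le> cmod \<eta> ^ n / 1" using that by (intro divide_left_mono) auto
    then show ?thesis by (simp add: norm_divide norm_power)
  qed
qed

lemma Re_pos_one_minus: "cmod w < 1 \<Longrightarrow> Re (1 - w) > 0"
  using abs_Re_le_cmod[of w] by simp

lemma ln_cmod_series:
  assumes "cmod \<eta> < 1" "cmod \<xi> = 1"
  shows "ln (cmod (1 - \<eta> * \<xi>)) = Re (\<Sum>n. - (\<eta> ^ n / of_nat n) * \<xi> ^ n)"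
proof -
  have "cmod (\<eta> * \<xi>) < 1" using assms by (simp add: norm_mult)
  then have "(\<lambda>n. - ((\<eta> * \<xi>) ^ n / of_nat n)) sums Ln (1 - \<eta> * \<xi>)" by (rule Ln_one_minus_sums)
  then have "(\<Sum>n. - (\<eta> ^ n / of_nat n) * \<xi> ^ n) = Ln (1 - \<eta> * \<xi>)"
    by (simp add: sums_iff power_mult_distrib)
  moreover have "1 - \<eta> * \<xi> \<noteq> 0" using \<open>cmod (\<eta> * \<xi>) < 1\<close> by auto
  ultimately show ?thesis by simp
qed

text \<open>Write ln |1 - \<eta> \<xi>| as (L + cnj L) / 2 with L the series of Ln (1 - \<eta>
  \<xi>). The product L H has mean 0 because L lacks a constant term, so only L paired with H by
  Parseval remains, whence the factor 1/2.\<close>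

lemma circle_integral_log_series:
  assumes \<eta>: "cmod \<eta> < 1" and h: "summable (\<lambda>n. cmod (h n))"
  shows "(LINT \<xi>|circle_measure. of_real (ln (cmod (1 - \<eta> * \<xi>))) * cnj (\<Sum>n. h n * \<xi> ^ n))
       = (\<Sum>n. - (\<eta> ^ n / of_nat n) * cnj (h n)) / 2"
proof -
  define a where "a n = - (\<eta> ^ n / of_nat n)" for n
  have a: "summable (\<lambda>n. cmod (a n))" unfolding a_def by (rule log_coeff_summable[OF \<eta>])
  let ?L = "\<lambda>\<xi>. \<Sum>n. a n * \<xi> ^ n" and ?H = "\<lambda>\<xi>. \<Sum>n. h n * \<xi> ^ n"
  have bnd: "cmod (\<Sum>n. c n * \<xi> ^ n) \<le> (\<Sum>n. cmod (c n))"
    if "summable (\<lambda>n. cmod (c n))" "cmod \<xi> = 1" for c :: "nat \<Rightarrow> complex" and \<xi>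
    using summable_norm[of "\<lambda>n. c n * \<xi> ^ n"] that by (simp add: norm_mult norm_power)
  have "(LINT \<xi>|circle_measure. of_real (ln (cmod (1 - \<eta> * \<xi>))) * cnj (?H \<xi>))
     = (LINT \<xi>|circle_measure. (?L \<xi> * cnj (?H \<xi>)) / 2 + cnj (?L \<xi> * ?H \<xi>) / 2)"
  proof (rule integral_cong_AE)
    show "AE \<xi> in circle_measure. of_real (ln (cmod (1 - \<eta> * \<xi>))) * cnj (?H \<xi>) = (?L \<xi> * cnj (?H \<xi>)) / 2 + cnj (?L \<xi> * ?H \<xi>) / 2"
      using AE_circle
    proof eventually_elim
      case (elim \<xi>)
      have "complex_of_real (ln (cmod (1 - \<eta> * \<xi>))) = (?L \<xi> + cnj (?L \<xi>)) / 2"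
        unfolding ln_cmod_series[OF \<eta> elim] a_def by (simp add: complex_add_cnj)
      then show ?case by (simp only: complex_cnj_mult) (simp add: field_simps)
    qed
  qed measurable
  also have "\<dots> = (LINT \<xi>|circle_measure. (?L \<xi> * cnj (?H \<xi>)) / 2) + (LINT \<xi>|circle_measure. cnj (?L \<xi> * ?H \<xi>) / 2)"
  proof (rule Bochner_Integration.integral_add)
    have LH: "cmod (?L \<xi>) * cmod (?H \<xi>) / 2 \<le> (\<Sum>n. cmod (a n)) * (\<Sum>n. cmod (h n)) / 2" if "cmod \<xi> = 1" for \<xi>
      by (intro divide_right_mono mult_mono bnd a h that suminf_nonneg norm_ge_zero) simp
    show "integrable circle_measure (\<lambda>\<xi>. (?L \<xi> * cnj (?H \<xi>)) / 2)"
    proof (rule circle_integrable_bounded)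
      show "cmod ((?L \<xi> * cnj (?H \<xi>)) / 2) \<le> (\<Sum>n. cmod (a n)) * (\<Sum>n. cmod (h n)) / 2" if "cmod \<xi> = 1" for \<xi>
        using LH[OF that] by (simp only: norm_mult norm_divide complex_mod_cnj norm_numeral)
    qed measurable
    show "integrable circle_measure (\<lambda>\<xi>. cnj (?L \<xi> * ?H \<xi>) / 2)"
    proof (rule circle_integrable_bounded)
      show "cmod (cnj (?L \<xi> * ?H \<xi>) / 2) \<le> (\<Sum>n. cmod (a n)) * (\<Sum>n. cmod (h n)) / 2" if "cmod \<xi> = 1" for \<xi>
        using LH[OF that] by (simp only: norm_mult norm_divide complex_mod_cnj norm_numeral)
    qed measurable
  qed
  also have "(LINT \<xi>|circle_measure. (?L \<xi> * cnj (?H \<xi>)) / 2) = (\<Sum>n. a n * cnj (h n)) / 2"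
    using circle_parseval[OF a h] by (simp add: sums_iff)
  also have "(LINT \<xi>|circle_measure. cnj (?L \<xi> * ?H \<xi>) / 2) = cnj (LINT \<xi>|circle_measure. ?L \<xi> * ?H \<xi>) / 2"
  proof -
    have "(LINT \<xi>|circle_measure. cnj (?L \<xi> * ?H \<xi>)) = cnj (LINT \<xi>|circle_measure. ?L \<xi> * ?H \<xi>)"
      by (rule Bochner_Integration.integral_cnj)
    then show ?thesis by simp
  qed
  also have "(LINT \<xi>|circle_measure. ?L \<xi> * ?H \<xi>) = 0"
  proof -
    have "(\<lambda>n. a n * (LINT \<xi>|circle_measure. \<xi> ^ n * ?H \<xi>)) sums (LINT \<xi>|circle_measure. ?L \<xi> * ?H \<xi>)"
      by (rule circle_integral_series[OF a _ bnd[OF h]]) measurable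
    moreover have "a n * (LINT \<xi>|circle_measure. \<xi> ^ n * ?H \<xi>) = 0" for n
      using circle_integral_series_power[OF h, of n] by (cases "n = 0") (simp_all add: mult.commute a_def)
    ultimately show ?thesis by (simp add: sums_iff)
  qed
  finally show ?thesis by (simp add: a_def)
qed

text \<open>Fourier coefficients of the conjugate of the Herglotz kernel: on the circle (\<xi> + z)
  / (\<xi> - z) is 1 plus twice the sum over n \<ge> 1 of (z cnj \<xi>)^n.\<close>

definition herglotz_coeff :: "complex \<Rightarrow> nat \<Rightarrow> complex" where
  "herglotz_coeff z n = (if n = 0 then 1 else 2 * cnj z ^ n)"

lemma herglotz_coeff_summable: "cmod z < 1 \<Longrightarrow> summable (\<lambda>n. cmod (herglotz_coeff z n))"
  by (rule summable_comparison_test'[where N=0 and g="\<lambda>n. 2 * cmod z ^ n"])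
     (auto simp: herglotz_coeff_def norm_mult norm_power intro!: summable_mult summable_geometric)

lemma herglotz_kernel_series:
  assumes "cmod z < 1" "cmod \<xi> = 1"
  shows "cnj (\<Sum>n. herglotz_coeff z n * \<xi> ^ n) = (\<xi> + z) / (\<xi> - z)"
proof -
  let ?w = "cnj z * \<xi>"
  have w: "cmod ?w < 1" using assms by (simp add: norm_mult)
  have "(\<lambda>n. 2 * ?w ^ n - (if n = 0 then 1 else 0)) sums (2 * (1 / (1 - ?w)) - 1)"
    using sums_single[of 0 "\<lambda>_. 1 :: complex"] by (intro sums_diff sums_mult geometric_sums w) simp
  moreover have "2 * ?w ^ n - (if n = 0 then 1 else 0) = herglotz_coeff z n * \<xi> ^ n" for n
    by (simp add: herglotz_coeff_def power_mult_distrib)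
  ultimately have "(\<Sum>n. herglotz_coeff z n * \<xi> ^ n) = 2 * (1 / (1 - ?w)) - 1" by (simp add: sums_iff)
  moreover have "cnj (2 * (1 / (1 - ?w)) - 1) = (\<xi> + z) / (\<xi> - z)"
  proof -
    have u: "\<xi> * cnj \<xi> = 1" using complex_norm_square[of \<xi>] assms(2) by simp
    have nz: "\<xi> \<noteq> z" using assms by auto
    have "cmod (z * cnj \<xi>) < 1" using assms by (simp add: norm_mult)
    then have nz2: "1 - z * cnj \<xi> \<noteq> 0" by auto
    have "\<xi> * (1 - z * cnj \<xi>) = \<xi> - z * (\<xi> * cnj \<xi>)" by (simp add: algebra_simps)
    then have "1 * (\<xi> - z) = \<xi> * (1 - z * cnj \<xi>)" by (simp add: u)
    then have "1 / (1 - z * cnj \<xi>) = \<xi> / (\<xi> - z)" using nz nz2 by (subst frac_eq_eq) auto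
    then have "2 * (1 / (1 - z * cnj \<xi>)) - 1 = 2 * (\<xi> / (\<xi> - z)) - 1" by (simp only:)
    moreover have "cnj (2 * (1 / (1 - ?w)) - 1) = 2 * (1 / (1 - z * cnj \<xi>)) - 1" by simp
    ultimately have "cnj (2 * (1 / (1 - ?w)) - 1) = 2 * (\<xi> / (\<xi> - z)) - 1" by (simp only:)
    also have "\<dots> = (\<xi> + z) / (\<xi> - z)" using nz by (simp add: field_simps)
    finally show ?thesis .
  qed
  ultimately show ?thesis by simp
qed

lemma herglotz_kernel_measurable [measurable]: "(\<lambda>\<xi>. (\<xi> + z) / (\<xi> - z) :: complex) \<in> borel_measurable borel"
  by measurable

lemma herglotz_kernel_bound:
  assumes "cmod z < 1" "cmod \<xi> = 1" shows "cmod ((\<xi> + z) / (\<xi> - z)) \<le> 2 / (1 - cmod z)"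
proof -
  have "cmod (\<xi> + z) \<le> 2" using norm_triangle_ineq[of \<xi> z] assms by simp
  moreover have "1 - cmod z \<le> cmod (\<xi> - z)" using norm_triangle_ineq2[of \<xi> z] assms by simp
  ultimately show ?thesis using assms unfolding norm_divide by (intro frac_le) auto
qed

lemma herglotz_const:
  assumes "cmod z < 1" shows "(LINT \<xi>|circle_measure. (\<xi> + z) / (\<xi> - z)) = 1"
proof -
  have "(LINT \<xi>|circle_measure. (\<xi> + z) / (\<xi> - z)) = (LINT \<xi>|circle_measure. cnj ((\<Sum>n. herglotz_coeff z n * \<xi> ^ n) * \<xi> ^ 0))"
  proof (rule integral_cong_AE)
    show "AE \<xi> in circle_measure. (\<xi> + z) / (\<xi> - z) = cnj ((\<Sum>n. herglotz_coeff z n * \<xi> ^ n) * \<xi> ^ 0)"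
      using AE_circle by eventually_elim (simp add: herglotz_kernel_series[OF assms, symmetric])
  qed measurable
  also have "\<dots> = cnj (LINT \<xi>|circle_measure. (\<Sum>n. herglotz_coeff z n * \<xi> ^ n) * \<xi> ^ 0)"
    by (rule Bochner_Integration.integral_cnj)
  also have "\<dots> = 1"
    unfolding circle_integral_series_power[OF herglotz_coeff_summable[OF assms]] by (simp add: herglotz_coeff_def)
  finally show ?thesis .
qed

text \<open>In other words, 1 - \<eta> z is outer. The coefficients 2 of the kernel cancel the 1/2
  that comes from taking the real part of the logarithm.\<close>

lemma herglotz_log_inner:
  assumes \<eta>: "cmod \<eta> < 1" and z: "cmod z < 1"
  shows "(LINT \<xi>|circle_measure. (\<xi> + z) / (\<xi> - z) * of_real (ln (cmod (1 - \<eta> * \<xi>)))) = Ln (1 - \<eta> * z)"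
proof -
  have "(LINT \<xi>|circle_measure. (\<xi> + z) / (\<xi> - z) * of_real (ln (cmod (1 - \<eta> * \<xi>))))
      = (LINT \<xi>|circle_measure. of_real (ln (cmod (1 - \<eta> * \<xi>))) * cnj (\<Sum>n. herglotz_coeff z n * \<xi> ^ n))"
  proof (rule integral_cong_AE)
    show "AE \<xi> in circle_measure. (\<xi> + z) / (\<xi> - z) * of_real (ln (cmod (1 - \<eta> * \<xi>))) = of_real (ln (cmod (1 - \<eta> * \<xi>))) * cnj (\<Sum>n. herglotz_coeff z n * \<xi> ^ n)"
      using AE_circle by eventually_elim (subst herglotz_kernel_series[OF z], assumption, rule mult.commute)
  qed measurable
  also have "\<dots> = (\<Sum>n. - (\<eta> ^ n / of_nat n) * cnj (herglotz_coeff z n)) / 2"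
    by (rule circle_integral_log_series[OF \<eta> herglotz_coeff_summable[OF z]])
  also have "(\<lambda>n. - (\<eta> ^ n / of_nat n) * cnj (herglotz_coeff z n)) = (\<lambda>n. 2 * - ((\<eta> * z) ^ n / of_nat n))"
    by (rule ext) (simp add: herglotz_coeff_def power_mult_distrib)
  also have "(\<Sum>n. 2 * - ((\<eta> * z) ^ n / of_nat n)) = 2 * Ln (1 - \<eta> * z)"
  proof -
    have "cmod (\<eta> * z) < 1" using \<eta> z mult_left_le[of "cmod z" "cmod \<eta>"] by (simp add: norm_mult)
    from sums_mult[OF Ln_one_minus_sums[OF this], of 2] show ?thesis by (simp add: sums_iff)
  qed
  finally show ?thesis by simp
qed

text \<open>Since 1 - r \<le> |1 - r w|, also |1 - w| \<le> |1 - r w| + (1 - r) \<le> 2 |1 - r w|: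
  dilation costs at most ln 2, uniformly in r. This is the dominating function for the limit towards
  the circle.\<close>

lemma ln_dilated_bound:
  assumes w: "cmod w = 1" "1 - w \<noteq> 0" and r: "0 \<le> r" "r < 1"
  shows "\<bar>ln (cmod (1 - of_real r * w))\<bar> \<le> \<bar>ln (cmod (1 - w))\<bar> + ln 2"
proof -
  have 1: "1 - r \<le> cmod (1 - of_real r * w)"
    using norm_triangle_ineq2[of 1 "of_real r * w"] w r by (simp add: norm_mult)
  have 2: "cmod (1 - of_real r * w) \<le> 2"
    using norm_triangle_ineq4[of 1 "of_real r * w"] w r by (simp add: norm_mult)
  have "cmod (1 - w) \<le> cmod (1 - of_real r * w) + cmod (of_real (r - 1) * w)"
    using norm_triangle_ineq[of "1 - of_real r * w" "of_real (r - 1) * w"] by (simp add: algebra_simps)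
  also have "cmod (of_real (r - 1) * w) = 1 - r" using w r by (simp only: norm_mult norm_of_real) simp
  finally have 3: "cmod (1 - w) / 2 \<le> cmod (1 - of_real r * w)" using 1 by simp
  have pos: "cmod (1 - w) > 0" using w by simp
  have "ln (cmod (1 - w) / 2) \<le> ln (cmod (1 - of_real r * w))" using 3 pos by (subst ln_le_cancel_iff) auto
  moreover have "ln (cmod (1 - of_real r * w)) \<le> ln 2" using 1 2 r by (subst ln_le_cancel_iff) auto
  moreover have "ln (cmod (1 - w) / 2) = ln (cmod (1 - w)) - ln 2" using pos by (simp add: ln_div)
  ultimately show ?thesis by linarith
qed

text \<open>For |\<eta>| = 1 the logarithm is unbounded on the circle and its series is not
  absolutely summable; the formula is obtained from r \<eta> with r tending to 1 by dominated
  convergence.\<close>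

lemma herglotz_log:
  assumes \<eta>: "cmod \<eta> \<le> 1" and z: "cmod z < 1"
    and int: "integrable circle_measure (\<lambda>\<xi>. ln (cmod (1 - \<eta> * \<xi>)))"
    and nz: "AE \<xi> in circle_measure. 1 - \<eta> * \<xi> \<noteq> 0"
  shows "(LINT \<xi>|circle_measure. (\<xi> + z) / (\<xi> - z) * of_real (ln (cmod (1 - \<eta> * \<xi>)))) = Ln (1 - \<eta> * z)"
proof (cases "cmod \<eta> < 1")
  case True then show ?thesis using z by (rule herglotz_log_inner)
next
  case False
  then have \<eta>1: "cmod \<eta> = 1" using \<eta> by simp
  define r where "r n = 1 - inverse (real (Suc n))" for n
  have r: "0 \<le> r n" "r n < 1" for n by (simp_all add: r_def inverse_le_1_iff)
  have rlim: "r \<longlonglongrightarrow> 1" unfolding r_def using tendsto_diff[OF tendsto_const LIMSEQ_inverse_real_of_nat, of 1] by simp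
  let ?k = "\<lambda>\<xi>. (\<xi> + z) / (\<xi> - z)"
  let ?C = "2 / (1 - cmod z)"
  have C0: "?C \<ge> 0" using z by simp
  have "(\<lambda>n. LINT \<xi>|circle_measure. ?k \<xi> * of_real (ln (cmod (1 - (of_real (r n) * \<eta>) * \<xi>))))
     \<longlonglongrightarrow> (LINT \<xi>|circle_measure. ?k \<xi> * of_real (ln (cmod (1 - \<eta> * \<xi>))))"
  proof (rule integral_dominated_convergence[where w="\<lambda>\<xi>. ?C * (\<bar>ln (cmod (1 - \<eta> * \<xi>))\<bar> + ln 2)"])
    show "integrable circle_measure (\<lambda>\<xi>. ?C * (\<bar>ln (cmod (1 - \<eta> * \<xi>))\<bar> + ln 2))"
      by (intro integrable_mult_right Bochner_Integration.integrable_add integrable_abs int) simp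
    show "AE \<xi> in circle_measure. (\<lambda>n. ?k \<xi> * of_real (ln (cmod (1 - (of_real (r n) * \<eta>) * \<xi>)))) \<longlonglongrightarrow> ?k \<xi> * of_real (ln (cmod (1 - \<eta> * \<xi>)))"
      using nz
    proof eventually_elim
      case (elim \<xi>)
      have "(\<lambda>n. ?k \<xi> * of_real (ln (cmod (1 - (of_real (r n) * \<eta>) * \<xi>)))) \<longlonglongrightarrow> ?k \<xi> * of_real (ln (cmod (1 - (of_real 1 * \<eta>) * \<xi>)))"
        using elim by (intro tendsto_mult tendsto_const tendsto_of_real tendsto_ln tendsto_norm tendsto_diff rlim) auto
      then show ?case by simp
    qed
    show "AE \<xi> in circle_measure. norm (?k \<xi> * of_real (ln (cmod (1 - (of_real (r n) * \<eta>) * \<xi>)))) \<le> ?C * (\<bar>ln (cmod (1 - \<eta> * \<xi>))\<bar> + ln 2)" for n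
      using nz AE_circle
    proof eventually_elim
      case (elim \<xi>)
      have "\<bar>ln (cmod (1 - of_real (r n) * (\<eta> * \<xi>)))\<bar> \<le> \<bar>ln (cmod (1 - \<eta> * \<xi>))\<bar> + ln 2"
        using elim \<eta>1 by (intro ln_dilated_bound r) (auto simp: norm_mult)
      then have "cmod (?k \<xi>) * \<bar>ln (cmod (1 - of_real (r n) * (\<eta> * \<xi>)))\<bar> \<le> ?C * (\<bar>ln (cmod (1 - \<eta> * \<xi>))\<bar> + ln 2)"
        using herglotz_kernel_bound[OF z elim(2)] C0 by (intro mult_mono) auto
      then show ?case by (simp only: norm_mult norm_of_real mult.assoc)
    qed
  qed measurable
  moreover have "(LINT \<xi>|circle_measure. ?k \<xi> * of_real (ln (cmod (1 - (of_real (r n) * \<eta>) * \<xi>)))) = Ln (1 - (of_real (r n) * \<eta>) * z)" for n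
    using r[of n] \<eta>1 z by (intro herglotz_log_inner) (auto simp: norm_mult)
  moreover have "(\<lambda>n. Ln (1 - (of_real (r n) * \<eta>) * z)) \<longlonglongrightarrow> Ln (1 - (of_real 1 * \<eta>) * z)"
  proof (intro tendsto_Ln tendsto_diff tendsto_mult tendsto_const tendsto_of_real rlim)
    have "Re (1 - (of_real 1 * \<eta>) * z) > 0" using \<eta>1 z by (intro Re_pos_one_minus) (simp add: norm_mult)
    then show "1 - (of_real 1 * \<eta>) * z \<notin> \<real>\<^sub>\<le>\<^sub>0" using complex_nonpos_Reals_iff by force
  qed
  ultimately show ?thesis by (simp add: LIMSEQ_unique)
qed

section \<open>Identification of the pair\<close>

lemma Hinf_subset_H2: "f \<in> Hinf \<Longrightarrow> f \<in> H2"
proof -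
  assume f: "f \<in> Hinf"
  then have Hol: "f \<in> Hol" by (simp add: Hinf_def)
  from f have "bounded (f ` unit_disc)" by (simp add: Hinf_def)
  then obtain C where "\<And>w. w \<in> f ` unit_disc \<Longrightarrow> cmod w \<le> C" unfolding bounded_iff by blast
  then have C: "\<And>z. cmod z < 1 \<Longrightarrow> cmod (f z) \<le> C" by simp
  have C0: "C \<ge> 0" using C[of 0] by (simp add: order_trans[OF norm_ge_zero])
  let ?a = "taylor_coeff f"
  \<comment> \<open>Parseval on the circle of radius r; only finitely many coefficients are kept, so
    that r may tend to 1 term by term.\<close>
  have r: "(\<Sum>n<N. (cmod (?a n * of_real (r ^ n)))\<^sup>2) \<le> C\<^sup>2" if r: "0 < r \<and> r < 1" for N r
  proof -
    have s: "summable (\<lambda>n. cmod (?a n * of_real (r ^ n)))"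
      using Hol_abs_summable[OF Hol, of r] r by (simp add: norm_mult norm_power)
    have "(\<Sum>n<N. (cmod (?a n * of_real (r ^ n)))\<^sup>2) \<le> (LINT \<xi>|circle_measure. (cmod (\<Sum>n. (?a n * of_real (r ^ n)) * \<xi> ^ n))\<^sup>2)"
    proof -
      note S = circle_parseval_norm[OF s]
      show ?thesis using sum_le_suminf[OF sums_summable[OF S], of "{..<N}"] by (simp only: sums_unique[OF S, symmetric]) simp
    qed
    also have "\<dots> \<le> (LINT \<xi>|circle_measure. C\<^sup>2)"
    proof (rule integral_mono_AE)
      have le: "(cmod (\<Sum>n. (?a n * of_real (r ^ n)) * \<xi> ^ n))\<^sup>2 \<le> C\<^sup>2" if "cmod \<xi> = 1" for \<xi>
      proof -
        have "cmod (of_real r * \<xi>) < 1" using r that by (simp add: norm_mult)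
        from Hol_sums[OF Hol this] C[OF this] show ?thesis
          by (intro power_mono) (simp_all add: sums_iff power_mult_distrib mult.assoc)
      qed
      then show "AE \<xi> in circle_measure. (cmod (\<Sum>n. (?a n * of_real (r ^ n)) * \<xi> ^ n))\<^sup>2 \<le> C\<^sup>2"
        using AE_circle by (auto elim: eventually_mono)
      show "integrable circle_measure (\<lambda>\<xi>. (cmod (\<Sum>n. (?a n * of_real (r ^ n)) * \<xi> ^ n))\<^sup>2)"
        by (rule circle_integrable_bounded[where C="C\<^sup>2"]) (use le in auto)
    qed simp
    finally show ?thesis by simp
  qed
  have "(\<Sum>n<N. (cmod (?a n))\<^sup>2) \<le> C\<^sup>2" for N
  proof (rule tendsto_upperbound)
    have "((\<lambda>r. \<Sum>n<N. (cmod (?a n * of_real (r ^ n)))\<^sup>2) \<longlongrightarrow> (\<Sum>n<N. (cmod (?a n * of_real (1 ^ n)))\<^sup>2)) (at_left (1::real))"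
      by (intro tendsto_intros)
    then show "((\<lambda>r. \<Sum>n<N. (cmod (?a n * of_real (r ^ n)))\<^sup>2) \<longlongrightarrow> (\<Sum>n<N. (cmod (?a n))\<^sup>2)) (at_left (1::real))" by simp
    show "\<forall>\<^sub>F r in at_left (1::real). (\<Sum>n<N. (cmod (?a n * of_real (r ^ n)))\<^sup>2) \<le> C\<^sup>2"
      using eventually_at_left_1 by eventually_elim (rule r)
  qed simp
  from l2_boundI(1)[OF this C0] show ?thesis using Hol by (simp add: H2_def)
qed

text \<open>With s = |\<zeta>|^2 and x = P^2, elimination of \<beta> = cnj \<zeta> / x leaves x + s
  / x = 2 + s, a quadratic equation with discriminant 4 + s^2. Its larger root is at least 2, which
  puts the zero of 1 - \<beta> z outside the closed disc.\<close>

lemma spectral_factor_exists: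
  assumes "cmod \<zeta> \<le> 1"
  obtains P :: real and \<beta> :: complex where "P > 0" "cmod \<beta> < 1" "P\<^sup>2 * (1 + \<beta> * cnj \<beta>) = 2 + \<zeta> * cnj \<zeta>" "P\<^sup>2 * \<beta> = cnj \<zeta>"
proof -
  define s where "s = (cmod \<zeta>)\<^sup>2"
  define x where "x = (2 + s + sqrt (4 + s\<^sup>2)) / 2"
  have s: "0 \<le> s" by (simp add: s_def)
  have "sqrt (4 + s\<^sup>2) \<ge> 2" by (rule real_le_rsqrt) simp
  then have x: "x \<ge> 2" using s by (simp add: x_def)
  have q: "x\<^sup>2 + s = (2 + s) * x"
  proof -
    have "(sqrt (4 + s\<^sup>2))\<^sup>2 = 4 + s\<^sup>2" by simp
    then show ?thesis by (simp add: x_def power2_eq_square field_simps)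
  qed
  have ss: "\<zeta> * cnj \<zeta> = of_real s" using complex_norm_square[of \<zeta>] by (simp add: s_def)
  show thesis
  proof (rule that[where P="sqrt x" and \<beta>="cnj \<zeta> / complex_of_real x"])
    show "sqrt x > 0" using x by simp
    show "cmod (cnj \<zeta> / x) < 1" using assms x by (simp add: norm_divide)
    have P: "complex_of_real ((sqrt x)\<^sup>2) = of_real x" using x by simp
    show "complex_of_real ((sqrt x)\<^sup>2) * (cnj \<zeta> / x) = cnj \<zeta>" unfolding P using x by simp
    have "of_real x * (1 + cnj \<zeta> / x * cnj (cnj \<zeta> / x)) = of_real x + (\<zeta> * cnj \<zeta>) / of_real x"
      using x by (simp add: field_simps power2_eq_square)
    also have "\<dots> = of_real (x + s / x)" by (simp add: ss)
    also have "x + s / x = 2 + s" using q x by (simp add: field_simps power2_eq_square)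
    finally show "complex_of_real ((sqrt x)\<^sup>2) * (1 + cnj \<zeta> / x * cnj (cnj \<zeta> / x)) = 2 + \<zeta> * cnj \<zeta>"
      unfolding P by (simp add: ss)
  qed
qed


lemma lipschitz_linear_fun:
  fixes \<eta> :: complex
  assumes "cmod \<eta> \<le> 1"
  shows "cmod ((1 - \<eta> * z) - (1 - \<eta> * w)) \<le> 1 * cmod (z - w)"
    and "cmod z \<le> 1 \<Longrightarrow> cmod (1 - \<eta> * z) \<le> 2"
proof -
  have "(1 - \<eta> * z) - (1 - \<eta> * w) = \<eta> * (w - z)" by (simp add: algebra_simps)
  then have "cmod ((1 - \<eta> * z) - (1 - \<eta> * w)) = cmod \<eta> * cmod (w - z)" by (simp only: norm_mult)
  then show "cmod ((1 - \<eta> * z) - (1 - \<eta> * w)) \<le> 1 * cmod (z - w)"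
    using mult_right_mono[OF assms, of "cmod (w - z)"] by (simp only: norm_minus_commute[of w z]) simp
  assume "cmod z \<le> 1"
  then have "cmod \<eta> * cmod z \<le> 1 * 1" using assms by (intro mult_mono) auto
  then show "cmod (1 - \<eta> * z) \<le> 2" using norm_triangle_ineq4[of 1 "\<eta> * z"] by (simp add: norm_mult)
qed

lemma pair_explicit:
  fixes \<zeta> \<beta> :: complex and P :: real
  assumes \<zeta>: "cmod \<zeta> \<le> 1" and \<beta>: "cmod \<beta> < 1" and P: "P > 0"
    and P\<beta>: "P\<^sup>2 * (1 + \<beta> * cnj \<beta>) = 2 + \<zeta> * cnj \<zeta>" "P\<^sup>2 * \<beta> = cnj \<zeta>"
    and a: "outer_Hinf a" and b: "b \<in> Hinf"
    and ab: "\<And>z. cmod z < 1 \<Longrightarrow> (1 - cnj \<zeta> * z) * b z = z * a z"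
    and pair: "AE \<xi> in circle_measure. (cmod (boundary_fun a \<xi>))\<^sup>2 + (cmod (boundary_fun b \<xi>))\<^sup>2 = 1"
  obtains c where "cmod c = 1" "\<And>z. cmod z < 1 \<Longrightarrow> a z = c * (1 - cnj \<zeta> * z) / (P * (1 - \<beta> * z))"
proof -
  have aH: "a \<in> Hinf" using a by (simp add: outer_Hinf_def)
  obtain xa where xa: "a = l2_fun xa" using Hinf_subset_H2[OF aH] unfolding H2_eq_range by blast
  obtain xb where xb: "b = l2_fun xb" using Hinf_subset_H2[OF b] unfolding H2_eq_range by blast
  let ?A = "boundary_fun a" and ?B = "boundary_fun b"
  have \<zeta>': "cmod (cnj \<zeta>) \<le> 1" using \<zeta> by simp
  have eqz: "l2_fun (shift xa) z = (1 - cnj \<zeta> * z) * l2_fun xb z" if "cmod z < 1" for z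
    using ab[OF that] by (simp add: l2_fun_shift xa xb)
  have bB: "AE \<xi> in circle_measure. boundary_fun (l2_fun (shift xa)) \<xi> = (1 - cnj \<zeta> * \<xi>) * ?B \<xi>"
    unfolding xb by (rule boundary_mult[OF lipschitz_linear_fun(1)[OF \<zeta>'] lipschitz_linear_fun(2)[OF \<zeta>'] eqz])
  have bA: "AE \<xi> in circle_measure. boundary_fun (l2_fun (shift xa)) \<xi> = \<xi> * ?A \<xi>"
    unfolding xa by (rule boundary_mult[where K=1 and C=1]) (auto simp: l2_fun_shift)
  have A0: "AE \<xi> in circle_measure. ?A \<xi> \<noteq> 0" and Aint: "integrable circle_measure (\<lambda>\<xi>. ln (cmod (?A \<xi>)))"
    using a by (auto simp: outer_Hinf_def)
  have [measurable]: "?A \<in> borel_measurable borel" unfolding xa by (rule L2T_measurable[OF boundary_L2T])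
  \<comment> \<open>The modulus of a is found almost everywhere from two linear equations for |a|^2
    and |b|^2. That 1 - cnj \<zeta> \<xi> does not vanish is recorded because ln 0 = 0; it follows
    from |a| = |1 - cnj \<zeta> \<xi>| |b| and a \<noteq> 0.\<close>
  have key: "AE \<xi> in circle_measure. 1 - cnj \<zeta> * \<xi> \<noteq> 0 \<and>
      ln (cmod (?A \<xi>)) = ln (cmod (1 - cnj \<zeta> * \<xi>)) - (ln P + ln (cmod (1 - \<beta> * \<xi>)))"
    using bA bB A0 pair AE_circle
  proof eventually_elim
    case (elim \<xi>)
    let ?u = "1 - cnj \<zeta> * \<xi>" and ?v = "1 - \<beta> * \<xi>"
    have u\<xi>: "\<xi> * cnj \<xi> = 1" using complex_norm_square[of \<xi>] elim by simp
    have "cmod (\<xi> * ?A \<xi>) = cmod (?u * ?B \<xi>)" using elim by simp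
    then have AB: "cmod (?A \<xi>) = cmod ?u * cmod (?B \<xi>)" using elim by (simp add: norm_mult)
    then have u0: "?u \<noteq> 0" using elim by auto
    have "cmod \<beta> * 1 < 1" using \<beta> by simp
    then have v0: "?v \<noteq> 0" using elim \<beta> norm_mult[of \<beta> \<xi>] by (metis mult_cancel_left1 norm_one order_less_irrefl right_minus_eq)
    have uv: "1 + (cmod ?u)\<^sup>2 = P\<^sup>2 * (cmod ?v)\<^sup>2"
    proof -
      have "complex_of_real (P\<^sup>2 * (cmod ?v)\<^sup>2) = P\<^sup>2 * (?v * cnj ?v)"
        unfolding complex_norm_square[symmetric] by simp
      also have "?v * cnj ?v = 1 + (\<beta> * cnj \<beta>) * (\<xi> * cnj \<xi>) - \<beta> * \<xi> - cnj \<beta> * cnj \<xi>"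
        by (simp add: algebra_simps)
      also have "P\<^sup>2 * (1 + (\<beta> * cnj \<beta>) * (\<xi> * cnj \<xi>) - \<beta> * \<xi> - cnj \<beta> * cnj \<xi>)
          = P\<^sup>2 * (1 + \<beta> * cnj \<beta>) - (P\<^sup>2 * \<beta>) * \<xi> - cnj (P\<^sup>2 * \<beta>) * cnj \<xi>"
        unfolding u\<xi> by (simp add: algebra_simps)
      also have "\<dots> = 2 + \<zeta> * cnj \<zeta> - cnj \<zeta> * \<xi> - \<zeta> * cnj \<xi>" unfolding P\<beta> by simp
      also have "\<dots> = 1 + (1 + (\<zeta> * cnj \<zeta>) * (\<xi> * cnj \<xi>) - cnj \<zeta> * \<xi> - \<zeta> * cnj \<xi>)" unfolding u\<xi> by simp
      also have "1 + (\<zeta> * cnj \<zeta>) * (\<xi> * cnj \<xi>) - cnj \<zeta> * \<xi> - \<zeta> * cnj \<xi> = ?u * cnj ?u"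
        by (simp add: algebra_simps)
      also have "1 + ?u * cnj ?u = complex_of_real (1 + (cmod ?u)\<^sup>2)"
        by (simp only: complex_norm_square of_real_add of_real_1)
      finally show ?thesis by (simp only: of_real_eq_iff)
    qed
    have "(cmod (?A \<xi>))\<^sup>2 * (1 + (cmod ?u)\<^sup>2) = (cmod (?A \<xi>))\<^sup>2 + (cmod ?u)\<^sup>2 * (cmod (?A \<xi>))\<^sup>2"
      by (simp add: algebra_simps)
    also have "\<dots> = (cmod ?u)\<^sup>2 * ((cmod (?A \<xi>))\<^sup>2 + (cmod (?B \<xi>))\<^sup>2)"
      by (subst (1) AB) (simp add: power_mult_distrib algebra_simps)
    also have "\<dots> = (cmod ?u)\<^sup>2" using elim by simp
    finally have "(cmod (?A \<xi>) * (P * cmod ?v))\<^sup>2 = (cmod ?u)\<^sup>2" unfolding uv by (simp add: power_mult_distrib)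
    then have "cmod (?A \<xi>) * (P * cmod ?v) = cmod ?u" using P by (simp add: power2_eq_iff_nonneg)
    then have "ln (cmod ?u) = ln (cmod (?A \<xi>) * (P * cmod ?v))" by simp
    also have "\<dots> = ln (cmod (?A \<xi>)) + (ln P + ln (cmod ?v))"
      using elim P v0 by (simp add: ln_mult)
    finally show ?case using u0 by simp
  qed
  have vint: "integrable circle_measure (\<lambda>\<xi>. ln (cmod (1 - \<beta> * \<xi>)))"
  proof (rule circle_integrable_bounded)
    fix \<xi> :: complex assume "cmod \<xi> = 1"
    then show "norm (ln (cmod (1 - \<beta> * \<xi>))) \<le> (\<Sum>n. cmod (- (\<beta> ^ n / of_nat n)))"
      using summable_norm[of "\<lambda>n. - (\<beta> ^ n / of_nat n) * \<xi> ^ n"] log_coeff_summable[OF \<beta>]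
        abs_Re_le_cmod[of "\<Sum>n. - (\<beta> ^ n / of_nat n) * \<xi> ^ n"]
      by (simp add: ln_cmod_series[OF \<beta>] norm_mult norm_power norm_divide)
  qed measurable
  \<comment> \<open>For |\<zeta>| = 1 this function has a singularity on the circle; its
    integrability is inherited from that of ln |a|, which is part of outerness.\<close>
  have uint: "integrable circle_measure (\<lambda>\<xi>. ln (cmod (1 - cnj \<zeta> * \<xi>)))"
  proof -
    have "integrable circle_measure (\<lambda>\<xi>. ln (cmod (?A \<xi>)) + (ln P + ln (cmod (1 - \<beta> * \<xi>))))"
      by (intro Bochner_Integration.integrable_add Aint vint) simp
    then show ?thesis
    proof (rule integrable_cong_AE_imp)
      show "AE \<xi> in circle_measure. ln (cmod (?A \<xi>)) + (ln P + ln (cmod (1 - \<beta> * \<xi>))) = ln (cmod (1 - cnj \<zeta> * \<xi>))"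
        using key by eventually_elim simp
    qed measurable
  qed
  have kint: "integrable circle_measure (\<lambda>\<xi>. (\<xi> + z) / (\<xi> - z) * of_real (f \<xi>))"
    if f: "integrable circle_measure f" and z: "cmod z < 1" for f :: "complex \<Rightarrow> real" and z
  proof (rule Bochner_Integration.integrable_bound[OF integrable_mult_right[OF f, of "2 / (1 - cmod z)"]])
    have [measurable]: "f \<in> borel_measurable borel" using f by (auto dest: borel_measurable_integrable)
    show "(\<lambda>\<xi>. (\<xi> + z) / (\<xi> - z) * of_real (f \<xi>)) \<in> borel_measurable circle_measure" by measurable
    show "AE \<xi> in circle_measure. norm ((\<xi> + z) / (\<xi> - z) * of_real (f \<xi>)) \<le> norm (2 / (1 - cmod z) * f \<xi>)"
      using AE_circle
    proof eventually_elim
      case (elim \<xi>)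
      have "cmod ((\<xi> + z) / (\<xi> - z)) * \<bar>f \<xi>\<bar> \<le> 2 / (1 - cmod z) * \<bar>f \<xi>\<bar>"
        by (rule mult_right_mono[OF herglotz_kernel_bound[OF z elim]]) simp
      also have "\<dots> = norm (2 / (1 - cmod z) * f \<xi>)" using z by (simp add: abs_mult)
      finally show ?case by (simp only: norm_mult norm_of_real)
    qed
  qed
  \<comment> \<open>Each of the three summands of ln |a| has an explicit Herglotz integral;
    exponentiating the result reconstructs a up to its unimodular constant.\<close>
  have her: "(LINT \<xi>|circle_measure. (\<xi> + z) / (\<xi> - z) * of_real (ln (cmod (?A \<xi>))))
      = Ln (1 - cnj \<zeta> * z) - (of_real (ln P) + Ln (1 - \<beta> * z))" if z: "cmod z < 1" for z
  proof -
    let ?k = "\<lambda>\<xi>. (\<xi> + z) / (\<xi> - z)"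
    have i1: "integrable circle_measure (\<lambda>\<xi>. ?k \<xi> * of_real (ln (cmod (1 - cnj \<zeta> * \<xi>))))" by (rule kint[OF uint z])
    have i2: "integrable circle_measure (\<lambda>\<xi>. ?k \<xi> * of_real (ln P))" by (rule kint[OF _ z]) simp
    have i3: "integrable circle_measure (\<lambda>\<xi>. ?k \<xi> * of_real (ln (cmod (1 - \<beta> * \<xi>))))" by (rule kint[OF vint z])
    have "(LINT \<xi>|circle_measure. ?k \<xi> * of_real (ln (cmod (?A \<xi>))))
       = (LINT \<xi>|circle_measure. ?k \<xi> * of_real (ln (cmod (1 - cnj \<zeta> * \<xi>))) - (?k \<xi> * of_real (ln P) + ?k \<xi> * of_real (ln (cmod (1 - \<beta> * \<xi>)))))"
    proof (rule integral_cong_AE)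
      show "AE \<xi> in circle_measure. ?k \<xi> * of_real (ln (cmod (?A \<xi>)))
        = ?k \<xi> * of_real (ln (cmod (1 - cnj \<zeta> * \<xi>))) - (?k \<xi> * of_real (ln P) + ?k \<xi> * of_real (ln (cmod (1 - \<beta> * \<xi>))))"
        using key
      proof eventually_elim
        case (elim \<xi>)
        then have e: "ln (cmod (?A \<xi>)) = ln (cmod (1 - cnj \<zeta> * \<xi>)) - (ln P + ln (cmod (1 - \<beta> * \<xi>)))" by blast
        show ?case unfolding e by (simp only: of_real_diff of_real_add right_diff_distrib distrib_left)
      qed
    qed measurable
    also have "\<dots> = (LINT \<xi>|circle_measure. ?k \<xi> * of_real (ln (cmod (1 - cnj \<zeta> * \<xi>))))
       - ((LINT \<xi>|circle_measure. ?k \<xi> * of_real (ln P)) + (LINT \<xi>|circle_measure. ?k \<xi> * of_real (ln (cmod (1 - \<beta> * \<xi>)))))"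
      by (simp only: Bochner_Integration.integral_diff[OF i1 Bochner_Integration.integrable_add[OF i2 i3]]
          Bochner_Integration.integral_add[OF i2 i3])
    also have "(LINT \<xi>|circle_measure. ?k \<xi> * of_real (ln (cmod (1 - cnj \<zeta> * \<xi>)))) = Ln (1 - cnj \<zeta> * z)"
      by (rule herglotz_log[OF \<zeta>' z uint]) (use key in \<open>auto elim: eventually_mono\<close>)
    also have "(LINT \<xi>|circle_measure. ?k \<xi> * of_real (ln (cmod (1 - \<beta> * \<xi>)))) = Ln (1 - \<beta> * z)"
      by (rule herglotz_log_inner[OF \<beta> z])
    also have "(LINT \<xi>|circle_measure. ?k \<xi> * of_real (ln P)) = of_real (ln P)"
      by (simp only: integral_mult_left_zero herglotz_const[OF z] mult_1)
    finally show ?thesis .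
  qed
  obtain c where c: "cmod c = 1"
      "\<And>z. z \<in> unit_disc \<Longrightarrow> a z = c * exp (LINT \<xi>|circle_measure. (\<xi> + z) / (\<xi> - z) * of_real (ln (cmod (?A \<xi>))))"
    using a unfolding outer_Hinf_def by blast
  have "a z = c * (1 - cnj \<zeta> * z) / (P * (1 - \<beta> * z))" if z: "cmod z < 1" for z
  proof -
    have "cmod (cnj \<zeta> * z) < 1" using \<zeta> z mult_right_mono[OF \<zeta>, of "cmod z"] by (simp add: norm_mult)
    then have n1: "1 - cnj \<zeta> * z \<noteq> 0" by auto
    have "cmod (\<beta> * z) < 1" using \<beta> z mult_left_le[of "cmod z" "cmod \<beta>"] by (simp add: norm_mult)
    then have n2: "1 - \<beta> * z \<noteq> 0" by auto
    have "a z = c * exp (Ln (1 - cnj \<zeta> * z) - (of_real (ln P) + Ln (1 - \<beta> * z)))"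
      using c(2)[of z] z by (simp only: her[OF z]) simp
    also have "exp (Ln (1 - cnj \<zeta> * z) - (of_real (ln P) + Ln (1 - \<beta> * z))) = (1 - cnj \<zeta> * z) / (P * (1 - \<beta> * z))"
      using n1 n2 P by (simp add: exp_diff exp_add exp_of_real)
    finally show ?thesis by simp
  qed
  with c(1) show thesis by (rule that)
qed

section \<open>Polar coordinates for the area measure\<close>

lemma nn_integral_lborel_translate:
  fixes F :: "complex \<Rightarrow> ennreal"
  assumes [measurable]: "F \<in> borel_measurable borel"
  shows "(\<integral>\<^sup>+z. F (a + z) \<partial>lborel) = (\<integral>\<^sup>+z. F z \<partial>lborel)"
proof -
  have "(\<integral>\<^sup>+z. F z \<partial>lborel) = (\<integral>\<^sup>+z. F z \<partial>distr lborel borel ((+) a))" by (simp only: lborel_distr_plus)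
  also have "\<dots> = (\<integral>\<^sup>+z. F (a + z) \<partial>lborel)" by (subst nn_integral_distr) auto
  finally show ?thesis by simp
qed

lemma unit_disc_borel [measurable]: "unit_disc \<in> sets borel"
  by (intro borel_open) simp

lemma emeasure_unit_disc: "emeasure lborel unit_disc = ennreal pi"
  by (simp add: emeasure_ball unit_ball_vol_2)

text \<open>The rotated measure is translation invariant, so comparing it with \<open>lborel\<close> by convolving with the
  indicator of the (rotation invariant) unit disc shows that they agree.\<close>

lemma nn_integral_lborel_rotate:
  fixes F :: "complex \<Rightarrow> ennreal"
  assumes u: "cmod u = 1" and [measurable]: "F \<in> borel_measurable borel"
  shows "(\<integral>\<^sup>+z. F (u * z) \<partial>lborel) = (\<integral>\<^sup>+z. F z \<partial>lborel)"
proof -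
  let ?B = "indicator unit_disc :: complex \<Rightarrow> ennreal"
  have u0: "u \<noteq> 0" using u by auto
  have "(\<integral>\<^sup>+z. F (u * z) \<partial>lborel) * ennreal pi = (\<integral>\<^sup>+y. (\<integral>\<^sup>+z. F (u * z) \<partial>lborel) * ?B y \<partial>lborel)"
  proof -
    have "(\<integral>\<^sup>+y. (\<integral>\<^sup>+z. F (u * z) \<partial>lborel) * ?B y \<partial>lborel) = (\<integral>\<^sup>+z. F (u * z) \<partial>lborel) * (\<integral>\<^sup>+y. ?B y \<partial>lborel)"
      by (rule nn_integral_cmult) measurable
    then show ?thesis by (simp add: emeasure_unit_disc)
  qed
  also have "\<dots> = (\<integral>\<^sup>+y. \<integral>\<^sup>+z. F (u * z) * ?B y \<partial>lborel \<partial>lborel)"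
    by (rule nn_integral_cong, rule nn_integral_multc[symmetric]) measurable
  also have "\<dots> = (\<integral>\<^sup>+y. \<integral>\<^sup>+z. F (u * (y / u + z)) * ?B y \<partial>lborel \<partial>lborel)"
  proof (rule nn_integral_cong)
    fix y :: complex
    show "(\<integral>\<^sup>+z. F (u * z) * ?B y \<partial>lborel) = (\<integral>\<^sup>+z. F (u * (y / u + z)) * ?B y \<partial>lborel)"
      by (rule nn_integral_lborel_translate[of "\<lambda>z. F (u * z) * ?B y" "y / u", symmetric]) measurable
  qed
  also have "\<dots> = (\<integral>\<^sup>+y. \<integral>\<^sup>+z. F (u * z + y) * ?B y \<partial>lborel \<partial>lborel)"
    using u0 by (simp add: distrib_left add.commute)
  also have "\<dots> = (\<integral>\<^sup>+z. \<integral>\<^sup>+y. F (u * z + y) * ?B y \<partial>lborel \<partial>lborel)"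
    by (rule lborel_pair.Fubini') measurable
  also have "\<dots> = (\<integral>\<^sup>+z. \<integral>\<^sup>+y. F y * ?B (y - u * z) \<partial>lborel \<partial>lborel)"
  proof (rule nn_integral_cong)
    fix z :: complex
    have "(\<integral>\<^sup>+y. F (u * z + y) * ?B ((u * z + y) - u * z) \<partial>lborel) = (\<integral>\<^sup>+y. F y * ?B (y - u * z) \<partial>lborel)"
      by (rule nn_integral_lborel_translate[of "\<lambda>y. F y * ?B (y - u * z)" "u * z"]) measurable
    then show "(\<integral>\<^sup>+y. F (u * z + y) * ?B y \<partial>lborel) = (\<integral>\<^sup>+y. F y * ?B (y - u * z) \<partial>lborel)" by simp
  qed
  also have "\<dots> = (\<integral>\<^sup>+y. \<integral>\<^sup>+z. F y * ?B (y - u * z) \<partial>lborel \<partial>lborel)"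
    by (rule lborel_pair.Fubini') measurable
  also have "\<dots> = (\<integral>\<^sup>+y. F y * ennreal pi \<partial>lborel)"
  proof (rule nn_integral_cong)
    fix y :: complex
    have B: "?B (y - u * z) = ?B (- (y / u) + z)" for z
    proof -
      have "y - u * z = - u * (- (y / u) + z)" using u0 by (simp add: field_simps)
      then have "cmod (y - u * z) = cmod (- u) * cmod (- (y / u) + z)" by (simp only: norm_mult)
      then have "cmod (y - u * z) = cmod (- (y / u) + z)" using u by (simp only: norm_minus_cancel mult_1)
      then show ?thesis by (simp add: indicator_def)
    qed
    have "(\<integral>\<^sup>+z. F y * ?B (y - u * z) \<partial>lborel) = F y * (\<integral>\<^sup>+z. ?B (- (y / u) + z) \<partial>lborel)"
      unfolding B by (rule nn_integral_cmult) measurable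
    also have "(\<integral>\<^sup>+z. ?B (- (y / u) + z) \<partial>lborel) = (\<integral>\<^sup>+z. ?B z \<partial>lborel)"
      by (rule nn_integral_lborel_translate) measurable
    finally show "(\<integral>\<^sup>+z. F y * ?B (y - u * z) \<partial>lborel) = F y * ennreal pi" by (simp add: emeasure_unit_disc)
  qed
  also have "\<dots> = (\<integral>\<^sup>+z. F z \<partial>lborel) * ennreal pi" by (rule nn_integral_multc) measurable
  finally show ?thesis
    by (simp add: ennreal_mult_cancel_left mult.commute[of _ "ennreal pi"])
qed

section \<open>Rotation averages and radial integrals for normalized area\<close>

lemma area_measure_sets [measurable_cong, simp]: "sets area_measure = sets borel"
  and area_measure_space [simp]: "space area_measure = UNIV"
  by (simp_all add: area_measure_def)

lemma nn_integral_area: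
  assumes [measurable]: "F \<in> borel_measurable borel"
  shows "(\<integral>\<^sup>+z. F z \<partial>area_measure) = (\<integral>\<^sup>+z. F z * indicator unit_disc z \<partial>lborel) / ennreal pi"
  unfolding area_measure_def by (subst nn_integral_uniform_measure) (auto simp: emeasure_unit_disc)

lemma emeasure_area_UNIV [simp]: "emeasure area_measure UNIV = 1"
  unfolding area_measure_def
  by (subst emeasure_uniform_measure) (auto simp: emeasure_unit_disc divide_ennreal)

interpretation area: finite_measure area_measure
  by (rule finite_measureI) simp

lemma AE_area: "AE z in area_measure. cmod z < 1"
  unfolding area_measure_def by (rule AE_uniform_measureI) auto

lemma nn_integral_area_rotate:
  assumes u: "cmod u = 1" and [measurable]: "F \<in> borel_measurable borel"
  shows "(\<integral>\<^sup>+z. F (z * u) \<partial>area_measure) = (\<integral>\<^sup>+z. F z \<partial>area_measure)"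
proof -
  have "(\<integral>\<^sup>+z. F (z * u) * indicator unit_disc z \<partial>lborel) = (\<integral>\<^sup>+z. F (u * z) * indicator unit_disc (u * z) \<partial>lborel)"
    using u by (intro nn_integral_cong) (simp add: mult.commute indicator_def norm_mult)
  also have "\<dots> = (\<integral>\<^sup>+z. F z * indicator unit_disc z \<partial>lborel)"
    by (rule nn_integral_lborel_rotate[OF u, of "\<lambda>z. F z * indicator unit_disc z"]) measurable
  finally show ?thesis by (simp add: nn_integral_area)
qed

lemma distr_area_rotate:
  assumes u: "cmod u = 1" shows "distr area_measure borel (\<lambda>z. z * u) = area_measure"
proof (rule measure_eqI)
  fix A assume "A \<in> sets (distr area_measure borel (\<lambda>z. z * u))"
  then have [measurable]: "A \<in> sets borel" by simp
  have "emeasure (distr area_measure borel (\<lambda>z. z * u)) A = (\<integral>\<^sup>+z. indicator A z \<partial>distr area_measure borel (\<lambda>z. z * u))"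
    by simp
  also have "\<dots> = (\<integral>\<^sup>+z. indicator A (z * u) \<partial>area_measure)" by (subst nn_integral_distr) auto
  also have "\<dots> = (\<integral>\<^sup>+z. indicator A z \<partial>area_measure)" by (rule nn_integral_area_rotate[OF u]) measurable
  finally show "emeasure (distr area_measure borel (\<lambda>z. z * u)) A = emeasure area_measure A" by simp
qed simp

interpretation circle_area: pair_sigma_finite circle_measure area_measure ..

text \<open>Polar coordinates without a change of variables: area is rotation invariant and the
  circle has total mass 1, so by Tonelli F may be replaced by its mean over the circle through
  z.\<close>

lemma nn_integral_area_polar:
  assumes [measurable]: "F \<in> borel_measurable borel"
  shows "(\<integral>\<^sup>+z. F z \<partial>area_measure) = (\<integral>\<^sup>+z. (\<integral>\<^sup>+\<xi>. F (z * \<xi>) \<partial>circle_measure) \<partial>area_measure)"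
proof -
  have "(\<integral>\<^sup>+z. (\<integral>\<^sup>+\<xi>. F (z * \<xi>) \<partial>circle_measure) \<partial>area_measure) = (\<integral>\<^sup>+\<xi>. (\<integral>\<^sup>+z. F (z * \<xi>) \<partial>area_measure) \<partial>circle_measure)"
    by (rule circle_area.Fubini') measurable
  also have "\<dots> = (\<integral>\<^sup>+\<xi>. (\<integral>\<^sup>+z. F z \<partial>area_measure) \<partial>circle_measure)"
    using AE_circle by (intro nn_integral_cong_AE) (auto elim!: eventually_mono intro: nn_integral_area_rotate)
  finally show ?thesis by simp
qed

lemma integral_area_polar:
  fixes F :: "complex \<Rightarrow> complex"
  assumes F: "integrable area_measure F"
  shows "(LINT z|area_measure. F z) = (LINT z|area_measure. (LINT \<xi>|circle_measure. F (z * \<xi>)))"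
proof -
  have [measurable]: "F \<in> borel_measurable borel" using F by (auto dest: borel_measurable_integrable)
  have rot: "integrable area_measure (\<lambda>z. F (z * \<xi>))" "(LINT z|area_measure. F (z * \<xi>)) = (LINT z|area_measure. F z)"
    "(LINT z|area_measure. cmod (F (z * \<xi>))) = (LINT z|area_measure. cmod (F z))" if "cmod \<xi> = 1" for \<xi>
  proof -
    note d = distr_area_rotate[OF that]
    have "integrable (distr area_measure borel (\<lambda>z. z * \<xi>)) F" using F by (simp only: d)
    then show "integrable area_measure (\<lambda>z. F (z * \<xi>))" by (subst (asm) integrable_distr_eq) auto
    have "(LINT z|distr area_measure borel (\<lambda>z. z * \<xi>). F z) = (LINT z|area_measure. F (z * \<xi>))"
      by (rule integral_distr) auto
    then show "(LINT z|area_measure. F (z * \<xi>)) = (LINT z|area_measure. F z)" by (simp only: d)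
    have "(LINT z|distr area_measure borel (\<lambda>z. z * \<xi>). cmod (F z)) = (LINT z|area_measure. cmod (F (z * \<xi>)))"
      by (rule integral_distr) auto
    then show "(LINT z|area_measure. cmod (F (z * \<xi>))) = (LINT z|area_measure. cmod (F z))" by (simp only: d)
  qed
  have int: "integrable (circle_measure \<Otimes>\<^sub>M area_measure) (\<lambda>(\<xi>, z). F (z * \<xi>))"
  proof (rule circle_area.Fubini_integrable)
    show "AE \<xi> in circle_measure. integrable area_measure (\<lambda>z. case (\<xi>, z) of (\<xi>, z) \<Rightarrow> F (z * \<xi>))"
      using AE_circle by eventually_elim (simp add: rot)
    have "integrable circle_measure (\<lambda>\<xi>. LINT z|area_measure. cmod (F z))" by simp
    then show "integrable circle_measure (\<lambda>\<xi>. LINT z|area_measure. norm (case (\<xi>, z) of (\<xi>, z) \<Rightarrow> F (z * \<xi>)))"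
    proof (rule integrable_cong_AE_imp)
      show "AE \<xi> in circle_measure. (LINT z|area_measure. cmod (F z)) = (LINT z|area_measure. norm (case (\<xi>, z) of (\<xi>, z) \<Rightarrow> F (z * \<xi>)))"
        using AE_circle by eventually_elim (simp add: rot)
    qed measurable
  qed measurable
  have "(LINT z|area_measure. (LINT \<xi>|circle_measure. F (z * \<xi>))) = (LINT \<xi>|circle_measure. (LINT z|area_measure. F (z * \<xi>)))"
    by (rule circle_area.Fubini_integral[OF int])
  also have "\<dots> = (LINT \<xi>|circle_measure. (LINT z|area_measure. F z))"
  proof (rule integral_cong_AE)
    show "AE \<xi> in circle_measure. (LINT z|area_measure. F (z * \<xi>)) = (LINT z|area_measure. F z)"
      using AE_circle by eventually_elim (rule rot)
  qed measurable
  finally show ?thesis by simp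
qed

text \<open>A disc of radius r has normalized area r^2, so the squared modulus is uniformly
  distributed. This is the radial half of polar coordinates, with t = |z|^2 as variable.\<close>

lemma distr_area_norm_square:
  "distr area_measure borel (\<lambda>z. (cmod z)\<^sup>2) = uniform_measure lborel {0..1::real}"
proof (rule measure_eqI_lessThan)
  interpret D: finite_measure "distr area_measure borel (\<lambda>z. (cmod z)\<^sup>2)"
    by (rule area.finite_measure_distr) simp
  show "emeasure (distr area_measure borel (\<lambda>z. (cmod z)\<^sup>2)) {x<..} < \<infinity>" for x
    by (simp add: D.emeasure_finite less_top[symmetric])
  show "emeasure (distr area_measure borel (\<lambda>z. (cmod z)\<^sup>2)) {x<..} = emeasure (uniform_measure lborel {0..1}) {x<..}" for x
  proof -
    have "emeasure (distr area_measure borel (\<lambda>z. (cmod z)\<^sup>2)) {x<..} = emeasure area_measure {z. x < (cmod z)\<^sup>2}"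
      by (subst emeasure_distr) (auto simp: vimage_def)
    also have "\<dots> = emeasure lborel (unit_disc \<inter> {z. x < (cmod z)\<^sup>2}) / ennreal pi"
      unfolding area_measure_def by (subst emeasure_uniform_measure) (auto simp: emeasure_unit_disc)
    also have "\<dots> = emeasure lborel ({0..1} \<inter> {x<..})"
    proof (cases "x < 0")
      case True
      then have "unit_disc \<inter> {z. x < (cmod z)\<^sup>2} = unit_disc" "{0..1} \<inter> {x<..} = {0..1}"
        by (auto intro: order_less_le_trans)
      then show ?thesis by (simp add: emeasure_unit_disc divide_ennreal)
    next
      case False
      show ?thesis
      proof (cases "x < 1")
        case True
        have eq: "unit_disc \<inter> {z. x < (cmod z)\<^sup>2} = unit_disc - cball 0 (sqrt x)"
        proof -
          have "(cmod z \<le> sqrt x) = ((cmod z)\<^sup>2 \<le> x)" for z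
            using real_sqrt_le_iff[of "(cmod z)\<^sup>2" x] unfolding real_sqrt_abs abs_norm_cancel .
          then show ?thesis by (auto simp: not_le[symmetric])
        qed
        have "sqrt x < 1" using True by simp
        then have sub: "cball 0 (sqrt x) \<subseteq> unit_disc"
          using order_le_less_trans by (auto simp del: real_sqrt_lt_1_iff)
        have "emeasure lborel (unit_disc - cball (0::complex) (sqrt x)) = emeasure lborel unit_disc - emeasure lborel (cball (0::complex) (sqrt x))"
          using False by (intro emeasure_Diff) (auto simp: sub emeasure_cball)
        also have "\<dots> = ennreal (pi * (1 - x))"
          using False by (simp add: emeasure_cball emeasure_unit_disc unit_ball_vol_2 ennreal_minus algebra_simps)
        finally have "emeasure lborel (unit_disc \<inter> {z. x < (cmod z)\<^sup>2}) / ennreal pi = ennreal (1 - x)"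
          unfolding eq using True by (simp add: divide_ennreal)
        moreover have "{0..1} \<inter> {x<..} = {x<..1}" using False by auto
        ultimately show ?thesis using True by simp
      next
        case F: False
        have "unit_disc \<inter> {z. x < (cmod z)\<^sup>2} = {}"
        proof -
          have "(cmod z)\<^sup>2 < 1" if "cmod z < 1" for z using that by (simp add: abs_square_less_1)
          then show ?thesis using F by force
        qed
        moreover have "{0..1} \<inter> {x<..} = {}" using F by auto
        ultimately show ?thesis by simp
      qed
    qed
    also have "\<dots> = emeasure (uniform_measure lborel {0..1}) {x<..}"
      by (subst emeasure_uniform_measure) (auto simp: divide_ennreal_def)
    finally show ?thesis .
  qed
qed auto

lemma nn_integral_area_radial:
  assumes [measurable]: "\<psi> \<in> borel_measurable borel"
  shows "(\<integral>\<^sup>+z. \<psi> ((cmod z)\<^sup>2) \<partial>area_measure) = (\<integral>\<^sup>+t. \<psi> t * indicator {0..1} t \<partial>lborel)"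
proof -
  have "(\<integral>\<^sup>+z. \<psi> ((cmod z)\<^sup>2) \<partial>area_measure) = (\<integral>\<^sup>+t. \<psi> t \<partial>distr area_measure borel (\<lambda>z. (cmod z)\<^sup>2))"
    by (subst nn_integral_distr) auto
  also have "\<dots> = (\<integral>\<^sup>+t. \<psi> t * indicator {0..1} t \<partial>lborel)"
    unfolding distr_area_norm_square by (subst nn_integral_uniform_measure) (auto simp: divide_ennreal_def)
  finally show ?thesis .
qed

lemma integral_area_radial:
  fixes \<psi> :: "real \<Rightarrow> real"
  assumes [measurable]: "\<psi> \<in> borel_measurable borel"
  shows "(LINT z|area_measure. \<psi> ((cmod z)\<^sup>2)) = (LINT t|lborel. indicator {0..1} t * \<psi> t)"
proof -
  have "(LINT z|area_measure. \<psi> ((cmod z)\<^sup>2)) = (LINT t|distr area_measure borel (\<lambda>z. (cmod z)\<^sup>2). \<psi> t)"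
    by (subst integral_distr) auto
  also have "\<dots> = (LINT t|density lborel (\<lambda>t. ennreal (indicator {0..1} t)). \<psi> t)"
  proof -
    have "uniform_measure lborel {0..1::real} = density lborel (\<lambda>t. ennreal (indicator {0..1} t))"
      unfolding uniform_measure_def by (intro density_cong) (auto simp: ennreal_indicator divide_ennreal_def)
    then show ?thesis by (simp only: distr_area_norm_square)
  qed
  also have "\<dots> = (LINT t|lborel. indicator {0..1} t * \<psi> t)"
    by (subst integral_density) auto
  finally show ?thesis .
qed

text \<open>The Beta integral B(n + 1, 2), origin of the denominators (n + 1)(n + 2).\<close>

lemma nn_integral_beta: "(\<integral>\<^sup>+t. ennreal ((1 - t) * t ^ n) * indicator {0..1} t \<partial>lborel) = ennreal (1 / (real (n + 1) * real (n + 2)))"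
proof -
  define F where "F t = t ^ (n + 1) / real (n + 1) - t ^ (n + 2) / real (n + 2)" for t :: real
  have "(\<integral>\<^sup>+t. ennreal ((1 - t) * t ^ n) * indicator {0..1} t \<partial>lborel) = ennreal (F 1 - F 0)"
  proof (rule nn_integral_FTC_Icc)
    show "DERIV F t :> (1 - t) * t ^ n" for t
    proof -
      have "DERIV F t :> real (n + 1) * t ^ n / real (n + 1) - real (n + 2) * t ^ (n + 1) / real (n + 2)"
        unfolding F_def by (intro derivative_eq_intros refl) (auto simp del: of_nat_add of_nat_Suc)
      then show ?thesis by (simp add: algebra_simps del: of_nat_add of_nat_Suc)
    qed
  qed auto
  also have "F 1 - F 0 = 1 / (real (n + 1) * real (n + 2))" by (simp add: F_def field_simps)
  finally show ?thesis .
qed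

text \<open>Parseval on each circle removes the mixed terms, and the radial integrals are Beta
  integrals. Values in \<open>ennreal\<close> make the identity hold for infinite integrals too, so
  it can also be used to prove finiteness of the sum.\<close>

lemma nn_integral_area_weighted_square:
  assumes F: "\<And>z. cmod z < 1 \<Longrightarrow> (\<lambda>n. a n * z ^ n) sums F z"
  shows "(\<integral>\<^sup>+z. ennreal ((1 - (cmod z)\<^sup>2) * (cmod (F z))\<^sup>2) \<partial>area_measure)
       = (\<Sum>n. ennreal ((cmod (a n))\<^sup>2 / (real (n + 1) * real (n + 2))))"
proof -
  \<comment> \<open>F is controlled only inside the disc; the series is Borel on the whole
    plane.\<close>
  let ?G = "\<lambda>z. \<Sum>n. a n * z ^ n"
  have abs: "summable (\<lambda>n. cmod (a n) * cmod z ^ n)" if z: "cmod z < 1" for z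
  proof -
    define r where "r = (1 + cmod z) / 2"
    have r: "0 \<le> r" "cmod z < r" "r < 1" using z by (auto simp: r_def)
    have "summable (\<lambda>n. a n * of_real r ^ n)" using F[of "of_real r"] r by (simp add: sums_iff)
    from powser_insidea[OF this, of z] r show ?thesis by (simp add: norm_mult norm_power)
  qed
  have circ: "(\<integral>\<^sup>+\<xi>. ennreal ((cmod (?G (z * \<xi>)))\<^sup>2) \<partial>circle_measure) = (\<Sum>n. ennreal ((cmod (a n))\<^sup>2 * ((cmod z)\<^sup>2) ^ n))"
    if z: "cmod z < 1" for z
  proof -
    have s: "summable (\<lambda>n. cmod (a n * z ^ n))" using abs[OF z] by (simp add: norm_mult norm_power)
    note S = circle_parseval_norm[OF s]
    have G: "?G (z * \<xi>) = (\<Sum>n. (a n * z ^ n) * \<xi> ^ n)" for \<xi> by (simp add: power_mult_distrib mult.assoc)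
    have bd: "cmod (?G (z * \<xi>)) \<le> (\<Sum>n. cmod (a n * z ^ n))" if "cmod \<xi> = 1" for \<xi>
      using summable_norm[of "\<lambda>n. (a n * z ^ n) * \<xi> ^ n"] s that unfolding G by (simp add: norm_mult norm_power)
    have "integrable circle_measure (\<lambda>\<xi>. (cmod (?G (z * \<xi>)))\<^sup>2)"
    proof (rule circle_integrable_bounded)
      show "norm ((cmod (?G (z * \<xi>)))\<^sup>2) \<le> (\<Sum>n. cmod (a n * z ^ n))\<^sup>2" if "cmod \<xi> = 1" for \<xi>
        using power_mono[OF bd[OF that] norm_ge_zero, of 2] by simp
    qed measurable
    then have "(\<integral>\<^sup>+\<xi>. ennreal ((cmod (?G (z * \<xi>)))\<^sup>2) \<partial>circle_measure) = ennreal (LINT \<xi>|circle_measure. (cmod (?G (z * \<xi>)))\<^sup>2)"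
      by (intro nn_integral_eq_integral) simp_all
    also have "(LINT \<xi>|circle_measure. (cmod (?G (z * \<xi>)))\<^sup>2) = (\<Sum>n. (cmod (a n * z ^ n))\<^sup>2)"
      unfolding G by (rule sums_unique[OF S])
    also have "ennreal (\<Sum>n. (cmod (a n * z ^ n))\<^sup>2) = (\<Sum>n. ennreal ((cmod (a n * z ^ n))\<^sup>2))"
      by (rule suminf_ennreal2[symmetric]) (auto intro: sums_summable[OF S])
    also have "(\<lambda>n. (cmod (a n * z ^ n))\<^sup>2) = (\<lambda>n. (cmod (a n))\<^sup>2 * ((cmod z)\<^sup>2) ^ n)"
      by (simp add: norm_mult norm_power power_mult_distrib power_commutes flip: power_mult) (simp add: mult.commute)
    finally show ?thesis .
  qed
  have "(\<integral>\<^sup>+z. ennreal ((1 - (cmod z)\<^sup>2) * (cmod (F z))\<^sup>2) \<partial>area_measure)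
      = (\<integral>\<^sup>+z. ennreal ((1 - (cmod z)\<^sup>2) * (cmod (?G z))\<^sup>2) \<partial>area_measure)"
  proof (rule nn_integral_cong_AE)
    show "AE z in area_measure. ennreal ((1 - (cmod z)\<^sup>2) * (cmod (F z))\<^sup>2) = ennreal ((1 - (cmod z)\<^sup>2) * (cmod (?G z))\<^sup>2)"
      using AE_area
    proof eventually_elim
      case (elim z) show ?case using F[OF elim] by (simp add: sums_iff)
    qed
  qed
  also have "\<dots> = (\<integral>\<^sup>+z. (\<integral>\<^sup>+\<xi>. ennreal ((1 - (cmod (z * \<xi>))\<^sup>2) * (cmod (?G (z * \<xi>)))\<^sup>2) \<partial>circle_measure) \<partial>area_measure)"
    by (rule nn_integral_area_polar) measurable
  also have "\<dots> = (\<integral>\<^sup>+z. (\<Sum>n. ennreal ((cmod (a n))\<^sup>2) * ennreal ((1 - (cmod z)\<^sup>2) * ((cmod z)\<^sup>2) ^ n)) \<partial>area_measure)"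
  proof (rule nn_integral_cong_AE)
    show "AE z in area_measure. (\<integral>\<^sup>+\<xi>. ennreal ((1 - (cmod (z * \<xi>))\<^sup>2) * (cmod (?G (z * \<xi>)))\<^sup>2) \<partial>circle_measure)
        = (\<Sum>n. ennreal ((cmod (a n))\<^sup>2) * ennreal ((1 - (cmod z)\<^sup>2) * ((cmod z)\<^sup>2) ^ n))"
      using AE_area
    proof eventually_elim
      case (elim z)
      have z2: "0 \<le> 1 - (cmod z)\<^sup>2" using elim by (simp add: abs_square_le_1)
      have "(\<integral>\<^sup>+\<xi>. ennreal ((1 - (cmod (z * \<xi>))\<^sup>2) * (cmod (?G (z * \<xi>)))\<^sup>2) \<partial>circle_measure)
          = (\<integral>\<^sup>+\<xi>. ennreal (1 - (cmod z)\<^sup>2) * ennreal ((cmod (?G (z * \<xi>)))\<^sup>2) \<partial>circle_measure)"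
      proof (rule nn_integral_cong_AE)
        show "AE \<xi> in circle_measure. ennreal ((1 - (cmod (z * \<xi>))\<^sup>2) * (cmod (?G (z * \<xi>)))\<^sup>2) = ennreal (1 - (cmod z)\<^sup>2) * ennreal ((cmod (?G (z * \<xi>)))\<^sup>2)"
          using AE_circle by eventually_elim (use z2 in \<open>simp add: norm_mult ennreal_mult\<close>)
      qed
      also have "\<dots> = ennreal (1 - (cmod z)\<^sup>2) * (\<integral>\<^sup>+\<xi>. ennreal ((cmod (?G (z * \<xi>)))\<^sup>2) \<partial>circle_measure)"
        by (rule nn_integral_cmult) measurable
      also have "\<dots> = (\<Sum>n. ennreal (1 - (cmod z)\<^sup>2) * ennreal ((cmod (a n))\<^sup>2 * ((cmod z)\<^sup>2) ^ n))"
        unfolding circ[OF elim] by (rule ennreal_suminf_cmult[symmetric])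
      also have "(\<lambda>n. ennreal (1 - (cmod z)\<^sup>2) * ennreal ((cmod (a n))\<^sup>2 * ((cmod z)\<^sup>2) ^ n)) = (\<lambda>n. ennreal ((cmod (a n))\<^sup>2) * ennreal ((1 - (cmod z)\<^sup>2) * ((cmod z)\<^sup>2) ^ n))"
        using z2 by (intro ext) (simp add: ennreal_mult[symmetric] mult_ac)
      finally show ?case .
    qed
  qed
  also have "\<dots> = (\<Sum>n. \<integral>\<^sup>+z. ennreal ((cmod (a n))\<^sup>2) * ennreal ((1 - (cmod z)\<^sup>2) * ((cmod z)\<^sup>2) ^ n) \<partial>area_measure)"
    by (rule nn_integral_suminf) measurable
  also have "\<dots> = (\<Sum>n. ennreal ((cmod (a n))\<^sup>2) * (\<integral>\<^sup>+z. ennreal ((1 - (cmod z)\<^sup>2) * ((cmod z)\<^sup>2) ^ n) \<partial>area_measure))"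
    by (intro suminf_cong nn_integral_cmult) measurable
  also have "\<dots> = (\<Sum>n. ennreal ((cmod (a n))\<^sup>2) * ennreal (1 / (real (n + 1) * real (n + 2))))"
    unfolding nn_integral_beta[symmetric]
    by (intro suminf_cong arg_cong2[where f="(*)"] refl nn_integral_area_radial[of "\<lambda>t. ennreal ((1 - t) * t ^ _)"]) measurable
  also have "\<dots> = (\<Sum>n. ennreal ((cmod (a n))\<^sup>2 / (real (n + 1) * real (n + 2))))"
    by (intro suminf_cong) (simp add: ennreal_mult[symmetric] del: of_nat_add)
  finally show ?thesis .
qed

section \<open>The local Douglas formula on the circle\<close>

text \<open>Here t k will be g_k \<zeta>^(k+1), up to an additive constant in one direction, and T
  its partial sums. M (n + 1) has the modulus of the n-th coefficient of f' / (\<zeta> - z), and e n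
  is the n-th term of the Dirichlet integral.\<close>

context
  fixes t :: "nat \<Rightarrow> complex" and T M :: "nat \<Rightarrow> complex" and e :: "nat \<Rightarrow> real"
  assumes T: "\<And>N. T N = (\<Sum>k<N. t k)"
    and M: "\<And>N. M N = (\<Sum>k<N. of_nat (Suc k) * (t k - t (Suc k)))"
    and e: "\<And>n. e n = (cmod (M (Suc n)))\<^sup>2 / (real (Suc n) * real (Suc (Suc n)))"
begin

lemma abel_M: "M N = T N - of_nat N * t N"
  by (induction N) (simp_all add: M T algebra_simps)

text \<open>The quotients are the increments of the arithmetic means T n / n, which is why these
  means govern convergence below.\<close>

lemma abel_quotient: "M (Suc n) / (of_nat (Suc n) * of_nat (Suc (Suc n))) = T (Suc n) / of_nat (Suc n) - T (Suc (Suc n)) / of_nat (Suc (Suc n))"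
proof -
  have nz: "of_nat (Suc n) \<noteq> (0::complex)" "of_nat (Suc (Suc n)) \<noteq> (0::complex)" by (rule of_nat_neq_0)+
  have q: "(b * x - a * y) / (a * b) = x / a - y / b" if "a \<noteq> 0" "b \<noteq> 0" for a b x y :: complex
    using that by (simp add: field_simps)
  have "T (Suc (Suc n)) = T (Suc n) + t (Suc n)" by (simp add: T)
  then have "M (Suc n) = of_nat (Suc (Suc n)) * T (Suc n) - of_nat (Suc n) * T (Suc (Suc n))"
    by (simp add: abel_M algebra_simps)
  then show ?thesis by (simp only: q[OF nz])
qed

text \<open>The telescoping identity. Expanding |T - x t|^2 and |T + t|^2 with x = n + 1, the mixed
  terms T \<bullet> t cancel.\<close>

lemma abel_energy: "e n = (cmod (t (Suc n)))\<^sup>2 + (cmod (T (Suc n)))\<^sup>2 / real (Suc n) - (cmod (T (Suc (Suc n))))\<^sup>2 / real (Suc (Suc n))"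
proof -
  define x where "x = real (Suc n)"
  have x: "x > 0" by (simp add: x_def)
  have T2: "T (Suc (Suc n)) = T (Suc n) + t (Suc n)" by (simp add: T)
  have Mx: "M (Suc n) = T (Suc n) - of_real x * t (Suc n)" by (simp add: abel_M x_def)
  have n: "(cmod (a + of_real r * b))\<^sup>2 = (cmod a)\<^sup>2 + r\<^sup>2 * (cmod b)\<^sup>2 + 2 * r * (a \<bullet> b)" for a b :: complex and r :: real
    unfolding cmod_power2 by (simp add: inner_complex_def power2_eq_square algebra_simps)
  have m: "(cmod (M (Suc n)))\<^sup>2 = (cmod (T (Suc n)))\<^sup>2 + x\<^sup>2 * (cmod (t (Suc n)))\<^sup>2 - 2 * x * (T (Suc n) \<bullet> t (Suc n))"
    unfolding Mx using n[of "T (Suc n)" "- x" "t (Suc n)"] by simp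
  have t2: "(cmod (T (Suc (Suc n))))\<^sup>2 = (cmod (T (Suc n)))\<^sup>2 + (cmod (t (Suc n)))\<^sup>2 + 2 * (T (Suc n) \<bullet> t (Suc n))"
    unfolding T2 using n[of "T (Suc n)" 1 "t (Suc n)"] by simp
  have Sx: "real (Suc (Suc n)) = x + 1" by (simp add: x_def)
  have "e n = ((cmod (T (Suc n)))\<^sup>2 + x\<^sup>2 * (cmod (t (Suc n)))\<^sup>2 - 2 * x * (T (Suc n) \<bullet> t (Suc n))) / (x * (x + 1))"
    unfolding e m Sx by (simp only: x_def[symmetric])
  also have "\<dots> = (cmod (t (Suc n)))\<^sup>2 + (cmod (T (Suc n)))\<^sup>2 / x - ((cmod (T (Suc n)))\<^sup>2 + (cmod (t (Suc n)))\<^sup>2 + 2 * (T (Suc n) \<bullet> t (Suc n))) / (x + 1)"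
    using x by (simp add: field_simps power2_eq_square)
  finally show ?thesis unfolding t2 Sx by (simp only: x_def[symmetric])
qed

lemma abel_energy_sum: "(\<Sum>n<K. e n) = (\<Sum>k<Suc K. (cmod (t k))\<^sup>2) - (cmod (T (Suc K)))\<^sup>2 / real (Suc K)"
proof (induction K)
  case 0 then show ?case by (simp add: T)
next
  case (Suc K) then show ?case by (simp add: abel_energy del: of_nat_Suc)
qed

lemma abel_energy_nonneg: "e n \<ge> 0"
  by (simp add: e)

lemma inv_prod_sums: "(\<lambda>n. 1 / (real (Suc n) * real (Suc (Suc n)))) sums 1"
proof -
  have "(\<lambda>n. 1 / real (Suc n) - 1 / real (Suc (Suc n))) sums (1 / real (Suc 0) - 0)"
    using telescope_sums'[OF LIMSEQ_inverse_real_of_nat] by (simp add: inverse_eq_divide)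
  moreover have "1 / real (Suc n) - 1 / real (Suc (Suc n)) = 1 / (real (Suc n) * real (Suc (Suc n)))" for n
    by (simp add: field_simps)
  ultimately show ?thesis by simp
qed

lemma abel_quotient_norm: "cmod (T (Suc n) / of_nat (Suc n) - T (Suc (Suc n)) / of_nat (Suc (Suc n))) = sqrt (e n) * sqrt (1 / (real (Suc n) * real (Suc (Suc n))))"
proof -
  have "sqrt (e n) * sqrt (1 / (real (Suc n) * real (Suc (Suc n)))) = sqrt ((cmod (M (Suc n)) / (real (Suc n) * real (Suc (Suc n))))\<^sup>2)"
    unfolding real_sqrt_mult[symmetric] e by (simp only: power2_eq_square times_divide_times_eq mult_1_right)
  also have "\<dots> = cmod (M (Suc n)) / (real (Suc n) * real (Suc (Suc n)))" by simp
  also have "\<dots> = cmod (M (Suc n) / (of_nat (Suc n) * of_nat (Suc (Suc n))))"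
    by (simp only: norm_divide norm_mult norm_of_nat)
  finally show ?thesis by (simp only: abel_quotient)
qed

text \<open>This removes the boundary term of the telescoped sum. By Cauchy--Schwarz the means q
  satisfy |q n - q (n + k)|^2 \<le> \<open>tail n\<close> / (n + 1); letting k tend to infinity, (n
  + 1) |q n|^2 is at most the tail of the energy.\<close>

lemma mean_tendsto_zero_imp:
  assumes se: "summable e" and lim: "(\<lambda>n. T (Suc n) / of_nat (Suc n)) \<longlonglongrightarrow> 0"
  shows "(\<lambda>n. (cmod (T (Suc n)))\<^sup>2 / real (Suc n)) \<longlonglongrightarrow> 0"
proof -
  define q where "q n = T (Suc n) / of_nat (Suc n)" for n
  define tail where "tail n = suminf e - (\<Sum>j<n. e j)" for n
  have diffq: "cmod (q j - q (Suc j)) = sqrt (e j) * sqrt (1 / (real (Suc j) * real (Suc (Suc j))))" for j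
    unfolding q_def by (rule abel_quotient_norm)
  have le: "(cmod (q n - q (n + k)))\<^sup>2 \<le> tail n * (1 / real (Suc n))" for n k
  proof -
    have "q n - q (n + k) = (\<Sum>j\<in>{n..<n+k}. q j - q (Suc j))"
      using sum_Suc_diff'[of n "n + k" "\<lambda>j. - q j"] by (simp add: algebra_simps)
    then have "cmod (q n - q (n + k)) \<le> (\<Sum>j\<in>{n..<n+k}. sqrt (e j) * sqrt (1 / (real (Suc j) * real (Suc (Suc j)))))"
      unfolding diffq[symmetric] by (simp only: norm_sum)
    then have "(cmod (q n - q (n + k)))\<^sup>2 \<le> (\<Sum>j\<in>{n..<n+k}. sqrt (e j) * sqrt (1 / (real (Suc j) * real (Suc (Suc j)))))\<^sup>2"
      by (intro power_mono) auto
    also have "\<dots> \<le> (\<Sum>j\<in>{n..<n+k}. (sqrt (e j))\<^sup>2) * (\<Sum>j\<in>{n..<n+k}. (sqrt (1 / (real (Suc j) * real (Suc (Suc j)))))\<^sup>2)"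
      by (rule Cauchy_Schwarz_ineq_sum)
    also have "\<dots> \<le> tail n * (1 / real (Suc n))"
    proof (rule mult_mono)
      have "(\<Sum>j\<in>{n..<n+k}. (sqrt (e j))\<^sup>2) = (\<Sum>j<n+k. e j) - (\<Sum>j<n. e j)"
        using abel_energy_nonneg sum_diff_nat_ivl[of 0 n "n + k" e] by (simp add: lessThan_atLeast0)
      also have "\<dots> \<le> tail n" unfolding tail_def using sum_le_suminf[OF se, of "{..<n+k}"] abel_energy_nonneg by simp
      finally show "(\<Sum>j\<in>{n..<n+k}. (sqrt (e j))\<^sup>2) \<le> tail n" .
      have "(\<Sum>j\<in>{n..<n+k}. (sqrt (1 / (real (Suc j) * real (Suc (Suc j)))))\<^sup>2) = (\<Sum>j\<in>{n..<n+k}. 1 / real (Suc j) - 1 / real (Suc (Suc j)))"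
        by (intro sum.cong refl) (simp add: field_simps)
      also have "\<dots> = 1 / real (Suc n) - 1 / real (Suc (n + k))"
        using sum_Suc_diff'[of n "n + k" "\<lambda>j. - (1 / real (Suc j))"] by simp
      also have "\<dots> \<le> 1 / real (Suc n)" by simp
      finally show "(\<Sum>j\<in>{n..<n+k}. (sqrt (1 / (real (Suc j) * real (Suc (Suc j)))))\<^sup>2) \<le> 1 / real (Suc n)" .
      show "0 \<le> tail n" unfolding tail_def using sum_le_suminf[OF se, of "{..<n}"] abel_energy_nonneg by simp
      show "0 \<le> (\<Sum>j\<in>{n..<n+k}. (sqrt (1 / (real (Suc j) * real (Suc (Suc j)))))\<^sup>2)" by (intro sum_nonneg) simp
    qed
    finally show ?thesis .
  qed
  have "(cmod (q n))\<^sup>2 \<le> tail n * (1 / real (Suc n))" for n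
  proof (rule LIMSEQ_le_const2)
    have "(\<lambda>k. q (n + k)) \<longlonglongrightarrow> 0" using LIMSEQ_ignore_initial_segment[OF lim, of n] by (simp add: q_def add.commute)
    then have "(\<lambda>k. (cmod (q n - q (n + k)))\<^sup>2) \<longlonglongrightarrow> (cmod (q n - 0))\<^sup>2"
      by (intro tendsto_power tendsto_norm tendsto_diff tendsto_const)
    then show "(\<lambda>k. (cmod (q n - q (n + k)))\<^sup>2) \<longlonglongrightarrow> (cmod (q n))\<^sup>2" by simp
  qed (use le in blast)
  then have bound: "(cmod (T (Suc n)))\<^sup>2 / real (Suc n) \<le> tail n" for n
  proof -
    have "(cmod (T (Suc n)))\<^sup>2 / real (Suc n) = (cmod (q n))\<^sup>2 * real (Suc n)"
      by (simp add: q_def norm_divide power_divide power2_eq_square del: of_nat_Suc)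
    also have "\<dots> \<le> tail n * (1 / real (Suc n)) * real (Suc n)"
      using \<open>\<And>n. (cmod (q n))\<^sup>2 \<le> tail n * (1 / real (Suc n))\<close> by (intro mult_right_mono) auto
    also have "\<dots> = tail n" by simp
    finally show ?thesis .
  qed
  have "tail \<longlonglongrightarrow> suminf e - suminf e"
    unfolding tail_def by (intro tendsto_diff tendsto_const summable_LIMSEQ se)
  then have lim0: "tail \<longlonglongrightarrow> 0" by simp
  show ?thesis
  proof (rule tendsto_sandwich[OF _ _ tendsto_const lim0])
    show "\<forall>\<^sub>F n in sequentially. 0 \<le> (cmod (T (Suc n)))\<^sup>2 / real (Suc n)" by simp
    show "\<forall>\<^sub>F n in sequentially. (cmod (T (Suc n)))\<^sup>2 / real (Suc n) \<le> tail n"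
      by (rule always_eventually, rule allI, rule bound)
  qed
qed

lemma abel_energy_sums:
  assumes "summable e" "(\<lambda>n. T (Suc n) / of_nat (Suc n)) \<longlonglongrightarrow> 0"
  shows "(\<lambda>k. (cmod (t k))\<^sup>2) sums suminf e"
proof -
  have "(\<lambda>K. (\<Sum>n<K. e n) + (cmod (T (Suc K)))\<^sup>2 / real (Suc K)) \<longlonglongrightarrow> suminf e + 0"
    by (intro tendsto_add summable_LIMSEQ mean_tendsto_zero_imp assms)
  then have "(\<lambda>K. \<Sum>k<Suc K. (cmod (t k))\<^sup>2) \<longlonglongrightarrow> suminf e"
    unfolding abel_energy_sum by (simp del: sum.lessThan_Suc of_nat_Suc)
  then show ?thesis unfolding sums_def by (rule LIMSEQ_imp_Suc)
qed

text \<open>For square-summable t the partial sums of e stay bounded because the boundary term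
  enters with a minus sign, and the means vanish in the limit because Cauchy--Schwarz bounds T (n +
  1) by a multiple of the root of n + 1.\<close>

lemma energy_of_l2:
  assumes "summable (\<lambda>k. (cmod (t k))\<^sup>2)"
  shows "e sums (\<Sum>k. (cmod (t k))\<^sup>2)"
proof -
  let ?S = "\<Sum>k. (cmod (t k))\<^sup>2"
  have part: "(\<Sum>k<N. (cmod (t k))\<^sup>2) \<le> ?S" for N by (rule sum_le_suminf[OF assms]) auto
  have se: "summable e"
  proof (rule bounded_imp_summable[where B="?S"])
    show "(\<Sum>k\<le>n. e k) \<le> ?S" for n
    proof -
      have "(\<Sum>k\<le>n. e k) = (\<Sum>k<Suc n. e k)" by (simp only: lessThan_Suc_atMost)
      also have "\<dots> = (\<Sum>k<Suc (Suc n). (cmod (t k))\<^sup>2) - (cmod (T (Suc (Suc n))))\<^sup>2 / real (Suc (Suc n))" by (rule abel_energy_sum)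
      also have "\<dots> \<le> (\<Sum>k<Suc (Suc n). (cmod (t k))\<^sup>2)" by (simp del: sum.lessThan_Suc of_nat_Suc)
      finally show ?thesis using part order_trans by blast
    qed
  qed (rule abel_energy_nonneg)
  have "(\<lambda>n. T (Suc n) / of_nat (Suc n)) \<longlonglongrightarrow> 0"
  proof (rule Lim_null_comparison)
    show "\<forall>\<^sub>F n in sequentially. norm (T (Suc n) / of_nat (Suc n)) \<le> sqrt (?S * (1 / real (Suc n)))"
    proof (intro always_eventually allI)
      fix n
      have "(cmod (T (Suc n)))\<^sup>2 \<le> (\<Sum>k<Suc n. cmod (t k) * 1)\<^sup>2"
        unfolding T by (intro power_mono) (auto simp del: sum.lessThan_Suc intro: norm_sum)
      also have "\<dots> \<le> (\<Sum>k<Suc n. (cmod (t k))\<^sup>2) * (\<Sum>k<Suc n. 1\<^sup>2)" by (rule Cauchy_Schwarz_ineq_sum)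
      also have "\<dots> \<le> ?S * real (Suc n)" using part[of "Suc n"] by (intro mult_mono) (auto simp del: sum.lessThan_Suc intro: suminf_nonneg assms)
      finally have "(cmod (T (Suc n)))\<^sup>2 / (real (Suc n))\<^sup>2 \<le> ?S * real (Suc n) / (real (Suc n))\<^sup>2"
        by (rule divide_right_mono) simp
      then have "(cmod (T (Suc n) / of_nat (Suc n)))\<^sup>2 \<le> ?S * (1 / real (Suc n))"
        by (simp add: norm_divide power_divide power2_eq_square del: of_nat_Suc)
      then show "norm (T (Suc n) / of_nat (Suc n)) \<le> sqrt (?S * (1 / real (Suc n)))" by (rule real_le_rsqrt)
    qed
    have "(\<lambda>n. ?S * (1 / real (Suc n))) \<longlonglongrightarrow> ?S * 0"
      using LIMSEQ_inverse_real_of_nat by (intro tendsto_mult tendsto_const) (simp only: inverse_eq_divide)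
    then have "(\<lambda>n. sqrt (?S * (1 / real (Suc n)))) \<longlonglongrightarrow> sqrt (?S * 0)" by (rule tendsto_real_sqrt)
    then show "(\<lambda>n. sqrt (?S * (1 / real (Suc n)))) \<longlonglongrightarrow> 0" by (simp only: mult_zero_right real_sqrt_zero)
  qed
  from abel_energy_sums[OF se this] have "suminf e = ?S" by (simp add: sums_iff)
  then show ?thesis using summable_sums[OF se] by simp
qed

text \<open>Finite energy alone suffices: an increment of the means is the product of the roots of e
  n and 1 / ((n + 1)(n + 2)), hence at most the sum of these two summable quantities.\<close>

lemma mean_converges:
  assumes "summable e"
  shows "convergent (\<lambda>n. T (Suc n) / of_nat (Suc n))"
proof -
  define q where "q n = T (Suc n) / of_nat (Suc n)" for n
  have "summable (\<lambda>n. e n + 1 / (real (Suc n) * real (Suc (Suc n))))"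
    by (intro summable_add assms sums_summable[OF inv_prod_sums])
  then have "summable (\<lambda>n. q n - q (Suc n))"
  proof (rule summable_comparison_test'[where N=0])
    show "norm (q n - q (Suc n)) \<le> e n + 1 / (real (Suc n) * real (Suc (Suc n)))" for n
    proof -
      define a where "a = sqrt (e n)"
      define b where "b = sqrt (1 / (real (Suc n) * real (Suc (Suc n))))"
      have ab: "a\<^sup>2 = e n" "b\<^sup>2 = 1 / (real (Suc n) * real (Suc (Suc n)))" "0 \<le> a * b"
        by (simp_all add: a_def b_def abel_energy_nonneg)
      have "norm (q n - q (Suc n)) = a * b" unfolding q_def a_def b_def by (rule abel_quotient_norm)
      also have "\<dots> \<le> a\<^sup>2 + b\<^sup>2" using sum_squares_bound[of a b] ab(3) by linarith
      finally show ?thesis unfolding ab .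
    qed
  qed
  then have "convergent (\<lambda>n. \<Sum>k<n. q k - q (Suc k))" by (simp only: summable_iff_convergent)
  moreover have "(\<Sum>k<n. q k - q (Suc k)) = q 0 - q n" for n by (rule sum_lessThan_telescope')
  ultimately have "convergent (\<lambda>n. q 0 - q n)" by simp
  then obtain L where "(\<lambda>n. q 0 - q n) \<longlonglongrightarrow> L" by (auto simp: convergent_def)
  then have "(\<lambda>n. q 0 - (q 0 - q n)) \<longlonglongrightarrow> q 0 - L" by (intro tendsto_diff tendsto_const)
  then show ?thesis unfolding q_def[symmetric] convergent_def by auto
qed

end

section \<open>Taylor series of the derivative and the Dirichlet integral for |\<zeta>| = 1\<close>

lemma power_series_abs_summable:
  fixes a :: "nat \<Rightarrow> complex"
  assumes "\<And>z. cmod z < 1 \<Longrightarrow> summable (\<lambda>n. a n * z ^ n)" and z: "cmod z < 1"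
  shows "summable (\<lambda>n. cmod (a n * z ^ n))"
proof -
  define r where "r = (1 + cmod z) / 2"
  have r: "0 \<le> r" "cmod z < r" "r < 1" using z by (auto simp: r_def)
  have "summable (\<lambda>n. a n * of_real r ^ n)" using assms(1)[of "of_real r"] r by simp
  from powser_insidea[OF this, of z] r show ?thesis by simp
qed

lemma Hol_deriv_sums:
  assumes "f \<in> Hol" "cmod z < 1"
  shows "(\<lambda>n. of_nat (Suc n) * taylor_coeff f (Suc n) * z ^ n) sums deriv f z"
proof -
  have "deriv f holomorphic_on ball 0 1" using assms by (intro holomorphic_deriv) (auto simp: Hol_def)
  then have "(\<lambda>n. (deriv ^^ n) (deriv f) 0 / fact n * (z - 0) ^ n) sums deriv f z"
    by (rule holomorphic_power_series) (use assms in simp)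
  moreover have "(deriv ^^ n) (deriv f) 0 / fact n = of_nat (Suc n) * taylor_coeff f (Suc n)" for n
  proof -
    have "(deriv ^^ n) (deriv f) = (deriv ^^ Suc n) f" by (simp only: funpow_Suc_right o_apply)
    then show ?thesis by (simp add: taylor_coeff_def fact_Suc del: funpow.simps of_nat_Suc)
  qed
  ultimately show ?thesis by simp
qed

text \<open>F collects the coefficients of f' / (\<zeta> - z), the Cauchy product with a geometric
  series. Multiplying F n by \<zeta>^(n+2) gives M (n + 1) without changing the modulus.\<close>

lemma dirichlet_integral_circle:
  assumes \<zeta>: "cmod \<zeta> = 1" and f: "f \<in> Hol"
  defines "M \<equiv> \<lambda>N. \<Sum>k<N. of_nat (Suc k) * (taylor_coeff f (Suc k) * \<zeta> ^ Suc k)"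
  shows "dirichlet_integral \<zeta> f = (\<Sum>n. ennreal ((cmod (M (Suc n)))\<^sup>2 / (real (Suc n) * real (Suc (Suc n)))))"
proof -
  define a where "a n = of_nat (Suc n) * taylor_coeff f (Suc n)" for n
  define F where "F n = (\<Sum>i\<le>n. a i * (inverse \<zeta> * inverse \<zeta> ^ (n - i)))" for n
  have \<zeta>0: "\<zeta> \<noteq> 0" using \<zeta> by auto
  have as: "(\<lambda>n. a n * z ^ n) sums deriv f z" if "cmod z < 1" for z
    unfolding a_def by (rule Hol_deriv_sums[OF f that])
  have Fs: "(\<lambda>n. F n * z ^ n) sums (deriv f z / (\<zeta> - z))" if z: "cmod z < 1" for z
  proof -
    have w: "cmod (z / \<zeta>) < 1" using z \<zeta> by (simp add: norm_divide)
    have b: "(\<lambda>n. inverse \<zeta> * (z / \<zeta>) ^ n) sums (inverse \<zeta> * (1 / (1 - z / \<zeta>)))"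
      by (intro sums_mult geometric_sums w)
    have bs: "summable (\<lambda>n. norm (inverse \<zeta> * (z / \<zeta>) ^ n))"
      using w by (simp add: norm_mult norm_power norm_divide summable_mult summable_geometric)
    have aa: "summable (\<lambda>n. norm (a n * z ^ n))"
      by (rule power_series_abs_summable[OF _ z]) (use as in \<open>auto simp: sums_iff\<close>)
    have "(\<lambda>k. \<Sum>i\<le>k. (a i * z ^ i) * (inverse \<zeta> * (z / \<zeta>) ^ (k - i))) sums ((\<Sum>k. a k * z ^ k) * (\<Sum>k. inverse \<zeta> * (z / \<zeta>) ^ k))"
      by (rule Cauchy_product_sums[OF aa bs])
    moreover have "(\<Sum>i\<le>k. (a i * z ^ i) * (inverse \<zeta> * (z / \<zeta>) ^ (k - i))) = F k * z ^ k" for k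
      unfolding F_def sum_distrib_right
    proof (rule sum.cong[OF refl])
      fix i assume "i \<in> {..k}"
      then have "z ^ k = z ^ i * z ^ (k - i)" by (simp flip: power_add)
      then show "(a i * z ^ i) * (inverse \<zeta> * (z / \<zeta>) ^ (k - i)) = a i * (inverse \<zeta> * inverse \<zeta> ^ (k - i)) * z ^ k"
        by (simp add: power_divide divide_inverse power_inverse power_mult_distrib mult_ac)
    qed
    moreover have "(\<Sum>k. a k * z ^ k) * (\<Sum>k. inverse \<zeta> * (z / \<zeta>) ^ k) = deriv f z / (\<zeta> - z)"
    proof -
      have "\<zeta> \<noteq> z" using z \<zeta> by auto
      then have "inverse \<zeta> * (1 / (1 - z / \<zeta>)) = 1 / (\<zeta> - z)" using \<zeta>0 by (simp add: field_simps)
      then show ?thesis using as[OF z] b by (simp add: sums_iff)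
    qed
    ultimately show ?thesis by simp
  qed
  have FM: "cmod (F n) = cmod (M (Suc n))" for n
  proof -
    have "F n * \<zeta> ^ Suc (Suc n) = M (Suc n)"
      unfolding F_def M_def sum_distrib_right lessThan_Suc_atMost
    proof (rule sum.cong[OF refl])
      fix i assume "i \<in> {..n}"
      then have "\<zeta> ^ Suc (Suc n) = \<zeta> ^ Suc i * (\<zeta> * \<zeta> ^ (n - i))" by (simp flip: power_add power_Suc)
      then show "a i * (inverse \<zeta> * inverse \<zeta> ^ (n - i)) * \<zeta> ^ Suc (Suc n) = of_nat (Suc i) * (taylor_coeff f (Suc i) * \<zeta> ^ Suc i)"
        using \<zeta>0 by (simp only: a_def) (simp add: field_simps)
    qed
    then have "cmod (F n * \<zeta> ^ Suc (Suc n)) = cmod (M (Suc n))" by simp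
    then show ?thesis by (simp only: norm_mult norm_power \<zeta> power_one mult_1_right)
  qed
  have "dirichlet_integral \<zeta> f = (\<integral>\<^sup>+z. ennreal ((1 - (cmod z)\<^sup>2) * (cmod (deriv f z / (\<zeta> - z)))\<^sup>2) \<partial>area_measure)"
    unfolding dirichlet_integral_def using \<zeta>
    by (simp add: norm_divide power_divide)
  also have "\<dots> = (\<Sum>n. ennreal ((cmod (F n))\<^sup>2 / (real (n + 1) * real (n + 2))))"
    by (rule nn_integral_area_weighted_square[OF Fs])
  also have "\<dots> = (\<Sum>n. ennreal ((cmod (M (Suc n)))\<^sup>2 / (real (Suc n) * real (Suc (Suc n)))))"
    by (simp add: FM)
  finally show ?thesis .
qed

text \<open>Rotating the coefficients by powers of \<zeta> reduces the graph relation to the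
  difference equation h k = t k - t (k + 1), to which the summation by parts applies.\<close>

lemma local_douglas_circle:
  assumes \<zeta>: "cmod \<zeta> = 1" and f: "f \<in> Hol"
  shows "(\<And>n. taylor_coeff f (Suc n) = coef g n - \<zeta> * coef g (Suc n)) \<Longrightarrow> dirichlet_integral \<zeta> f = ennreal ((norm g)\<^sup>2)"
    and "dirichlet_integral \<zeta> f < \<infinity> \<Longrightarrow> \<exists>g. \<forall>n. taylor_coeff f (Suc n) = coef g n - \<zeta> * coef g (Suc n)"
proof -
  define h where "h k = taylor_coeff f (Suc k) * \<zeta> ^ Suc k" for k
  define M where "M N = (\<Sum>k<N. of_nat (Suc k) * h k)" for N
  define e where "e n = (cmod (M (Suc n)))\<^sup>2 / (real (Suc n) * real (Suc (Suc n)))" for n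
  have \<zeta>0: "\<zeta> \<noteq> 0" using \<zeta> by auto
  have e0: "e n \<ge> 0" for n by (simp add: e_def)
  have D: "dirichlet_integral \<zeta> f = (\<Sum>n. ennreal (e n))"
    unfolding e_def M_def h_def by (rule dirichlet_integral_circle[OF \<zeta> f])
  show "dirichlet_integral \<zeta> f = ennreal ((norm g)\<^sup>2)" if g: "\<And>n. taylor_coeff f (Suc n) = coef g n - \<zeta> * coef g (Suc n)"
  proof -
    define t where "t k = coef g k * \<zeta> ^ Suc k" for k
    have ht: "h k = t k - t (Suc k)" for k by (simp add: h_def t_def g algebra_simps)
    have M': "M N = (\<Sum>k<N. of_nat (Suc k) * (t k - t (Suc k)))" for N by (simp add: M_def ht)
    have nt: "cmod (t k) = cmod (coef g k)" for k by (simp add: t_def norm_mult norm_power \<zeta>)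
    have "e sums (\<Sum>k. (cmod (t k))\<^sup>2)"
      by (rule energy_of_l2[OF refl M' e_def]) (simp add: nt summable_coef)
    then have "e sums (norm g)\<^sup>2" by (simp add: nt l2_norm_square)
    then show ?thesis unfolding D using e0 by (simp add: sums_iff suminf_ennreal2)
  qed
  show "\<exists>g. \<forall>n. taylor_coeff f (Suc n) = coef g n - \<zeta> * coef g (Suc n)" if fin: "dirichlet_integral \<zeta> f < \<infinity>"
  proof -
    have se: "summable e" using fin e0 unfolding D by (intro summable_suminf_not_top) auto
    \<comment> \<open>The differences of t are prescribed, so an additive constant is free.
      Square-summable t has means tending to 0, and this dictates which constant to
      subtract.\<close>
    define t where "t k = - (\<Sum>j<k. h j)" for k
    have ht: "h k = t k - t (Suc k)" for k by (simp add: t_def)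
    have M': "M N = (\<Sum>k<N. of_nat (Suc k) * (t k - t (Suc k)))" for N unfolding M_def ht[symmetric] ..
    \<comment> \<open>In the sense of Cesaro summation, L is f(0) - f(\<zeta>).\<close>
    obtain L where L: "(\<lambda>n. (\<Sum>k<Suc n. t k) / of_nat (Suc n)) \<longlonglongrightarrow> L"
      using mean_converges[OF refl M' e_def se] by (auto simp: convergent_def)
    define t' where "t' k = t k - L" for k
    have M'': "M N = (\<Sum>k<N. of_nat (Suc k) * (t' k - t' (Suc k)))" for N unfolding M' by (simp add: t'_def)
    have "(\<lambda>n. (\<Sum>k<Suc n. t' k) / of_nat (Suc n)) \<longlonglongrightarrow> 0"
    proof -
      have "(\<Sum>k<Suc n. t' k) / of_nat (Suc n) = (\<Sum>k<Suc n. t k) / of_nat (Suc n) - L" for n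
        unfolding t'_def sum_subtractf by (simp add: diff_divide_distrib del: sum.lessThan_Suc of_nat_Suc)
      moreover have "(\<lambda>n. (\<Sum>k<Suc n. t k) / of_nat (Suc n) - L) \<longlonglongrightarrow> L - L" by (intro tendsto_diff L tendsto_const)
      ultimately show ?thesis by (simp del: sum.lessThan_Suc of_nat_Suc)
    qed
    from abel_energy_sums[OF refl M'' e_def se this]
    have st: "summable (\<lambda>k. (cmod (t' k))\<^sup>2)" by (simp add: sums_iff)
    have cg: "coef (Abs_l2 (\<lambda>k. t' k / \<zeta> ^ Suc k)) = (\<lambda>k. t' k / \<zeta> ^ Suc k)"
      using st by (intro coef_Abs_l2) (simp add: norm_divide norm_mult norm_power \<zeta>)
    have tc: "taylor_coeff f (Suc n) = t' n / \<zeta> ^ Suc n - \<zeta> * (t' (Suc n) / \<zeta> ^ Suc (Suc n))" for n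
    proof -
      have "taylor_coeff f (Suc n) = h n / \<zeta> ^ Suc n" using \<zeta>0 by (simp add: h_def)
      also have "\<dots> = (t' n - t' (Suc n)) / \<zeta> ^ Suc n" by (simp add: ht t'_def)
      finally show ?thesis using \<zeta>0 by (simp add: field_simps)
    qed
    show ?thesis
      by (rule exI[of _ "Abs_l2 (\<lambda>k. t' k / \<zeta> ^ Suc k)"], unfold cg, intro allI tc)
  qed
qed

section \<open>The local Douglas formula in the disc\<close>

text \<open>The Green function of the disc with pole \<zeta>, up to normalisation. At z = \<zeta>
  the quotient by 0 and then ln 0 make it 0 instead of infinite, a null set for area.\<close>

definition green_weight :: "complex \<Rightarrow> complex \<Rightarrow> real" where
  "green_weight \<zeta> z = ln (cmod ((1 - cnj \<zeta> * z) / (\<zeta> - z)))"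

lemma green_weight_measurable [measurable]: "green_weight \<zeta> \<in> borel_measurable borel"
  unfolding green_weight_def by measurable

lemma cmod_one_minus_square:
  "(cmod (1 - cnj \<zeta> * z))\<^sup>2 - (cmod (\<zeta> - z))\<^sup>2 = (1 - (cmod \<zeta>)\<^sup>2) * (1 - (cmod z)\<^sup>2)"
  unfolding cmod_power2 by (simp add: power2_eq_square algebra_simps)

text \<open>With w the pseudohyperbolic distance, - ln w \<ge> 1 - w \<ge> (1 - w^2) / 2, while 1 -
  w^2 = (1 - |\<zeta>|^2)(1 - |z|^2) / |1 - cnj \<zeta> z|^2 and the denominator is at most 4; hence
  the 8. The bound compares the two kinds of Dirichlet weight.\<close>

lemma green_weight_lower:
  assumes \<zeta>: "cmod \<zeta> < 1" and z: "cmod z < 1"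
  shows "green_weight \<zeta> z \<ge> 0"
    and "z \<noteq> \<zeta> \<Longrightarrow> green_weight \<zeta> z \<ge> (1 - (cmod \<zeta>)\<^sup>2) * (1 - (cmod z)\<^sup>2) / 8"
proof -
  let ?u = "cmod (1 - cnj \<zeta> * z)" and ?v = "cmod (\<zeta> - z)"
  have nn: "0 \<le> (1 - (cmod \<zeta>)\<^sup>2) * (1 - (cmod z)\<^sup>2)"
    using \<zeta> z by (intro mult_nonneg_nonneg) (simp_all add: abs_square_le_1)
  have main: "green_weight \<zeta> z \<ge> (1 - (cmod \<zeta>)\<^sup>2) * (1 - (cmod z)\<^sup>2) / 8" if "z \<noteq> \<zeta>"
  proof -
    have v: "?v > 0" using that by simp
    have "cmod (cnj \<zeta> * z) < 1" using mult_left_le[of "cmod z" "cmod \<zeta>"] \<zeta> z by (simp add: norm_mult)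
    then have u: "?u > 0" and u2: "?u \<le> 2" using norm_triangle_ineq4[of 1 "cnj \<zeta> * z"] by auto
    define w where "w = ?v / ?u"
    have w0: "w > 0" using u v by (simp add: w_def)
    have vu: "?v\<^sup>2 \<le> ?u\<^sup>2" using nn cmod_one_minus_square[of \<zeta> z] by linarith
    then have w1: "w \<le> 1" using u by (simp add: w_def power2_le_iff_abs_le)
    have "ln w \<le> w - 1" by (rule ln_le_minus_one[OF w0])
    moreover have "green_weight \<zeta> z = - ln w"
      using u v by (simp add: green_weight_def w_def norm_divide ln_div)
    ultimately have "green_weight \<zeta> z \<ge> 1 - w" by simp
    moreover have "1 - w \<ge> (1 - w\<^sup>2) / 2"
    proof -
      have "(1 - w)\<^sup>2 = 1 - 2 * w + w\<^sup>2" by (simp add: power2_eq_square algebra_simps)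
      then have "0 \<le> 1 - 2 * w + w\<^sup>2" using zero_le_power2[of "1 - w"] by (simp only:)
      then show ?thesis by (simp add: field_simps)
    qed
    moreover have "1 - w\<^sup>2 \<ge> (1 - (cmod \<zeta>)\<^sup>2) * (1 - (cmod z)\<^sup>2) / 4"
    proof -
      have "1 - w\<^sup>2 = (?u\<^sup>2 - ?v\<^sup>2) / ?u\<^sup>2" using u by (simp add: w_def power_divide diff_divide_distrib)
      also have "\<dots> = (1 - (cmod \<zeta>)\<^sup>2) * (1 - (cmod z)\<^sup>2) / ?u\<^sup>2" by (simp only: cmod_one_minus_square)
      also have "\<dots> \<ge> (1 - (cmod \<zeta>)\<^sup>2) * (1 - (cmod z)\<^sup>2) / 4"
        using nn u power_mono[OF u2, of 2] by (intro divide_left_mono) auto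
      finally show ?thesis .
    qed
    moreover have "K / 8 \<le> x" if "1 - w \<le> x" "(1 - v) / 2 \<le> 1 - w" "K / 4 \<le> 1 - v" for K x v :: real
      using that by (simp add: field_simps)
    ultimately show ?thesis by blast
  qed
  then show "z \<noteq> \<zeta> \<Longrightarrow> green_weight \<zeta> z \<ge> (1 - (cmod \<zeta>)\<^sup>2) * (1 - (cmod z)\<^sup>2) / 8" .
  show "green_weight \<zeta> z \<ge> 0"
  proof (cases "z = \<zeta>")
    case True then show ?thesis by (simp add: green_weight_def)
  next
    case False then show ?thesis using main nn by simp
  qed
qed

text \<open>For k = 0 the right-hand side is 1 / 0 = 0, in agreement with the mean value property of
  ln |1 - \<eta> z|.\<close>

lemma circle_log_moment:
  assumes "cmod \<eta> < 1"
  shows "(LINT \<xi>|circle_measure. of_real (ln (cmod (1 - \<eta> * \<xi>))) * \<xi> ^ k) = - (cnj \<eta> ^ k / of_nat k) / 2"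
proof -
  let ?h = "\<lambda>n. if n = k then 1 else (0::complex)"
  have s: "summable (\<lambda>n. cmod (?h n))" by (rule summable_finite[of "{k}"]) auto
  have h: "(\<Sum>n. ?h n * \<xi> ^ n) = \<xi> ^ k" for \<xi>
    by (subst suminf_finite[of "{k}"]) auto
  have "(LINT \<xi>|circle_measure. of_real (ln (cmod (1 - \<eta> * \<xi>))) * cnj (\<xi> ^ k)) = - (\<eta> ^ k / of_nat k) / 2"
    using circle_integral_log_series[OF assms s] unfolding h
    by (subst (asm) suminf_finite[of "{k}"]) auto
  then have "cnj (LINT \<xi>|circle_measure. of_real (ln (cmod (1 - \<eta> * \<xi>))) * cnj (\<xi> ^ k)) = - (cnj \<eta> ^ k / of_nat k) / 2"
    by simp
  moreover have "cnj (LINT \<xi>|circle_measure. of_real (ln (cmod (1 - \<eta> * \<xi>))) * cnj (\<xi> ^ k))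
      = (LINT \<xi>|circle_measure. cnj (of_real (ln (cmod (1 - \<eta> * \<xi>))) * cnj (\<xi> ^ k)))"
    by (rule Bochner_Integration.integral_cnj[symmetric])
  ultimately show ?thesis by simp
qed

lemma circle_log_integrable:
  assumes "cmod \<eta> < 1" shows "integrable circle_measure (\<lambda>\<xi>. ln (cmod (1 - \<eta> * \<xi>)))"
proof (rule circle_integrable_bounded)
  fix \<xi> :: complex assume "cmod \<xi> = 1"
  then show "norm (ln (cmod (1 - \<eta> * \<xi>))) \<le> (\<Sum>n. cmod (- (\<eta> ^ n / of_nat n)))"
    using summable_norm[of "\<lambda>n. - (\<eta> ^ n / of_nat n) * \<xi> ^ n"] log_coeff_summable[OF assms]
      abs_Re_le_cmod[of "\<Sum>n. - (\<eta> ^ n / of_nat n) * \<xi> ^ n"]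
    by (simp add: ln_cmod_series[OF assms] norm_mult norm_power norm_divide)
qed measurable

text \<open>From \<zeta> - z \<xi> the number of larger modulus is factored out, so that the rest is
  1 - \<eta> \<xi> in modulus with |\<eta>| < 1; if z is the larger one, a conjugation turns cnj
  \<xi> into \<xi>. The circle |z| = |\<zeta>| is excluded and is null for area.\<close>

lemma green_weight_circle:
  assumes \<zeta>: "cmod \<zeta> < 1" and z: "cmod z < 1" "z \<noteq> 0" "cmod z \<noteq> cmod \<zeta>"
  defines "\<eta> \<equiv> if cmod \<zeta> < cmod z then cnj (\<zeta> / z) else z / \<zeta>"
  shows "cmod \<eta> < 1" and "cmod (cnj \<zeta> * z) < 1"
    and "cmod \<xi> = 1 \<Longrightarrow> green_weight \<zeta> (z * \<xi>)
      = ln (cmod (1 - (cnj \<zeta> * z) * \<xi>)) - ln (max (cmod z) (cmod \<zeta>)) - ln (cmod (1 - \<eta> * \<xi>))"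
    and "z ^ k * cnj \<eta> ^ k = (if cmod \<zeta> < cmod z then \<zeta> ^ k else of_real (((cmod z)\<^sup>2) ^ k / ((cmod \<zeta>)\<^sup>2) ^ k) * \<zeta> ^ k)"
proof -
  have \<zeta>0: "\<not> cmod \<zeta> < cmod z \<Longrightarrow> \<zeta> \<noteq> 0" using z by auto
  show \<eta>1: "cmod \<eta> < 1" using z \<zeta>0 by (auto simp: \<eta>_def norm_divide divide_less_eq)
  show w1: "cmod (cnj \<zeta> * z) < 1" using mult_left_le[of "cmod z" "cmod \<zeta>"] \<zeta> z by (simp add: norm_mult)
  show "green_weight \<zeta> (z * \<xi>) = ln (cmod (1 - (cnj \<zeta> * z) * \<xi>)) - ln (max (cmod z) (cmod \<zeta>)) - ln (cmod (1 - \<eta> * \<xi>))"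
    if \<xi>: "cmod \<xi> = 1"
  proof -
    have u\<xi>: "\<xi> * cnj \<xi> = 1" using complex_norm_square[of \<xi>] \<xi> by simp
    have "cmod ((cnj \<zeta> * z) * \<xi>) < 1" using w1 \<xi> by (simp add: norm_mult)
    then have n1: "cmod (1 - (cnj \<zeta> * z) * \<xi>) > 0" by auto
    have "cmod (\<eta> * \<xi>) < 1" using \<eta>1 \<xi> by (simp add: norm_mult)
    then have n2: "cmod (1 - \<eta> * \<xi>) > 0" by auto
    have n3: "max (cmod z) (cmod \<zeta>) > 0" using z by (simp add: less_max_iff_disj)
    have "cmod (\<zeta> - z * \<xi>) = max (cmod z) (cmod \<zeta>) * cmod (1 - \<eta> * \<xi>)"
    proof (cases "cmod \<zeta> < cmod z")
      case True
      have "cmod (1 - \<eta> * \<xi>) = cmod (cnj (1 - \<eta> * \<xi>))" by (simp only: complex_mod_cnj)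
      also have "cnj (1 - \<eta> * \<xi>) = (z * \<xi> - \<zeta>) * cnj \<xi> / z"
        using True z u\<xi> by (simp add: \<eta>_def field_simps)
      also have "cmod \<dots> = cmod (\<zeta> - z * \<xi>) / cmod z" using \<xi> by (simp add: norm_mult norm_divide norm_minus_commute)
      finally show ?thesis using True z by simp
    next
      case False
      have "\<zeta> - z * \<xi> = \<zeta> * (1 - \<eta> * \<xi>)" using False \<zeta>0 by (simp add: \<eta>_def field_simps)
      then show ?thesis using False by (simp add: norm_mult)
    qed
    then show ?thesis unfolding green_weight_def
      using n1 n2 n3 by (simp add: norm_divide ln_div ln_mult mult.assoc)
  qed
  show "z ^ k * cnj \<eta> ^ k = (if cmod \<zeta> < cmod z then \<zeta> ^ k else of_real (((cmod z)\<^sup>2) ^ k / ((cmod \<zeta>)\<^sup>2) ^ k) * \<zeta> ^ k)"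
  proof (cases "cmod \<zeta> < cmod z")
    case True
    then have "z * cnj \<eta> = \<zeta>" using z by (simp add: \<eta>_def)
    then show ?thesis using True by (simp flip: power_mult_distrib)
  next
    case False
    have "z * cnj \<eta> = z * cnj z / cnj \<zeta>" using False by (simp add: \<eta>_def)
    also have "\<dots> = (z * cnj z) / (\<zeta> * cnj \<zeta>) * \<zeta>" using \<zeta>0[OF False] by simp
    also have "\<dots> = of_real ((cmod z)\<^sup>2 / (cmod \<zeta>)\<^sup>2) * \<zeta>" unfolding complex_norm_square[symmetric] by simp
    finally have "(z * cnj \<eta>) ^ k = (of_real ((cmod z)\<^sup>2 / (cmod \<zeta>)\<^sup>2) * \<zeta>) ^ k" by simp
    then show ?thesis using False by (simp add: power_mult_distrib power_divide)
  qed
qed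

lemma green_weight_circle_moment:
  assumes \<zeta>: "cmod \<zeta> < 1" and z: "cmod z < 1" "z \<noteq> 0" "cmod z \<noteq> cmod \<zeta>"
  shows "integrable circle_measure (\<lambda>\<xi>. green_weight \<zeta> (z * \<xi>))"
    and "(LINT \<xi>|circle_measure. green_weight \<zeta> (z * \<xi>)) = - ln (max (cmod z) (cmod \<zeta>))"
    and "k > 0 \<Longrightarrow> z ^ k * (LINT \<xi>|circle_measure. of_real (green_weight \<zeta> (z * \<xi>)) * \<xi> ^ k)
       = \<zeta> ^ k / (2 * of_nat k) * of_real ((if (cmod \<zeta>)\<^sup>2 < (cmod z)\<^sup>2 then 1 else ((cmod z)\<^sup>2) ^ k / ((cmod \<zeta>)\<^sup>2) ^ k) - ((cmod z)\<^sup>2) ^ k)"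
proof -
  define \<eta> where "\<eta> = (if cmod \<zeta> < cmod z then cnj (\<zeta> / z) else z / \<zeta>)"
  define w where "w = cnj \<zeta> * z"
  let ?\<rho> = "ln (max (cmod z) (cmod \<zeta>))"
  note G = green_weight_circle[OF \<zeta> z, folded \<eta>_def]
  have w: "cmod w < 1" using G(2) by (simp add: w_def)
  have gw: "cmod \<xi> = 1 \<Longrightarrow> green_weight \<zeta> (z * \<xi>) = ln (cmod (1 - w * \<xi>)) - ?\<rho> - ln (cmod (1 - \<eta> * \<xi>))" for \<xi>
    unfolding w_def by (rule G(3))
  have iw: "integrable circle_measure (\<lambda>\<xi>. ln (cmod (1 - w * \<xi>)))" by (rule circle_log_integrable[OF w])
  have i\<eta>: "integrable circle_measure (\<lambda>\<xi>. ln (cmod (1 - \<eta> * \<xi>)))" by (rule circle_log_integrable[OF G(1)])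
  have ic: "integrable circle_measure (\<lambda>\<xi>. of_real (f \<xi>) * \<xi> ^ k)" if "integrable circle_measure f" for f :: "complex \<Rightarrow> real" and k
  proof (rule Bochner_Integration.integrable_bound[OF that])
    have [measurable]: "f \<in> borel_measurable borel" using that by (auto dest: borel_measurable_integrable)
    show "(\<lambda>\<xi>. of_real (f \<xi>) * \<xi> ^ k) \<in> borel_measurable circle_measure" by measurable
    show "AE \<xi> in circle_measure. norm (complex_of_real (f \<xi>) * \<xi> ^ k) \<le> norm (f \<xi>)"
      using AE_circle by eventually_elim (simp add: norm_mult norm_power)
  qed
  have "integrable circle_measure (\<lambda>\<xi>. ln (cmod (1 - w * \<xi>)) - ?\<rho> - ln (cmod (1 - \<eta> * \<xi>)))"
    by (intro Bochner_Integration.integrable_diff iw i\<eta>) simp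
  then show int: "integrable circle_measure (\<lambda>\<xi>. green_weight \<zeta> (z * \<xi>))"
  proof (rule integrable_cong_AE_imp)
    show "AE \<xi> in circle_measure. ln (cmod (1 - w * \<xi>)) - ?\<rho> - ln (cmod (1 - \<eta> * \<xi>)) = green_weight \<zeta> (z * \<xi>)"
      using AE_circle by eventually_elim (simp add: gw)
  qed measurable
  \<comment> \<open>Valid for k = 0 as well: the two quotients by \<open>of_nat 0\<close> vanish and
    only the constant - ln max is left.\<close>
  have mom: "(LINT \<xi>|circle_measure. of_real (green_weight \<zeta> (z * \<xi>)) * \<xi> ^ k)
     = - (cnj w ^ k / of_nat k) / 2 - of_real ?\<rho> * (if k = 0 then 1 else 0) - - (cnj \<eta> ^ k / of_nat k) / 2" for k
  proof -
    have "(LINT \<xi>|circle_measure. of_real (green_weight \<zeta> (z * \<xi>)) * \<xi> ^ k)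
       = (LINT \<xi>|circle_measure. of_real (ln (cmod (1 - w * \<xi>))) * \<xi> ^ k - of_real ?\<rho> * \<xi> ^ k - of_real (ln (cmod (1 - \<eta> * \<xi>))) * \<xi> ^ k)"
    proof (rule integral_cong_AE)
      show "AE \<xi> in circle_measure. of_real (green_weight \<zeta> (z * \<xi>)) * \<xi> ^ k
        = of_real (ln (cmod (1 - w * \<xi>))) * \<xi> ^ k - of_real ?\<rho> * \<xi> ^ k - of_real (ln (cmod (1 - \<eta> * \<xi>))) * \<xi> ^ k"
        using AE_circle by eventually_elim (simp only: gw of_real_diff left_diff_distrib)
    qed measurable
    also have "\<dots> = (LINT \<xi>|circle_measure. of_real (ln (cmod (1 - w * \<xi>))) * \<xi> ^ k) - (LINT \<xi>|circle_measure. of_real ?\<rho> * \<xi> ^ k)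
        - (LINT \<xi>|circle_measure. of_real (ln (cmod (1 - \<eta> * \<xi>))) * \<xi> ^ k)"
      using ic[OF iw, of k] ic[OF i\<eta>, of k] ic[of "\<lambda>_. ?\<rho>" k]
      by (subst Bochner_Integration.integral_diff; simp?)+
    also have "(LINT \<xi>|circle_measure. of_real ?\<rho> * \<xi> ^ k) = of_real ?\<rho> * (if k = 0 then 1 else 0)"
      using circle_integral_monomials[of k 0] by simp
    finally show ?thesis by (simp only: circle_log_moment[OF w] circle_log_moment[OF G(1)])
  qed
  have "complex_of_real (LINT \<xi>|circle_measure. green_weight \<zeta> (z * \<xi>)) = of_real (- ?\<rho>)"
    using mom[of 0] by (simp flip: integral_complex_of_real)
  then show "(LINT \<xi>|circle_measure. green_weight \<zeta> (z * \<xi>)) = - ?\<rho>" by (simp only: of_real_eq_iff)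
  show "z ^ k * (LINT \<xi>|circle_measure. of_real (green_weight \<zeta> (z * \<xi>)) * \<xi> ^ k)
       = \<zeta> ^ k / (2 * of_nat k) * of_real ((if (cmod \<zeta>)\<^sup>2 < (cmod z)\<^sup>2 then 1 else ((cmod z)\<^sup>2) ^ k / ((cmod \<zeta>)\<^sup>2) ^ k) - ((cmod z)\<^sup>2) ^ k)"
    if k: "k > 0"
  proof -
    have "z * cnj w = \<zeta> * of_real ((cmod z)\<^sup>2)" unfolding complex_norm_square by (simp add: w_def)
    then have zw: "z ^ k * cnj w ^ k = \<zeta> ^ k * of_real (((cmod z)\<^sup>2) ^ k)" by (simp flip: power_mult_distrib)
    have sq: "((cmod \<zeta>)\<^sup>2 < (cmod z)\<^sup>2) = (cmod \<zeta> < cmod z)"      using power2_less_imp_less[of "cmod \<zeta>" "cmod z"] power_strict_mono[of "cmod \<zeta>" "cmod z" 2] by auto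
    have "z ^ k * (LINT \<xi>|circle_measure. of_real (green_weight \<zeta> (z * \<xi>)) * \<xi> ^ k)
        = (z ^ k * cnj \<eta> ^ k - z ^ k * cnj w ^ k) / (2 * of_nat k)"
      using k unfolding mom by (simp add: field_simps)
    also have "\<dots> = \<zeta> ^ k / (2 * of_nat k) * of_real ((if (cmod \<zeta>)\<^sup>2 < (cmod z)\<^sup>2 then 1 else ((cmod z)\<^sup>2) ^ k / ((cmod \<zeta>)\<^sup>2) ^ k) - ((cmod z)\<^sup>2) ^ k)"
      unfolding G(4) zw sq by (simp add: algebra_simps diff_divide_distrib)
    finally show ?thesis .
  qed
qed

section \<open>Radial integrals and moments of the Green function\<close>

lemma AE_area_generic: "AE z in area_measure. cmod z < 1 \<and> z \<noteq> 0 \<and> cmod z \<noteq> cmod \<zeta> \<and> z \<noteq> \<zeta>"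
proof -
  have ne: "AE z in area_measure. (cmod z)\<^sup>2 \<noteq> c" for c
  proof -
    have "AE t in uniform_measure lborel {0..1::real}. t \<noteq> c"
      by (rule AE_uniform_measureI) (use AE_lborel_singleton[of c] in auto)
    then show ?thesis unfolding distr_area_norm_square[symmetric] by (subst (asm) AE_distr_iff) auto
  qed
  show ?thesis using AE_area ne[of 0] ne[of "(cmod \<zeta>)\<^sup>2"] by eventually_elim auto
qed

text \<open>Writing - ln (max t c) as the integral of 1 / u from max t c to 1 and exchanging the
  integrals leaves powers only; all terms are nonnegative, so the singularity at 0 for c = 0 does no
  harm.\<close>

lemma nn_integral_log_power:
  assumes c: "0 \<le> c" "c \<le> 1"
  shows "(\<integral>\<^sup>+t. ennreal (- ln (max t c) * t ^ n) * indicator {0..1} t \<partial>lborel) = ennreal ((1 - c ^ Suc n) / (real (Suc n))\<^sup>2)"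
proof -
  have inner: "ennreal (- ln (max t c)) = (\<integral>\<^sup>+u. ennreal (1 / u) * indicator {max t c..1} u \<partial>lborel)" if t: "0 < t" "t \<le> 1" for t
  proof -
    have m: "0 < max t c" "max t c \<le> 1" using t c by auto
    have "(\<integral>\<^sup>+u. ennreal (1 / u) * indicator {max t c..1} u \<partial>lborel) = ennreal (ln 1 - ln (max t c))"
      using m by (intro nn_integral_FTC_Icc) (auto intro!: derivative_eq_intros simp: divide_inverse)
    then show ?thesis by simp
  qed
  have "(\<integral>\<^sup>+t. ennreal (- ln (max t c) * t ^ n) * indicator {0..1} t \<partial>lborel)
      = (\<integral>\<^sup>+t. (\<integral>\<^sup>+u. ennreal (1 / u) * indicator {c..1} u * (ennreal (t ^ n) * indicator {0..u} t) \<partial>lborel) \<partial>lborel)"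
  proof (rule nn_integral_cong_AE)
    show "AE t in lborel. ennreal (- ln (max t c) * t ^ n) * indicator {0..1} t
        = (\<integral>\<^sup>+u. ennreal (1 / u) * indicator {c..1} u * (ennreal (t ^ n) * indicator {0..u} t) \<partial>lborel)"
      using AE_lborel_singleton[of 0]
    proof eventually_elim
      case (elim t)
      show ?case
      proof (cases "0 < t \<and> t \<le> 1")
        case True
        have "ennreal (- ln (max t c) * t ^ n) * indicator {0..1} t = (\<integral>\<^sup>+u. ennreal (1 / u) * indicator {max t c..1} u \<partial>lborel) * ennreal (t ^ n)"
        proof -
          have "ln (max t c) \<le> 0" using True c by (subst ln_le_zero_iff) auto
          then have "ennreal (- ln (max t c) * t ^ n) = ennreal (- ln (max t c)) * ennreal (t ^ n)"
            using True by (intro ennreal_mult) auto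
          moreover have "ennreal (- ln (max t c)) = (\<integral>\<^sup>+u. ennreal (1 / u) * indicator {max t c..1} u \<partial>lborel)"
            using True by (intro inner) auto
          ultimately show ?thesis using True by simp
        qed
        also have "\<dots> = (\<integral>\<^sup>+u. ennreal (1 / u) * indicator {max t c..1} u * ennreal (t ^ n) \<partial>lborel)"
          by (rule nn_integral_multc[symmetric]) measurable
        also have "\<dots> = (\<integral>\<^sup>+u. ennreal (1 / u) * indicator {c..1} u * (ennreal (t ^ n) * indicator {0..u} t) \<partial>lborel)"
          using True by (intro nn_integral_cong) (auto simp: indicator_def)
        finally show ?thesis .
      next
        case False
        then have "t < 0 \<or> 1 < t" using elim by auto
        then have Z: "ennreal (1 / u) * indicator {c..1} u * (ennreal (t ^ n) * indicator {0..u} t) = 0" for u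
          by (auto simp: indicator_def)
        have "ennreal (- ln (max t c) * t ^ n) * indicator {0..1} t = 0"
          using \<open>t < 0 \<or> 1 < t\<close> by (auto simp: indicator_def)
        then show ?thesis by (simp only: Z nn_integral_const mult_zero_left)
      qed
    qed
  qed
  also have "\<dots> = (\<integral>\<^sup>+u. (\<integral>\<^sup>+t. ennreal (1 / u) * indicator {c..1} u * (ennreal (t ^ n) * indicator {0..u} t) \<partial>lborel) \<partial>lborel)"
  proof (rule lborel_pair.Fubini')
    have [measurable]: "Measurable.pred (borel \<Otimes>\<^sub>M borel) (\<lambda>x. snd x \<in> {0..fst x :: real})"
      by (simp only: atLeastAtMost_iff) measurable
    show "(\<lambda>(u, t). ennreal (1 / u) * indicator {c..1} u * (ennreal (t ^ n) * indicator {0..u} t)) \<in> borel_measurable (lborel \<Otimes>\<^sub>M lborel)"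
      by measurable
  qed
  also have "\<dots> = (\<integral>\<^sup>+u. ennreal (u ^ n / real (Suc n)) * indicator {c..1} u \<partial>lborel)"
  proof (rule nn_integral_cong_AE)
    show "AE u in lborel. (\<integral>\<^sup>+t. ennreal (1 / u) * indicator {c..1} u * (ennreal (t ^ n) * indicator {0..u} t) \<partial>lborel)
        = ennreal (u ^ n / real (Suc n)) * indicator {c..1} u"
      using AE_lborel_singleton[of 0]
    proof eventually_elim
      case (elim u)
      show ?case
      proof (cases "u \<in> {c..1}")
        case True
        then have u: "u > 0" using elim c by auto
        have F: "(\<integral>\<^sup>+t. ennreal (t ^ n) * indicator {0..u} t \<partial>lborel) = ennreal (u ^ Suc n / real (Suc n) - 0 ^ Suc n / real (Suc n))"
        proof (rule nn_integral_FTC_Icc)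
          show "((\<lambda>t. t ^ Suc n / real (Suc n)) has_real_derivative t ^ n) (at t)" for t :: real
            using DERIV_cdivide[OF DERIV_pow[of "Suc n" t UNIV], of "real (Suc n)"] by (simp del: of_nat_Suc power_Suc)
        qed (use u in auto)
        have "(\<integral>\<^sup>+t. ennreal (1 / u) * indicator {c..1} u * (ennreal (t ^ n) * indicator {0..u} t) \<partial>lborel)
            = ennreal (1 / u) * indicator {c..1} u * ennreal (u ^ Suc n / real (Suc n))"
          by (subst nn_integral_cmult) (use F in auto)
        also have "\<dots> = ennreal (1 / u) * ennreal (u ^ Suc n / real (Suc n))" using True by simp
        also have "\<dots> = ennreal (1 / u * (u ^ Suc n / real (Suc n)))"
          by (rule ennreal_mult[symmetric]) (use u in simp_all)
        also have "1 / u * (u ^ Suc n / real (Suc n)) = u ^ n / real (Suc n)" using u by simp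
        finally show ?thesis using True by (simp only: indicator_simps mult_1_right)
      qed simp
    qed
  qed
  also have "\<dots> = ennreal (1 ^ Suc n / (real (Suc n))\<^sup>2 - c ^ Suc n / (real (Suc n))\<^sup>2)"
  proof (rule nn_integral_FTC_Icc)
    show "((\<lambda>t. t ^ Suc n / (real (Suc n))\<^sup>2) has_real_derivative t ^ n / real (Suc n)) (at t)" for t :: real
      using DERIV_cdivide[OF DERIV_pow[of "Suc n" t UNIV], of "(real (Suc n))\<^sup>2"] by (simp add: power2_eq_square del: of_nat_Suc power_Suc)
  qed (use c in auto)
  finally show ?thesis by (simp add: diff_divide_distrib)
qed

text \<open>The mean of the Green function over the circle of radius |z| is - ln max(|z|,
  |\<zeta>|); rewriting it in terms of squares gives the factor 1/2. This provides both
  integrability of the weight and the diagonal moments.\<close>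

lemma nn_integral_green_weight_power:
  assumes \<zeta>: "cmod \<zeta> < 1"
  shows "(\<integral>\<^sup>+z. ennreal (green_weight \<zeta> z * ((cmod z)\<^sup>2) ^ n) \<partial>area_measure)
       = ennreal ((1 - ((cmod \<zeta>)\<^sup>2) ^ Suc n) / (2 * (real (Suc n))\<^sup>2))"
proof -
  let ?c = "(cmod \<zeta>)\<^sup>2"
  have "(\<integral>\<^sup>+z. ennreal (green_weight \<zeta> z * ((cmod z)\<^sup>2) ^ n) \<partial>area_measure)
     = (\<integral>\<^sup>+z. (\<integral>\<^sup>+\<xi>. ennreal (green_weight \<zeta> (z * \<xi>) * ((cmod (z * \<xi>))\<^sup>2) ^ n) \<partial>circle_measure) \<partial>area_measure)"
    by (rule nn_integral_area_polar) measurable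
  also have "\<dots> = (\<integral>\<^sup>+z. ennreal (1/2) * ennreal (- ln (max ((cmod z)\<^sup>2) ?c) * ((cmod z)\<^sup>2) ^ n) \<partial>area_measure)"
  proof (rule nn_integral_cong_AE)
    show "AE z in area_measure. (\<integral>\<^sup>+\<xi>. ennreal (green_weight \<zeta> (z * \<xi>) * ((cmod (z * \<xi>))\<^sup>2) ^ n) \<partial>circle_measure)
        = ennreal (1/2) * ennreal (- ln (max ((cmod z)\<^sup>2) ?c) * ((cmod z)\<^sup>2) ^ n)"
      using AE_area_generic[of \<zeta>]
    proof eventually_elim
      case (elim z)
      then have z: "cmod z < 1" "z \<noteq> 0" "cmod z \<noteq> cmod \<zeta>" by auto
      note G = green_weight_circle_moment[OF \<zeta> z]
      have pos: "max (cmod z) (cmod \<zeta>) > 0" using z by (simp add: less_max_iff_disj)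
      have mx: "max ((cmod z)\<^sup>2) ?c = (max (cmod z) (cmod \<zeta>))\<^sup>2"
        by (simp add: max_def power_mono_iff)
      have ln2: "ln (max ((cmod z)\<^sup>2) ?c) = 2 * ln (max (cmod z) (cmod \<zeta>))"
        unfolding mx using pos by (simp add: ln_realpow)
      have "(\<integral>\<^sup>+\<xi>. ennreal (green_weight \<zeta> (z * \<xi>) * ((cmod (z * \<xi>))\<^sup>2) ^ n) \<partial>circle_measure)
         = (\<integral>\<^sup>+\<xi>. ennreal (green_weight \<zeta> (z * \<xi>)) * ennreal (((cmod z)\<^sup>2) ^ n) \<partial>circle_measure)"
      proof (rule nn_integral_cong_AE)
        show "AE \<xi> in circle_measure. ennreal (green_weight \<zeta> (z * \<xi>) * ((cmod (z * \<xi>))\<^sup>2) ^ n) = ennreal (green_weight \<zeta> (z * \<xi>)) * ennreal (((cmod z)\<^sup>2) ^ n)"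
          using AE_circle
        proof eventually_elim
          case (elim \<xi>)
          then have "green_weight \<zeta> (z * \<xi>) \<ge> 0" using z by (intro green_weight_lower(1)[OF \<zeta>]) (simp add: norm_mult)
          then show ?case using elim by (simp add: norm_mult ennreal_mult)
        qed
      qed
      also have "\<dots> = (\<integral>\<^sup>+\<xi>. ennreal (green_weight \<zeta> (z * \<xi>)) \<partial>circle_measure) * ennreal (((cmod z)\<^sup>2) ^ n)"
        by (rule nn_integral_multc) measurable
      also have "(\<integral>\<^sup>+\<xi>. ennreal (green_weight \<zeta> (z * \<xi>)) \<partial>circle_measure) = ennreal (LINT \<xi>|circle_measure. green_weight \<zeta> (z * \<xi>))"
      proof (rule nn_integral_eq_integral[OF G(1)])
        show "AE \<xi> in circle_measure. 0 \<le> green_weight \<zeta> (z * \<xi>)"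
          using AE_circle by eventually_elim (use z in \<open>auto intro!: green_weight_lower(1)[OF \<zeta>] simp: norm_mult\<close>)
      qed
      also have "(LINT \<xi>|circle_measure. green_weight \<zeta> (z * \<xi>)) = 1/2 * (- ln (max ((cmod z)\<^sup>2) ?c))"
        unfolding G(2) ln2 by simp
      also have "ennreal (1/2 * (- ln (max ((cmod z)\<^sup>2) ?c))) * ennreal (((cmod z)\<^sup>2) ^ n) = ennreal (1/2) * ennreal (- ln (max ((cmod z)\<^sup>2) ?c) * ((cmod z)\<^sup>2) ^ n)"
      proof -
        have "max (cmod z) (cmod \<zeta>) \<le> 1" using z \<zeta> by simp
        then have "ln (max ((cmod z)\<^sup>2) ?c) \<le> 0" unfolding ln2 using pos by simp
        then have nn: "0 \<le> - ln (max ((cmod z)\<^sup>2) ?c)" by simp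
        have "ennreal (1/2 * (- ln (max ((cmod z)\<^sup>2) ?c))) = ennreal (1/2) * ennreal (- ln (max ((cmod z)\<^sup>2) ?c))"
          by (rule ennreal_mult[OF _ nn]) simp
        moreover have "ennreal (- ln (max ((cmod z)\<^sup>2) ?c) * ((cmod z)\<^sup>2) ^ n) = ennreal (- ln (max ((cmod z)\<^sup>2) ?c)) * ennreal (((cmod z)\<^sup>2) ^ n)"
          by (rule ennreal_mult[OF nn]) simp
        ultimately show ?thesis by (simp only: mult.assoc)
      qed
      finally show ?case .
    qed
  qed
  also have "\<dots> = ennreal (1/2) * (\<integral>\<^sup>+z. ennreal (- ln (max ((cmod z)\<^sup>2) ?c) * ((cmod z)\<^sup>2) ^ n) \<partial>area_measure)"
    by (rule nn_integral_cmult) measurable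
  also have "(\<integral>\<^sup>+z. ennreal (- ln (max ((cmod z)\<^sup>2) ?c) * ((cmod z)\<^sup>2) ^ n) \<partial>area_measure)
      = (\<integral>\<^sup>+t. ennreal (- ln (max t ?c) * t ^ n) * indicator {0..1} t \<partial>lborel)"
    by (rule nn_integral_area_radial[of "\<lambda>t. ennreal (- ln (max t ?c) * t ^ n)"]) measurable
  also have "\<dots> = ennreal ((1 - ?c ^ Suc n) / (real (Suc n))\<^sup>2)"
    using \<zeta> by (intro nn_integral_log_power) (simp_all add: abs_square_le_1)
  also have "ennreal (1/2) * ennreal ((1 - ?c ^ Suc n) / (real (Suc n))\<^sup>2) = ennreal (1/2 * ((1 - ?c ^ Suc n) / (real (Suc n))\<^sup>2))"
  proof (rule ennreal_mult[symmetric])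
    have "?c ^ Suc n \<le> 1" using \<zeta> by (intro power_le_one) (simp_all add: abs_square_le_1)
    then show "0 \<le> (1 - ?c ^ Suc n) / (real (Suc n))\<^sup>2" by simp
  qed simp
  finally show ?thesis by simp
qed

lemma green_weight_integrable:
  assumes \<zeta>: "cmod \<zeta> < 1" shows "integrable area_measure (green_weight \<zeta>)"
proof (rule integrableI_nonneg)
  show "AE z in area_measure. 0 \<le> green_weight \<zeta> z"
    using AE_area by eventually_elim (rule green_weight_lower(1)[OF \<zeta>])
  show "(\<integral>\<^sup>+z. ennreal (green_weight \<zeta> z) \<partial>area_measure) < \<infinity>"
    using nn_integral_green_weight_power[OF \<zeta>, of 0] by simp
qed measurable

lemma green_weight_times_integrable:
  fixes F :: "complex \<Rightarrow> complex"
  assumes \<zeta>: "cmod \<zeta> < 1" and [measurable]: "F \<in> borel_measurable borel"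
    and C: "\<And>z. cmod z < 1 \<Longrightarrow> cmod (F z) \<le> C"
  shows "integrable area_measure (\<lambda>z. of_real (green_weight \<zeta> z) * F z)"
proof (rule Bochner_Integration.integrable_bound)
  show "integrable area_measure (\<lambda>z. C * green_weight \<zeta> z)"
    by (intro integrable_mult_right green_weight_integrable \<zeta>)
  show "AE z in area_measure. norm (complex_of_real (green_weight \<zeta> z) * F z) \<le> norm (C * green_weight \<zeta> z)"
    using AE_area
  proof eventually_elim
    case (elim z)
    have "0 \<le> C" using C[OF elim] norm_ge_zero order_trans by blast
    then show ?case using C[OF elim] green_weight_lower(1)[OF \<zeta> elim]
      by (subst mult.commute) (simp add: norm_mult abs_mult mult_left_mono mult.commute[of C])
  qed
qed measurable

text \<open>The radial integral of the off-diagonal moments, split at c = |\<zeta>|^2 where the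
  expansion of the Green function changes. For c = 0 the second branch meets the interval only at
  the point 0.\<close>

lemma piecewise_power_integral:
  assumes c: "0 \<le> c" "c \<le> 1"
  shows "(LINT t|lborel. indicator {0..1} t * (t ^ n * ((if c < t then 1 else t ^ k / c ^ k) - t ^ k)))
       = (1 - c ^ Suc n) * (1 / real (Suc n) - 1 / real (Suc (n + k)))"
proof -
  have I: "has_bochner_integral lborel (\<lambda>t. indicator {a..b} t *\<^sub>R (t ^ m :: real)) (b ^ Suc m / real (Suc m) - a ^ Suc m / real (Suc m))" if "a \<le> b" for a b :: real and m
  proof (rule has_bochner_integral_FTC_Icc[OF that])
    fix t :: real
    have "((\<lambda>t. t ^ Suc m / real (Suc m)) has_real_derivative t ^ m) (at t within {a..b})"
      using DERIV_cdivide[OF DERIV_pow[of "Suc m" t "{a..b}"], of "real (Suc m)"] by (simp del: of_nat_Suc power_Suc)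
    then show "((\<lambda>t. t ^ Suc m / real (Suc m)) has_vector_derivative t ^ m) (at t within {a..b})"
      by (simp only: has_real_derivative_iff_has_vector_derivative)
  qed (intro continuous_intros)
  let ?m = "n + k"
  have "has_bochner_integral lborel (\<lambda>t. (indicator {0..c} t *\<^sub>R t ^ ?m) * (1 / c ^ k) + indicator {c..1} t *\<^sub>R t ^ n - indicator {0..1} t *\<^sub>R t ^ ?m)
      ((c ^ Suc ?m / real (Suc ?m) - 0 ^ Suc ?m / real (Suc ?m)) * (1 / c ^ k) + (1 ^ Suc n / real (Suc n) - c ^ Suc n / real (Suc n)) - (1 ^ Suc ?m / real (Suc ?m) - 0 ^ Suc ?m / real (Suc ?m)))"
    using c by (intro has_bochner_integral_diff has_bochner_integral_add has_bochner_integral_mult_left I) auto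
  then have "(LINT t|lborel. (indicator {0..c} t *\<^sub>R t ^ ?m) * (1 / c ^ k) + indicator {c..1} t *\<^sub>R t ^ n - indicator {0..1} t *\<^sub>R t ^ ?m)
      = (c ^ Suc ?m / real (Suc ?m)) * (1 / c ^ k) + (1 / real (Suc n) - c ^ Suc n / real (Suc n)) - 1 / real (Suc ?m)"
    by (simp add: has_bochner_integral_integral_eq del: of_nat_Suc power_Suc)
  moreover have "(c ^ Suc ?m / real (Suc ?m)) * (1 / c ^ k) = c ^ Suc n / real (Suc ?m)"
  proof (cases "c = 0")
    case False
    have "c ^ Suc ?m = c ^ Suc n * c ^ k" by (simp add: power_add)
    then show ?thesis using False by simp
  qed simp
  moreover have "(LINT t|lborel. indicator {0..1} t * (t ^ n * ((if c < t then 1 else t ^ k / c ^ k) - t ^ k)))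
     = (LINT t|lborel. (indicator {0..c} t *\<^sub>R t ^ ?m) * (1 / c ^ k) + indicator {c..1} t *\<^sub>R t ^ n - indicator {0..1} t *\<^sub>R t ^ ?m)"
  proof (rule integral_cong_AE)
    show "AE t in lborel. indicator {0..1} t * (t ^ n * ((if c < t then 1 else t ^ k / c ^ k) - t ^ k))
      = (indicator {0..c} t *\<^sub>R t ^ ?m) * (1 / c ^ k) + indicator {c..1} t *\<^sub>R t ^ n - indicator {0..1} t *\<^sub>R t ^ ?m"
      using AE_lborel_singleton[of c]
      by eventually_elim (use c in \<open>auto simp: indicator_def power_add algebra_simps\<close>)
  qed measurable
  ultimately show ?thesis by (simp add: algebra_simps diff_divide_distrib del: of_nat_Suc power_Suc)
qed

text \<open>\<open>\<Sum>i\<le>m. \<zeta> ^ (m - i) * z ^ i\<close> is the quotient \<open>(z ^ Suc m - \<zeta> ^ Suc m) / (z - \<zeta>)\<close>; these are the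
  inner products of two such quotients.\<close>

definition green_gram :: "complex \<Rightarrow> nat \<Rightarrow> nat \<Rightarrow> complex" where
  "green_gram \<zeta> m n = (\<Sum>i\<le>min m n. \<zeta> ^ (m - i) * cnj \<zeta> ^ (n - i))"

lemma green_gram_cnj: "green_gram \<zeta> n m = cnj (green_gram \<zeta> m n)"
  by (simp add: green_gram_def min.commute mult.commute)

lemma green_gram_add: "green_gram \<zeta> (n + k) n = \<zeta> ^ k * of_real (\<Sum>i\<le>n. ((cmod \<zeta>)\<^sup>2) ^ i)"
proof -
  have "green_gram \<zeta> (n + k) n = (\<Sum>i\<le>n. \<zeta> ^ k * of_real (((cmod \<zeta>)\<^sup>2) ^ (n - i)))"
    unfolding green_gram_def min_absorb2[OF le_add1]
  proof (rule sum.cong[OF refl])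
    fix i assume "i \<in> {..n}"
    then have "\<zeta> ^ (n + k - i) = \<zeta> ^ k * \<zeta> ^ (n - i)" by (simp flip: power_add add: add.commute)
    then show "\<zeta> ^ (n + k - i) * cnj \<zeta> ^ (n - i) = \<zeta> ^ k * of_real (((cmod \<zeta>)\<^sup>2) ^ (n - i))"
      by (simp only: of_real_power[of "(cmod \<zeta>)\<^sup>2"] complex_norm_square power_mult_distrib mult.assoc)
  qed
  also have "\<dots> = \<zeta> ^ k * of_real (\<Sum>i\<le>n. ((cmod \<zeta>)\<^sup>2) ^ (n - i))" by (simp add: sum_distrib_left)
  also have "(\<Sum>i\<le>n. ((cmod \<zeta>)\<^sup>2) ^ (n - i)) = (\<Sum>i\<le>n. ((cmod \<zeta>)\<^sup>2) ^ i)"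
    by (rule sum.reindex_bij_witness[of _ "\<lambda>i. n - i" "\<lambda>i. n - i"]) auto
  finally show ?thesis .
qed

text \<open>The diagonal is treated apart, because for k = 0 the circular mean is logarithmic. For k
  > 0 it is \<zeta>^k / (2 k) times a radial function, and the k cancels against 1 / (n + 1) - 1 /
  (n + k + 1) = k / ((n + 1)(n + k + 1)).\<close>

lemma green_moment_add:
  assumes \<zeta>: "cmod \<zeta> < 1"
  shows "(LINT z|area_measure. of_real (green_weight \<zeta> z) * (z ^ (n + k) * cnj z ^ n))
    = \<zeta> ^ k * of_real ((1 - ((cmod \<zeta>)\<^sup>2) ^ Suc n) / (2 * real (Suc n) * real (Suc (n + k))))"
proof (cases "k = 0")
  case True
  let ?J = "(1 - ((cmod \<zeta>)\<^sup>2) ^ Suc n) / (2 * (real (Suc n))\<^sup>2)"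
  have "?J \<ge> 0"
  proof -
    have "((cmod \<zeta>)\<^sup>2) ^ Suc n \<le> 1" using \<zeta> by (intro power_le_one) (simp_all add: abs_square_le_1)
    then show ?thesis by simp
  qed
  have nn: "AE z in area_measure. 0 \<le> green_weight \<zeta> z * ((cmod z)\<^sup>2) ^ n"
    using AE_area by eventually_elim (simp add: green_weight_lower(1)[OF \<zeta>])
  have I: "(LINT z|area_measure. green_weight \<zeta> z * ((cmod z)\<^sup>2) ^ n) = ?J"
    by (subst integral_eq_nn_integral[OF _ nn])
       (use \<open>?J \<ge> 0\<close> in \<open>simp_all add: nn_integral_green_weight_power[OF \<zeta>] del: of_nat_Suc power_Suc\<close>)
  have zz: "z ^ n * cnj z ^ n = of_real (((cmod z)\<^sup>2) ^ n)" for z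
    by (simp only: of_real_power[of "(cmod z)\<^sup>2"] complex_norm_square power_mult_distrib)
  have "(LINT z|area_measure. of_real (green_weight \<zeta> z) * (z ^ n * cnj z ^ n)) = (LINT z|area_measure. complex_of_real (green_weight \<zeta> z * ((cmod z)\<^sup>2) ^ n))"
    by (simp only: zz of_real_mult)
  also have "\<dots> = of_real ?J" by (simp only: integral_complex_of_real I)
  also have "?J = (1 - ((cmod \<zeta>)\<^sup>2) ^ Suc n) / (2 * real (Suc n) * real (Suc n))"
    by (simp only: power2_eq_square mult.assoc)
  finally show ?thesis using True by (simp only: add_0_right power_0 mult_1_left)
next
  case False
  then have k: "k > 0" by simp
  let ?c = "(cmod \<zeta>)\<^sup>2"
  let ?\<psi> = "\<lambda>t::real. t ^ n * ((if ?c < t then 1 else t ^ k / ?c ^ k) - t ^ k)"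
  let ?F = "\<lambda>z. of_real (green_weight \<zeta> z) * (z ^ (n + k) * cnj z ^ n)"
  have int: "integrable area_measure ?F"
    by (rule green_weight_times_integrable[OF \<zeta>, where C=1]) (auto simp: norm_mult norm_power power_le_one mult_le_one)
  have "(LINT z|area_measure. ?F z) = (LINT z|area_measure. (LINT \<xi>|circle_measure. ?F (z * \<xi>)))"
    by (rule integral_area_polar[OF int])
  also have "\<dots> = (LINT z|area_measure. \<zeta> ^ k / (2 * of_nat k) * of_real (?\<psi> ((cmod z)\<^sup>2)))"
  proof (rule integral_cong_AE)
    show "AE z in area_measure. (LINT \<xi>|circle_measure. ?F (z * \<xi>)) = \<zeta> ^ k / (2 * of_nat k) * of_real (?\<psi> ((cmod z)\<^sup>2))"
      using AE_area_generic[of \<zeta>]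
    proof eventually_elim
      case (elim z)
      then have z: "cmod z < 1" "z \<noteq> 0" "cmod z \<noteq> cmod \<zeta>" by auto
      have "(LINT \<xi>|circle_measure. ?F (z * \<xi>)) = (LINT \<xi>|circle_measure. (of_real (((cmod z)\<^sup>2) ^ n) * z ^ k) * (of_real (green_weight \<zeta> (z * \<xi>)) * \<xi> ^ k))"
      proof (rule integral_cong_AE)
        show "AE \<xi> in circle_measure. ?F (z * \<xi>) = (of_real (((cmod z)\<^sup>2) ^ n) * z ^ k) * (of_real (green_weight \<zeta> (z * \<xi>)) * \<xi> ^ k)"
          using AE_circle
        proof eventually_elim
          case (elim \<xi>)
          have "(z * \<xi>) ^ (n + k) * cnj (z * \<xi>) ^ n = (\<xi> * cnj \<xi>) ^ n * ((z * cnj z) ^ n * (z ^ k * \<xi> ^ k))"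
            by (simp add: power_mult_distrib power_add mult_ac)
          also have "\<xi> * cnj \<xi> = 1" using complex_norm_square[of \<xi>] elim by simp
          also have "z * cnj z = of_real ((cmod z)\<^sup>2)" by (rule complex_norm_square[symmetric])
          finally show ?case by (simp add: mult_ac)
        qed
      qed measurable
      also have "\<dots> = of_real (((cmod z)\<^sup>2) ^ n) * (z ^ k * (LINT \<xi>|circle_measure. of_real (green_weight \<zeta> (z * \<xi>)) * \<xi> ^ k))"
        by (simp only: integral_mult_right_zero mult.assoc)
      also have "\<dots> = \<zeta> ^ k / (2 * of_nat k) * of_real (?\<psi> ((cmod z)\<^sup>2))"
        unfolding green_weight_circle_moment(3)[OF \<zeta> z k] by (simp only: of_real_mult mult_ac)
      finally show ?case .
    qed
  qed measurable
  also have "\<dots> = \<zeta> ^ k / (2 * of_nat k) * of_real (LINT z|area_measure. ?\<psi> ((cmod z)\<^sup>2))"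
    by (simp only: integral_mult_right_zero integral_complex_of_real)
  also have "(LINT z|area_measure. ?\<psi> ((cmod z)\<^sup>2)) = (1 - ?c ^ Suc n) * (1 / real (Suc n) - 1 / real (Suc (n + k)))"
  proof -
    have "?\<psi> \<in> borel_measurable borel" by measurable
    from integral_area_radial[OF this] show ?thesis
      using piecewise_power_integral[of ?c n k] \<zeta> by (simp add: abs_square_le_1 del: of_nat_Suc power_Suc)
  qed
  also have "1 / real (Suc n) - 1 / real (Suc (n + k)) = real k / (real (Suc n) * real (Suc (n + k)))"
    by (simp add: field_simps)
  also have "\<zeta> ^ k / (2 * of_nat k) * of_real ((1 - ?c ^ Suc n) * (real k / (real (Suc n) * real (Suc (n + k)))))
     = \<zeta> ^ k * of_real ((1 - ?c ^ Suc n) / (2 * real (Suc n) * real (Suc (n + k))))"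
    using k by (simp add: field_simps del: of_nat_Suc power_Suc)
  finally show ?thesis .
qed

text \<open>The factors m + 1 and n + 1 from differentiation and the normalisation 2 / (1 -
  |\<zeta>|^2) turn the moment into \<zeta>^k times the finite geometric sum of
  \<open>green_gram_add\<close>. Conjugation covers m < n.\<close>

lemma green_moment:
  assumes \<zeta>: "cmod \<zeta> < 1"
  shows "of_real (2 / (1 - (cmod \<zeta>)\<^sup>2)) * (of_nat (Suc m) * of_nat (Suc n)) * (LINT z|area_measure. of_real (green_weight \<zeta> z) * (z ^ m * cnj z ^ n))
    = green_gram \<zeta> m n"
proof -
  let ?c = "(cmod \<zeta>)\<^sup>2"
  have c: "?c < 1" using \<zeta> by (simp add: abs_square_less_1)
  have add: "of_real (2 / (1 - ?c)) * (of_nat (Suc (n + k)) * of_nat (Suc n)) * (LINT z|area_measure. of_real (green_weight \<zeta> z) * (z ^ (n + k) * cnj z ^ n)) = green_gram \<zeta> (n + k) n" for n k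
  proof -
    have "(\<Sum>i\<le>n. ?c ^ i) = (1 - ?c ^ Suc n) / (1 - ?c)" using c by (subst sum_gp0) auto
    moreover have "2 / (1 - ?c) * (real (Suc (n + k)) * real (Suc n)) * ((1 - ?c ^ Suc n) / (2 * real (Suc n) * real (Suc (n + k)))) = (1 - ?c ^ Suc n) / (1 - ?c)"
    proof -
      have cancel: "2 / d * (A * B) * (X / (2 * B * A)) = X / d" if "A \<noteq> 0" "B \<noteq> 0" for d A B X :: real
        using that by simp
      show ?thesis by (rule cancel) simp_all
    qed
    moreover have "of_real (2 / (1 - ?c)) * (of_nat (Suc (n + k)) * of_nat (Suc n)) * (\<zeta> ^ k * of_real Y)
       = \<zeta> ^ k * complex_of_real (2 / (1 - ?c) * (real (Suc (n + k)) * real (Suc n)) * Y)" for Y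
      by (simp only: of_real_mult of_real_of_nat_eq mult_ac)
    ultimately show ?thesis unfolding green_moment_add[OF \<zeta>] green_gram_add by (simp only:)
  qed
  show ?thesis
  proof (cases "n \<le> m")
    case True
    then show ?thesis using add[of n "m - n"] by simp
  next
    case False
    then have nm: "n = m + (n - m)" by simp
    have "(LINT z|area_measure. of_real (green_weight \<zeta> z) * (z ^ m * cnj z ^ n)) = (LINT z|area_measure. cnj (of_real (green_weight \<zeta> z) * (z ^ n * cnj z ^ m)))"
      by (simp add: mult.commute)
    also have "\<dots> = cnj (LINT z|area_measure. of_real (green_weight \<zeta> z) * (z ^ n * cnj z ^ m))"
      by (rule Bochner_Integration.integral_cnj)
    finally have "of_real (2 / (1 - ?c)) * (of_nat (Suc m) * of_nat (Suc n)) * (LINT z|area_measure. of_real (green_weight \<zeta> z) * (z ^ m * cnj z ^ n))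
       = cnj (of_real (2 / (1 - ?c)) * (of_nat (Suc n) * of_nat (Suc m)) * (LINT z|area_measure. of_real (green_weight \<zeta> z) * (z ^ n * cnj z ^ m)))"
      by (simp add: mult_ac del: of_nat_Suc)
    also have "\<dots> = cnj (green_gram \<zeta> n m)" using add[of m "n - m"] False by simp
    finally show ?thesis by (simp only: green_gram_cnj[of \<zeta> m n])
  qed
qed

section \<open>The Dirichlet energy for |\<zeta>| < 1 on coefficient sequences\<close>

definition l2_deriv :: "l2 \<Rightarrow> complex \<Rightarrow> complex" where
  "l2_deriv x z = (\<Sum>n. of_nat (Suc n) * coef x (Suc n) * z ^ n)"

text \<open>The reason for replacing \<open>deriv\<close> by its power series: the series is Borel
  on the whole plane and equals the derivative on the disc.\<close>

lemma l2_deriv_measurable [measurable]: "l2_deriv x \<in> borel_measurable borel"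
  unfolding l2_deriv_def[abs_def] by (rule series_measurable)

lemma l2_deriv_sums: "cmod z < 1 \<Longrightarrow> (\<lambda>n. of_nat (Suc n) * coef x (Suc n) * z ^ n) sums deriv (l2_fun x) z"
  using Hol_deriv_sums[OF l2_fun_Hol, of z x] by (simp only: taylor_coeff_l2_fun)

lemma deriv_l2_fun: "cmod z < 1 \<Longrightarrow> deriv (l2_fun x) z = l2_deriv x z"
  unfolding l2_deriv_def by (rule sums_unique[OF l2_deriv_sums])

lemma l2_deriv_add:
  assumes "cmod z < 1" shows "l2_deriv (x + y) z = l2_deriv x z + l2_deriv y z"
proof -
  have "(\<lambda>n. of_nat (Suc n) * coef (x + y) (Suc n) * z ^ n) sums (l2_deriv x z + l2_deriv y z)"
    using sums_add[OF l2_deriv_sums[OF assms, of x] l2_deriv_sums[OF assms, of y]]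
    unfolding deriv_l2_fun[OF assms] by (simp add: algebra_simps del: of_nat_Suc)
  moreover note l2_deriv_sums[OF assms, of "x + y"]
  ultimately show ?thesis unfolding deriv_l2_fun[OF assms] by (metis sums_unique2)
qed

definition green_energy :: "complex \<Rightarrow> l2 \<Rightarrow> ennreal" where
  "green_energy \<zeta> x = (\<integral>\<^sup>+z. ennreal (green_weight \<zeta> z * (2 / (1 - (cmod \<zeta>)\<^sup>2)) * (cmod (l2_deriv x z))\<^sup>2) \<partial>area_measure)"

lemma dirichlet_integral_l2_fun:
  assumes "cmod \<zeta> < 1" shows "dirichlet_integral \<zeta> (l2_fun x) = green_energy \<zeta> x"
proof -
  have "dirichlet_integral \<zeta> (l2_fun x) = (\<integral>\<^sup>+z. ennreal (green_weight \<zeta> z * (2 / (1 - (cmod \<zeta>)\<^sup>2)) * (cmod (deriv (l2_fun x) z))\<^sup>2) \<partial>area_measure)"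
    using assms by (simp add: dirichlet_integral_def green_weight_def)
  also have "\<dots> = green_energy \<zeta> x"
    unfolding green_energy_def
    by (rule nn_integral_cong_AE) (use AE_area in eventually_elim, simp add: deriv_l2_fun)
  finally show ?thesis .
qed

text \<open>The Green weight dominates a multiple of 1 - |z|^2, for which the integral is the sum of
  |a_n|^2 / ((n + 1)(n + 2)); as a_n = (n + 1) f_(n+1), twice the n-th term is at least
  |f_(n+1)|^2.\<close>

lemma dirichlet_finite_H2:
  assumes \<zeta>: "cmod \<zeta> < 1" and f: "f \<in> Hol" and fin: "dirichlet_integral \<zeta> f < \<infinity>"
  shows "f \<in> H2"
proof -
  define a where "a n = of_nat (Suc n) * taylor_coeff f (Suc n)" for n
  define F where "F z = (\<Sum>n. a n * z ^ n)" for z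
  have [measurable]: "F \<in> borel_measurable borel"
    unfolding F_def[abs_def] by (rule series_measurable)
  have as: "(\<lambda>n. a n * z ^ n) sums deriv f z" if "cmod z < 1" for z
    unfolding a_def by (rule Hol_deriv_sums[OF f that])
  have F: "F z = deriv f z" if "cmod z < 1" for z
    unfolding F_def by (rule sums_unique[OF as[OF that], symmetric])
  have c: "(cmod \<zeta>)\<^sup>2 < 1" using \<zeta> by (simp add: abs_square_less_1)
  have "(\<Sum>n. ennreal ((cmod (a n))\<^sup>2 / (real (n + 1) * real (n + 2))))
      = (\<integral>\<^sup>+z. ennreal ((1 - (cmod z)\<^sup>2) * (cmod (deriv f z))\<^sup>2) \<partial>area_measure)"
    by (rule nn_integral_area_weighted_square[OF as, symmetric])
  also have "\<dots> \<le> (\<integral>\<^sup>+z. ennreal 4 * ennreal (green_weight \<zeta> z * (2 / (1 - (cmod \<zeta>)\<^sup>2)) * (cmod (F z))\<^sup>2) \<partial>area_measure)"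
  proof (rule nn_integral_mono_AE)
    show "AE z in area_measure. ennreal ((1 - (cmod z)\<^sup>2) * (cmod (deriv f z))\<^sup>2)
        \<le> ennreal 4 * ennreal (green_weight \<zeta> z * (2 / (1 - (cmod \<zeta>)\<^sup>2)) * (cmod (F z))\<^sup>2)"
      using AE_area_generic[of \<zeta>]
    proof eventually_elim
      case (elim z)
      then have z: "cmod z < 1" "z \<noteq> \<zeta>" by auto
      let ?d = "1 - (cmod \<zeta>)\<^sup>2"
      have d: "?d > 0" using c by simp
      have lower: "?d * (1 - (cmod z)\<^sup>2) / 8 \<le> green_weight \<zeta> z" by (rule green_weight_lower(2)[OF \<zeta> z])
      \<comment> \<open>The constant 4 undoes the 1/8 of the lower bound together with the 2 of the
        normalised weight.\<close>
      have "s = 4 * (d * s / 8 * (2 / d))" if "d > 0" for s d :: real using that by simp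
      then have "1 - (cmod z)\<^sup>2 = 4 * (?d * (1 - (cmod z)\<^sup>2) / 8 * (2 / ?d))" using d by blast
      also have "\<dots> \<le> 4 * (green_weight \<zeta> z * (2 / ?d))"
        using d by (intro mult_left_mono mult_right_mono lower) auto
      finally have "(1 - (cmod z)\<^sup>2) * (cmod (deriv f z))\<^sup>2 \<le> 4 * (green_weight \<zeta> z * (2 / ?d)) * (cmod (F z))\<^sup>2"
        unfolding F[OF z(1)] by (rule mult_right_mono) simp
      then show ?case by (subst ennreal_mult'[symmetric]) (auto simp: mult.assoc intro!: ennreal_leI)
    qed
  qed
  also have "\<dots> = ennreal 4 * (\<integral>\<^sup>+z. ennreal (green_weight \<zeta> z * (2 / (1 - (cmod \<zeta>)\<^sup>2)) * (cmod (F z))\<^sup>2) \<partial>area_measure)"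
    by (rule nn_integral_cmult) measurable
  also have "(\<integral>\<^sup>+z. ennreal (green_weight \<zeta> z * (2 / (1 - (cmod \<zeta>)\<^sup>2)) * (cmod (F z))\<^sup>2) \<partial>area_measure)
      = (\<integral>\<^sup>+z. ennreal (green_weight \<zeta> z * (2 / (1 - (cmod \<zeta>)\<^sup>2)) * (cmod (deriv f z))\<^sup>2) \<partial>area_measure)"
    by (rule nn_integral_cong_AE) (use AE_area in eventually_elim, simp add: F)
  also have "\<dots> = dirichlet_integral \<zeta> f"
    using \<zeta> by (simp add: dirichlet_integral_def green_weight_def)
  also have "ennreal 4 * dirichlet_integral \<zeta> f < \<infinity>"
    using fin by (simp add: ennreal_mult_less_top)
  finally have "summable (\<lambda>n. (cmod (a n))\<^sup>2 / (real (n + 1) * real (n + 2)))"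
    by (intro summable_suminf_not_top) auto
  then have s: "summable (\<lambda>n. 2 * ((cmod (a n))\<^sup>2 / (real (n + 1) * real (n + 2))))"
    by (rule summable_mult)
  have "summable (\<lambda>n. (cmod (taylor_coeff f (Suc n)))\<^sup>2)"
  proof (rule summable_comparison_test'[OF s])
    fix n :: nat
    have "2 * ((cmod (a n))\<^sup>2 / (real (n + 1) * real (n + 2))) = (cmod (taylor_coeff f (Suc n)))\<^sup>2 * (2 * real (n + 1) / real (n + 2))"
    proof -
      have "2 * ((N * t)\<^sup>2 / (N * M)) = t\<^sup>2 * (2 * N / M)" if "N > 0" "M > 0" for N M t :: real
        using that by (simp add: power2_eq_square field_simps)
      from this[of "real (n + 1)" "real (n + 2)" "cmod (taylor_coeff f (Suc n))"] show ?thesis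
        by (simp add: a_def norm_mult del: of_nat_Suc of_nat_add)
    qed
    moreover have "1 \<le> 2 * real (n + 1) / real (n + 2)" by (simp add: field_simps)
    then have "(cmod (taylor_coeff f (Suc n)))\<^sup>2 * 1 \<le> (cmod (taylor_coeff f (Suc n)))\<^sup>2 * (2 * real (n + 1) / real (n + 2))"
      by (intro mult_left_mono) auto
    ultimately show "norm ((cmod (taylor_coeff f (Suc n)))\<^sup>2) \<le> 2 * ((cmod (a n))\<^sup>2 / (real (n + 1) * real (n + 2)))"
      by simp
  qed
  then have "summable (\<lambda>n. (cmod (taylor_coeff f n))\<^sup>2)" by (subst (asm) summable_Suc_iff)
  then show ?thesis using f by (simp add: H2_def)
qed

text \<open>For |\<zeta>| < 1 the backward shift times \<zeta> is a strict contraction, so every f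
  has a partner g and depends on it boundedly in both directions: the whole of H2 is the domain.
  This gives continuity in the later limit of truncations.\<close>

lemma quot_graph_resolvent:
  assumes \<zeta>: "cmod \<zeta> < 1"
  obtains L where "bounded_linear L" "\<And>x. (x, L x) \<in> quot_graph \<zeta>"
proof -
  have T: "bounded_linear (\<lambda>x. cscale \<zeta> (backshift x))"
    by (rule bounded_linear_compose[OF bounded_linear_cscale bounded_linear_backshift])
  have q: "norm (cscale \<zeta> (backshift x)) \<le> cmod \<zeta> * norm x" for x
    by (simp add: norm_cscale mult_left_mono norm_backshift)
  obtain R where R: "bounded_linear R" "\<And>x. R x - cscale \<zeta> (backshift (R x)) = x"
    using neumann_inverse[OF T q _ \<zeta>] by (metis norm_ge_zero)
  have "(x, R (backshift x)) \<in> quot_graph \<zeta>" for x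
  proof -
    have "coef (R (backshift x) - cscale \<zeta> (backshift (R (backshift x)))) n = coef (backshift x) n" for n
      by (simp only: R(2))
    then show ?thesis by (simp add: quot_graph_def)
  qed
  then show thesis
    using that[OF bounded_linear_compose[OF R(1) bounded_linear_backshift]] by blast
qed

lemma l2_deriv_trunc:
  "l2_deriv (trunc (Suc N) x) z = (\<Sum>n<N. of_nat (Suc n) * coef x (Suc n) * z ^ n)"
proof -
  have "l2_deriv (trunc (Suc N) x) z = (\<Sum>n<N. of_nat (Suc n) * coef (trunc (Suc N) x) (Suc n) * z ^ n)"
    unfolding l2_deriv_def by (rule suminf_finite) (auto simp: coef_trunc)
  also have "\<dots> = (\<Sum>n<N. of_nat (Suc n) * coef x (Suc n) * z ^ n)"
    by (rule sum.cong) (auto simp: coef_trunc)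
  finally show ?thesis .
qed

text \<open>For a polynomial the relation is solved backwards from the top coefficient: h i is the
  sum over m \<ge> i of x_(m+1) \<zeta>^(m-i). Expanding |h i|^2 and summing over i first leaves the
  Gram matrix.\<close>

lemma quot_graph_trunc_norm:
  assumes \<zeta>: "cmod \<zeta> \<le> 1" and g: "(trunc (Suc N) x, g) \<in> quot_graph \<zeta>"
  shows "complex_of_real ((norm g)\<^sup>2) = (\<Sum>m<N. \<Sum>n<N. coef x (Suc m) * cnj (coef x (Suc n)) * green_gram \<zeta> m n)"
proof -
  define h where "h i = (\<Sum>m<N. if i \<le> m then coef x (Suc m) * \<zeta> ^ (m - i) else 0)" for i
  have h0: "h i = 0" if "i \<ge> N" for i unfolding h_def using that by (intro sum.neutral) auto
  have sm: "summable (\<lambda>i. (cmod (h i))\<^sup>2)"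
    by (rule summable_finite[of "{..<N}"]) (auto simp: h0)
  have rec: "h i - \<zeta> * h (Suc i) = coef (trunc (Suc N) x) (Suc i)" for i
  proof -
    have "\<zeta> * h (Suc i) = (\<Sum>m<N. if i < m then coef x (Suc m) * \<zeta> ^ (m - i) else 0)"
      unfolding h_def sum_distrib_left
    proof (rule sum.cong[OF refl])
      fix m
      show "\<zeta> * (if Suc i \<le> m then coef x (Suc m) * \<zeta> ^ (m - Suc i) else 0) = (if i < m then coef x (Suc m) * \<zeta> ^ (m - i) else 0)"
      proof (cases "i < m")
        case True
        then have "m - i = Suc (m - Suc i)" by simp
        then show ?thesis using True by simp
      qed simp
    qed
    then have "h i - \<zeta> * h (Suc i) = (\<Sum>m<N. (if i \<le> m then coef x (Suc m) * \<zeta> ^ (m - i) else 0) - (if i < m then coef x (Suc m) * \<zeta> ^ (m - i) else 0))"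
      by (simp add: h_def sum_subtractf)
    also have "\<dots> = (\<Sum>m<N. if m = i then coef x (Suc i) else 0)"
      by (rule sum.cong) auto
    also have "\<dots> = coef (trunc (Suc N) x) (Suc i)" by (simp add: coef_trunc)
    finally show ?thesis .
  qed
  have "(trunc (Suc N) x, Abs_l2 h) \<in> quot_graph \<zeta>"
    unfolding quot_graph_def by (simp add: coef_Abs_l2[OF sm] rec)
  then have "g = Abs_l2 h" by (rule quot_graph_unique[OF \<zeta> g])
  then have "(norm g)\<^sup>2 = (\<Sum>i. (cmod (h i))\<^sup>2)" by (simp add: l2_norm_square coef_Abs_l2[OF sm])
  also have "\<dots> = (\<Sum>i<N. (cmod (h i))\<^sup>2)" by (rule suminf_finite) (auto simp: h0)
  finally have "complex_of_real ((norm g)\<^sup>2) = (\<Sum>i<N. h i * cnj (h i))"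
    by (simp only: of_real_sum complex_norm_square)
  also have "\<dots> = (\<Sum>i<N. \<Sum>m<N. \<Sum>n<N. coef x (Suc m) * cnj (coef x (Suc n)) * (if i \<le> m \<and> i \<le> n then \<zeta> ^ (m - i) * cnj \<zeta> ^ (n - i) else 0))"
    unfolding h_def cnj_sum sum_product
    by (intro sum.cong refl) simp
  also have "\<dots> = (\<Sum>m<N. \<Sum>i<N. \<Sum>n<N. coef x (Suc m) * cnj (coef x (Suc n)) * (if i \<le> m \<and> i \<le> n then \<zeta> ^ (m - i) * cnj \<zeta> ^ (n - i) else 0))"
    by (rule sum.swap)
  also have "\<dots> = (\<Sum>m<N. \<Sum>n<N. \<Sum>i<N. coef x (Suc m) * cnj (coef x (Suc n)) * (if i \<le> m \<and> i \<le> n then \<zeta> ^ (m - i) * cnj \<zeta> ^ (n - i) else 0))"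
    by (rule sum.cong[OF refl], rule sum.swap)
  also have "\<dots> = (\<Sum>m<N. \<Sum>n<N. coef x (Suc m) * cnj (coef x (Suc n)) * green_gram \<zeta> m n)"
  proof (intro sum.cong refl)
    fix m n assume "m \<in> {..<N}" "n \<in> {..<N}"
    then have "(\<Sum>i<N. if i \<le> m \<and> i \<le> n then \<zeta> ^ (m - i) * cnj \<zeta> ^ (n - i) else 0) = green_gram \<zeta> m n"
      unfolding green_gram_def by (subst sum.inter_filter[symmetric]) (auto intro!: sum.cong)
    then show "(\<Sum>i<N. coef x (Suc m) * cnj (coef x (Suc n)) * (if i \<le> m \<and> i \<le> n then \<zeta> ^ (m - i) * cnj \<zeta> ^ (n - i) else 0))
        = coef x (Suc m) * cnj (coef x (Suc n)) * green_gram \<zeta> m n"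
      by (simp only: flip: sum_distrib_left)
  qed
  finally show ?thesis .
qed

text \<open>Energy and squared norm of g are sesquilinear forms in the same coefficients, and their
  matrices agree entry by entry by \<open>green_moment\<close>.\<close>

lemma green_energy_trunc:
  assumes \<zeta>: "cmod \<zeta> < 1" and g: "(trunc (Suc N) x, g) \<in> quot_graph \<zeta>"
  shows "green_energy \<zeta> (trunc (Suc N) x) = ennreal ((norm g)\<^sup>2)"
proof -
  let ?w = "2 / (1 - (cmod \<zeta>)\<^sup>2)"
  let ?u = "\<lambda>n. of_nat (Suc n) * coef x (Suc n)"
  let ?E = "\<lambda>z. green_weight \<zeta> z * ?w * (cmod (l2_deriv (trunc (Suc N) x) z))\<^sup>2"
  let ?G = "\<lambda>m n z. of_real (green_weight \<zeta> z) * (z ^ m * cnj z ^ n)"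
  have w: "?w \<ge> 0" using \<zeta> by (simp add: abs_square_le_1)
  have int: "integrable area_measure (?G m n)" for m n
    by (rule green_weight_times_integrable[OF \<zeta>, where C=1]) (auto simp: norm_mult norm_power power_le_one mult_le_one)
  have E: "complex_of_real (?E z) = (\<Sum>m<N. \<Sum>n<N. (of_real ?w * (?u m * cnj (?u n))) * ?G m n z)" for z
  proof -
    have "complex_of_real ((cmod (l2_deriv (trunc (Suc N) x) z))\<^sup>2) = (\<Sum>m<N. \<Sum>n<N. (?u m * z ^ m) * (cnj (?u n) * cnj z ^ n))"
      unfolding complex_norm_square l2_deriv_trunc cnj_sum sum_product by simp
    then have "complex_of_real (?E z) = of_real (green_weight \<zeta> z) * of_real ?w * (\<Sum>m<N. \<Sum>n<N. (?u m * z ^ m) * (cnj (?u n) * cnj z ^ n))"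
      by (simp only: of_real_mult)
    then show ?thesis by (simp only: sum_distrib_left mult_ac)
  qed
  have intE: "integrable area_measure (\<lambda>z. complex_of_real (?E z))"
    unfolding E by (intro Bochner_Integration.integrable_sum integrable_mult_right int)
  have "complex_of_real (LINT z|area_measure. ?E z) = (LINT z|area_measure. complex_of_real (?E z))"
    by (rule integral_complex_of_real[symmetric])
  also have "\<dots> = (\<Sum>m<N. \<Sum>n<N. (of_real ?w * (?u m * cnj (?u n))) * (LINT z|area_measure. ?G m n z))"
    unfolding E by (simp only: Bochner_Integration.integral_sum Bochner_Integration.integrable_sum integrable_mult_right int integral_mult_right_zero)
  also have "\<dots> = (\<Sum>m<N. \<Sum>n<N. coef x (Suc m) * cnj (coef x (Suc n)) * green_gram \<zeta> m n)"
  proof (intro sum.cong refl)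
    fix m n
    have "of_real ?w * (?u m * cnj (?u n)) * (LINT z|area_measure. ?G m n z)
        = coef x (Suc m) * cnj (coef x (Suc n)) * (of_real ?w * (of_nat (Suc m) * of_nat (Suc n)) * (LINT z|area_measure. ?G m n z))"
      by (simp only: complex_cnj_mult complex_cnj_of_nat mult_ac)
    then show "of_real ?w * (?u m * cnj (?u n)) * (LINT z|area_measure. ?G m n z) = coef x (Suc m) * cnj (coef x (Suc n)) * green_gram \<zeta> m n"
      by (simp only: green_moment[OF \<zeta>])
  qed
  also have "\<dots> = complex_of_real ((norm g)\<^sup>2)"
    by (rule quot_graph_trunc_norm[symmetric]) (use \<zeta> g in auto)
  finally have I: "(LINT z|area_measure. ?E z) = (norm g)\<^sup>2" by (simp only: of_real_eq_iff)
  have "integrable area_measure ?E" using intE by (simp only: complex_of_real_integrable_eq)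
  moreover have "AE z in area_measure. 0 \<le> ?E z"
    using AE_area by eventually_elim (use w green_weight_lower(1)[OF \<zeta>] in simp)
  ultimately have "(\<integral>\<^sup>+z. ennreal (?E z) \<partial>area_measure) = ennreal (LINT z|area_measure. ?E z)"
    by (rule nn_integral_eq_integral)
  then show ?thesis unfolding green_energy_def I .
qed

text \<open>A weighted triangle inequality, used pointwise instead of Minkowski's inequality for the
  energy: the first factor tends to 1 with \<epsilon>, so no constant is lost in the limit.\<close>

lemma cmod_add_square_weighted:
  assumes "\<epsilon> > 0"
  shows "(cmod (a + b))\<^sup>2 \<le> (1 + \<epsilon>) * (cmod a)\<^sup>2 + (1 + 1 / \<epsilon>) * (cmod b)\<^sup>2"
proof -
  have "0 \<le> (\<epsilon> * cmod a - cmod b)\<^sup>2 / \<epsilon>" using assms by simp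
  also have "\<dots> = \<epsilon> * (cmod a)\<^sup>2 - 2 * (cmod a * cmod b) + (cmod b)\<^sup>2 / \<epsilon>"
    using assms by (simp add: power2_eq_square field_simps)
  finally have "2 * (cmod a * cmod b) \<le> \<epsilon> * (cmod a)\<^sup>2 + (cmod b)\<^sup>2 / \<epsilon>" by simp
  moreover have "(cmod (a + b))\<^sup>2 \<le> (cmod a + cmod b)\<^sup>2"
    by (rule power_mono[OF norm_triangle_ineq]) simp
  ultimately show ?thesis by (simp add: power2_sum algebra_simps)
qed

lemma green_energy_add_le:
  assumes \<zeta>: "cmod \<zeta> < 1" and \<epsilon>: "\<epsilon> > 0"
  shows "green_energy \<zeta> (x + y) \<le> ennreal (1 + \<epsilon>) * green_energy \<zeta> x + ennreal (1 + 1 / \<epsilon>) * green_energy \<zeta> y"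
proof -
  let ?e = "\<lambda>x z. green_weight \<zeta> z * (2 / (1 - (cmod \<zeta>)\<^sup>2)) * (cmod (l2_deriv x z))\<^sup>2"
  have w: "2 / (1 - (cmod \<zeta>)\<^sup>2) \<ge> 0" using \<zeta> by (simp add: abs_square_le_1)
  have "green_energy \<zeta> (x + y) \<le> (\<integral>\<^sup>+z. ennreal (1 + \<epsilon>) * ennreal (?e x z) + ennreal (1 + 1 / \<epsilon>) * ennreal (?e y z) \<partial>area_measure)"
    unfolding green_energy_def
  proof (rule nn_integral_mono_AE)
    show "AE z in area_measure. ennreal (?e (x + y) z) \<le> ennreal (1 + \<epsilon>) * ennreal (?e x z) + ennreal (1 + 1 / \<epsilon>) * ennreal (?e y z)"
      using AE_area
    proof eventually_elim
      case (elim z)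
      let ?k = "green_weight \<zeta> z * (2 / (1 - (cmod \<zeta>)\<^sup>2))"
      have k: "0 \<le> ?k" by (intro mult_nonneg_nonneg w green_weight_lower(1)[OF \<zeta> elim])
      have nn: "0 \<le> ?e x z" "0 \<le> ?e y z" by (intro mult_nonneg_nonneg[OF k zero_le_power2])+
      have "?e (x + y) z \<le> ?k * ((1 + \<epsilon>) * (cmod (l2_deriv x z))\<^sup>2 + (1 + 1 / \<epsilon>) * (cmod (l2_deriv y z))\<^sup>2)"
        unfolding l2_deriv_add[OF elim] by (intro mult_left_mono cmod_add_square_weighted \<epsilon> k)
      also have "\<dots> = (1 + \<epsilon>) * ?e x z + (1 + 1 / \<epsilon>) * ?e y z" by (simp only: distrib_left mult_ac)
      finally have "ennreal (?e (x + y) z) \<le> ennreal ((1 + \<epsilon>) * ?e x z + (1 + 1 / \<epsilon>) * ?e y z)" by (rule ennreal_leI)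
      also have "\<dots> = ennreal (1 + \<epsilon>) * ennreal (?e x z) + ennreal (1 + 1 / \<epsilon>) * ennreal (?e y z)"
      proof -
        have "ennreal (p * s + q * t) = ennreal p * ennreal s + ennreal q * ennreal t"
          if "0 \<le> p" "0 \<le> q" "0 \<le> s" "0 \<le> t" for p q s t
          using that by (simp add: ennreal_mult)
        from this[OF _ _ nn, of "1 + \<epsilon>" "1 + 1 / \<epsilon>"] show ?thesis using \<epsilon> by simp
      qed
      finally show ?case .
    qed
  qed
  also have "\<dots> = (\<integral>\<^sup>+z. ennreal (1 + \<epsilon>) * ennreal (?e x z) \<partial>area_measure) + (\<integral>\<^sup>+z. ennreal (1 + 1 / \<epsilon>) * ennreal (?e y z) \<partial>area_measure)"
    by (rule nn_integral_add) measurable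
  also have "(\<integral>\<^sup>+z. ennreal (1 + \<epsilon>) * ennreal (?e x z) \<partial>area_measure) = ennreal (1 + \<epsilon>) * green_energy \<zeta> x"
    unfolding green_energy_def by (rule nn_integral_cmult) measurable
  also have "(\<integral>\<^sup>+z. ennreal (1 + 1 / \<epsilon>) * ennreal (?e y z) \<partial>area_measure) = ennreal (1 + 1 / \<epsilon>) * green_energy \<zeta> y"
    unfolding green_energy_def by (rule nn_integral_cmult) measurable
  finally show ?thesis .
qed

lemma l2_deriv_trunc_tendsto:
  assumes "cmod z < 1" shows "(\<lambda>N. l2_deriv (trunc (Suc N) x) z) \<longlonglongrightarrow> l2_deriv x z"
  using l2_deriv_sums[OF assms, of x] unfolding deriv_l2_fun[OF assms] l2_deriv_trunc sums_def .

lemma green_energy_le_liminf_trunc: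
  assumes \<zeta>: "cmod \<zeta> < 1"
  shows "green_energy \<zeta> x \<le> liminf (\<lambda>N. green_energy \<zeta> (trunc (Suc N) x))"
proof -
  let ?e = "\<lambda>x z. green_weight \<zeta> z * (2 / (1 - (cmod \<zeta>)\<^sup>2)) * (cmod (l2_deriv x z))\<^sup>2"
  have "green_energy \<zeta> x = (\<integral>\<^sup>+z. liminf (\<lambda>N. ennreal (?e (trunc (Suc N) x) z)) \<partial>area_measure)"
    unfolding green_energy_def
  proof (rule nn_integral_cong_AE)
    show "AE z in area_measure. ennreal (?e x z) = liminf (\<lambda>N. ennreal (?e (trunc (Suc N) x) z))"
      using AE_area
    proof eventually_elim
      case (elim z)
      have "(\<lambda>N. ennreal (?e (trunc (Suc N) x) z)) \<longlonglongrightarrow> ennreal (?e x z)"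
        by (intro tendsto_intros tendsto_ennrealI l2_deriv_trunc_tendsto elim)
      then show ?case by (intro lim_imp_Liminf[symmetric]) auto
    qed
  qed
  also have "\<dots> \<le> liminf (\<lambda>N. \<integral>\<^sup>+z. ennreal (?e (trunc (Suc N) x) z) \<partial>area_measure)"
    by (rule nn_integral_liminf) measurable
  finally show ?thesis unfolding green_energy_def .
qed

text \<open>Fatou's lemma along the truncations bounds the energy by the squared norm of L x.
  Conversely a truncation is x plus an error y; by the bound just proved the energy of y is at most
  the squared norm of L y, which tends to 0, and then \<epsilon> tends to 0.\<close>

lemma local_douglas_disc:
  assumes \<zeta>: "cmod \<zeta> < 1" and g: "(x, g) \<in> quot_graph \<zeta>"
  shows "green_energy \<zeta> x = ennreal ((norm g)\<^sup>2)"
proof -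
  obtain L where L: "bounded_linear L" "\<And>x. (x, L x) \<in> quot_graph \<zeta>"
    using quot_graph_resolvent[OF \<zeta>] by blast
  interpret L: bounded_linear L by fact
  have tr: "(\<lambda>N. trunc (Suc N) y) \<longlonglongrightarrow> y" for y by (rule LIMSEQ_Suc[OF trunc_tendsto])
  have upper: "green_energy \<zeta> y \<le> ennreal ((norm (L y))\<^sup>2)" for y
  proof -
    have "(\<lambda>N. ennreal ((norm (L (trunc (Suc N) y)))\<^sup>2)) \<longlonglongrightarrow> ennreal ((norm (L y))\<^sup>2)"
      by (intro tendsto_intros tendsto_ennrealI L.tendsto tr)
    then have "liminf (\<lambda>N. green_energy \<zeta> (trunc (Suc N) y)) = ennreal ((norm (L y))\<^sup>2)"
      unfolding green_energy_trunc[OF \<zeta> L(2)] by (intro lim_imp_Liminf) auto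
    then show ?thesis using green_energy_le_liminf_trunc[OF \<zeta>, of y] by simp
  qed
  obtain d where d: "green_energy \<zeta> x = ennreal d" "d \<ge> 0"
    using upper[of x] by (cases "green_energy \<zeta> x") (auto simp: top_unique)
  have lower: "(norm (L x))\<^sup>2 \<le> (1 + \<epsilon>) * d" if \<epsilon>: "\<epsilon> > 0" for \<epsilon>
  proof (rule LIMSEQ_le)
    have "(\<lambda>N. L (trunc (Suc N) x)) \<longlonglongrightarrow> L x" by (intro L.tendsto tr)
    then show "(\<lambda>N. (norm (L (trunc (Suc N) x)))\<^sup>2) \<longlonglongrightarrow> (norm (L x))\<^sup>2" by (intro tendsto_intros)
    have "(\<lambda>N. (1 + \<epsilon>) * d + (1 + 1 / \<epsilon>) * (norm (L (trunc (Suc N) x - x)))\<^sup>2) \<longlonglongrightarrow> (1 + \<epsilon>) * d + (1 + 1 / \<epsilon>) * (norm (L (x - x)))\<^sup>2"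
      by (intro tendsto_intros L.tendsto tr)
    then show "(\<lambda>N. (1 + \<epsilon>) * d + (1 + 1 / \<epsilon>) * (norm (L (trunc (Suc N) x - x)))\<^sup>2) \<longlonglongrightarrow> (1 + \<epsilon>) * d"
      by (simp add: L.zero)
    have "(norm (L (trunc (Suc N) x)))\<^sup>2 \<le> (1 + \<epsilon>) * d + (1 + 1 / \<epsilon>) * (norm (L (trunc (Suc N) x - x)))\<^sup>2" for N
    proof -
      let ?y = "trunc (Suc N) x - x"
      have "ennreal ((norm (L (trunc (Suc N) x)))\<^sup>2) = green_energy \<zeta> (x + ?y)"
        by (simp add: green_energy_trunc[OF \<zeta> L(2)])
      also have "\<dots> \<le> ennreal (1 + \<epsilon>) * green_energy \<zeta> x + ennreal (1 + 1 / \<epsilon>) * green_energy \<zeta> ?y"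
        by (rule green_energy_add_le[OF \<zeta> \<epsilon>])
      also have "\<dots> \<le> ennreal (1 + \<epsilon>) * ennreal d + ennreal (1 + 1 / \<epsilon>) * ennreal ((norm (L ?y))\<^sup>2)"
        unfolding d(1) by (intro add_left_mono mult_left_mono upper) simp
      also have "\<dots> = ennreal ((1 + \<epsilon>) * d + (1 + 1 / \<epsilon>) * (norm (L ?y))\<^sup>2)"
        using \<epsilon> d(2) by (simp add: ennreal_mult ennreal_plus)
      finally show ?thesis
        using \<epsilon> d(2) by (subst (asm) ennreal_le_iff) (auto intro!: add_nonneg_nonneg mult_nonneg_nonneg)
    qed
    then show "\<exists>N0. \<forall>N\<ge>N0. (norm (L (trunc (Suc N) x)))\<^sup>2 \<le> (1 + \<epsilon>) * d + (1 + 1 / \<epsilon>) * (norm (L (trunc (Suc N) x - x)))\<^sup>2"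
      by blast
  qed
  have le: "(norm (L x))\<^sup>2 \<le> d"
  proof (rule LIMSEQ_le_const)
    show "(\<lambda>n. (1 + 1 / real (Suc n)) * d) \<longlonglongrightarrow> d"
      using tendsto_mult[OF tendsto_add[OF tendsto_const[of 1] LIMSEQ_inverse_real_of_nat] tendsto_const[of d]]
      by (simp add: inverse_eq_divide)
    show "\<exists>N. \<forall>n\<ge>N. (norm (L x))\<^sup>2 \<le> (1 + 1 / real (Suc n)) * d" using lower by simp
  qed
  have "green_energy \<zeta> x = ennreal ((norm (L x))\<^sup>2)"
    using antisym[OF upper[of x, unfolded d(1)] ennreal_leI[OF le]] d(1) by simp
  moreover have "L x = g" by (rule quot_graph_unique[OF less_imp_le[OF \<zeta>] L(2) g])
  ultimately show ?thesis by simp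
qed

section \<open>Both spaces as the domain of the quotient graph\<close>

lemma dirichlet_space_eq:
  assumes \<zeta>: "cmod \<zeta> \<le> 1"
  shows "dirichlet_space \<zeta> = l2_fun ` fst ` quot_graph \<zeta>"
    and "(f, g) \<in> quot_graph \<zeta> \<Longrightarrow> dirichlet_norm \<zeta> (l2_fun f) = sqrt ((norm f)\<^sup>2 + (norm g)\<^sup>2)"
proof -
  have D: "dirichlet_integral \<zeta> (l2_fun x) = ennreal ((norm g)\<^sup>2)" if "(x, g) \<in> quot_graph \<zeta>" for x g
  proof (cases "cmod \<zeta> < 1")
    case True
    then show ?thesis using local_douglas_disc that by (simp add: dirichlet_integral_l2_fun)
  next
    case False
    then have "cmod \<zeta> = 1" using \<zeta> by simp
    then show ?thesis
      by (rule local_douglas_circle(1)[OF _ l2_fun_Hol]) (use that in \<open>simp add: taylor_coeff_l2_fun quot_graph_def\<close>)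
  qed
  then show "(f, g) \<in> quot_graph \<zeta> \<Longrightarrow> dirichlet_norm \<zeta> (l2_fun f) = sqrt ((norm f)\<^sup>2 + (norm g)\<^sup>2)"
    by (simp add: dirichlet_norm_def H2_norm_l2_fun)
  have "\<exists>x g. h = l2_fun x \<and> (x, g) \<in> quot_graph \<zeta>" if h: "h \<in> Hol" and fin: "dirichlet_integral \<zeta> h < \<infinity>" for h
  proof (cases "cmod \<zeta> < 1")
    case True
    then have "h \<in> H2" using dirichlet_finite_H2 h fin by blast
    then obtain x where x: "h = l2_fun x" unfolding H2_eq_range by blast
    obtain L where L: "bounded_linear L" "\<And>x. (x, L x) \<in> quot_graph \<zeta>"
      by (rule quot_graph_resolvent[OF True], rule that)
    show ?thesis by (intro exI[of _ x] exI[of _ "L x"] conjI x L(2))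
  next
    case False
    then have "cmod \<zeta> = 1" using \<zeta> by simp
    from local_douglas_circle(2)[OF this h fin]
    obtain g where g: "taylor_coeff h (Suc n) = coef g n - \<zeta> * coef g (Suc n)" for n by blast
    \<comment> \<open>On the circle membership in H2 comes out of the relation itself: the
      coefficients of h from index 1 on are those of the square-summable sequence g - \<zeta>
      \<open>backshift\<close> g.\<close>
    have "taylor_coeff h (Suc n) = coef (g - cscale \<zeta> (backshift g)) n" for n by (simp add: g)
    then have "summable (\<lambda>n. (cmod (taylor_coeff h (Suc n)))\<^sup>2)" by (simp only: summable_coef)
    then have "summable (\<lambda>n. (cmod (taylor_coeff h n))\<^sup>2)" by (subst (asm) summable_Suc_iff)
    then have "h \<in> H2" using h by (simp add: H2_def)
    then obtain x where x: "h = l2_fun x" unfolding H2_eq_range by blast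
    have "(x, g) \<in> quot_graph \<zeta>" using g unfolding x by (simp add: quot_graph_def taylor_coeff_l2_fun)
    with x show ?thesis by blast
  qed
  then show "dirichlet_space \<zeta> = l2_fun ` fst ` quot_graph \<zeta>"
    unfolding dirichlet_space_def using D by (force simp: l2_fun_Hol)
qed

theorem theorem4p1:
  fixes \<zeta> :: complex and a b :: "complex \<Rightarrow> complex"
  assumes "cmod \<zeta> \<le> 1"
    and "is_pair b a"
    and "\<forall>z\<in>unit_disc. b z / a z = z / (1 - cnj \<zeta> * z)"
  shows "dirichlet_space \<zeta> = dBR_space b \<and>
         (\<forall>f\<in>dirichlet_space \<zeta>. dirichlet_norm \<zeta> f = dBR_norm b f)"
proof -
  have a: "outer_Hinf a" and bH: "b \<in> Hinf"
    and ab1: "AE \<xi> in circle_measure. (cmod (boundary_fun a \<xi>))\<^sup>2 + (cmod (boundary_fun b \<xi>))\<^sup>2 = 1"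
    using assms(2) by (auto simp: is_pair_def non_extreme_def Hinf_ball_def)
  have den: "1 - cnj \<zeta> * z \<noteq> 0" if "cmod z < 1" for z
  proof
    assume "1 - cnj \<zeta> * z = 0"
    then have "cmod (cnj \<zeta> * z) = 1" by (metis eq_iff_diff_eq_0 norm_one)
    moreover have "cmod (cnj \<zeta> * z) \<le> cmod z"
      using mult_right_mono[OF assms(1), of "cmod z"] by (simp add: norm_mult)
    ultimately show False using that by simp
  qed
  \<comment> \<open>An outer function is a constant times an exponential, hence free of zeros. This
    is needed to clear the denominator, since division by 0 would give 0.\<close>
  have a0: "a z \<noteq> 0" if "cmod z < 1" for z
  proof -
    obtain c where "cmod c = 1" "\<forall>z\<in>unit_disc. a z = c * exp (LINT \<xi>|circle_measure. (\<xi> + z) / (\<xi> - z) * of_real (ln (cmod (boundary_fun a \<xi>))))"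
      using a unfolding outer_Hinf_def by blast
    then show ?thesis using that by auto
  qed
  have ab: "(1 - cnj \<zeta> * z) * b z = z * a z" if "cmod z < 1" for z
    using assms(3)[rule_format, of z] den[OF that] a0[OF that] that by (simp add: field_simps)
  obtain P :: real and \<beta> :: complex where P: "P > 0" "cmod \<beta> < 1"
    "P\<^sup>2 * (1 + \<beta> * cnj \<beta>) = 2 + \<zeta> * cnj \<zeta>" "P\<^sup>2 * \<beta> = cnj \<zeta>"
    by (rule spectral_factor_exists[OF assms(1)], rule that)
  obtain c where c: "cmod c = 1" "\<And>z. cmod z < 1 \<Longrightarrow> a z = c * (1 - cnj \<zeta> * z) / (P * (1 - \<beta> * z))"
    by (rule pair_explicit[OF assms(1) P(2,1,3,4) a bH ab ab1], assumption, rule that)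
  have b: "b z = c * z / (P * (1 - \<beta> * z))" if "cmod z < 1" for z
  proof -
    have "(1 - cnj \<zeta> * z) * b z = (1 - cnj \<zeta> * z) * (c * z / (P * (1 - \<beta> * z)))"
      unfolding ab[OF that] c(2)[OF that] by simp
    then show ?thesis using den[OF that] by (simp only: mult_cancel_left simp_thms)
  qed
  have "b \<in> Hol" using bH by (simp add: Hinf_def)
  note B = dBR_explicit[OF assms(1) c(1) P(2,1,3,4) this b]
  note D = dirichlet_space_eq[OF assms(1)]
  show ?thesis
  proof
    show "dirichlet_space \<zeta> = dBR_space b" by (simp only: D(1) B(1))
    show "\<forall>f\<in>dirichlet_space \<zeta>. dirichlet_norm \<zeta> f = dBR_norm b f"
      unfolding D(1) using D(2) B(2) by auto
  qed
qed

end
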